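(* Consider equations of the form $$u_t=F(t,x,u,u_x,u_{xx},u_{xxx})\,u_{xxxx}+G(t,x,u,u_x,u_{xx},u_{xxx}),\qquad F\neq 0 .$$ Up to the equivalence described in the context, there are exactly two inequivalent (families of) equations of this form invariant under one-parameter symmetry groups: - $A_1^1=\langle\partial_t\rangle$: $\;u_t=\tilde F(x,u,u_x,u_{xx},u_{xxx})\,u_{xxxx}+\tilde G(x,u,u_x,u_{xx},u_{xxx})$; - $A_1^2=\langle\partial_x\rangle$: $\;u_t=\tilde F(t,u,u_x,u_{xx},u_{xxx})\,u_{xxxx}+\tilde G(t,u,u_x,u_{xx},u_{xxx})$. Here $\tilde F\neq0$ and $\tilde G$ are arbitrary smooth functions. Furthermore, the associated one-dimensional symmetry algebra is maximal in Lie's sense.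
   Context: Here $u=u(t,x)$ is a real function of two real variables, subscripts denote partial derivatives, and $F,G$ are smooth real functions. Everything is local: functions and vector fields are considered near generic points (each relevant coefficient function is either identically zero or nowhere zero in the neighbourhood considered). A vector field $V=\tau\partial_t+\xi\partial_x+\eta\partial_u$ (coefficients smooth functions of $(t,x,u)$) is admitted by an equation if it generates a local one-parameter group of point transformations mapping solutions to solutions (Lie's infinitesimal criterion). For equations of the considered form any admitted $V$ has $\tau=\tau(t)$. An equation is invariant under a one-parameter symmetry group if it admits a nonzero vector field. Equivalence: vector fields and equations are considered up to local invertible changes of variables $\bar t=T(t)$, $\bar x=X(t,x,u)$, $\bar u=U(t,x,u)$ with $\dot T\neq0$ and $\frac{D(X,U)}{D(x,u)}\neq0$; these preserve the class of equations considered. "Maximal in Lie's sense" means that when $\tilde F,\tilde G$ are arbitrary (generic, unspecialized), the equation admits no vector fields other than those in the given algebra. *)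

theory Defs
  imports "HOL-Analysis.Analysis"
begin

section \<open>Smooth functions\<close>

text \<open>Meant for open \<open>S\<close>: all iterated directional derivatives exist and are continuous.\<close>

primrec Ck_on :: "nat \<Rightarrow> ('a::real_normed_vector \<Rightarrow> 'b::real_normed_vector) \<Rightarrow> 'a set \<Rightarrow> bool" where
  "Ck_on 0 f S \<longleftrightarrow> continuous_on S f"
| "Ck_on (Suc k) f S \<longleftrightarrow> (\<forall>x\<in>S. f differentiable (at x)) \<and>
     (\<forall>v. Ck_on k (\<lambda>x. frechet_derivative f (at x) v) S)"

definition smooth_on :: "('a::real_normed_vector \<Rightarrow> 'b::real_normed_vector) \<Rightarrow> 'a set \<Rightarrow> bool" where
  "smooth_on f S \<longleftrightarrow> (\<forall>k. Ck_on k f S)"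


section \<open>Jets and total derivatives\<close>

text \<open>A \<open>point\<close> is \<open>(t, x, u)\<close>; a \<open>jet3\<close> is \<open>(t, x, u, u\<^sub>x, u\<^sub>x\<^sub>x, u\<^sub>x\<^sub>x\<^sub>x)\<close>. A \<open>jet\<close> is \<open>(t, x, w)\<close>, where
  the coordinate \<open>w i j\<close> stands for the derivative of \<open>u\<close> taken \<open>i\<close> times in \<open>t\<close> and \<open>j\<close> times
  in \<open>x\<close>. All these coordinates are independent.\<close>

type_synonym point = "real \<times> real \<times> real"
type_synonym jet3 = "real \<times> real \<times> real \<times> real \<times> real \<times> real"
type_synonym jet = "real \<times> real \<times> (nat \<Rightarrow> nat \<Rightarrow> real)"

fun point_of_jet3 :: "jet3 \<Rightarrow> point" where
  "point_of_jet3 (t, x, u, u1, u2, u3) = (t, x, u)"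

fun point_of_jet :: "jet \<Rightarrow> point" where
  "point_of_jet (t, x, w) = (t, x, w 0 0)"

fun jet3_of_jet :: "jet \<Rightarrow> jet3" where
  "jet3_of_jet (t, x, w) = (t, x, w 0 0, w 0 1, w 0 2, w 0 3)"

text \<open>The total derivatives are the vector fields
  \<open>\<partial>\<^sub>t + (\<Sum>i j. w (i+1) j \<partial>/\<partial>(w i j))\<close> and \<open>\<partial>\<^sub>x + (\<Sum>i j. w i (j+1) \<partial>/\<partial>(w i j))\<close> on jet space, written as
  directional derivatives; they are applied to functions of finitely many jet coordinates.\<close>

fun Dt :: "(jet \<Rightarrow> real) \<Rightarrow> jet \<Rightarrow> real" where
  "Dt P (t, x, w) = deriv (\<lambda>s. P (t + s, x, \<lambda>i j. w i j + s * w (Suc i) j)) 0"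

fun Dx :: "(jet \<Rightarrow> real) \<Rightarrow> jet \<Rightarrow> real" where
  "Dx P (t, x, w) = deriv (\<lambda>s. P (t, x + s, \<lambda>i j. w i j + s * w i (Suc j))) 0"


section \<open>Equations\<close>

record evol_eq =
  edom :: "jet3 set"
  eF :: "jet3 \<Rightarrow> real"
  eG :: "jet3 \<Rightarrow> real"

definition evolution_equation :: "evol_eq \<Rightarrow> bool" where
  "evolution_equation E \<longleftrightarrow> open (edom E) \<and> edom E \<noteq> {} \<and>
     smooth_on (eF E) (edom E) \<and> smooth_on (eG E) (edom E) \<and> (\<forall>z\<in>edom E. eF E z \<noteq> 0)"

definition base :: "evol_eq \<Rightarrow> point set" where
  "base E = point_of_jet3 ` edom E"

text \<open>The equation is the zero set of \<open>u\<^sub>t - F u\<^sub>x\<^sub>x\<^sub>x\<^sub>x - G\<close> in jet space.\<close>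

fun eq_fun :: "evol_eq \<Rightarrow> jet \<Rightarrow> real" where
  "eq_fun E (t, x, w) =
     w 1 0 - eF E (jet3_of_jet (t, x, w)) * w 0 4 - eG E (jet3_of_jet (t, x, w))"


section \<open>Vector fields and Lie's infinitesimal criterion\<close>

text \<open>The value \<open>V p = (\<tau>, \<xi>, \<eta>)\<close> stands for \<open>\<tau> \<partial>\<^sub>t + \<xi> \<partial>\<^sub>x + \<eta> \<partial>\<^sub>u\<close>.\<close>

type_synonym vfield = "point \<Rightarrow> point"

definition vf_t :: vfield where "vf_t = (\<lambda>p. (1, 0, 0))"
definition vf_x :: vfield where "vf_x = (\<lambda>p. (0, 1, 0))"

abbreviation vtau :: "vfield \<Rightarrow> point \<Rightarrow> real" where "vtau V p \<equiv> fst (V p)"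
abbreviation vxi :: "vfield \<Rightarrow> point \<Rightarrow> real" where "vxi V p \<equiv> fst (snd (V p))"
abbreviation veta :: "vfield \<Rightarrow> point \<Rightarrow> real" where "veta V p \<equiv> snd (snd (V p))"

fun characteristic :: "vfield \<Rightarrow> jet \<Rightarrow> real" where
  "characteristic V (t, x, w) =
     veta V (t, x, w 0 0) - vtau V (t, x, w 0 0) * w 1 0 - vxi V (t, x, w 0 0) * w 0 1"

text \<open>The coefficient of \<open>\<partial>/\<partial>(w i j)\<close> in the prolongation of \<open>V\<close> is
  \<open>D\<^sub>t\<^sup>i D\<^sub>x\<^sup>j Q + \<tau> w (i+1) j + \<xi> w i (j+1)\<close>, where \<open>Q = \<eta> - \<tau> u\<^sub>t - \<xi> u\<^sub>x\<close>.\<close>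

fun prol_coeff :: "vfield \<Rightarrow> nat \<Rightarrow> nat \<Rightarrow> jet \<Rightarrow> real" where
  "prol_coeff V i j (t, x, w) =
     (Dt ^^ i) ((Dx ^^ j) (characteristic V)) (t, x, w)
       + vtau V (t, x, w 0 0) * w (Suc i) j + vxi V (t, x, w 0 0) * w i (Suc j)"

fun prolong :: "vfield \<Rightarrow> (jet \<Rightarrow> real) \<Rightarrow> jet \<Rightarrow> real" where
  "prolong V P (t, x, w) =
     deriv (\<lambda>s. P (t + s * vtau V (t, x, w 0 0), x + s * vxi V (t, x, w 0 0),
                   \<lambda>i j. w i j + s * prol_coeff V i j (t, x, w))) 0"

definition admits :: "evol_eq \<Rightarrow> vfield \<Rightarrow> bool" where
  "admits E V \<longleftrightarrow> smooth_on V (base E) \<and>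
     (\<forall>J. jet3_of_jet J \<in> edom E \<and> eq_fun E J = 0 \<longrightarrow> prolong V (eq_fun E) J = 0)"

definition zero_or_nonvanishing :: "(point \<Rightarrow> real) \<Rightarrow> point set \<Rightarrow> bool" where
  "zero_or_nonvanishing f D \<longleftrightarrow> (\<forall>p\<in>D. f p = 0) \<or> (\<forall>p\<in>D. f p \<noteq> 0)"

definition generic_on :: "vfield \<Rightarrow> point set \<Rightarrow> bool" where
  "generic_on V D \<longleftrightarrow> zero_or_nonvanishing (vtau V) D \<and>
     zero_or_nonvanishing (vxi V) D \<and> zero_or_nonvanishing (veta V) D"


section \<open>Changes of variables\<close>

record ptrans =
  pT :: "real \<Rightarrow> real"
  pX :: "point \<Rightarrow> real"
  pU :: "point \<Rightarrow> real"

definition pmap :: "ptrans \<Rightarrow> point \<Rightarrow> point" where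
  "pmap \<Phi> p = (pT \<Phi> (fst p), pX \<Phi> p, pU \<Phi> p)"

definition pderiv_x :: "(point \<Rightarrow> real) \<Rightarrow> point \<Rightarrow> real" where
  "pderiv_x f p = frechet_derivative f (at p) (0, 1, 0)"

definition pderiv_u :: "(point \<Rightarrow> real) \<Rightarrow> point \<Rightarrow> real" where
  "pderiv_u f p = frechet_derivative f (at p) (0, 0, 1)"

definition point_transformation :: "ptrans \<Rightarrow> point set \<Rightarrow> bool" where
  "point_transformation \<Phi> D \<longleftrightarrow> open D \<and> D \<noteq> {} \<and>
     smooth_on (pT \<Phi>) (fst ` D) \<and> smooth_on (pX \<Phi>) D \<and> smooth_on (pU \<Phi>) D \<and>
     (\<forall>p\<in>D. deriv (pT \<Phi>) (fst p) \<noteq> 0) \<and>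
     (\<forall>p\<in>D. pderiv_x (pX \<Phi>) p * pderiv_u (pU \<Phi>) p
             - pderiv_u (pX \<Phi>) p * pderiv_x (pU \<Phi>) p \<noteq> 0) \<and>
     inj_on (pmap \<Phi>) D"

definition pushes_forward :: "ptrans \<Rightarrow> point set \<Rightarrow> vfield \<Rightarrow> vfield \<Rightarrow> bool" where
  "pushes_forward \<Phi> D V W \<longleftrightarrow>
     (\<forall>p\<in>D. frechet_derivative (pmap \<Phi>) (at p) (V p) = W (pmap \<Phi> p))"

text \<open>Total derivatives with respect to the new independent variables, in terms of the old ones,
  for \<open>t' = T t\<close> and \<open>x' = X (t, x, u)\<close>. They make sense where \<open>D\<^sub>x X \<noteq> 0\<close>, that is, where the
  transformed graph is again the graph of a function.\<close>

definition Dx_new :: "ptrans \<Rightarrow> (jet \<Rightarrow> real) \<Rightarrow> jet \<Rightarrow> real" where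
  "Dx_new \<Phi> P J = Dx P J / Dx (pX \<Phi> \<circ> point_of_jet) J"

definition Dt_new :: "ptrans \<Rightarrow> (jet \<Rightarrow> real) \<Rightarrow> jet \<Rightarrow> real" where
  "Dt_new \<Phi> P J =
     (Dt P J - Dt (pX \<Phi> \<circ> point_of_jet) J * Dx_new \<Phi> P J) / deriv (pT \<Phi>) (fst J)"

definition prolong_trans :: "ptrans \<Rightarrow> jet \<Rightarrow> jet" where
  "prolong_trans \<Phi> J = (pT \<Phi> (fst J), pX \<Phi> (point_of_jet J),
     \<lambda>i j. (Dt_new \<Phi> ^^ i) ((Dx_new \<Phi> ^^ j) (pU \<Phi> \<circ> point_of_jet)) J)"

text \<open>Near the jet \<open>z\<close>, the change of variables turns the equation \<open>E\<close> into \<open>E'\<close>.\<close>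

definition transforms_near :: "ptrans \<Rightarrow> point set \<Rightarrow> evol_eq \<Rightarrow> jet3 \<Rightarrow> evol_eq \<Rightarrow> bool" where
  "transforms_near \<Phi> D E z E' \<longleftrightarrow>
     (\<exists>N. open N \<and> z \<in> N \<and> N \<subseteq> edom E \<and> point_of_jet3 ` N \<subseteq> D \<and>
        (\<forall>J. jet3_of_jet J \<in> N \<longrightarrow>
           Dx (pX \<Phi> \<circ> point_of_jet) J \<noteq> 0 \<and>
           jet3_of_jet (prolong_trans \<Phi> J) \<in> edom E' \<and>
           (eq_fun E J = 0 \<longleftrightarrow> eq_fun E' (prolong_trans \<Phi> J) = 0)))"

definition equivalent_near :: "evol_eq \<Rightarrow> jet3 \<Rightarrow> evol_eq \<Rightarrow> bool" where
  "equivalent_near E z E' \<longleftrightarrow>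
     (\<exists>\<Phi> D. point_transformation \<Phi> D \<and> transforms_near \<Phi> D E z E')"

text \<open>Equivalence of the one-dimensional algebras spanned by two vector fields that are defined
  everywhere.\<close>

definition equivalent_algebras :: "vfield \<Rightarrow> vfield \<Rightarrow> bool" where
  "equivalent_algebras V W \<longleftrightarrow>
     (\<exists>\<Phi> D c. point_transformation \<Phi> D \<and> c \<noteq> 0 \<and> pushes_forward \<Phi> D V (\<lambda>p. c *\<^sub>R W p))"


section \<open>The two families\<close>

definition family_t :: "evol_eq \<Rightarrow> bool" where
  "family_t E \<longleftrightarrow> evolution_equation E \<and>
     (\<exists>F G. \<forall>(t, x, u, u1, u2, u3) \<in> edom E.
        eF E (t, x, u, u1, u2, u3) = F (x, u, u1, u2, u3) \<and>
        eG E (t, x, u, u1, u2, u3) = G (x, u, u1, u2, u3))"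

definition family_x :: "evol_eq \<Rightarrow> bool" where
  "family_x E \<longleftrightarrow> evolution_equation E \<and>
     (\<exists>F G. \<forall>(t, x, u, u1, u2, u3) \<in> edom E.
        eF E (t, x, u, u1, u2, u3) = F (t, u, u1, u2, u3) \<and>
        eG E (t, x, u, u1, u2, u3) = G (t, u, u1, u2, u3))"

text \<open>On no part of the domain of \<open>E\<close>, however small, is there an admitted vector field outside
  the span of \<open>W\<close>.\<close>

definition admits_only :: "evol_eq \<Rightarrow> vfield \<Rightarrow> bool" where
  "admits_only E W \<longleftrightarrow>
     (\<forall>N V. open N \<and> connected N \<and> N \<subseteq> edom E \<and> admits (E\<lparr>edom := N\<rparr>) V \<longrightarrow>
        (\<exists>c. \<forall>p\<in>point_of_jet3 ` N. V p = c *\<^sub>R W p))"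

text \<open>Genericity inside a class \<open>\<F>\<close>: through every member there is a line
  \<open>(F, G + s g)\<close> inside \<open>\<F>\<close> on which all but countably many members, in particular some
  arbitrarily close to the given one with all derivatives, admit only multiples of \<open>W\<close>.\<close>

definition generically_admits_only :: "(evol_eq \<Rightarrow> bool) \<Rightarrow> vfield \<Rightarrow> bool" where
  "generically_admits_only \<F> W \<longleftrightarrow>
     (\<forall>E. \<F> E \<longrightarrow>
        (\<exists>g C. countable C \<and>
           (\<forall>s. \<F> (E\<lparr>eG := \<lambda>z. eG E z + s * g z\<rparr>)) \<and>
           (\<forall>s. s \<notin> C \<longrightarrow> admits_only (E\<lparr>eG := \<lambda>z. eG E z + s * g z\<rparr>) W)))"

end

(* Normal forms: the prolongation formula shows that an admitted field has tau = tau(t), so near a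
   generic point the flow of V gives fibre-preserving coordinates in which V is d/dt or d/dx; a shear
   makes the transformed graphs graphs again, and invariance removes t, respectively x, from F and G.

   Maximality: along a line in the direction u_xxx of jet3, with u_xxxx = 0, Lie's criterion becomes a linear
   relation with constant coefficients between finitely many functions of v = u_xxx. Replacing G by
   G + s g with g = exp (k v) (v^4 + y + u v) turns it into a linear pencil in s, whose exceptional s are
   finite in number for all but finitely many k. Doing this at countably many points leaves a
   countable exceptional set of s; the relation then forces tau, xi, eta to be trivial on a dense set.

   Inequivalence: an equivalence would pull d/dx back to a second symmetry of a generic member of the
   d/dt family, and conversely. *)

theory Submission
  imports Defs "HOL-Computational_Algebra.Polynomial"
begin

section \<open>Calculus of smooth functions\<close>

text \<open>The given member is arbitrary, so nothing about its F and G can be computed, and a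
  symmetry V may exist on a small open set only and may depend on s. The relation at a fixed (t, x,
  u, u_x, u_xx) is therefore split: five unknown numbers Y multiply functions of v into which g
  enters, five others, w, multiply functions free of g. Non-zero Y belonging to different s are
  linearly independent, as eigenvectors are, so only finitely many s are bad at one point, whatever
  the given functions are; a similar count for w bounds the bad k. A countable dense set of jets,
  each with countably many intervals in u_xxx, tests all open sets at once, which keeps the
  exceptional set countable.

  Smoothness of flows and of local inverses comes from one bootstrap: their derivatives solve linear
  equations whose coefficients are as smooth as the function is already known to be. Most jet
  computations rest on commutators of vector fields on jet space: D_x and D_t with each other and
  with the prolonged field, and D_x with d/du_k, where u_k is the k-th x-derivative of u.\<close>

lemma Ck_on_cong:
  assumes "open S" "\<And>x. x \<in> S \<Longrightarrow> f x = g x" "Ck_on k f S"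
  shows "Ck_on k g S"
  using assms
proof (induction k arbitrary: f g)
  case 0
  then show ?case using continuous_on_cong by (metis Ck_on.simps(1))
next
  case (Suc k)
  have hd: "(f has_derivative D) (at x) \<longleftrightarrow> (g has_derivative D) (at x)" if "x \<in> S" for x D
    using has_derivative_transform_within_open[OF _ Suc.prems(1) that] Suc.prems(2) by metis
  have fd: "frechet_derivative f (at x) = frechet_derivative g (at x)" if "x \<in> S" for x
    unfolding frechet_derivative_def using hd[OF that] by simp
  have 1: "\<forall>x\<in>S. g differentiable (at x)"
    using Suc.prems(3) hd unfolding differentiable_def Ck_on.simps by metis
  have "Ck_on k (\<lambda>x. frechet_derivative g (at x) v) S" for v
    using Suc.IH[OF Suc.prems(1), of "\<lambda>x. frechet_derivative f (at x) v"] Suc.prems(3) fd by simp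
  then show ?case using 1 by simp
qed

lemma Ck_on_Suc_imp: "Ck_on (Suc k) f S \<Longrightarrow> Ck_on k f S"
proof (induction k arbitrary: f)
  case 0
  then show ?case
    by (auto intro!: continuous_at_imp_continuous_on differentiable_imp_continuous_within)
next
  case (Suc k)
  then show ?case by simp
qed

lemma Ck_on_mono: "Ck_on k f S \<Longrightarrow> j \<le> k \<Longrightarrow> Ck_on j f S"
  by (induction k) (auto simp del: Ck_on.simps simp: le_Suc_eq dest: Ck_on_Suc_imp)

lemma Ck_on_imp_continuous_on: "Ck_on k f S \<Longrightarrow> continuous_on S f"
  using Ck_on_mono[of k f S 0] by simp

lemma Ck_on_subset: "Ck_on k f S \<Longrightarrow> T \<subseteq> S \<Longrightarrow> Ck_on k f T"
  by (induction k arbitrary: f) (auto intro: continuous_on_subset)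

lemma Ck_on_SucI:
  assumes "open S" "\<And>x. x \<in> S \<Longrightarrow> (f has_derivative f' x) (at x)"
    and "\<And>v. Ck_on k (\<lambda>x. f' x v) S"
  shows "Ck_on (Suc k) f S"
proof -
  have "frechet_derivative f (at x) = f' x" if "x \<in> S" for x
    using assms(2)[OF that] frechet_derivative_at by metis
  then show ?thesis
    using assms Ck_on_cong[OF assms(1) _ assms(3)] by (auto simp: differentiable_def)
qed

section \<open>Closure properties of C^k and smooth functions\<close>

lemma Ck_on_const [simp]: "Ck_on k (\<lambda>x. c) S"
proof (induction k arbitrary: c)
  case (Suc k)
  have "frechet_derivative (\<lambda>x::'a. c::'b) (at x) v = 0" for x v by (simp)
  then show ?case using Suc by simp
qed simp

lemma Ck_on_bounded_linear:
  assumes "bounded_linear f" shows "Ck_on k f S"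
proof (cases k)
  case 0
  then show ?thesis using assms by (simp add: linear_continuous_on)
next
  case (Suc j)
  have "f differentiable (at x)" for x
    using assms bounded_linear_imp_has_derivative differentiable_def by blast
  moreover have "frechet_derivative f (at x) = f" for x
    using bounded_linear_imp_has_derivative[OF assms] frechet_derivative_at by metis
  ultimately show ?thesis using Suc by simp
qed

lemma Ck_on_has_derivative:
  "Ck_on (Suc k) f S \<Longrightarrow> x \<in> S \<Longrightarrow> (f has_derivative frechet_derivative f (at x)) (at x)"
  by (simp add: frechet_derivative_works)

lemma Ck_on_frechet: "Ck_on (Suc k) f S \<Longrightarrow> Ck_on k (\<lambda>x. frechet_derivative f (at x) v) S"
  by simp

lemma Ck_on_compose_linear:
  assumes "open S" "bounded_linear L" "Ck_on k f S"
  shows "Ck_on k (\<lambda>x. L (f x)) S"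
  using assms(3)
proof (induction k arbitrary: f)
  case 0
  then show ?case using assms(2) by (simp add: bounded_linear.continuous_on)
next
  case (Suc k)
  show ?case
    by (rule Ck_on_SucI[OF assms(1)])
       (auto intro!: bounded_linear.has_derivative[OF assms(2)] Ck_on_has_derivative[OF Suc.prems]
          Suc.IH Ck_on_frechet[OF Suc.prems])
qed

lemma Ck_on_add:
  assumes "open S" "Ck_on k f S" "Ck_on k g S"
  shows "Ck_on k (\<lambda>x. f x + g x) S"
  using assms(2,3)
proof (induction k arbitrary: f g)
  case 0
  then show ?case by (auto intro: continuous_intros)
next
  case (Suc k)
  show ?case
    by (rule Ck_on_SucI[OF assms(1)])
       (auto intro!: has_derivative_add Ck_on_has_derivative[OF Suc.prems(1)] Ck_on_has_derivative[OF Suc.prems(2)]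
          Suc.IH Ck_on_frechet[OF Suc.prems(1)] Ck_on_frechet[OF Suc.prems(2)])
qed

lemma Ck_on_bilinear:
  assumes "open S" "bounded_bilinear B" "Ck_on k f S" "Ck_on k g S"
  shows "Ck_on k (\<lambda>x. B (f x) (g x)) S"
  using assms(3,4)
proof (induction k arbitrary: f g)
  case 0
  then show ?case using assms(2) by (auto intro: bounded_bilinear.continuous_on)
next
  case (Suc k)
  show ?case
    by (rule Ck_on_SucI[OF assms(1)])
       (auto intro!: bounded_bilinear.FDERIV[OF assms(2)] Ck_on_has_derivative[OF Suc.prems(1)] Ck_on_has_derivative[OF Suc.prems(2)]
          Ck_on_add Suc.IH Ck_on_frechet[OF Suc.prems(1)] Ck_on_frechet[OF Suc.prems(2)] 
          Ck_on_Suc_imp[OF Suc.prems(1)] Ck_on_Suc_imp[OF Suc.prems(2)] assms(1))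
qed

lemma Ck_on_sum:
  assumes "open S" "\<And>i. i \<in> I \<Longrightarrow> Ck_on k (f i) S"
  shows "Ck_on k (\<lambda>x. \<Sum>i\<in>I. f i x) S"
  using assms(2) by (induction I rule: infinite_finite_induct) (auto intro: Ck_on_add[OF assms(1)])

lemma Ck_on_Pair:
  assumes "open S" "Ck_on k f S" "Ck_on k g S"
  shows "Ck_on k (\<lambda>x. (f x, g x)) S"
proof -
  have "Ck_on k (\<lambda>x. (f x, 0) + (0, g x)) S"
    by (intro Ck_on_add assms Ck_on_compose_linear[OF assms(1) _ assms(2)] Ck_on_compose_linear[OF assms(1) _ assms(3)]
          bounded_linear_Pair bounded_linear_ident bounded_linear_zero)
  then show ?thesis by simp
qed

text \<open>\<open>Ck_on\<close> controls derivatives in fixed directions only; this expansion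
  handles a direction that varies with the point.\<close>

lemma frechet_expand:
  fixes f :: "'a::euclidean_space \<Rightarrow> 'b::real_normed_vector"
  assumes "(f has_derivative f') (at x)"
  shows "f' v = (\<Sum>b\<in>Basis. (v \<bullet> b) *\<^sub>R f' b)"
proof -
  have "linear f'" using assms has_derivative_linear by blast
  then have "f' (\<Sum>b\<in>Basis. (v \<bullet> b) *\<^sub>R b) = (\<Sum>b\<in>Basis. (v \<bullet> b) *\<^sub>R f' b)"
    by (simp only: linear_sum linear_cmul)
  then show ?thesis by (simp only: euclidean_representation)
qed

text \<open>The chain rule produces the derivative of f in a moving direction. Expanded in the basis
  it is a sum of products of C^k functions: the induction hypothesis is applied to the derivatives
  of f in the basis directions.\<close>

lemma Ck_on_compose:
  fixes g :: "'a::real_normed_vector \<Rightarrow> 'b::euclidean_space"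
  assumes "open S" "open T" "g ` S \<subseteq> T" "Ck_on k g S" "Ck_on k f T"
  shows "Ck_on k (\<lambda>x. f (g x)) S"
  using assms(4,5)
proof (induction k arbitrary: f)
  case 0
  then show ?case using assms(3) by (auto intro: continuous_on_compose2)
next
  case (Suc k)
  have hd: "((\<lambda>x. f (g x)) has_derivative (\<lambda>v. \<Sum>b\<in>Basis. (frechet_derivative g (at x) v \<bullet> b) *\<^sub>R frechet_derivative f (at (g x)) b)) (at x)"
    if "x \<in> S" for x
  proof -
    have 1: "(g has_derivative frechet_derivative g (at x)) (at x)"
      using Ck_on_has_derivative[OF Suc.prems(1)] that by simp
    have 2: "(f has_derivative frechet_derivative f (at (g x))) (at (g x))"
      using Ck_on_has_derivative[OF Suc.prems(2)] that assms(3) by blast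
    show ?thesis
      using has_derivative_compose[OF 1 2] unfolding frechet_expand[OF 2, of "frechet_derivative g (at x) _"] .
  qed
  show ?case
  proof (rule Ck_on_SucI[OF assms(1) hd])
    fix v
    show "Ck_on k (\<lambda>x. \<Sum>b\<in>Basis. (frechet_derivative g (at x) v \<bullet> b) *\<^sub>R frechet_derivative f (at (g x)) b) S"
      by (intro Ck_on_sum Ck_on_bilinear[OF assms(1) bounded_bilinear_scaleR] assms(1) Suc.IH Ck_on_frechet[OF Suc.prems(2)]
          Ck_on_Suc_imp[OF Suc.prems(1)] Ck_on_compose_linear[OF assms(1) bounded_linear_inner_left] Ck_on_frechet[OF Suc.prems(1)])
  qed
qed

text \<open>The derivative of 1/f is built from 1/f and the derivative of f, so knowing 1/f to be
  C^k makes its derivative C^k.\<close>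

lemma Ck_on_inverse:
  fixes f :: "'a::real_normed_vector \<Rightarrow> real"
  assumes "open S" "Ck_on k f S" "\<And>x. x \<in> S \<Longrightarrow> f x \<noteq> 0"
  shows "Ck_on k (\<lambda>x. inverse (f x)) S"
  using assms(2)
proof (induction k)
  case 0
  then show ?case using assms(3) by (auto intro!: continuous_intros)
next
  case (Suc k)
  show ?case
  proof (rule Ck_on_SucI[OF assms(1)])
    show "((\<lambda>x. inverse (f x)) has_derivative (\<lambda>v. (- 1) * (inverse (f x) * frechet_derivative f (at x) v * inverse (f x)))) (at x)" if "x \<in> S" for x
      using Deriv.has_derivative_inverse[OF assms(3)[OF that] Ck_on_has_derivative[OF Suc.prems that]] by simp
    show "Ck_on k (\<lambda>x. - 1 * (inverse (f x) * frechet_derivative f (at x) v * inverse (f x))) S" for v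
      by (intro Ck_on_bilinear[OF assms(1) bounded_bilinear_mult] Ck_on_const Suc.IH Ck_on_Suc_imp[OF Suc.prems]
          Ck_on_frechet[OF Suc.prems])
  qed
qed

lemma Ck_on_exp: "Ck_on k (exp :: real \<Rightarrow> real) UNIV"
proof (induction k)
  case 0
  then show ?case by (simp add: continuous_on_exp)
next
  case (Suc k)
  show ?case
  proof (rule Ck_on_SucI)
    show "(exp has_derivative (\<lambda>v. exp x * v)) (at x)" for x :: real
      using DERIV_exp[of x] by (simp add: has_field_derivative_def)
    show "Ck_on k (\<lambda>x. exp x * v) UNIV" for v :: real
      by (intro Ck_on_bilinear[OF _ bounded_bilinear_mult] Suc Ck_on_const) auto
  qed auto
qed

lemma smooth_on_cong: "open S \<Longrightarrow> (\<And>x. x \<in> S \<Longrightarrow> f x = g x) \<Longrightarrow> smooth_on f S \<Longrightarrow> smooth_on g S"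
  unfolding smooth_on_def by (auto intro: Ck_on_cong)

lemma smooth_on_subset: "smooth_on f S \<Longrightarrow> T \<subseteq> S \<Longrightarrow> smooth_on f T"
  unfolding smooth_on_def using Ck_on_subset by blast

lemma smooth_on_const [simp]: "smooth_on (\<lambda>x. c) S"
  unfolding smooth_on_def by simp

lemma smooth_on_bounded_linear: "bounded_linear f \<Longrightarrow> smooth_on f S"
  unfolding smooth_on_def using Ck_on_bounded_linear by blast

lemma smooth_on_compose_linear: "open S \<Longrightarrow> bounded_linear L \<Longrightarrow> smooth_on f S \<Longrightarrow> smooth_on (\<lambda>x. L (f x)) S"
  unfolding smooth_on_def by (simp add: Ck_on_compose_linear)

lemma smooth_on_add: "open S \<Longrightarrow> smooth_on f S \<Longrightarrow> smooth_on g S \<Longrightarrow> smooth_on (\<lambda>x. f x + g x) S"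
  unfolding smooth_on_def by (simp add: Ck_on_add)

lemma smooth_on_mult:
  fixes f g :: "'a::real_normed_vector \<Rightarrow> real"
  shows "open S \<Longrightarrow> smooth_on f S \<Longrightarrow> smooth_on g S \<Longrightarrow> smooth_on (\<lambda>x. f x * g x) S"
  unfolding smooth_on_def by (simp add: Ck_on_bilinear[OF _ bounded_bilinear_mult])

lemma smooth_on_uminus: "open S \<Longrightarrow> smooth_on f S \<Longrightarrow> smooth_on (\<lambda>x. - f x) S"
  using smooth_on_compose_linear[of S uminus f] bounded_linear_minus[OF bounded_linear_ident] by blast

lemma smooth_on_diff: "open S \<Longrightarrow> smooth_on f S \<Longrightarrow> smooth_on g S \<Longrightarrow> smooth_on (\<lambda>x. f x - g x) S"
  using smooth_on_add[of S f "\<lambda>x. - g x"] smooth_on_uminus[of S g] by simp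

lemma smooth_on_Pair: "open S \<Longrightarrow> smooth_on f S \<Longrightarrow> smooth_on g S \<Longrightarrow> smooth_on (\<lambda>x. (f x, g x)) S"
  unfolding smooth_on_def by (simp add: Ck_on_Pair)

lemma smooth_on_compose:
  fixes g :: "'a::real_normed_vector \<Rightarrow> 'b::euclidean_space"
  shows "open S \<Longrightarrow> open T \<Longrightarrow> g ` S \<subseteq> T \<Longrightarrow> smooth_on g S \<Longrightarrow> smooth_on f T \<Longrightarrow> smooth_on (\<lambda>x. f (g x)) S"
  unfolding smooth_on_def using Ck_on_compose[of S T g _ f] by metis

lemma smooth_on_inverse:
  fixes f :: "'a::real_normed_vector \<Rightarrow> real"
  shows "open S \<Longrightarrow> smooth_on f S \<Longrightarrow> (\<And>x. x \<in> S \<Longrightarrow> f x \<noteq> 0) \<Longrightarrow> smooth_on (\<lambda>x. inverse (f x)) S"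
  unfolding smooth_on_def by (simp add: Ck_on_inverse)

lemma smooth_on_frechet: "smooth_on f S \<Longrightarrow> smooth_on (\<lambda>x. frechet_derivative f (at x) v) S"
  unfolding smooth_on_def by (metis Ck_on.simps(2))

lemma smooth_on_has_derivative:
  "smooth_on f S \<Longrightarrow> x \<in> S \<Longrightarrow> (f has_derivative frechet_derivative f (at x)) (at x)"
  unfolding smooth_on_def by (metis Ck_on_has_derivative)

lemma smooth_on_continuous_on: "smooth_on f S \<Longrightarrow> continuous_on S f"
  unfolding smooth_on_def using Ck_on_imp_continuous_on by blast

text \<open>Pass from x to x + v one coordinate at a time. On each segment the mean value bound
  applies to f minus its linear part, and continuity of the partial derivatives at x makes the error
  small relative to that coordinate.\<close>

lemma continuous_partials_imp_has_derivative:
  fixes f :: "'a::euclidean_space \<Rightarrow> 'b::real_normed_vector"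
  assumes S: "open S" and x: "x \<in> S"
    and D: "\<And>b y. b \<in> Basis \<Longrightarrow> y \<in> S \<Longrightarrow> ((\<lambda>h. f (y + h *\<^sub>R b)) has_vector_derivative D b y) (at 0)"
    and cont: "\<And>b. b \<in> Basis \<Longrightarrow> continuous_on S (D b)"
  shows "(f has_derivative (\<lambda>v. \<Sum>b\<in>Basis. (v \<bullet> b) *\<^sub>R D b x)) (at x)"
proof -
  have D': "((\<lambda>h. f (y + h *\<^sub>R b)) has_vector_derivative D b (y + r *\<^sub>R b)) (at r)"
    if "b \<in> Basis" "y + r *\<^sub>R b \<in> S" for b y r
  proof -
    have "((\<lambda>h. f ((y + r *\<^sub>R b) + h *\<^sub>R b)) has_derivative (\<lambda>h. h *\<^sub>R D b (y + r *\<^sub>R b))) (at 0)"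
      using D that by (simp add: has_vector_derivative_def)
    then have "((\<lambda>h. f ((y + r *\<^sub>R b) + h *\<^sub>R b)) has_derivative (\<lambda>h. h *\<^sub>R D b (y + r *\<^sub>R b))) (at (r - r))"
      by simp
    moreover have "((\<lambda>h. h - r) has_derivative (\<lambda>h. h)) (at r)"
      by (auto intro!: derivative_eq_intros)
    ultimately have "((\<lambda>s. f ((y + r *\<^sub>R b) + (s - r) *\<^sub>R b)) has_derivative (\<lambda>h. h *\<^sub>R D b (y + r *\<^sub>R b))) (at r)"
      using has_derivative_compose[of "\<lambda>h. h - r" "\<lambda>h. h" r UNIV "\<lambda>h. f ((y + r *\<^sub>R b) + h *\<^sub>R b)"] by simp
    moreover have "(y + r *\<^sub>R b) + (s - r) *\<^sub>R b = y + s *\<^sub>R b" for s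
      by (simp add: algebra_simps)
    ultimately show ?thesis by (simp add: has_vector_derivative_def)
  qed
  \<comment> \<open>The sum norm is additive over the coordinates, so the errors of the successive
    segments add up to exactly \<open>e * N v\<close>.\<close>
  define N where "N v = (\<Sum>b\<in>Basis. \<bar>v \<bullet> b\<bar>)" for v :: 'a
  have N_le: "N v \<le> real DIM('a) * norm v" for v
    unfolding N_def using sum_bounded_above[of Basis "\<lambda>b. \<bar>v \<bullet> b\<bar>" "norm v"] by (simp add: Basis_le_norm)
  have key: "\<exists>\<delta>>0. \<forall>v. N v < \<delta> \<longrightarrow> norm (f (x + v) - f x - (\<Sum>b\<in>Basis. (v \<bullet> b) *\<^sub>R D b x)) \<le> e * N v"
    if "e > 0" for e
  proof -
    have "\<forall>\<^sub>F y in nhds x. y \<in> S \<and> (\<forall>b\<in>Basis. dist (D b y) (D b x) < e)"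
    proof (intro eventually_conj eventually_ball_finite ballI)
      show "\<forall>\<^sub>F y in nhds x. y \<in> S" using S x by (rule eventually_nhds_in_open)
      fix b :: 'a assume "b \<in> Basis"
      then have "isCont (D b) x" using cont S x continuous_on_eq_continuous_at by blast
      then have "\<forall>\<^sub>F y in at x. dist (D b y) (D b x) < e" using that by (simp add: isCont_def tendsto_iff)
      then show "\<forall>\<^sub>F y in nhds x. dist (D b y) (D b x) < e"
        using that by (auto simp: eventually_at_filter elim: eventually_mono)
    qed simp
    then obtain \<delta> where \<delta>: "\<delta> > 0" "\<And>y. dist y x < \<delta> \<Longrightarrow> y \<in> S \<and> (\<forall>b\<in>Basis. dist (D b y) (D b x) < e)"
      unfolding eventually_nhds_metric by blast
    have "norm (f (x + (\<Sum>b\<in>B. (v \<bullet> b) *\<^sub>R b)) - f x - (\<Sum>b\<in>B. (v \<bullet> b) *\<^sub>R D b x)) \<le> e * (\<Sum>b\<in>B. \<bar>v \<bullet> b\<bar>)"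
      if "finite B" "B \<subseteq> Basis" "N v < \<delta>" for v B
      using that(1,2)
    proof (induction B rule: finite_induct)
      case (insert b B)
      define y where "y = x + (\<Sum>b\<in>B. (v \<bullet> b) *\<^sub>R b)"
      have near: "dist (y + r *\<^sub>R b) x < \<delta>" if "r \<in> closed_segment 0 (v \<bullet> b)" for r
      proof -
        have "\<bar>r\<bar> \<le> \<bar>v \<bullet> b\<bar>" using that by (auto simp: closed_segment_eq_real_ivl split: if_splits)
        have "dist (y + r *\<^sub>R b) x = norm ((\<Sum>b\<in>B. (v \<bullet> b) *\<^sub>R b) + r *\<^sub>R b)"
          by (simp add: y_def dist_norm algebra_simps)
        also have "\<dots> \<le> (\<Sum>b\<in>B. norm ((v \<bullet> b) *\<^sub>R b)) + norm (r *\<^sub>R b)"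
          by (intro norm_triangle_le add_right_mono norm_sum)
        also have "\<dots> \<le> (\<Sum>b\<in>B. \<bar>v \<bullet> b\<bar>) + \<bar>v \<bullet> b\<bar>"
          using \<open>\<bar>r\<bar> \<le> \<bar>v \<bullet> b\<bar>\<close> insert.prems by (intro add_mono sum_mono) (auto simp: subset_iff)
        also have "\<dots> = (\<Sum>b\<in>insert b B. \<bar>v \<bullet> b\<bar>)" using insert by simp
        also have "\<dots> \<le> N v" unfolding N_def using insert.prems by (intro sum_mono2) auto
        finally show ?thesis using \<open>N v < \<delta>\<close> by simp
      qed
      have b: "b \<in> Basis" using insert.prems by simp
      have "norm ((f (y + (v \<bullet> b) *\<^sub>R b) - (v \<bullet> b) *\<^sub>R D b x) - (f (y + 0 *\<^sub>R b) - 0 *\<^sub>R D b x)) \<le> e * norm (v \<bullet> b - 0)"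
      proof (rule differentiable_bound[of "closed_segment 0 (v \<bullet> b)" _ "\<lambda>r h. h *\<^sub>R (D b (y + r *\<^sub>R b) - D b x)"])
        fix r assume r: "r \<in> closed_segment 0 (v \<bullet> b)"
        have "((\<lambda>h. f (y + h *\<^sub>R b)) has_derivative (\<lambda>h. h *\<^sub>R D b (y + r *\<^sub>R b))) (at r)"
          using D'[OF b conjunct1[OF \<delta>(2)[OF near[OF r]]]] unfolding has_vector_derivative_def .
        then show "((\<lambda>h. f (y + h *\<^sub>R b) - h *\<^sub>R D b x) has_derivative (\<lambda>h. h *\<^sub>R (D b (y + r *\<^sub>R b) - D b x)))
            (at r within closed_segment 0 (v \<bullet> b))"
          using has_derivative_diff[OF _ has_derivative_scaleR_left[OF has_derivative_ident, of "D b x" "at r"]]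
          by (simp add: scaleR_diff_right has_derivative_at_withinI)
        have "norm (D b (y + r *\<^sub>R b) - D b x) \<le> e"
          using \<delta>(2)[OF near[OF r]] b by (simp add: dist_norm less_imp_le)
        then show "onorm (\<lambda>h. h *\<^sub>R (D b (y + r *\<^sub>R b) - D b x)) \<le> e"
          by (intro onorm_le) (simp add: mult.commute[of e] mult_left_mono)
      qed auto
      then have 1: "norm (f (y + (v \<bullet> b) *\<^sub>R b) - f y - (v \<bullet> b) *\<^sub>R D b x) \<le> e * \<bar>v \<bullet> b\<bar>"
        by (simp add: algebra_simps)
      have 2: "norm (f y - f x - (\<Sum>b\<in>B. (v \<bullet> b) *\<^sub>R D b x)) \<le> e * (\<Sum>b\<in>B. \<bar>v \<bullet> b\<bar>)"
        unfolding y_def using insert by simp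
      have "norm ((f (y + (v \<bullet> b) *\<^sub>R b) - f y - (v \<bullet> b) *\<^sub>R D b x) + (f y - f x - (\<Sum>b\<in>B. (v \<bullet> b) *\<^sub>R D b x)))
         \<le> e * \<bar>v \<bullet> b\<bar> + e * (\<Sum>b\<in>B. \<bar>v \<bullet> b\<bar>)"
        using 1 2 norm_triangle_mono by blast
      moreover have "x + (\<Sum>b\<in>insert b B. (v \<bullet> b) *\<^sub>R b) = y + (v \<bullet> b) *\<^sub>R b"
        using insert by (simp add: y_def algebra_simps)
      moreover have "(\<Sum>b\<in>insert b B. (v \<bullet> b) *\<^sub>R D b x) = (v \<bullet> b) *\<^sub>R D b x + (\<Sum>b\<in>B. (v \<bullet> b) *\<^sub>R D b x)"
        "e * (\<Sum>b\<in>insert b B. \<bar>v \<bullet> b\<bar>) = e * \<bar>v \<bullet> b\<bar> + e * (\<Sum>b\<in>B. \<bar>v \<bullet> b\<bar>)"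
        using insert by (simp_all add: algebra_simps)
      ultimately show ?case by (simp add: algebra_simps)
    qed simp
    from this[OF finite_Basis order_refl] show ?thesis
      using \<delta>(1) by (intro exI[of _ \<delta>]) (auto simp: N_def euclidean_representation)
  qed
  show ?thesis
    unfolding has_derivative_at_alt
  proof (intro conjI allI impI)
    show "bounded_linear (\<lambda>v. \<Sum>b\<in>Basis. (v \<bullet> b) *\<^sub>R D b x)"
      by (intro bounded_linear_sum bounded_linear_scaleR_const bounded_linear_inner_left)
    fix e :: real assume "e > 0"
    define n where "n = real DIM('a)"
    have n: "n > 0" by (simp add: n_def)
    obtain \<delta> where \<delta>: "\<delta> > 0" "\<And>v. N v < \<delta> \<Longrightarrow> norm (f (x + v) - f x - (\<Sum>b\<in>Basis. (v \<bullet> b) *\<^sub>R D b x)) \<le> e / n * N v"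
      using key[of "e / n"] \<open>e > 0\<close> n by auto
    show "\<exists>d>0. \<forall>y. norm (y - x) < d \<longrightarrow>
        norm (f y - f x - (\<Sum>b\<in>Basis. ((y - x) \<bullet> b) *\<^sub>R D b x)) \<le> e * norm (y - x)"
    proof (intro exI conjI allI impI)
      show "\<delta> / n > 0" using \<delta>(1) n by simp
      fix y assume "norm (y - x) < \<delta> / n"
      then have "n * norm (y - x) < \<delta>" using n by (simp add: field_simps)
      then have "N (y - x) < \<delta>" using N_le[of "y - x"] unfolding n_def by simp
      from \<delta>(2)[OF this] have "norm (f y - f x - (\<Sum>b\<in>Basis. ((y - x) \<bullet> b) *\<^sub>R D b x)) \<le> e / n * N (y - x)"
        by simp
      also have "\<dots> \<le> e / n * (n * norm (y - x))"
        using N_le[of "y - x"] \<open>e > 0\<close> n unfolding n_def by (intro mult_left_mono) auto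
      finally show "norm (f y - f x - (\<Sum>b\<in>Basis. ((y - x) \<bullet> b) *\<^sub>R D b x)) \<le> e * norm (y - x)"
        using n by simp
    qed
  qed
qed

text \<open>The form in which flows and solutions of linear systems gain one order: what is computed
  for them are partial derivatives.\<close>

lemma Ck_on_SucI_partials:
  fixes f :: "'a::euclidean_space \<Rightarrow> 'b::real_normed_vector"
  assumes S: "open S"
    and D: "\<And>b y. b \<in> Basis \<Longrightarrow> y \<in> S \<Longrightarrow> ((\<lambda>h. f (y + h *\<^sub>R b)) has_vector_derivative D b y) (at 0)"
    and C: "\<And>b. b \<in> Basis \<Longrightarrow> Ck_on k (D b) S"
  shows "Ck_on (Suc k) f S"
proof (rule Ck_on_SucI[OF S continuous_partials_imp_has_derivative[OF S _ D]])
  show "Ck_on k (\<lambda>x. \<Sum>b\<in>Basis. (v \<bullet> b) *\<^sub>R D b x) S" for v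
    by (intro Ck_on_sum Ck_on_compose_linear[OF S bounded_linear_scaleR_right] C S)
qed (use C Ck_on_imp_continuous_on in auto)

lemma frechet_directional:
  assumes "(f has_derivative f') (at x)"
  shows "((\<lambda>h. f (x + h *\<^sub>R v)) has_vector_derivative f' v) (at 0)"
proof -
  have "((\<lambda>h. x + h *\<^sub>R v) has_derivative (\<lambda>h. h *\<^sub>R v)) (at 0)"
    by (auto intro!: derivative_eq_intros)
  then have "((\<lambda>h. f (x + h *\<^sub>R v)) has_derivative (\<lambda>h. f' (h *\<^sub>R v))) (at 0)"
    using has_derivative_compose[of "\<lambda>h. x + h *\<^sub>R v" "\<lambda>h. h *\<^sub>R v" 0 UNIV f f'] assms by simp
  then show ?thesis
    using has_derivative_linear[OF assms] by (simp add: has_vector_derivative_def linear_cmul)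
qed

text \<open>Schwarz's theorem. It enters the jet calculus in the base case of
  \<open>commutator\<close>.\<close>

lemma second_derivative_symmetric:
  fixes f :: "'a::real_normed_vector \<Rightarrow> real"
  assumes S: "open S" and f: "Ck_on 2 f S" and x: "x \<in> S"
  shows "frechet_derivative (\<lambda>y. frechet_derivative f (at y) v) (at x) w =
         frechet_derivative (\<lambda>y. frechet_derivative f (at y) w) (at x) v"
proof -
  define D where "D a y = frechet_derivative f (at y) a" for a y
  define D2 where "D2 a b y = frechet_derivative (D a) (at y) b" for a b y
  have f1: "Ck_on 1 f S" "\<And>a. Ck_on 1 (D a) S"
    using f Ck_on_mono[of 2 f S 1] unfolding D_def numeral_2_eq_2 by auto
  have cont: "continuous_on S (D2 a b)" for a b
    using f1(2)[of a] unfolding D2_def by simp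
  have along: "((\<lambda>h. g (y + h *\<^sub>R a)) has_real_derivative frechet_derivative g (at (y + r *\<^sub>R a)) a) (at r)"
    if "y + r *\<^sub>R a \<in> S" "Ck_on 1 g S" for y r a and g :: "'a \<Rightarrow> real"
  proof -
    have g: "(g has_derivative frechet_derivative g (at (y + r *\<^sub>R a))) (at (y + r *\<^sub>R a))"
      using that by (simp add: frechet_derivative_works)
    have "((\<lambda>h. y + h *\<^sub>R a) has_derivative (\<lambda>h. h *\<^sub>R a)) (at r)"
      by (auto intro!: derivative_eq_intros)
    from has_derivative_compose[OF this g] show ?thesis
      using has_derivative_linear[OF g] by (simp add: has_field_derivative_def linear_cmul mult.commute[of _ "frechet_derivative g _ _"])
  qed
  have near: "D2 a b x - D2 b a x = 0" for a b
  proof (rule ccontr)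
    assume neq: "D2 a b x - D2 b a x \<noteq> 0"
    define e where "e = \<bar>D2 a b x - D2 b a x\<bar> / 2"
    have e: "e > 0" using neq by (simp add: e_def)
    have "\<forall>\<^sub>F y in nhds x. y \<in> S \<and> dist (D2 a b y) (D2 a b x) < e \<and> dist (D2 b a y) (D2 b a x) < e"
      using cont[of a b] cont[of b a] S x e
      by (intro eventually_conj eventually_nhds_in_open)
         (auto simp: continuous_on_eq_continuous_at continuous_at_eps_delta eventually_nhds_metric)
    then obtain \<delta> where \<delta>: "\<delta> > 0"
      "\<And>y. dist y x < \<delta> \<Longrightarrow> y \<in> S \<and> dist (D2 a b y) (D2 a b x) < e \<and> dist (D2 b a y) (D2 b a x) < e"
      unfolding eventually_nhds_metric by blast
    \<comment> \<open>The parallelogram with sides k a and k b stays within distance \<delta> of x;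
      the summand 1 keeps the denominator positive when both directions vanish.\<close>
    define k where "k = \<delta> / (norm a + norm b + 1)"
    have k: "k > 0" "k * (norm a + norm b) < \<delta>"
    proof -
      have "norm a + norm b + 1 > 0" by (smt (verit) norm_ge_zero)
      then show "k > 0" "k * (norm a + norm b) < \<delta>" using \<delta>(1) by (auto simp: k_def field_simps)
    qed
    have ball: "dist (x + s *\<^sub>R a + r *\<^sub>R b) x < \<delta>" if "0 \<le> s" "s \<le> k" "0 \<le> r" "r \<le> k" for s r
    proof -
      have "dist (x + s *\<^sub>R a + r *\<^sub>R b) x = norm (s *\<^sub>R a + r *\<^sub>R b)"
        by (simp add: dist_norm algebra_simps)
      also have "\<dots> \<le> s * norm a + r * norm b"
        using that norm_triangle_ineq[of "s *\<^sub>R a" "r *\<^sub>R b"] by simp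
      also have "\<dots> \<le> k * norm a + k * norm b"
        using that by (intro add_mono mult_right_mono) auto
      finally show ?thesis using k by (simp add: algebra_simps)
    qed
    \<comment> \<open>the second difference of \<open>f\<close> over a parallelogram, as a mixed derivative in either order\<close>
    have mixed: "\<exists>y. dist y x < \<delta> \<and> f (x + k *\<^sub>R p + k *\<^sub>R q) - f (x + k *\<^sub>R p) - f (x + k *\<^sub>R q) + f x = k * (k * D2 p q y)"
      if pq: "\<And>s r. 0 \<le> s \<Longrightarrow> s \<le> k \<Longrightarrow> 0 \<le> r \<Longrightarrow> r \<le> k \<Longrightarrow> dist (x + s *\<^sub>R p + r *\<^sub>R q) x < \<delta>" for p q
    proof -
      have inS: "x + s *\<^sub>R p + r *\<^sub>R q \<in> S" if "0 \<le> s" "s \<le> k" "0 \<le> r" "r \<le> k" for s r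
        using pq[OF that] \<delta>(2) by blast
      have "((\<lambda>s. f (x + k *\<^sub>R q + s *\<^sub>R p) - f (x + s *\<^sub>R p)) has_real_derivative
          D p (x + k *\<^sub>R q + s *\<^sub>R p) - D p (x + s *\<^sub>R p)) (at s)" if "0 \<le> s" "s \<le> k" for s
        unfolding D_def
      proof (intro DERIV_diff along f1(1))
        show "x + k *\<^sub>R q + s *\<^sub>R p \<in> S" "x + s *\<^sub>R p \<in> S"
          using inS[of s k] inS[of s 0] that k(1) by (simp_all add: algebra_simps)
      qed
      then obtain s where s: "0 < s" "s < k"
        "(f (x + k *\<^sub>R q + k *\<^sub>R p) - f (x + k *\<^sub>R p)) - (f (x + k *\<^sub>R q + 0 *\<^sub>R p) - f (x + 0 *\<^sub>R p))
           = (k - 0) * (D p (x + k *\<^sub>R q + s *\<^sub>R p) - D p (x + s *\<^sub>R p))"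
        using MVT2[OF k(1), of "\<lambda>s. f (x + k *\<^sub>R q + s *\<^sub>R p) - f (x + s *\<^sub>R p)"
            "\<lambda>s. D p (x + k *\<^sub>R q + s *\<^sub>R p) - D p (x + s *\<^sub>R p)"] by auto
      have "((\<lambda>r. D p (x + s *\<^sub>R p + r *\<^sub>R q)) has_real_derivative D2 p q (x + s *\<^sub>R p + r *\<^sub>R q)) (at r)" if "0 \<le> r" "r \<le> k" for r
        unfolding D2_def by (rule along[OF inS f1(2)]) (use that s in auto)
      then obtain r where r: "0 < r" "r < k" "D p (x + s *\<^sub>R p + k *\<^sub>R q) - D p (x + s *\<^sub>R p + 0 *\<^sub>R q) = (k - 0) * D2 p q (x + s *\<^sub>R p + r *\<^sub>R q)"
        using MVT2[OF k(1), of "\<lambda>r. D p (x + s *\<^sub>R p + r *\<^sub>R q)" "\<lambda>r. D2 p q (x + s *\<^sub>R p + r *\<^sub>R q)"] by auto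
      show ?thesis
        using s r pq[of s r] by (intro exI[of _ "x + s *\<^sub>R p + r *\<^sub>R q"]) (auto simp: algebra_simps)
    qed
    obtain y where y: "dist y x < \<delta>" "f (x + k *\<^sub>R a + k *\<^sub>R b) - f (x + k *\<^sub>R a) - f (x + k *\<^sub>R b) + f x = k * (k * D2 a b y)"
      using mixed[OF ball] by blast
    obtain y' where y': "dist y' x < \<delta>" "f (x + k *\<^sub>R b + k *\<^sub>R a) - f (x + k *\<^sub>R b) - f (x + k *\<^sub>R a) + f x = k * (k * D2 b a y')"
      using mixed[of b a] ball by (metis add.commute add.left_commute)
    have eq: "x + k *\<^sub>R b + k *\<^sub>R a = x + k *\<^sub>R a + k *\<^sub>R b" by simp
    have "k * (k * D2 a b y) = k * (k * D2 b a y')" using y(2) y'(2)[unfolded eq] by linarith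
    then have "D2 a b y = D2 b a y'" using k(1) by simp
    then show False using \<delta>(2)[OF y(1)] \<delta>(2)[OF y'(1)] unfolding e_def dist_real_def by argo
  qed
  then show ?thesis unfolding D2_def D_def by simp
qed

section \<open>Ordinary differential equations\<close>

lemma vector_derivative_bound:
  fixes h :: "real \<Rightarrow> 'e::real_normed_vector"
  assumes "convex S" "\<And>x. x \<in> S \<Longrightarrow> (h has_vector_derivative h' x) (at x within S)"
    and "\<And>x. x \<in> S \<Longrightarrow> norm (h' x) \<le> C" and "x \<in> S" "y \<in> S"
  shows "norm (h x - h y) \<le> C * \<bar>x - y\<bar>"
proof -
  have "norm (h x - h y) \<le> C * norm (x - y)"
  proof (rule differentiable_bound[OF assms(1), of h "\<lambda>x t. t *\<^sub>R h' x"])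
    show "(h has_derivative (\<lambda>t. t *\<^sub>R h' x)) (at x within S)" if "x \<in> S" for x
      using assms(2)[OF that] by (simp add: has_vector_derivative_def)
    show "onorm (\<lambda>t. t *\<^sub>R h' x) \<le> C" if "x \<in> S" for x
      using assms(3)[OF that] by (intro onorm_le) (simp add: mult.commute[of C] mult_left_mono)
  qed (use assms in auto)
  then show ?thesis by simp
qed

text \<open>At a point where the norm of d is maximal, the bound on the derivative gives max \<le>
  norm (d 0) + max / 2 + r \<epsilon>, because r L \<le> 1/2. Absorbing the half replaces the
  exponential of Gronwall's inequality.\<close>

lemma ode_estimate:
  fixes d :: "real \<Rightarrow> 'e::real_normed_vector"
  assumes r: "0 \<le> r" "r * L \<le> 1/2" and L: "0 \<le> L" and "0 \<le> \<epsilon>"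
    and d: "\<And>s. s \<in> {-r..r} \<Longrightarrow> (d has_vector_derivative d' s) (at s within {-r..r})"
    and b: "\<And>s. s \<in> {-r..r} \<Longrightarrow> norm (d' s) \<le> L * norm (d s) + \<epsilon>"
    and s: "s \<in> {-r..r}"
  shows "norm (d s) \<le> 2 * (norm (d 0) + r * \<epsilon>)"
proof -
  have cont: "continuous_on {-r..r} d"
    using d by (meson continuous_on_vector_derivative)
  obtain s0 where s0: "s0 \<in> {-r..r}" "\<And>s. s \<in> {-r..r} \<Longrightarrow> norm (d s) \<le> norm (d s0)"
    using continuous_attains_sup[of "{-r..r}" "\<lambda>s. norm (d s)"] cont r(1) continuous_on_norm by force
  have "norm (d s0 - d 0) \<le> (L * norm (d s0) + \<epsilon>) * \<bar>s0 - 0\<bar>"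
  proof (rule vector_derivative_bound[OF _ d])
    fix s assume s: "s \<in> {-r..r}"
    show "norm (d' s) \<le> L * norm (d s0) + \<epsilon>"
      using b[OF s] mult_left_mono[OF s0(2)[OF s] L] by linarith
  qed (use r s0 in auto)
  also have "\<dots> \<le> (L * norm (d s0) + \<epsilon>) * r"
    using s0(1) L \<open>0 \<le> \<epsilon>\<close> by (intro mult_left_mono) auto
  also have "\<dots> = (r * L) * norm (d s0) + r * \<epsilon>" by (simp add: algebra_simps)
  also have "\<dots> \<le> (1/2) * norm (d s0) + r * \<epsilon>"
    using mult_right_mono[OF r(2), of "norm (d s0)"] by simp
  finally have "norm (d s0) \<le> 2 * (norm (d 0) + r * \<epsilon>)"
    using norm_triangle_ineq2[of "d s0" "d 0"] by (simp add: distrib_left)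
  then show ?thesis using s0(2)[OF s] by linarith
qed

text \<open>Banach's fixed point theorem for the integral operator; a L \<le> 1/2 is its contraction
  factor.\<close>

lemma picard_closed:
  fixes f :: "real \<Rightarrow> 'e::euclidean_space \<Rightarrow> 'e"
  assumes a: "0 < a" "a * L \<le> 1/2" and L: "0 \<le> L"
    and cont: "continuous_on ({-a..a} \<times> UNIV) (\<lambda>(s, y). f s y)"
    and lip: "\<And>s y z. s \<in> {-a..a} \<Longrightarrow> norm (f s y - f s z) \<le> L * norm (y - z)"
  shows "\<exists>y. y 0 = c \<and> (\<forall>s\<in>{-a..a}. (y has_vector_derivative f s (y s)) (at s within {-a..a}))"
proof -
  \<comment> \<open>Clamps time to the interval, so that functions on it extend to bounded
    continuous functions on the whole line, which form a complete space.\<close>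
  define \<kappa> where "\<kappa> s = max (-a) (min a s)" for s
  have \<kappa>: "\<kappa> s \<in> {-a..a}" "s \<in> {-a..a} \<Longrightarrow> \<kappa> s = s" "continuous_on UNIV \<kappa>" for s
    using a(1) unfolding \<kappa>_def by (auto intro!: continuous_intros)
  \<comment> \<open>The integral from 0 to s, written as a difference so that negative s is
    covered.\<close>
  define J where "J g s = integral {-a..s} g - integral {-a..0} g" for g :: "real \<Rightarrow> 'e" and s
  have J0 [simp]: "J g 0 = 0" for g by (simp add: J_def)
  have J: "(J g has_vector_derivative g s) (at s within {-a..a})"
    if "continuous_on {-a..a} g" "s \<in> {-a..a}" for g s
    using has_vector_derivative_diff[OF integral_has_vector_derivative[OF that] has_vector_derivative_const]
    unfolding J_def by simp
  have fy: "continuous_on {-a..a} (\<lambda>s. f s (y s))" if "continuous_on {-a..a} y" for y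
  proof -
    have "continuous_on {-a..a} (\<lambda>s. (\<lambda>(s, y). f s y) (s, y s))"
      by (rule continuous_on_compose2[OF cont continuous_on_Pair[OF continuous_on_id that]]) auto
    then show ?thesis by simp
  qed
  have bc: "continuous_on S (apply_bcontfun y)" for S and y :: "real \<Rightarrow>\<^sub>C 'e"
    using continuous_on_subset[OF continuous_on_apply_bcontfun] by fast
  define P where "P y = (\<lambda>s. c + J (\<lambda>s. f s (apply_bcontfun y s)) (\<kappa> s))" for y :: "real \<Rightarrow>\<^sub>C 'e"
  have cJ: "continuous_on {-a..a} (J (\<lambda>s. f s (apply_bcontfun y s)))" for y :: "real \<Rightarrow>\<^sub>C 'e"
    by (rule continuous_on_vector_derivative[OF J[OF fy[OF bc]]])
  have P: "P y \<in> bcontfun" for y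
  proof -
    have "continuous_on UNIV (\<lambda>s. J (\<lambda>s. f s (apply_bcontfun y s)) (\<kappa> s))"
      by (rule continuous_on_compose2[OF cJ \<kappa>(3)]) (use \<kappa>(1) in blast)
    moreover have "bounded ((\<lambda>s. c + J (\<lambda>s. f s (apply_bcontfun y s)) s) ` {-a..a})"
      by (intro compact_imp_bounded compact_continuous_image continuous_on_add continuous_on_const cJ) auto
    then have "bounded (range (P y))"
      by (rule bounded_subset) (use \<kappa>(1) in \<open>auto simp: P_def\<close>)
    ultimately show ?thesis unfolding P_def bcontfun_def by (auto intro!: continuous_intros)
  qed
  have ap: "apply_bcontfun (Bcontfun (P y)) = P y" for y using P by (simp add: Bcontfun_inverse)
  have "\<exists>!y. Bcontfun (P y) = y"
  proof (rule banach_fix_type[of "1/2"])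
    show "\<forall>y z. dist (Bcontfun (P y)) (Bcontfun (P z)) \<le> 1/2 * dist y z"
    proof (intro allI dist_bound)
      fix y z :: "real \<Rightarrow>\<^sub>C 'e" and s
      let ?h = "\<lambda>s. J (\<lambda>s. f s (apply_bcontfun y s)) s - J (\<lambda>s. f s (apply_bcontfun z s)) s"
      have "norm (?h (\<kappa> s) - ?h 0) \<le> (L * dist y z) * \<bar>\<kappa> s - 0\<bar>"
      proof (rule vector_derivative_bound[of "{-a..a}"])
        fix s assume s: "s \<in> {-a..a}"
        show "(?h has_vector_derivative (f s (apply_bcontfun y s) - f s (apply_bcontfun z s))) (at s within {-a..a})"
          by (intro has_vector_derivative_diff J[OF fy[OF bc] s])
        show "norm (f s (apply_bcontfun y s) - f s (apply_bcontfun z s)) \<le> L * dist y z"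
          using lip[OF s] mult_left_mono[OF dist_bounded[of y s z] L] by (smt (verit) dist_norm)
      qed (use \<kappa>(1) a(1) in auto)
      also have "\<dots> \<le> (L * dist y z) * a"
        using \<kappa>(1)[of s] L by (intro mult_left_mono) auto
      also have "\<dots> \<le> 1/2 * dist y z"
        using mult_right_mono[OF a(2), of "dist y z"] by (simp add: algebra_simps)
      finally show "dist (apply_bcontfun (Bcontfun (P y)) s) (apply_bcontfun (Bcontfun (P z)) s) \<le> 1/2 * dist y z"
        unfolding ap by (simp add: P_def dist_norm)
    qed
  qed auto
  then obtain y where "Bcontfun (P y) = y" by blast
  then have y: "apply_bcontfun y = P y" using ap by metis
  show ?thesis
  proof (intro exI[of _ "apply_bcontfun y"] conjI ballI)
    show "apply_bcontfun y 0 = c"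
      unfolding y using \<kappa>(2)[of 0] a(1) by (simp add: P_def)
    fix s assume s: "s \<in> {-a..a}"
    have "((\<lambda>s. c + J (\<lambda>s. f s (apply_bcontfun y s)) s) has_vector_derivative 0 + f s (apply_bcontfun y s)) (at s within {-a..a})"
      by (intro has_vector_derivative_add J[OF fy[OF bc] s] has_vector_derivative_const)
    moreover have "c + J (\<lambda>s. f s (apply_bcontfun y s)) r = apply_bcontfun y r" if "r \<in> {-a..a}" for r
      using fun_cong[OF y, of r] unfolding P_def \<kappa>(2)[OF that] by (rule sym)
    ultimately show "(apply_bcontfun y has_vector_derivative f s (apply_bcontfun y s)) (at s within {-a..a})"
      using has_vector_derivative_transform[OF s, of "apply_bcontfun y" "\<lambda>s. c + J (\<lambda>s. f s (apply_bcontfun y s)) s"] by simp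
  qed
qed

text \<open>The right-hand side need not extend continuously to the ends of the interval. Solutions
  on smaller closed intervals agree where both exist, by \<open>ode_estimate\<close>, and are
  glued.\<close>

lemma picard_open:
  fixes f :: "real \<Rightarrow> 'e::euclidean_space \<Rightarrow> 'e"
  assumes a: "0 < a" "a * L \<le> 1/2" and L: "0 \<le> L"
    and cont: "continuous_on ({-a<..<a} \<times> UNIV) (\<lambda>(s, y). f s y)"
    and lip: "\<And>s y z. s \<in> {-a<..<a} \<Longrightarrow> norm (f s y - f s z) \<le> L * norm (y - z)"
  shows "\<exists>y. y 0 = c \<and> (\<forall>s\<in>{-a<..<a}. (y has_vector_derivative f s (y s)) (at s))"
proof -
  define sol where "sol r y \<longleftrightarrow> y 0 = c \<and> (\<forall>s\<in>{-r..r}. (y has_vector_derivative f s (y s)) (at s within {-r..r}))" for r y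
  have ex: "\<exists>y. sol r y" if "0 < r" "r < a" for r
    unfolding sol_def
  proof (rule picard_closed)
    show "r * L \<le> 1/2" using that a L by (smt (verit) mult_right_mono)
    show "continuous_on ({-r..r} \<times> UNIV) (\<lambda>(s, y). f s y)"
      by (rule continuous_on_subset[OF cont]) (use that in auto)
  qed (use that L lip in auto)
  have unique: "y s = z s" if "sol r y" "sol r' z" "r \<le> r'" "r' < a" "s \<in> {-r..r}" for r r' y z s
  proof -
    have "norm (y s - z s) \<le> 2 * (norm (y 0 - z 0) + r * 0)"
    proof (rule ode_estimate[where L = L and d' = "\<lambda>s. f s (y s) - f s (z s)"])
      show "r * L \<le> 1/2" using that a L by (smt (verit) mult_right_mono)
      fix s assume "s \<in> {-r..r}"
      then show "((\<lambda>s. y s - z s) has_vector_derivative f s (y s) - f s (z s)) (at s within {-r..r})"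
        using that has_vector_derivative_within_subset[of z "f s (z s)" s "{-r'..r'}" "{-r..r}"]
        by (intro has_vector_derivative_diff) (auto simp: sol_def)
    qed (use that lip L in auto)
    then show ?thesis using that by (simp add: sol_def)
  qed
  define W where "W r = (SOME y. sol r y)" for r
  have W: "sol r (W r)" if "0 < r" "r < a" for r
    unfolding W_def using ex[OF that] by (rule someI_ex)
  \<comment> \<open>At time s the solution on the interval of radius halfway between \<bar>s\<bar>
    and a is used; by uniqueness any other admissible radius gives the same value.\<close>
  define w where "w s = W ((\<bar>s\<bar> + a) / 2) s" for s
  have w: "w s = W r s" if "0 < r" "r < a" "\<bar>s\<bar> \<le> r" for r s
  proof (cases "r \<le> (\<bar>s\<bar> + a) / 2")
    case True
    then show ?thesis unfolding w_def
      using unique[of r "W r" "(\<bar>s\<bar> + a) / 2" "W ((\<bar>s\<bar> + a) / 2)" s] W that by (auto simp: abs_le_iff)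
  next
    case False
    have "s \<in> {- ((\<bar>s\<bar> + a) / 2)..(\<bar>s\<bar> + a) / 2}" using that by (auto simp: abs_if field_simps)
    then show ?thesis using False unfolding w_def
      using unique[of "(\<bar>s\<bar> + a) / 2" "W ((\<bar>s\<bar> + a) / 2)" r "W r" s] W that a by (auto simp: abs_le_iff)
  qed
  show ?thesis
  proof (intro exI[of _ w] conjI ballI)
    show "w 0 = c" using W[of "a/2"] w[of "a/2" 0] a by (simp add: sol_def)
    fix s assume s: "s \<in> {-a<..<a}"
    define r where "r = (\<bar>s\<bar> + a) / 2"
    have r: "0 < r" "r < a" "\<bar>s\<bar> < r" using s by (auto simp: r_def)
    have "(W r has_vector_derivative f s (W r s)) (at s within {-r..r})"
      using W[OF r(1,2)] r(3) by (auto simp: sol_def abs_less_iff)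
    then have "(W r has_vector_derivative f s (W r s)) (at s)"
      using r(3) by (subst (asm) at_within_interior) (auto simp: abs_less_iff)
    then show "(w has_vector_derivative f s (w s)) (at s)"
      using has_vector_derivative_transform_within_open[of "W r" "f s (W r s)" s "{-r<..<r}" w] w[OF r(1,2)] r
      by (auto simp: abs_less_iff abs_le_iff)
  qed
qed

section \<open>Uniform estimates near a compact set\<close>

lemma uniformly_near_compact:
  fixes g :: "'a::euclidean_space \<Rightarrow> 'b::metric_space"
  assumes "open T" "compact K" "K \<subseteq> T" "continuous_on T g" "e > 0"
  shows "\<exists>\<delta>>0. \<forall>a\<in>K. \<forall>x. dist x a < \<delta> \<longrightarrow> x \<in> T \<and> dist (g x) (g a) < e"
proof -
  obtain \<rho> where \<rho>: "\<rho> > 0" "(\<Union>x\<in>K. ball x \<rho>) \<subseteq> T"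
    using compact_subset_open_imp_ball_epsilon_subset[OF assms(2,1,3)] by blast
  \<comment> \<open>A compact neighbourhood of K inside T: uniform continuity on it allows the
    second point to lie outside K.\<close>
  define K' where "K' = {x + y |x y. x \<in> K \<and> y \<in> cball 0 (\<rho>/2)}"
  have "compact K'" unfolding K'_def by (intro compact_sums assms(2)) auto
  have "K' \<subseteq> T"
  proof
    fix z assume "z \<in> K'"
    then obtain x y where "z = x + y" "x \<in> K" "norm y \<le> \<rho>/2" by (auto simp: K'_def)
    then have "z \<in> ball x \<rho>" using \<rho>(1) by (simp add: dist_norm)
    then show "z \<in> T" using \<rho>(2) \<open>x \<in> K\<close> by blast
  qed
  have "uniformly_continuous_on K' g"
    using \<open>compact K'\<close> \<open>K' \<subseteq> T\<close> assms(4) by (meson compact_uniformly_continuous continuous_on_subset)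
  then obtain d where d: "d > 0" "\<And>x y. x \<in> K' \<Longrightarrow> y \<in> K' \<Longrightarrow> dist y x < d \<Longrightarrow> dist (g y) (g x) < e"
    unfolding uniformly_continuous_on_def using assms(5) by metis
  have near: "x \<in> K'" if "a \<in> K" "dist x a < \<rho>/2" for a x
  proof -
    have "x = a + (x - a)" "x - a \<in> cball 0 (\<rho>/2)" using that by (auto simp: dist_norm norm_minus_commute)
    then show ?thesis using that(1) unfolding K'_def by blast
  qed
  show ?thesis
    using d \<rho>(1) near \<open>K' \<subseteq> T\<close> by (intro exI[of _ "min d (\<rho>/2)"]) (auto simp: subset_iff)
qed

lemma derivative_uniform_bound:
  fixes f :: "'a::euclidean_space \<Rightarrow> 'b::real_normed_vector"
  assumes K: "compact K" "K \<subseteq> T"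
    and hd: "\<And>z. z \<in> T \<Longrightarrow> (f has_derivative f' z) (at z)"
    and cont: "\<And>v. continuous_on T (\<lambda>z. f' z v)"
  shows "\<exists>N\<ge>0. \<forall>a\<in>K. \<forall>v. norm (f' a v) \<le> N * norm v"
proof -
  have "\<exists>N\<ge>0. \<forall>a\<in>K. norm (f' a b) \<le> N" for b
  proof -
    have "bounded ((\<lambda>z. f' z b) ` K)"
      using K cont by (intro compact_imp_bounded compact_continuous_image) (auto intro: continuous_on_subset)
    then show ?thesis unfolding bounded_iff by (metis dual_order.trans imageI linorder_linear norm_ge_zero)
  qed
  then obtain N where N: "\<And>b. N b \<ge> 0" "\<And>a b. a \<in> K \<Longrightarrow> norm (f' a b) \<le> N b" by metis
  have "norm (f' a v) \<le> (\<Sum>b\<in>Basis. N b) * norm v" if "a \<in> K" for a v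
  proof -
    have "f' a v = (\<Sum>b\<in>Basis. (v \<bullet> b) *\<^sub>R f' a b)" using frechet_expand[OF hd] that K by blast
    also have "norm \<dots> \<le> (\<Sum>b\<in>Basis. N b * norm v)"
    proof (rule sum_norm_le)
      fix b :: 'a assume b: "b \<in> Basis"
      have "norm ((v \<bullet> b) *\<^sub>R f' a b) = \<bar>v \<bullet> b\<bar> * norm (f' a b)" by simp
      also have "\<dots> \<le> norm v * N b" using N(2)[OF that] Basis_le_norm[OF b] by (intro mult_mono) auto
      finally show "norm ((v \<bullet> b) *\<^sub>R f' a b) \<le> N b * norm v" by (simp add: mult.commute)
    qed
    finally show ?thesis by (simp add: sum_distrib_right)
  qed
  then show ?thesis using N(1) by (intro exI[of _ "\<Sum>b\<in>Basis. N b"]) (auto intro: sum_nonneg)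
qed

text \<open>The linearisation error is controlled by the oscillation of the derivative over a small
  ball, and this oscillation is small uniformly over centres in K.\<close>

lemma uniformly_differentiable:
  fixes f :: "'a::euclidean_space \<Rightarrow> 'b::real_normed_vector"
  assumes T: "open T" and K: "compact K" "K \<subseteq> T"
    and hd: "\<And>z. z \<in> T \<Longrightarrow> (f has_derivative f' z) (at z)"
    and cont: "\<And>v. continuous_on T (\<lambda>z. f' z v)" and e: "e > 0"
  shows "\<exists>\<delta>>0. \<forall>a\<in>K. \<forall>x. norm (x - a) < \<delta> \<longrightarrow> x \<in> T \<and> norm (f x - f a - f' a (x - a)) \<le> e * norm (x - a)"
proof -
  define n where "n = real DIM('a)"
  have n: "n > 0" by (simp add: n_def)
  have "\<exists>\<delta>>0. \<forall>a\<in>K. \<forall>x. dist x a < \<delta> \<longrightarrow> x \<in> T \<and> dist (f' x b) (f' a b) < e / n" for b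
    using uniformly_near_compact[OF T K cont, of "e / n" b] e n by simp
  then obtain \<delta> where \<delta>: "\<And>b. \<delta> b > 0" "\<And>b a x. a \<in> K \<Longrightarrow> dist x a < \<delta> b \<Longrightarrow> x \<in> T \<and> dist (f' x b) (f' a b) < e / n"
    by metis
  define d where "d = Min (\<delta> ` Basis)"
  have d: "d > 0" "\<And>b. b \<in> Basis \<Longrightarrow> d \<le> \<delta> b" using \<delta>(1) by (auto simp: d_def)
  obtain b0 :: 'a where b0: "b0 \<in> Basis" using nonempty_Basis by blast
  show ?thesis
  proof (intro exI[of _ d] conjI ballI allI impI)
    fix a x assume a: "a \<in> K" and x: "norm (x - a) < d"
    have inT: "y \<in> T" if "y \<in> ball a d" for y
      using \<delta>(2)[OF a, of y b0] d(2)[OF b0] that by (simp add: dist_commute)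
    show "x \<in> T" using inT[of x] x by (simp add: dist_norm norm_minus_commute)
    have "norm (f x - f a - f' a (x - a)) \<le> norm (x - a) * e"
    proof (rule differentiable_bound_linearization[where S = "ball a d" and f' = f'])
      fix t :: real assume t: "t \<in> {0..1}"
      then have "\<bar>t\<bar> * norm (x - a) \<le> 1 * norm (x - a)" by (intro mult_right_mono) auto
      then show "a + t *\<^sub>R (x - a) \<in> ball a d" using x by (simp add: dist_norm)
    next
      fix y assume y: "y \<in> ball a d"
      show "(f has_derivative f' y) (at y within ball a d)" using hd[OF inT[OF y]] has_derivative_at_withinI by blast
      show "onorm (f' y - f' a) \<le> e"
      proof (rule onorm_le)
        fix v
        have "(f' y - f' a) v = (\<Sum>b\<in>Basis. (v \<bullet> b) *\<^sub>R (f' y b - f' a b))"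
          using frechet_expand[OF hd[OF inT[OF y]], of v] frechet_expand[OF hd, of a v] a K
          by (simp add: scaleR_diff_right sum_subtractf subset_iff)
        also have "norm \<dots> \<le> (\<Sum>b\<in>(Basis::'a set). e / n * norm v)"
        proof (rule sum_norm_le)
          fix b :: 'a assume b: "b \<in> Basis"
          have "norm (f' y b - f' a b) \<le> e / n"
            using \<delta>(2)[OF a, of y b] d(2)[OF b] y by (simp add: dist_norm norm_minus_commute less_imp_le)
          then have "\<bar>v \<bullet> b\<bar> * norm (f' y b - f' a b) \<le> norm v * (e / n)"
            using Basis_le_norm[OF b, of v] by (intro mult_mono) auto
          then show "norm ((v \<bullet> b) *\<^sub>R (f' y b - f' a b)) \<le> e / n * norm v" by (simp add: mult.commute)
        qed
        also have "\<dots> = e * norm v" using n by (simp add: n_def)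
        finally show "norm ((f' y - f' a) v) \<le> e * norm v" .
      qed
    qed (use d in auto)
    then show "norm (f x - f a - f' a (x - a)) \<le> e * norm (x - a)" by (simp add: mult.commute)
  qed (use d in auto)
qed


section \<open>Families of solutions depending on a parameter\<close>

locale ode_family =
  fixes f :: "real \<times> 'e::euclidean_space \<times> 'p::euclidean_space \<Rightarrow> 'e"
    and a L :: real and Y :: "'e set" and B :: "'p set" and y :: "real \<times> 'p \<Rightarrow> 'e"
  assumes a: "0 < a" "a * L \<le> 1/2" and L: "0 \<le> L" and opn: "open Y" "open B"
    and cont: "continuous_on ({-a<..<a} \<times> Y \<times> B) f"
    and lip: "\<And>s u v p. s \<in> {-a<..<a} \<Longrightarrow> p \<in> B \<Longrightarrow> u \<in> Y \<Longrightarrow> v \<in> Y \<Longrightarrow>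
      norm (f (s, u, p) - f (s, v, p)) \<le> L * norm (u - v)"
    and inY: "\<And>s p. s \<in> {-a<..<a} \<Longrightarrow> p \<in> B \<Longrightarrow> y (s, p) \<in> Y"
    and sol: "\<And>s p. s \<in> {-a<..<a} \<Longrightarrow> p \<in> B \<Longrightarrow>
      ((\<lambda>s. y (s, p)) has_vector_derivative f (s, y (s, p), p)) (at s)"
    and init: "continuous_on B (\<lambda>p. y (0, p))"
begin

lemma rL: "r < a \<Longrightarrow> r * L \<le> 1/2"
  using a L mult_right_mono[of r a L] by linarith

lemma continuous_time: "p \<in> B \<Longrightarrow> continuous_on {-a<..<a} (\<lambda>s. y (s, p))"
  by (intro continuous_at_imp_continuous_on ballI has_vector_derivative_continuous[OF sol])

text \<open>The difference of two solutions satisfies \<open>ode_estimate\<close>, where the defect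
  is the change of the right-hand side with the parameter along the fixed curve at
  \<open>p0\<close>. By compactness of the time interval this defect is uniformly small.\<close>

lemma uniformly_close:
  assumes p: "p0 \<in> B" and r: "0 \<le> r" "r < a" and e: "e > 0"
  shows "\<exists>X. open X \<and> p0 \<in> X \<and> (\<forall>p\<in>X \<inter> B. \<forall>s\<in>{-r..r}. norm (y (s, p) - y (s, p0)) \<le> e)"
proof -
  \<comment> \<open>Makes r \<epsilon> \<le> e/4. Together with e/4 for the initial values and the
    factor 2 of \<open>ode_estimate\<close> this yields e.\<close>
  define \<epsilon> where "\<epsilon> = e / (4 * (r + 1))"
  have \<epsilon>: "\<epsilon> > 0" "r * \<epsilon> \<le> e / 4" using r e by (auto simp: \<epsilon>_def field_simps)
  have "continuous_on (B \<times> {-r..r}) (\<lambda>z. y (snd z, p0))"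
    by (rule continuous_on_compose2[OF continuous_time[OF p] continuous_on_snd[OF continuous_on_id]]) (use r in auto)
  then have "continuous_on (B \<times> {-r..r}) (\<lambda>(p, s). f (s, y (s, p0), p))"
    unfolding case_prod_unfold
    by (intro continuous_on_compose2[OF cont] continuous_intros) (use r inY p in auto)
  from continuous_on_prod_compactE[OF this _ p \<epsilon>(1)] obtain X where X: "p0 \<in> X" "open X"
    "\<forall>p\<in>X \<inter> B. \<forall>s\<in>{-r..r}. dist (f (s, y (s, p0), p)) (f (s, y (s, p0), p0)) \<le> \<epsilon>"
    by auto
  have "isCont (\<lambda>p. y (0, p)) p0" using init opn(2) p by (simp add: continuous_on_eq_continuous_at)
  then obtain \<delta> where \<delta>: "\<delta> > 0" "\<And>p. dist p p0 < \<delta> \<Longrightarrow> dist (y (0, p)) (y (0, p0)) < e/4"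
    unfolding continuous_at_eps_delta using e by (metis zero_less_divide_iff zero_less_numeral)
  show ?thesis
  proof (intro exI[of _ "X \<inter> ball p0 \<delta>"] conjI ballI)
    fix p s assume pp: "p \<in> X \<inter> ball p0 \<delta> \<inter> B" and s: "s \<in> {-r..r}"
    have "norm (y (s, p) - y (s, p0)) \<le> 2 * (norm (y (0, p) - y (0, p0)) + r * \<epsilon>)"
    proof (rule ode_estimate[OF r(1) rL[OF r(2)] L _ _ _ s])
      fix s assume s: "s \<in> {-r..r}"
      then have s': "s \<in> {-a<..<a}" using r by auto
      show "((\<lambda>s. y (s, p) - y (s, p0)) has_vector_derivative f (s, y (s, p), p) - f (s, y (s, p0), p0)) (at s within {-r..r})"
        using pp by (intro has_vector_derivative_diff has_vector_derivative_at_within[OF sol] s' p) auto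
      have "norm (f (s, y (s, p), p) - f (s, y (s, p0), p)) \<le> L * norm (y (s, p) - y (s, p0))"
        using lip[OF s' _ inY[OF s'] inY[OF s' p]] pp by auto
      moreover have "norm (f (s, y (s, p0), p) - f (s, y (s, p0), p0)) \<le> \<epsilon>"
        using X(3) pp s by (auto simp: dist_norm)
      ultimately show "norm (f (s, y (s, p), p) - f (s, y (s, p0), p0)) \<le> L * norm (y (s, p) - y (s, p0)) + \<epsilon>"
        using norm_triangle_ineq[of "f (s, y (s, p), p) - f (s, y (s, p0), p)" "f (s, y (s, p0), p) - f (s, y (s, p0), p0)"] by simp
    qed (use \<epsilon> in auto)
    also have "\<dots> \<le> 2 * (e/4 + e/4)"
      using \<delta>(2)[of p] pp \<epsilon>(2) by (auto simp: dist_norm norm_minus_commute intro!: add_mono)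
    finally show "norm (y (s, p) - y (s, p0)) \<le> e" by simp
  qed (use X \<delta> in auto)
qed

lemma continuous_solution: "continuous_on ({-a<..<a} \<times> B) y"
proof -
  have "isCont y (s0, p0)" if s0: "s0 \<in> {-a<..<a}" and p0: "p0 \<in> B" for s0 p0
  proof -
    define r where "r = (\<bar>s0\<bar> + a) / 2"
    have r: "0 \<le> r" "r < a" "\<bar>s0\<bar> < r" using s0 by (auto simp: r_def)
    have "\<forall>\<^sub>F z in nhds (s0, p0). dist (y z) (y (s0, p0)) < e" if e: "e > 0" for e
    proof -
      obtain X where X: "open X" "p0 \<in> X" "\<And>p s. p \<in> X \<inter> B \<Longrightarrow> s \<in> {-r..r} \<Longrightarrow> norm (y (s, p) - y (s, p0)) \<le> e/3"
        using uniformly_close[OF p0 r(1,2), of "e/3"] e by auto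
      have "isCont (\<lambda>s. y (s, p0)) s0"
        using continuous_time[OF p0] s0 by (simp add: continuous_on_eq_continuous_at)
      then obtain \<delta> where \<delta>: "\<delta> > 0" "\<And>s. dist s s0 < \<delta> \<Longrightarrow> dist (y (s, p0)) (y (s0, p0)) < e/3"
        unfolding continuous_at_eps_delta using e by (metis zero_less_divide_iff zero_less_numeral)
      have "open ((ball s0 \<delta> \<inter> {-r<..<r}) \<times> (X \<inter> B))" by (intro open_Times open_Int opn X) auto
      moreover have "(s0, p0) \<in> (ball s0 \<delta> \<inter> {-r<..<r}) \<times> (X \<inter> B)" using \<delta> r X p0 by auto
      ultimately have "\<forall>\<^sub>F z in nhds (s0, p0). z \<in> (ball s0 \<delta> \<inter> {-r<..<r}) \<times> (X \<inter> B)"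
        by (rule eventually_nhds_in_open)
      then show ?thesis
      proof eventually_elim
        case (elim z)
        obtain s p where z: "z = (s, p)" by fastforce
        have "dist (y (s, p)) (y (s, p0)) \<le> e/3" using X(3)[of p s] elim z by (auto simp: dist_norm)
        moreover have "dist (y (s, p0)) (y (s0, p0)) < e/3" using \<delta>(2)[of s] elim z by (auto simp: dist_commute)
        ultimately have "dist (y (s, p)) (y (s0, p0)) < e"
          using dist_triangle[of "y (s, p)" "y (s0, p0)" "y (s, p0)"] e by linarith
        then show ?case using z by simp
      qed
    qed
    then show ?thesis
      unfolding isCont_def tendsto_iff eventually_at_filter by (auto intro: eventually_mono)
  qed
  then show ?thesis by (intro continuous_at_imp_continuous_on) auto
qed

end

text \<open>Passes the Lipschitz constant of a right-hand side on to its derivative, so that the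
  variational equation has the same constant L.\<close>

lemma derivative_le_lipschitz:
  assumes hd: "(f has_derivative f') (at x)" and S: "open S" "x \<in> S"
    and lip: "\<And>h. x + h *\<^sub>R v \<in> S \<Longrightarrow> norm (f (x + h *\<^sub>R v) - f x) \<le> C * \<bar>h\<bar>"
  shows "norm (f' v) \<le> C"
proof -
  have hv: "((\<lambda>h. f (x + h *\<^sub>R v)) has_derivative (\<lambda>h. h *\<^sub>R f' v)) (at 0)"
    using frechet_directional[OF hd] by (simp add: has_vector_derivative_def)
  have "((\<lambda>h. x + h *\<^sub>R v) \<longlongrightarrow> x + 0 *\<^sub>R v) (at (0::real))" by (intro tendsto_intros)
  then have "\<forall>\<^sub>F h in at (0::real). x + h *\<^sub>R v \<in> S"
    using S topological_tendstoD by fastforce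
  then obtain d1 where d1: "d1 > 0" "\<And>h. h \<noteq> 0 \<Longrightarrow> \<bar>h\<bar> < d1 \<Longrightarrow> x + h *\<^sub>R v \<in> S"
    unfolding eventually_at by (auto simp: dist_norm)
  have "norm (f' v) \<le> C + e" if e: "e > 0" for e
  proof -
    obtain d2 where d2: "d2 > 0" "\<And>h. \<bar>h\<bar> < d2 \<Longrightarrow> norm (f (x + h *\<^sub>R v) - f x - h *\<^sub>R f' v) \<le> e * \<bar>h\<bar>"
      using hv e unfolding has_derivative_at_alt by auto
    define h where "h = min d1 d2 / 2"
    have h: "h > 0" "\<bar>h\<bar> < d1" "\<bar>h\<bar> < d2" using d1 d2 by (auto simp: h_def min_def)
    have "norm (h *\<^sub>R f' v) \<le> norm (f (x + h *\<^sub>R v) - f x) + norm (f (x + h *\<^sub>R v) - f x - h *\<^sub>R f' v)"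
      using norm_triangle_ineq4[of "f (x + h *\<^sub>R v) - f x" "f (x + h *\<^sub>R v) - f x - h *\<^sub>R f' v"] by simp
    also have "\<dots> \<le> C * \<bar>h\<bar> + e * \<bar>h\<bar>"
      using lip[OF d1(2)[of h]] d2(2)[of h] h by (intro add_mono) auto
    finally have "h * norm (f' v) \<le> h * (C + e)" using h(1) by (simp add: algebra_simps)
    then show ?thesis using h(1) by simp
  qed
  then show ?thesis by (rule field_le_epsilon)
qed

text \<open>The candidate w solves the variational equation along y. \<open>ode_estimate\<close>
  applied to y (s, p + h e) - y (s, p) - h w shows that it is the derivative; by \<open>in0\<close>
  this difference starts at zero.\<close>

lemma (in ode_family) parameter_derivative:
  assumes hd: "\<And>z. z \<in> {-a<..<a} \<times> Y \<times> B \<Longrightarrow> (f has_derivative f' z) (at z)"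
    and cd: "\<And>v. continuous_on ({-a<..<a} \<times> Y \<times> B) (\<lambda>z. f' z v)"
    and in0: "\<And>p h. p \<in> B \<Longrightarrow> p + h *\<^sub>R e \<in> B \<Longrightarrow> y (0, p + h *\<^sub>R e) = y (0, p) + h *\<^sub>R c"
  shows "\<exists>w. \<forall>p\<in>B. w (0, p) = c \<and> (\<forall>s\<in>{-a<..<a}.
      ((\<lambda>s. w (s, p)) has_vector_derivative f' (s, y (s, p), p) (0, w (s, p), e)) (at s) \<and>
      ((\<lambda>h. y (s, p + h *\<^sub>R e)) has_vector_derivative w (s, p)) (at 0))"
proof -
  define Q where "Q p w \<longleftrightarrow> w 0 = c \<and> (\<forall>s\<in>{-a<..<a}.
      (w has_vector_derivative f' (s, y (s, p), p) (0, w s, e)) (at s) \<and>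
      ((\<lambda>h. y (s, p + h *\<^sub>R e)) has_vector_derivative w s) (at 0))" for p w
  have ex: "\<exists>w. Q p w" if p: "p \<in> B" for p
  proof -
    define A where "A s u = f' (s, y (s, p), p) (0, u, e)" for s u
    have T: "open ({-a<..<a} \<times> Y \<times> B)" using opn by (intro open_Times) auto
    have inT: "(s, y (s, p), p) \<in> {-a<..<a} \<times> Y \<times> B" if "s \<in> {-a<..<a}" for s
      using that p inY by auto
    have lin: "linear (f' (s, y (s, p), p))" if "s \<in> {-a<..<a}" for s
      using hd[OF inT[OF that]] has_derivative_linear by blast
    have A_diff: "A s u - A s v = f' (s, y (s, p), p) (0, u - v, 0)" if "s \<in> {-a<..<a}" for s u v
      unfolding A_def using linear_diff[OF lin[OF that], of "(0, u, e)" "(0, v, e)"] by simp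
    have lipA: "norm (f' (s, y (s, p), p) (0, u, 0)) \<le> L * norm u" if "s \<in> {-a<..<a}" for s u
    proof (rule derivative_le_lipschitz[OF hd[OF inT[OF that]] T inT[OF that]])
      fix h assume "(s, y (s, p), p) + h *\<^sub>R (0, u, 0) \<in> {-a<..<a} \<times> Y \<times> B"
      then show "norm (f ((s, y (s, p), p) + h *\<^sub>R (0, u, 0)) - f (s, y (s, p), p)) \<le> L * norm u * \<bar>h\<bar>"
        using lip[OF that p, of "y (s, p) + h *\<^sub>R u" "y (s, p)"] inY[OF that p] by (simp add: mult.commute mult.left_commute)
    qed
    have cy: "continuous_on {-a<..<a} (\<lambda>s. (s, y (s, p), p))"
      by (intro continuous_intros continuous_time p)
    have "continuous_on ({-a<..<a} \<times> UNIV) (\<lambda>(s, u). A s u)"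
    proof -
      have "continuous_on ({-a<..<a} \<times> UNIV) (\<lambda>z. \<Sum>b\<in>Basis. ((0, snd z, e) \<bullet> b) *\<^sub>R f' (fst z, y (fst z, p), p) b)"
        by (intro continuous_intros continuous_on_compose2[OF continuous_on_compose2[OF cd cy]]) (use inY p in auto)
      then show ?thesis
        by (rule continuous_on_eq) (use frechet_expand[OF hd[OF inT]] in \<open>auto simp: A_def case_prod_unfold\<close>)
    qed
    from picard_open[OF a L this, of c] obtain w where w: "w 0 = c"
      "\<And>s. s \<in> {-a<..<a} \<Longrightarrow> (w has_vector_derivative A s (w s)) (at s)"
      using A_diff lipA by auto
    have "((\<lambda>h. y (s, p + h *\<^sub>R e)) has_vector_derivative w s) (at 0)" if s0: "s \<in> {-a<..<a}" for s
    proof -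
      define r where "r = \<bar>s\<bar>"
      have r: "0 \<le> r" "r < a" "s \<in> {-r..r}" using s0 by (auto simp: r_def)
      have ra: "s \<in> {-a<..<a}" if "s \<in> {-r..r}" for s using that r by auto
      define K where "K = (\<lambda>s. (s, y (s, p), p)) ` {-r..r}"
      have K: "compact K" "K \<subseteq> {-a<..<a} \<times> Y \<times> B" unfolding K_def
        by (intro compact_continuous_image continuous_on_subset[OF cy]) (use r inY p in auto)
      obtain N where N: "N \<ge> 0" "\<And>z v. z \<in> K \<Longrightarrow> norm (f' z v) \<le> N * norm v"
        using derivative_uniform_bound[OF K hd cd] by blast
      have UD: "\<exists>\<delta>>0. \<forall>z\<in>K. \<forall>x. norm (x - z) < \<delta> \<longrightarrow> x \<in> {-a<..<a} \<times> Y \<times> B \<and> norm (f x - f z - f' z (x - z)) \<le> \<epsilon> * norm (x - z)"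
        if "\<epsilon> > 0" for \<epsilon> using uniformly_differentiable[OF T K hd cd that] .
      obtain \<delta>1 where \<delta>1: "\<delta>1 > 0" "\<And>z x. z \<in> K \<Longrightarrow> norm (x - z) < \<delta>1 \<Longrightarrow> x \<in> {-a<..<a} \<times> Y \<times> B \<and> norm (f x - f z - f' z (x - z)) \<le> 1 * norm (x - z)"
        using UD[OF zero_less_one] by blast
      \<comment> \<open>A Lipschitz constant in h from a first use of \<open>ode_estimate\<close>.
        It makes the distance of the two arguments of f proportional to \<bar>h\<bar>, so the
        linearisation remainder becomes small compared with \<bar>h\<bar>.\<close>
      define C where "C = 2 * (norm c + r * ((N + 1) * norm e))"
      have C0: "C \<ge> 0" using N r by (auto simp: C_def)
      have inB: "p + h *\<^sub>R e \<in> B" if "\<bar>h\<bar> * norm e < \<delta>1" for h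
      proof -
        have "(0, y (0, p), p) \<in> K" using r unfolding K_def by auto
        from \<delta>1(2)[OF this, of "(0, y (0, p), p + h *\<^sub>R e)"] show ?thesis using that by (simp add: norm_Pair)
      qed
      have near: "norm (y (s, p + h *\<^sub>R e) - y (s, p)) \<le> C * \<bar>h\<bar>"
        if h: "\<bar>h\<bar> * norm e < \<delta>1" and s: "s \<in> {-r..r}" for h s
      proof -
        have "norm (y (s, p + h *\<^sub>R e) - y (s, p)) \<le> 2 * (norm (y (0, p + h *\<^sub>R e) - y (0, p)) + r * ((N + 1) * (\<bar>h\<bar> * norm e)))"
        proof (rule ode_estimate[OF r(1) rL[OF r(2)] L _ _ _ s])
          fix s assume s: "s \<in> {-r..r}"
          show "((\<lambda>s. y (s, p + h *\<^sub>R e) - y (s, p)) has_vector_derivative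
              f (s, y (s, p + h *\<^sub>R e), p + h *\<^sub>R e) - f (s, y (s, p), p)) (at s within {-r..r})"
            by (intro has_vector_derivative_diff has_vector_derivative_at_within[OF sol] ra[OF s] p inB h)
          have 1: "norm (f (s, y (s, p + h *\<^sub>R e), p + h *\<^sub>R e) - f (s, y (s, p), p + h *\<^sub>R e)) \<le> L * norm (y (s, p + h *\<^sub>R e) - y (s, p))"
            by (intro lip ra[OF s] inB h inY p)
          have z: "(s, y (s, p), p) \<in> K" using s by (auto simp: K_def)
          have "norm (f (s, y (s, p), p + h *\<^sub>R e) - f (s, y (s, p), p) - f' (s, y (s, p), p) (0, 0, h *\<^sub>R e)) \<le> 1 * (\<bar>h\<bar> * norm e)"
            using \<delta>1(2)[OF z, of "(s, y (s, p), p + h *\<^sub>R e)"] h by (simp add: norm_Pair)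
          moreover have "norm (f' (s, y (s, p), p) (0, 0, h *\<^sub>R e)) \<le> N * (\<bar>h\<bar> * norm e)"
            using N(2)[OF z, of "(0, 0, h *\<^sub>R e)"] by (simp add: norm_Pair)
          ultimately have "norm (f (s, y (s, p), p + h *\<^sub>R e) - f (s, y (s, p), p)) \<le> (N + 1) * (\<bar>h\<bar> * norm e)"
            using norm_triangle_sub[of "f (s, y (s, p), p + h *\<^sub>R e) - f (s, y (s, p), p)" "f' (s, y (s, p), p) (0, 0, h *\<^sub>R e)"]
            by (simp add: distrib_right)
          then show "norm (f (s, y (s, p + h *\<^sub>R e), p + h *\<^sub>R e) - f (s, y (s, p), p))
              \<le> L * norm (y (s, p + h *\<^sub>R e) - y (s, p)) + (N + 1) * (\<bar>h\<bar> * norm e)"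
            using 1 norm_triangle_ineq[of "f (s, y (s, p + h *\<^sub>R e), p + h *\<^sub>R e) - f (s, y (s, p), p + h *\<^sub>R e)"
                "f (s, y (s, p), p + h *\<^sub>R e) - f (s, y (s, p), p)"] by simp
        qed (use N in auto)
        also have "norm (y (0, p + h *\<^sub>R e) - y (0, p)) = \<bar>h\<bar> * norm c"
          using in0[OF p inB[OF h]] by simp
        finally show ?thesis by (simp add: C_def algebra_simps)
      qed
      show ?thesis
        unfolding has_vector_derivative_def has_derivative_at_alt
      proof (intro conjI allI impI)
        show "bounded_linear (\<lambda>x. x *\<^sub>R w s)" by (rule bounded_linear_scaleR_left)
        fix \<eta> :: real assume \<eta>: "\<eta> > 0"
        define D where "D = C + norm e + 1"
        have D: "D > 0" "D \<ge> C + norm e" using C0 by (auto simp: D_def add_nonneg_pos)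
        \<comment> \<open>Chosen so that 2 r \<epsilon> D \<le> \<eta>; writing r + 1 for r covers
          the case r = 0.\<close>
        define m where "m = 2 * (r + 1) * D"
        have m: "m > 0" using D(1) r(1) by (simp add: m_def)
        define \<epsilon> where "\<epsilon> = \<eta> / m"
        have \<epsilon>1: "\<epsilon> > 0" "\<epsilon> * m = \<eta>" using \<eta> m by (simp_all add: \<epsilon>_def)
        then have "\<eta> = 2 * (r * (\<epsilon> * D)) + 2 * (\<epsilon> * D)" by (simp add: m_def algebra_simps)
        moreover have "\<epsilon> * D > 0" using \<epsilon>1(1) D(1) by simp
        ultimately have \<epsilon>: "\<epsilon> > 0" "2 * (r * (\<epsilon> * D)) \<le> \<eta>" using \<epsilon>1(1) by linarith+
        obtain \<delta>2 where \<delta>2: "\<delta>2 > 0" "\<And>z x. z \<in> K \<Longrightarrow> norm (x - z) < \<delta>2 \<Longrightarrow> norm (f x - f z - f' z (x - z)) \<le> \<epsilon> * norm (x - z)"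
          using UD[OF \<epsilon>(1)] by blast
        define d where "d = min \<delta>1 \<delta>2 / D"
        have d: "d > 0" using \<delta>1 \<delta>2 D by (simp add: d_def)
        show "\<exists>d>0. \<forall>h. norm (h - 0) < d \<longrightarrow>
            norm (y (s, p + h *\<^sub>R e) - y (s, p + 0 *\<^sub>R e) - (h - 0) *\<^sub>R w s) \<le> \<eta> * norm (h - 0)"
        proof (intro exI[of _ d] conjI allI impI d)
          fix h :: real assume "norm (h - 0) < d"
          then have hD: "\<bar>h\<bar> * D < \<delta>1" "\<bar>h\<bar> * D < \<delta>2" using D by (auto simp: d_def field_simps)
          have "\<bar>h\<bar> * norm e \<le> \<bar>h\<bar> * D" using D C0 by (intro mult_left_mono) auto
          then have h1: "\<bar>h\<bar> * norm e < \<delta>1" using hD by linarith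
          have "norm (y (s, p + h *\<^sub>R e) - y (s, p) - h *\<^sub>R w s) \<le> 2 * (norm (y (0, p + h *\<^sub>R e) - y (0, p) - h *\<^sub>R w 0) + r * (\<epsilon> * (D * \<bar>h\<bar>)))"
          proof (rule ode_estimate[OF r(1) rL[OF r(2)] L _ _ _ r(3)])
            fix s assume s: "s \<in> {-r..r}"
            let ?z = "(s, y (s, p), p)" and ?x = "(s, y (s, p + h *\<^sub>R e), p + h *\<^sub>R e)"
            show "((\<lambda>s. y (s, p + h *\<^sub>R e) - y (s, p) - h *\<^sub>R w s) has_vector_derivative
              f ?x - f ?z - h *\<^sub>R A s (w s)) (at s within {-r..r})"
              by (intro has_vector_derivative_diff has_vector_derivative_at_within[OF sol] ra[OF s] p inB h1
                  bounded_linear.has_vector_derivative[OF bounded_linear_scaleR_right] has_vector_derivative_at_within[OF w(2)])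
            let ?q = "y (s, p + h *\<^sub>R e) - y (s, p)"
            have "norm (?x - ?z) \<le> norm ?q + \<bar>h\<bar> * norm e"
              using norm_Pair_le[of "?q" "h *\<^sub>R e"] by (simp add: norm_Pair)
            also have "\<dots> \<le> (C + norm e) * \<bar>h\<bar>" using near[OF h1 s] by (simp add: algebra_simps)
            also have "\<dots> \<le> D * \<bar>h\<bar>" using D by (intro mult_right_mono) auto
            finally have xz: "norm (?x - ?z) \<le> D * \<bar>h\<bar>" .
            have z: "?z \<in> K" using s by (auto simp: K_def)
            have "norm (f ?x - f ?z - f' ?z (?x - ?z)) \<le> \<epsilon> * norm (?x - ?z)"
              using \<delta>2(2)[OF z order.strict_trans1[OF xz]] hD(2) by (simp only: mult.commute)
            also have "\<dots> \<le> \<epsilon> * (D * \<bar>h\<bar>)" using xz \<epsilon> by (intro mult_left_mono) auto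
            finally have rem: "norm (f ?x - f ?z - f' ?z (0, ?q, h *\<^sub>R e)) \<le> \<epsilon> * (D * \<bar>h\<bar>)" by simp
            have "h *\<^sub>R A s (w s) = f' ?z (0, h *\<^sub>R w s, h *\<^sub>R e)"
              unfolding A_def using linear_cmul[OF lin[OF ra[OF s]], of h "(0, w s, e)"] by simp
            then have eq: "f' ?z (0, ?q, h *\<^sub>R e) - h *\<^sub>R A s (w s) = f' ?z (0, ?q - h *\<^sub>R w s, 0)"
              using linear_diff[OF lin[OF ra[OF s]], of "(0, ?q, h *\<^sub>R e)" "(0, h *\<^sub>R w s, h *\<^sub>R e)"] by simp
            have "norm (f' ?z (0, ?q, h *\<^sub>R e) - h *\<^sub>R A s (w s)) \<le> L * norm (?q - h *\<^sub>R w s)"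
              unfolding eq by (rule lipA[OF ra[OF s]])
            from norm_triangle_mono[OF rem this]
            show "norm (f ?x - f ?z - h *\<^sub>R A s (w s)) \<le> L * norm (?q - h *\<^sub>R w s) + \<epsilon> * (D * \<bar>h\<bar>)"
              by (simp add: add.commute)
          qed (use \<epsilon> D in auto)
          also have "norm (y (0, p + h *\<^sub>R e) - y (0, p) - h *\<^sub>R w 0) = 0"
            using in0[OF p inB[OF h1]] w(1) by simp
          also have "2 * (0 + r * (\<epsilon> * (D * \<bar>h\<bar>))) = (2 * (r * (\<epsilon> * D))) * \<bar>h\<bar>" by simp
          also have "\<dots> \<le> \<eta> * \<bar>h\<bar>" using \<epsilon> by (intro mult_right_mono) auto
          finally show "norm (y (s, p + h *\<^sub>R e) - y (s, p + 0 *\<^sub>R e) - (h - 0) *\<^sub>R w s) \<le> \<eta> * norm (h - 0)"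
            by simp
        qed
      qed
    qed
    then show ?thesis using w by (intro exI[of _ w]) (auto simp: A_def Q_def)
  qed
  then obtain w where "\<And>p. p \<in> B \<Longrightarrow> Q p (w p)" by metis
  then show ?thesis by (intro exI[of _ "\<lambda>(s, p). w p s"]) (simp add: Q_def)
qed

text \<open>\<open>M b\<close> is the column of the matrix belonging to b. A parameter derivative of
  z solves the linear equation with the same matrix, with initial value zero since c does not depend
  on p, and with an inhomogeneity of class C^k, so the induction hypothesis covers it. The time
  derivative is read off the equation.\<close>

lemma linear_ode_smooth:
  fixes M :: "'e::euclidean_space \<Rightarrow> real \<times> 'p::euclidean_space \<Rightarrow> 'e"
  assumes a: "0 < a" "a * L \<le> 1/2" and L: "0 \<le> L" and B: "open B"
    and M: "\<And>b. b \<in> Basis \<Longrightarrow> Ck_on k (M b) ({-a<..<a} \<times> B)"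
    and bound: "\<And>s p u. s \<in> {-a<..<a} \<Longrightarrow> p \<in> B \<Longrightarrow> norm (\<Sum>b\<in>Basis. (u \<bullet> b) *\<^sub>R M b (s, p)) \<le> L * norm u"
    and g: "Ck_on k g ({-a<..<a} \<times> B)"
    and sol: "\<And>s p. s \<in> {-a<..<a} \<Longrightarrow> p \<in> B \<Longrightarrow>
      ((\<lambda>s. z (s, p)) has_vector_derivative (\<Sum>b\<in>Basis. (z (s, p) \<bullet> b) *\<^sub>R M b (s, p)) + g (s, p)) (at s)"
    and init: "\<And>p. p \<in> B \<Longrightarrow> z (0, p) = c"
  shows "Ck_on k z ({-a<..<a} \<times> B)"
  using M g sol init
proof (induction k arbitrary: g z c)
  let ?\<Omega> = "{-a<..<a} \<times> B"
  define F where "F g x = (\<Sum>b\<in>Basis. (fst (snd x) \<bullet> b) *\<^sub>R M b (fst x, snd (snd x))) + g (fst x, snd (snd x))"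
    for g and x :: "real \<times> 'e \<times> 'p"
  have fam: "ode_family (F g) a L UNIV B z"
    if M: "\<And>b. b \<in> Basis \<Longrightarrow> continuous_on ?\<Omega> (M b)" and g: "continuous_on ?\<Omega> g"
    and sol: "\<And>s p. s \<in> {-a<..<a} \<Longrightarrow> p \<in> B \<Longrightarrow>
      ((\<lambda>s. z (s, p)) has_vector_derivative (\<Sum>b\<in>Basis. (z (s, p) \<bullet> b) *\<^sub>R M b (s, p)) + g (s, p)) (at s)"
    and init: "\<And>p. p \<in> B \<Longrightarrow> z (0, p) = c" for g z c
  proof
    show "continuous_on ({-a<..<a} \<times> UNIV \<times> B) (F g)"
      unfolding F_def
      by (intro continuous_intros continuous_on_compose2[OF M] continuous_on_compose2[OF g]) auto
    show "norm (F g (s, u, p) - F g (s, v, p)) \<le> L * norm (u - v)" if "s \<in> {-a<..<a}" "p \<in> B" for s u v p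
      using bound[OF that, of "u - v"] by (simp add: F_def inner_diff_left scaleR_diff_left sum_subtractf)
    show "continuous_on B (\<lambda>p. z (0, p))" using init by (simp cong: continuous_on_cong)
    show "((\<lambda>s. z (s, p)) has_vector_derivative F g (s, z (s, p), p)) (at s)" if "s \<in> {-a<..<a}" "p \<in> B" for s p
      using sol[OF that] by (simp add: F_def)
  qed (use a L B in auto)
  have \<Omega>: "open ?\<Omega>" using B by (intro open_Times) auto
  {
    case 0
    from ode_family.continuous_solution[OF fam[OF _ _ 0(3,4)]] 0(1,2) show ?case by simp
  next
    case (Suc k)
    have Mc: "continuous_on ?\<Omega> (M b)" if "b \<in> Basis" for b using Suc.prems(1)[OF that] Ck_on_imp_continuous_on by blast
    have gc: "continuous_on ?\<Omega> g" using Suc.prems(2) Ck_on_imp_continuous_on by blast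
    interpret ode_family "F g" a L UNIV B z by (rule fam[OF Mc gc Suc.prems(3,4)])
    have Mk: "Ck_on k (M b) ?\<Omega>" if "b \<in> Basis" for b using Ck_on_Suc_imp[OF Suc.prems(1)[OF that]] .
    have gk: "Ck_on k g ?\<Omega>" using Ck_on_Suc_imp[OF Suc.prems(2)] .
    have zk: "Ck_on k z ?\<Omega>" by (rule Suc.IH[OF Mk gk Suc.prems(3,4)])
    have sums: "Ck_on k (\<lambda>x. (\<Sum>b\<in>Basis. (z x \<bullet> b) *\<^sub>R N b x) + h x) ?\<Omega>"
      if "\<And>b. b \<in> Basis \<Longrightarrow> Ck_on k (N b) ?\<Omega>" "Ck_on k h ?\<Omega>" for N h
      by (intro Ck_on_add[OF \<Omega>] Ck_on_sum[OF \<Omega>] Ck_on_bilinear[OF \<Omega> bounded_bilinear_scaleR]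
          Ck_on_compose_linear[OF \<Omega> bounded_linear_inner_left] zk that)
    define F' where "F' x v = (\<Sum>b\<in>Basis. (fst (snd x) \<bullet> b) *\<^sub>R frechet_derivative (M b) (at (fst x, snd (snd x))) (fst v, snd (snd v))
         + (fst (snd v) \<bullet> b) *\<^sub>R M b (fst x, snd (snd x)))
       + frechet_derivative g (at (fst x, snd (snd x))) (fst v, snd (snd v))" for x v :: "real \<times> 'e \<times> 'p"
    have hd: "(F g has_derivative F' x) (at x)" if "x \<in> {-a<..<a} \<times> UNIV \<times> B" for x
    proof -
      have q: "(fst x, snd (snd x)) \<in> ?\<Omega>" using that by auto
      have l: "((\<lambda>x::real \<times> 'e \<times> 'p. (fst x, snd (snd x))) has_derivative (\<lambda>v. (fst v, snd (snd v)))) (at x)"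
        by (auto intro!: derivative_eq_intros)
      have l2: "((\<lambda>x::real \<times> 'e \<times> 'p. fst (snd x) \<bullet> b) has_derivative (\<lambda>v. fst (snd v) \<bullet> b)) (at x)" for b
        by (auto intro!: derivative_eq_intros)
      show ?thesis unfolding F_def[abs_def] F'_def
        by (intro has_derivative_add has_derivative_sum has_derivative_scaleR l2
            has_derivative_compose[OF l Ck_on_has_derivative[OF Suc.prems(1) q]]
            has_derivative_compose[OF l Ck_on_has_derivative[OF Suc.prems(2) q]])
    qed
    have cd: "continuous_on ({-a<..<a} \<times> UNIV \<times> B) (\<lambda>x. F' x v)" for v
    proof -
      have 1: "continuous_on ?\<Omega> (\<lambda>x. frechet_derivative (M b) (at x) u)" if "b \<in> Basis" for b u
        using Ck_on_imp_continuous_on[OF Ck_on_frechet[OF Suc.prems(1)[OF that]]] .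
      have 2: "continuous_on ?\<Omega> (\<lambda>x. frechet_derivative g (at x) u)" for u
        using Ck_on_imp_continuous_on[OF Ck_on_frechet[OF Suc.prems(2)]] .
      show ?thesis unfolding F'_def
        by (intro continuous_intros continuous_on_compose2[OF 1] continuous_on_compose2[OF 2] continuous_on_compose2[OF Mc]) auto
    qed
    define Q where "Q e w \<longleftrightarrow> (\<forall>p\<in>B. w (0, p) = 0 \<and> (\<forall>s\<in>{-a<..<a}.
        ((\<lambda>s. w (s, p)) has_vector_derivative F' (s, z (s, p), p) (0, w (s, p), e)) (at s) \<and>
        ((\<lambda>h. z (s, p + h *\<^sub>R e)) has_vector_derivative w (s, p)) (at 0)))" for e w
    have "\<exists>w. Q e w" for e
      unfolding Q_def by (rule parameter_derivative[OF hd cd]) (use Suc.prems(4) in auto)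
    then obtain w where "\<And>e. Q e (w e)" by metis
    then have w: "\<And>e p. p \<in> B \<Longrightarrow> w e (0, p) = 0"
      "\<And>e p s. p \<in> B \<Longrightarrow> s \<in> {-a<..<a} \<Longrightarrow>
        ((\<lambda>s. w e (s, p)) has_vector_derivative F' (s, z (s, p), p) (0, w e (s, p), e)) (at s)"
      "\<And>e p s. p \<in> B \<Longrightarrow> s \<in> {-a<..<a} \<Longrightarrow> ((\<lambda>h. z (s, p + h *\<^sub>R e)) has_vector_derivative w e (s, p)) (at 0)"
      unfolding Q_def by blast+
    have wk: "Ck_on k (w e) ?\<Omega>" for e
    proof (rule Suc.IH[where z = "w e" and c = 0, OF Mk])
      show "Ck_on k (\<lambda>x. (\<Sum>b\<in>Basis. (z x \<bullet> b) *\<^sub>R frechet_derivative (M b) (at x) (0, e)) + frechet_derivative g (at x) (0, e)) ?\<Omega>"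
        by (intro sums Ck_on_frechet Suc.prems)
      show "((\<lambda>s. w e (s, p)) has_vector_derivative (\<Sum>b\<in>Basis. (w e (s, p) \<bullet> b) *\<^sub>R M b (s, p)) +
          ((\<Sum>b\<in>Basis. (z (s, p) \<bullet> b) *\<^sub>R frechet_derivative (M b) (at (s, p)) (0, e)) + frechet_derivative g (at (s, p)) (0, e))) (at s)"
        if "s \<in> {-a<..<a}" "p \<in> B" for s p
        using w(2)[OF that(2,1), of e] by (simp add: F'_def sum.distrib algebra_simps)
    qed (use w(1) in auto)
    show ?case
    proof (rule Ck_on_SucI_partials[OF \<Omega>, where D = "\<lambda>b x. fst b *\<^sub>R ((\<Sum>b\<in>Basis. (z x \<bullet> b) *\<^sub>R M b x) + g x) + w (snd b) x"])
      fix b :: "real \<times> 'p" and x assume b: "b \<in> Basis" and x: "x \<in> ?\<Omega>"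
      \<comment> \<open>The claimed partial derivative contains \<open>w (snd b)\<close> for every
        basis vector b; in the time direction \<open>snd b\<close> is 0, and that term has to
        vanish.\<close>
      have w0: "w 0 x = 0"
      proof -
        have "((\<lambda>h. z (fst x, snd x + h *\<^sub>R 0)) has_vector_derivative w 0 (fst x, snd x)) (at (0::real))"
          by (rule w(3)) (use x in auto)
        moreover have "((\<lambda>h. z (fst x, snd x + h *\<^sub>R 0)) has_vector_derivative 0) (at (0::real))" by simp
        ultimately show ?thesis using vector_derivative_unique_at by (metis prod.collapse)
      qed
      from b consider "b = (1, 0)" | e where "b = (0, e)" by (auto simp: Basis_prod_def)
      then show "((\<lambda>h. z (x + h *\<^sub>R b)) has_vector_derivative
          fst b *\<^sub>R ((\<Sum>b\<in>Basis. (z x \<bullet> b) *\<^sub>R M b x) + g x) + w (snd b) x) (at 0)"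
      proof cases
        case 1
        have "((\<lambda>s. z (s, snd x)) has_derivative (\<lambda>h. h *\<^sub>R ((\<Sum>b\<in>Basis. (z x \<bullet> b) *\<^sub>R M b x) + g x))) (at (fst x))"
          using Suc.prems(3)[of "fst x" "snd x"] x by (auto simp: has_vector_derivative_def)
        from frechet_directional[OF this, of 1] show ?thesis using 1 w0 by (simp add: plus_prod_def)
      next
        case 2
        then show ?thesis using w(3)[of "snd x" "fst x" e] x by (auto simp: plus_prod_def)
      qed
    next
      fix b :: "real \<times> 'p"
      show "Ck_on k (\<lambda>x. fst b *\<^sub>R ((\<Sum>b\<in>Basis. (z x \<bullet> b) *\<^sub>R M b x) + g x) + w (snd b) x) ?\<Omega>"
        by (intro Ck_on_add[OF \<Omega>] Ck_on_compose_linear[OF \<Omega> bounded_linear_scaleR_right] sums Mk gk wk)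
    qed
  }
qed

text \<open>The space derivative of the flow solves the linear equation whose matrix is the
  derivative of v along the flow. If the flow is C^k, so is this matrix, hence so is that
  derivative, and the flow gains one order.\<close>

lemma smooth_flow:
  fixes v :: "'e::euclidean_space \<Rightarrow> 'e"
  assumes S: "open S" "p0 \<in> S" and v: "smooth_on v S"
  obtains a r \<phi> where "a > 0" "r > 0" "smooth_on \<phi> ({-a<..<a} \<times> ball p0 r)"
    "\<And>p. p \<in> ball p0 r \<Longrightarrow> \<phi> (0, p) = p"
    "\<And>s p. s \<in> {-a<..<a} \<Longrightarrow> p \<in> ball p0 r \<Longrightarrow> \<phi> (s, p) \<in> S"
    "\<And>s p. s \<in> {-a<..<a} \<Longrightarrow> p \<in> ball p0 r \<Longrightarrow> ((\<lambda>s. \<phi> (s, p)) has_vector_derivative v (\<phi> (s, p))) (at s)"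
proof -
  obtain R where R: "R > 0" "cball p0 R \<subseteq> S" using S open_contains_cball by blast
  have hd: "(v has_derivative frechet_derivative v (at x)) (at x)" if "x \<in> S" for x
    using smooth_on_has_derivative[OF v that] .
  have cd: "continuous_on S (\<lambda>x. frechet_derivative v (at x) u)" for u
    using smooth_on_continuous_on[OF smooth_on_frechet[OF v]] .
  obtain L where L: "L \<ge> 0" "\<And>x u. x \<in> cball p0 R \<Longrightarrow> norm (frechet_derivative v (at x) u) \<le> L * norm u"
    using derivative_uniform_bound[OF compact_cball R(2) hd cd] by blast
  have lip: "norm (v x - v y) \<le> L * norm (x - y)" if "x \<in> cball p0 R" "y \<in> cball p0 R" for x y
  proof (rule differentiable_bound[OF convex_cball _ _ that])
    show "(v has_derivative frechet_derivative v (at x)) (at x within cball p0 R)" if "x \<in> cball p0 R" for x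
      using hd that R has_derivative_at_withinI by blast
    show "onorm (frechet_derivative v (at x)) \<le> L" if "x \<in> cball p0 R" for x
      by (rule onorm_le) (use L(2)[OF that] in auto)
  qed
  have cv: "continuous_on (cball p0 R) v" using smooth_on_continuous_on[OF v] R continuous_on_subset by blast
  obtain N where N: "\<And>x. x \<in> cball p0 R \<Longrightarrow> norm (v x) \<le> N"
    using compact_imp_bounded[OF compact_continuous_image[OF cv compact_cball]] unfolding bounded_iff by (metis imageI)
  have N0: "N \<ge> 0" using N[of p0] R(1) norm_ge_zero order_trans by (metis centre_in_cball less_imp_le)
  \<comment> \<open>The first bound gives a L \<le> 1/2 for the contraction. The second gives a N
    \<le> R/4, so a curve starting within R/2 of \<open>p0\<close> stays in the ball of radius
    R.\<close>
  define a where "a = min (1 / (2 * (L + 1))) (R / (4 * (N + 1)))"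
  have a: "a > 0" using L(1) N0 R(1) by (simp add: a_def)
  have aL: "a * L \<le> 1/2"
  proof -
    have "a * (L + 1) \<le> 1 / (2 * (L + 1)) * (L + 1)" using L(1) by (intro mult_right_mono) (auto simp: a_def)
    also have "\<dots> = 1/2" using L(1) by (simp add: field_simps)
    finally have "a * (L + 1) \<le> 1/2" .
    then show ?thesis using a by (simp add: distrib_left)
  qed
  have aN: "a * N \<le> R / 4"
  proof -
    have "a * (N + 1) \<le> R / (4 * (N + 1)) * (N + 1)" using N0 by (intro mult_right_mono) (auto simp: a_def)
    also have "\<dots> = R / 4" using N0 by (simp add: field_simps)
    finally have "a * (N + 1) \<le> R / 4" .
    then show ?thesis using a by (simp add: distrib_left)
  qed
  \<comment> \<open>Projection to the nearest point of the ball is 1-Lipschitz, which makes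
    \<open>v (cp x)\<close> globally Lipschitz with the same L. The curves considered stay in the
    ball, where the modified field equals v.\<close>
  define cp where "cp = closest_point (cball p0 R)"
  have cp: "cp x \<in> cball p0 R" "x \<in> cball p0 R \<Longrightarrow> cp x = x" for x
    using closest_point_in_set[of "cball p0 R" x] closest_point_self[of x "cball p0 R"] R(1) by (auto simp: cp_def)
  have cpl: "norm (cp x - cp y) \<le> norm (x - y)" for x y
    using closest_point_lipschitz[of "cball p0 R" x y] R(1) by (auto simp: cp_def dist_norm)
  have "continuous_on UNIV cp"
    unfolding cp_def using R(1) by (intro continuous_on_closest_point) auto
  then have cvc: "continuous_on UNIV (\<lambda>x. v (cp x))"
    by (rule continuous_on_compose2[OF cv]) (use cp in blast)
  have "\<exists>y. y 0 = p \<and> (\<forall>s\<in>{-a<..<a}. (y has_vector_derivative v (cp (y s))) (at s))" for p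
  proof (rule picard_open[OF a aL L(1)])
    show "continuous_on ({-a<..<a} \<times> UNIV) (\<lambda>(s::real, y). v (cp y))"
      unfolding case_prod_unfold by (intro continuous_on_compose2[OF cvc] continuous_intros) auto
    show "norm (v (cp y) - v (cp z)) \<le> L * norm (y - z)" for y z
      using lip[OF cp(1) cp(1), of y z] mult_left_mono[OF cpl L(1), of y z] by linarith
  qed
  then obtain y where y: "\<And>p. y p 0 = p" "\<And>p s. s \<in> {-a<..<a} \<Longrightarrow> (y p has_vector_derivative v (cp (y p s))) (at s)"
    by metis
  define \<phi> where "\<phi> x = y (snd x) (fst x)" for x
  have near: "\<phi> (s, p) \<in> ball p0 R" if "s \<in> {-a<..<a}" "p \<in> ball p0 (R/2)" for s p
  proof -
    have "norm (y p s - y p 0) \<le> N * \<bar>s - 0\<bar>"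
    proof (rule vector_derivative_bound[of "{-a<..<a}" _ "\<lambda>s. v (cp (y p s))"])
      show "(y p has_vector_derivative v (cp (y p s))) (at s within {-a<..<a})" if "s \<in> {-a<..<a}" for s
        by (rule has_vector_derivative_at_within[OF y(2)[OF that]])
    qed (use N[OF cp(1)] that a in auto)
    also have "\<dots> \<le> N * a" using that N0 by (intro mult_left_mono) auto
    also have "\<dots> \<le> R / 4" using aN by (simp add: mult.commute)
    finally have "dist (y p s) p \<le> R / 4" using y(1) by (simp add: dist_norm)
    then have "dist p0 (y p s) < R"
      using dist_triangle[of p0 "y p s" p] that R(1) by (simp add: dist_commute)
    then show ?thesis by (simp add: \<phi>_def)
  qed
  have sol: "((\<lambda>s. \<phi> (s, p)) has_vector_derivative v (\<phi> (s, p))) (at s)" if "s \<in> {-a<..<a}" "p \<in> ball p0 (R/2)" for s p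
  proof -
    have "cp (y p s) = y p s" using near[OF that] cp(2) by (simp add: \<phi>_def)
    then show ?thesis using y(2)[OF that(1), of p] by (simp add: \<phi>_def)
  qed
  let ?B = "ball p0 (R/2)"
  let ?\<Omega> = "{-a<..<a} \<times> ?B"
  have sub: "ball p0 R \<subseteq> S" using R by auto
  interpret fl: ode_family "\<lambda>x. v (fst (snd x))" a L "ball p0 R" ?B \<phi>
  proof
    show "continuous_on ({-a<..<a} \<times> ball p0 R \<times> ?B) (\<lambda>x. v (fst (snd x)))"
      by (intro continuous_on_compose2[OF smooth_on_continuous_on[OF v]] continuous_intros) (use sub in auto)
    show "continuous_on ?B (\<lambda>p. \<phi> (0, p))" by (simp add: \<phi>_def y(1) continuous_on_id)
  qed (use a aL L(1) lip near sol in auto)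
  have hdv: "((\<lambda>x. v (fst (snd x))) has_derivative (\<lambda>u. frechet_derivative v (at (fst (snd x))) (fst (snd u)))) (at x)"
    if "x \<in> {-a<..<a} \<times> ball p0 R \<times> ?B" for x
    by (rule has_derivative_compose[OF _ hd, of "\<lambda>x. fst (snd x)" "\<lambda>x. fst (snd x)"]) (use that sub in \<open>auto intro!: derivative_eq_intros\<close>)
  have cdv: "continuous_on ({-a<..<a} \<times> ball p0 R \<times> ?B) (\<lambda>x. frechet_derivative v (at (fst (snd x))) (fst (snd u)))" for u
    by (intro continuous_on_compose2[OF cd] continuous_intros) (use sub in auto)
  define Q where "Q e w \<longleftrightarrow> (\<forall>p\<in>?B. w (0, p) = e \<and> (\<forall>s\<in>{-a<..<a}.
      ((\<lambda>s. w (s, p)) has_vector_derivative frechet_derivative v (at (fst (snd (s, \<phi> (s, p), p)))) (fst (snd (0::real, w (s, p), e)))) (at s) \<and>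
      ((\<lambda>h. \<phi> (s, p + h *\<^sub>R e)) has_vector_derivative w (s, p)) (at 0)))" for e w
  have "\<exists>w. Q e w" for e
    unfolding Q_def by (rule fl.parameter_derivative[OF hdv cdv]) (simp_all add: \<phi>_def y(1))
  then obtain w where "\<And>e. Q e (w e)" by metis
  then have w: "\<And>e p. p \<in> ?B \<Longrightarrow> w e (0, p) = e"
    "\<And>e p s. p \<in> ?B \<Longrightarrow> s \<in> {-a<..<a} \<Longrightarrow>
       ((\<lambda>s. w e (s, p)) has_vector_derivative frechet_derivative v (at (\<phi> (s, p))) (w e (s, p))) (at s)"
    "\<And>e p s. p \<in> ?B \<Longrightarrow> s \<in> {-a<..<a} \<Longrightarrow> ((\<lambda>h. \<phi> (s, p + h *\<^sub>R e)) has_vector_derivative w e (s, p)) (at 0)"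
    unfolding Q_def fst_conv snd_conv by blast+
  have \<Omega>: "open ?\<Omega>" by (intro open_Times) auto
  have \<phi>S: "\<phi> ` ?\<Omega> \<subseteq> S" using near sub by auto
  have "Ck_on k \<phi> ?\<Omega>" for k
  proof (induction k)
    case 0
    then show ?case using fl.continuous_solution by simp
  next
    case (Suc k)
    have vk: "Ck_on k (\<lambda>x. v (\<phi> x)) ?\<Omega>" "Ck_on k (\<lambda>x. frechet_derivative v (at (\<phi> x)) b) ?\<Omega>" for b
      using Ck_on_compose[OF \<Omega> S(1) \<phi>S Suc, of v] Ck_on_compose[OF \<Omega> S(1) \<phi>S Suc, of "\<lambda>x. frechet_derivative v (at x) b"]
        v smooth_on_frechet[OF v] by (auto simp: smooth_on_def)
    have wk: "Ck_on k (w e) ?\<Omega>" for e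
    proof (rule linear_ode_smooth[OF a aL L(1) open_ball, where g = "\<lambda>x. 0" and M = "\<lambda>b x. frechet_derivative v (at (\<phi> x)) b"])
      fix s p assume sp: "s \<in> {-a<..<a}" "p \<in> ?B"
      have \<phi>R: "\<phi> (s, p) \<in> ball p0 R" "\<phi> (s, p) \<in> S" using near[OF sp] sub by auto
      show "norm (\<Sum>b\<in>Basis. (u \<bullet> b) *\<^sub>R frechet_derivative v (at (\<phi> (s, p))) b) \<le> L * norm u" for u
        using L(2)[of "\<phi> (s, p)" u] frechet_expand[OF hd[OF \<phi>R(2)], of u] \<phi>R(1) by auto
      show "((\<lambda>s. w e (s, p)) has_vector_derivative (\<Sum>b\<in>Basis. (w e (s, p) \<bullet> b) *\<^sub>R frechet_derivative v (at (\<phi> (s, p))) b) + 0) (at s)"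
        using w(2)[OF sp(2,1), of e] frechet_expand[OF hd[OF \<phi>R(2)], of "w e (s, p)"] by simp
    qed (use vk w(1) in auto)
    show ?case
    proof (rule Ck_on_SucI_partials[OF \<Omega>, where D = "\<lambda>b x. fst b *\<^sub>R v (\<phi> x) + w (snd b) x"])
      fix b :: "real \<times> 'e" and x assume b: "b \<in> Basis" and x: "x \<in> ?\<Omega>"
      have w0: "w 0 x = 0"
      proof -
        have "((\<lambda>h. \<phi> (fst x, snd x + h *\<^sub>R 0)) has_vector_derivative w 0 (fst x, snd x)) (at (0::real))"
          by (rule w(3)) (use x in auto)
        moreover have "((\<lambda>h. \<phi> (fst x, snd x + h *\<^sub>R 0)) has_vector_derivative 0) (at (0::real))" by simp
        ultimately show ?thesis using vector_derivative_unique_at by (metis prod.collapse)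
      qed
      from b consider "b = (1, 0)" | e where "b = (0, e)" by (auto simp: Basis_prod_def)
      then show "((\<lambda>h. \<phi> (x + h *\<^sub>R b)) has_vector_derivative fst b *\<^sub>R v (\<phi> x) + w (snd b) x) (at 0)"
      proof cases
        case 1
        have "((\<lambda>s. \<phi> (s, snd x)) has_derivative (\<lambda>h. h *\<^sub>R v (\<phi> x))) (at (fst x))"
          using sol[of "fst x" "snd x"] x by (auto simp: has_vector_derivative_def)
        from frechet_directional[OF this, of 1] show ?thesis using 1 w0 by (simp add: plus_prod_def)
      next
        case 2
        then show ?thesis using w(3)[of "snd x" "fst x" e] x by (auto simp: plus_prod_def)
      qed
    next
      fix b :: "real \<times> 'e"
      show "Ck_on k (\<lambda>x. fst b *\<^sub>R v (\<phi> x) + w (snd b) x) ?\<Omega>"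
        by (intro Ck_on_add[OF \<Omega>] Ck_on_compose_linear[OF \<Omega> bounded_linear_scaleR_right] vk wk)
    qed
  qed
  then have sm: "smooth_on \<phi> ?\<Omega>" by (simp add: smooth_on_def)
  show ?thesis
  proof (rule that[of a "R/2" \<phi>])
    show "smooth_on \<phi> ?\<Omega>" by (rule sm)
    show "\<phi> (s, p) \<in> S" if "s \<in> {-a<..<a}" "p \<in> ?B" for s p
      using near[OF that] sub by blast
  qed (use a R(1) y(1) sol in \<open>simp_all add: \<phi>_def\<close>)
qed

section \<open>The smooth inverse function theorem\<close>

text \<open>No inverse matrix is formed. A local lower bound for the norm of T p u gives continuity
  of the solution, and its derivative is the solution \<omega> of the differentiated system, to
  which the induction hypothesis applies.\<close>

lemma linear_system_smooth:
  fixes A :: "'e::euclidean_space \<Rightarrow> 'p::euclidean_space \<Rightarrow> 'e"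
  assumes B: "open B"
    and inj: "\<And>p u. p \<in> B \<Longrightarrow> (\<Sum>b\<in>Basis. (u \<bullet> b) *\<^sub>R A b p) = 0 \<Longrightarrow> u = 0"
    and A: "\<And>b. b \<in> Basis \<Longrightarrow> Ck_on k (A b) B"
    and r: "Ck_on k r B"
    and w: "\<And>p. p \<in> B \<Longrightarrow> (\<Sum>b\<in>Basis. (w p \<bullet> b) *\<^sub>R A b p) = r p"
  shows "Ck_on k w B"
  using A r w
proof (induction k arbitrary: r w)
  define T where "T p u = (\<Sum>b\<in>Basis. (u \<bullet> b) *\<^sub>R A b p)" for p u
  have T_diff: "T p (u - v) = T p u - T p v" for p u v
    by (simp add: T_def inner_diff_left scaleR_diff_left sum_subtractf)
  have T_lin: "linear (T p)" for p
    by (rule linearI) (simp_all add: T_def inner_add_left scaleR_add_left sum.distrib scaleR_sum_right)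
  have T_inj: "inj (T p)" if "p \<in> B" for p
    using inj[OF that] linear_injective_0[OF T_lin] by (auto simp: T_def)
  \<comment> \<open>Injectivity with a bound is an open condition: a lower bound c at
    \<open>p0\<close> loses at most half when the columns move by less than c/2 in total.\<close>
  have below: "\<exists>m>0. \<forall>\<^sub>F p in nhds p0. p \<in> B \<and> (\<forall>u. norm u \<le> m * norm (T p u))"
    if cA: "\<And>b. b \<in> Basis \<Longrightarrow> continuous_on B (A b)" and p0: "p0 \<in> B" for p0
  proof -
    obtain c where c: "c > 0" "\<And>u. c * norm u \<le> norm (T p0 u)"
      using linear_inj_bounded_below_pos[OF T_lin T_inj[OF p0]] by (metis mult.commute)
    have "isCont (\<lambda>p. \<Sum>b\<in>Basis. norm (A b p - A b p0)) p0"
      using cA B p0 by (intro continuous_intros) (auto simp: continuous_on_eq_continuous_at)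
    then have "\<forall>\<^sub>F p in nhds p0. dist (\<Sum>b\<in>Basis. norm (A b p - A b p0)) 0 < c / 2"
      unfolding isCont_def tendsto_iff eventually_at_filter using c(1)
      by (auto elim!: allE[of _ "c / 2"] eventually_mono)
    moreover have "\<forall>\<^sub>F p in nhds p0. p \<in> B" using B p0 by (rule eventually_nhds_in_open)
    ultimately have "\<forall>\<^sub>F p in nhds p0. p \<in> B \<and> (\<forall>u. norm u \<le> (2 / c) * norm (T p u))"
    proof eventually_elim
      case (elim p)
      have "norm u \<le> (2 / c) * norm (T p u)" for u
      proof -
        have "T p u - T p0 u = (\<Sum>b\<in>Basis. (u \<bullet> b) *\<^sub>R (A b p - A b p0))"
          by (simp add: T_def scaleR_diff_right sum_subtractf)
        also have "norm \<dots> \<le> (\<Sum>b\<in>Basis. norm u * norm (A b p - A b p0))"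
          by (rule sum_norm_le) (auto intro!: mult_right_mono Basis_le_norm)
        also have "\<dots> = (\<Sum>b\<in>Basis. norm (A b p - A b p0)) * norm u" by (simp add: sum_distrib_left mult.commute)
        also have "\<dots> \<le> (c / 2) * norm u"
          using elim(1) by (intro mult_right_mono) (auto simp: dist_norm)
        finally have "norm (T p u - T p0 u) \<le> (c / 2) * norm u" .
        then have "c * norm u \<le> norm (T p u) + (c / 2) * norm u"
          using c(2)[of u] norm_triangle_ineq2[of "T p0 u" "T p u"] by (simp add: norm_minus_commute)
        then show ?thesis using c(1) by (simp add: field_simps)
      qed
      then show ?case using elim(2) by blast
    qed
    then show ?thesis using c(1) by (intro exI[of _ "2 / c"]) simp
  qed
  {
    case (0 r w)
    have cA: "continuous_on B (A b)" if "b \<in> Basis" for b using 0(1)[OF that] by simp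
    have "isCont w p0" if p0: "p0 \<in> B" for p0
    proof -
      obtain m where m: "m > 0" "\<forall>\<^sub>F p in nhds p0. p \<in> B \<and> (\<forall>u. norm u \<le> m * norm (T p u))"
        using below[OF cA p0] by blast
      have "isCont (\<lambda>p. m * norm (r p - T p (w p0))) p0"
        unfolding T_def using cA 0(2) B p0 by (intro continuous_intros) (auto simp: continuous_on_eq_continuous_at)
      then have lim: "((\<lambda>p. m * norm (r p - T p (w p0))) \<longlongrightarrow> 0) (at p0)"
        using 0(3)[OF p0] by (simp add: isCont_def T_def)
      have "\<forall>\<^sub>F p in at p0. norm (w p - w p0) \<le> m * norm (r p - T p (w p0))"
      proof -
        have "\<forall>\<^sub>F p in at p0. p \<in> B \<and> (\<forall>u. norm u \<le> m * norm (T p u))"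
          using m(2) by (auto simp: eventually_at_filter elim: eventually_mono)
        then show ?thesis
        proof eventually_elim
          case (elim p)
          have "T p (w p) = r p" using 0(3) elim by (simp add: T_def)
          then have "T p (w p - w p0) = r p - T p (w p0)" by (simp add: T_diff)
          then show ?case using elim by metis
        qed
      qed
      then have "((\<lambda>p. w p - w p0) \<longlongrightarrow> 0) (at p0)" by (rule Lim_null_comparison[OF _ lim])
      then show ?thesis by (simp add: isCont_def LIM_zero_iff)
    qed
    then show ?case by (simp add: continuous_at_imp_continuous_on)
  next
    case (Suc k r w)
    have Ak: "Ck_on k (A b) B" if "b \<in> Basis" for b using Ck_on_Suc_imp[OF Suc.prems(1)[OF that]] .
    have cA: "continuous_on B (A b)" if "b \<in> Basis" for b using Ck_on_imp_continuous_on[OF Ak[OF that]] .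
    have wk: "Ck_on k w B" by (rule Suc.IH[OF Ak Ck_on_Suc_imp[OF Suc.prems(2)] Suc.prems(3)])
    define R where "R e p = frechet_derivative r (at p) e - (\<Sum>b\<in>Basis. (w p \<bullet> b) *\<^sub>R frechet_derivative (A b) (at p) e)" for e p
    define \<omega> where "\<omega> e p = (SOME u. T p u = R e p)" for e p
    have \<omega>: "T p (\<omega> e p) = R e p" if "p \<in> B" for e p
      unfolding \<omega>_def
      by (rule someI_ex) (use linear_injective_imp_surjective[OF T_lin T_inj[OF that]] in \<open>metis surjD\<close>)
    have \<omega>k: "Ck_on k (\<omega> e) B" for e
    proof (rule Suc.IH[OF Ak])
      have "Ck_on k (\<lambda>p. frechet_derivative r (at p) e + (\<Sum>b\<in>Basis. (w p \<bullet> b) *\<^sub>R (- frechet_derivative (A b) (at p) e))) B"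
        by (intro Ck_on_add[OF B] Ck_on_sum[OF B] Ck_on_bilinear[OF B bounded_bilinear_scaleR]
            Ck_on_compose_linear[OF B bounded_linear_inner_left] Ck_on_compose_linear[OF B bounded_linear_minus[OF bounded_linear_ident]]
            wk Ck_on_frechet Suc.prems)
      then show "Ck_on k (R e) B" by (simp add: R_def[abs_def] sum_negf)
      show "(\<Sum>b\<in>Basis. (\<omega> e p \<bullet> b) *\<^sub>R A b p) = R e p" if "p \<in> B" for p
        using \<omega>[OF that] by (simp add: T_def)
    qed auto
    show ?case
    proof (rule Ck_on_SucI_partials[OF B _ \<omega>k])
      fix e p assume p: "p \<in> B"
      \<comment> \<open>The defect of the affine prediction w p + h \<omega> in the system at p + h
        e. Its value and derivative at h = 0 vanish, and \<open>below\<close> turns it into an error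
        bound for w.\<close>
      define \<rho> where "\<rho> h = r (p + h *\<^sub>R e) - (\<Sum>b\<in>Basis. ((w p + h *\<^sub>R \<omega> e p) \<bullet> b) *\<^sub>R A b (p + h *\<^sub>R e))" for h :: real
      have \<rho>0: "\<rho> 0 = 0" using Suc.prems(3)[OF p] by (simp add: \<rho>_def)
      have dA: "((\<lambda>h. A b (p + h *\<^sub>R e)) has_derivative (\<lambda>h. h *\<^sub>R frechet_derivative (A b) (at p) e)) (at 0)" if "b \<in> Basis" for b
        using frechet_directional[OF Ck_on_has_derivative[OF Suc.prems(1)[OF that] p]] by (simp add: has_vector_derivative_def)
      have dr: "((\<lambda>h. r (p + h *\<^sub>R e)) has_derivative (\<lambda>h. h *\<^sub>R frechet_derivative r (at p) e)) (at 0)"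
        using frechet_directional[OF Ck_on_has_derivative[OF Suc.prems(2) p]] by (simp add: has_vector_derivative_def)
      have dw: "((\<lambda>h. (w p + h *\<^sub>R \<omega> e p) \<bullet> b) has_derivative (\<lambda>h. h * (\<omega> e p \<bullet> b))) (at 0)" for b
        by (auto intro!: derivative_eq_intros)
      have "(\<rho> has_derivative (\<lambda>h. h *\<^sub>R frechet_derivative r (at p) e -
          (\<Sum>b\<in>Basis. ((w p + 0 *\<^sub>R \<omega> e p) \<bullet> b) *\<^sub>R (h *\<^sub>R frechet_derivative (A b) (at p) e) + (h * (\<omega> e p \<bullet> b)) *\<^sub>R A b (p + 0 *\<^sub>R e)))) (at 0)"
        unfolding \<rho>_def[abs_def] by (intro has_derivative_diff has_derivative_sum has_derivative_scaleR dA dr dw)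
      moreover have "h *\<^sub>R frechet_derivative r (at p) e -
          (\<Sum>b\<in>Basis. ((w p + 0 *\<^sub>R \<omega> e p) \<bullet> b) *\<^sub>R (h *\<^sub>R frechet_derivative (A b) (at p) e) + (h * (\<omega> e p \<bullet> b)) *\<^sub>R A b (p + 0 *\<^sub>R e)) = 0" for h
      proof -
        have "h *\<^sub>R (R e p - T p (\<omega> e p)) = 0" using \<omega>[OF p] by simp
        then show ?thesis
          by (simp add: R_def T_def scaleR_diff_right scaleR_sum_right sum.distrib scaleR_left_commute algebra_simps)
      qed
      ultimately have d\<rho>: "(\<rho> has_derivative (\<lambda>h. 0)) (at 0)" by (simp only:)
      obtain m where m: "m > 0" "\<forall>\<^sub>F p in nhds p. p \<in> B \<and> (\<forall>u. norm u \<le> m * norm (T p u))"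
        using below[OF cA p] by blast
      have "((\<lambda>h. p + h *\<^sub>R e) \<longlongrightarrow> p + 0 *\<^sub>R e) (nhds (0::real))" by (intro tendsto_intros filterlim_ident)
      then have "\<forall>\<^sub>F h in nhds 0. p + h *\<^sub>R e \<in> B \<and> (\<forall>u. norm u \<le> m * norm (T (p + h *\<^sub>R e) u))"
        using eventually_compose_filterlim[OF m(2)] by fastforce
      then obtain d1 where d1: "d1 > 0" "\<And>h u. \<bar>h\<bar> < d1 \<Longrightarrow> p + h *\<^sub>R e \<in> B \<and> norm u \<le> m * norm (T (p + h *\<^sub>R e) u)"
        unfolding eventually_nhds_metric by auto
      have bd: "norm (w (p + h *\<^sub>R e) - w p - h *\<^sub>R \<omega> e p) \<le> m * norm (\<rho> h)" if "\<bar>h\<bar> < d1" for h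
      proof -
        have "T (p + h *\<^sub>R e) (w (p + h *\<^sub>R e)) = r (p + h *\<^sub>R e)"
          using Suc.prems(3) d1(2)[OF that] by (simp add: T_def)
        then have "T (p + h *\<^sub>R e) (w (p + h *\<^sub>R e) - (w p + h *\<^sub>R \<omega> e p)) = \<rho> h"
          by (simp add: T_diff \<rho>_def) (simp add: T_def)
        then show ?thesis using d1(2)[OF that, of "w (p + h *\<^sub>R e) - (w p + h *\<^sub>R \<omega> e p)"] by (simp add: diff_diff_eq)
      qed
      show "((\<lambda>h. w (p + h *\<^sub>R e)) has_vector_derivative \<omega> e p) (at 0)"
        unfolding has_vector_derivative_def has_derivative_at_alt
      proof (intro conjI allI impI)
        show "bounded_linear (\<lambda>x. x *\<^sub>R \<omega> e p)" by (rule bounded_linear_scaleR_left)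
        fix \<eta> :: real assume "\<eta> > 0"
        then have "\<eta> / m > 0" using m(1) by simp
        from conjunct2[OF d\<rho>[unfolded has_derivative_at_alt], rule_format, OF this]
        obtain d2 where d2: "d2 > 0" "\<And>h. \<bar>h\<bar> < d2 \<Longrightarrow> norm (\<rho> h) \<le> (\<eta> / m) * \<bar>h\<bar>"
          using \<rho>0 by auto
        show "\<exists>d>0. \<forall>h. norm (h - 0) < d \<longrightarrow>
            norm (w (p + h *\<^sub>R e) - w (p + 0 *\<^sub>R e) - (h - 0) *\<^sub>R \<omega> e p) \<le> \<eta> * norm (h - 0)"
        proof (intro exI[of _ "min d1 d2"] conjI allI impI)
          fix h :: real assume "norm (h - 0) < min d1 d2"
          then have h: "\<bar>h\<bar> < d1" "\<bar>h\<bar> < d2" by auto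
          have "m * norm (\<rho> h) \<le> m * ((\<eta> / m) * \<bar>h\<bar>)" using d2(2)[OF h(2)] m(1) by (intro mult_left_mono) auto
          then show "norm (w (p + h *\<^sub>R e) - w (p + 0 *\<^sub>R e) - (h - 0) *\<^sub>R \<omega> e p) \<le> \<eta> * norm (h - 0)"
            using bd[OF h(1)] m(1) by simp
        qed (use d1 d2 in auto)
      qed
    qed
  }
qed

text \<open>The classical theorem yields an inverse g whose derivative solves the linear system with
  matrix Df at g y. If g is C^k, so is this matrix; by \<open>linear_system_smooth\<close> the
  derivative of g is C^k.\<close>

lemma smooth_inverse_function:
  fixes f :: "'e::euclidean_space \<Rightarrow> 'e"
  assumes S: "open S" "x0 \<in> S" and f: "smooth_on f S"
    and inj: "\<And>v. frechet_derivative f (at x0) v = 0 \<Longrightarrow> v = 0"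
  obtains U V g where "open U" "x0 \<in> U" "U \<subseteq> S" "open V" "homeomorphism U V f g" "smooth_on g V"
    "\<And>x v. x \<in> U \<Longrightarrow> frechet_derivative f (at x) v = 0 \<Longrightarrow> v = 0"
proof -
  define f' where "f' x = Blinfun (frechet_derivative f (at x))" for x
  have hd: "(f has_derivative frechet_derivative f (at x)) (at x)" if "x \<in> S" for x
    using smooth_on_has_derivative[OF f that] .
  have f': "blinfun_apply (f' x) = frechet_derivative f (at x)" if "x \<in> S" for x
    unfolding f'_def using hd[OF that] has_derivative_bounded_linear bounded_linear_Blinfun_apply by blast
  have hd': "(f has_derivative blinfun_apply (f' x)) (at x)" if "x \<in> S" for x
    using hd[OF that] f'[OF that] by simp
  have cont: "continuous_on S f'"
  proof (rule continuous_at_imp_continuous_on, rule ballI, rule continuous_blinfun_componentwiseI1)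
    fix x i assume x: "x \<in> S"
    have "isCont (\<lambda>x. frechet_derivative f (at x) i) x"
      using smooth_on_continuous_on[OF smooth_on_frechet[OF f]] S(1) x by (simp add: continuous_on_eq_continuous_at)
    moreover have ev: "\<forall>\<^sub>F y in nhds x. frechet_derivative f (at y) i = blinfun_apply (f' y) i"
      using eventually_nhds_in_open[OF S(1) x] by eventually_elim (simp add: f')
    ultimately show "isCont (\<lambda>x. blinfun_apply (f' x) i) x"
      by (simp only: isCont_cong[OF ev])
  qed
  have lin: "linear (frechet_derivative f (at x))" if "x \<in> S" for x using hd[OF that] has_derivative_linear by blast
  obtain G where G: "linear G" "G \<circ> frechet_derivative f (at x0) = id"
    using linear_injective_left_inverse[OF lin[OF S(2)]] inj linear_injective_0[OF lin[OF S(2)]] by auto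
  have inv: "Blinfun G o\<^sub>L f' x0 = id_blinfun"
    using G(2) bounded_linear_Blinfun_apply[OF linear_conv_bounded_linear[THEN iffD1, OF G(1)]] f'[OF S(2)]
    by (intro blinfun_eqI) (auto simp: fun_eq_iff)
  obtain U V g g' where *: "open U" "U \<subseteq> S" "x0 \<in> U" "open V" "f x0 \<in> V" "homeomorphism U V f g"
    "\<And>y. y \<in> V \<Longrightarrow> (g has_derivative (g' y)) (at y)"
    "\<And>y. y \<in> V \<Longrightarrow> g' y = inv (blinfun_apply (f' (g y)))"
    "\<And>y. y \<in> V \<Longrightarrow> bij (blinfun_apply (f' (g y)))"
    using inverse_function_theorem[OF S(1) hd' cont S(2) inv] by metis
  have gU: "g y \<in> U" "g y \<in> S" if "y \<in> V" for y using that *(2,6) by (auto simp: homeomorphism_def)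
  have nz: "v = 0" if "x \<in> U" "frechet_derivative f (at x) v = 0" for x v
  proof -
    have "x = g (f x)" "f x \<in> V" using *(6) that(1) by (auto simp: homeomorphism_def)
    then have "inj (frechet_derivative f (at x))" using *(9)[of "f x"] f' that(1) *(2) by (auto simp: bij_def)
    then show ?thesis using that(2) linear_0[OF lin] that(1) *(2) by (metis injD subsetD)
  qed
  have "Ck_on k g V" for k
  proof (induction k)
    case 0
    then show ?case using *(6) by (simp add: homeomorphism_def)
  next
    case (Suc k)
    show ?case
    proof (rule Ck_on_SucI[OF *(4) *(7)])
      fix v
      show "Ck_on k (\<lambda>y. g' y v) V"
      proof (rule linear_system_smooth[OF *(4), where A = "\<lambda>b y. frechet_derivative f (at (g y)) b" and r = "\<lambda>y. v"])
        fix y assume y: "y \<in> V"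
        have exp: "frechet_derivative f (at (g y)) u = (\<Sum>b\<in>Basis. (u \<bullet> b) *\<^sub>R frechet_derivative f (at (g y)) b)" for u
          by (rule frechet_expand[OF hd[OF gU(2)[OF y]]])
        show "u = 0" if "(\<Sum>b\<in>Basis. (u \<bullet> b) *\<^sub>R frechet_derivative f (at (g y)) b) = 0" for u
          using nz[OF gU(1)[OF y], of u] that exp[of u] by simp
        have "frechet_derivative f (at (g y)) (g' y v) = v"
          using *(8)[OF y] *(9)[OF y] f'[OF gU(2)[OF y]] by (metis bij_inv_eq_iff)
        then show "(\<Sum>b\<in>Basis. (g' y v \<bullet> b) *\<^sub>R frechet_derivative f (at (g y)) b) = v"
          using exp by metis
      next
        show "Ck_on k (\<lambda>y. frechet_derivative f (at (g y)) b) V" for b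
          by (rule Ck_on_compose[OF *(4) S(1) _ Suc, where f = "\<lambda>x. frechet_derivative f (at x) b"])
             (use gU smooth_on_frechet[OF f] in \<open>auto simp: smooth_on_def\<close>)
      qed auto
    qed
  qed
  then have "smooth_on g V" by (simp add: smooth_on_def)
  then show ?thesis using that[OF *(1,3,2,4,6)] nz by blast
qed

section \<open>Differential functions and vector fields on jet space\<close>

text \<open>\<open>jmove J v s\<close> is \<open>J + s v\<close>; tangent vectors of jet space are represented by jets.\<close>

definition jmove :: "jet \<Rightarrow> jet \<Rightarrow> real \<Rightarrow> jet" where
  "jmove J v s = (fst J + s * fst v, fst (snd J) + s * fst (snd v), \<lambda>i j. snd (snd J) i j + s * snd (snd v) i j)"

abbreviation jc :: "jet \<Rightarrow> nat \<Rightarrow> nat \<Rightarrow> real" where "jc J \<equiv> snd (snd J)"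

text \<open>Jet space is infinite dimensional, so derivatives are taken along lines. Additivity in
  the direction is not built in; for functions of the class \<open>dfun\<close> it is
  \<open>jd_linear\<close>.\<close>

definition jd :: "(jet \<Rightarrow> real) \<Rightarrow> jet \<Rightarrow> jet \<Rightarrow> real" where
  "jd P J v = deriv (\<lambda>s. P (jmove J v s)) 0"

definition has_jd :: "(jet \<Rightarrow> real) \<Rightarrow> jet \<Rightarrow> jet \<Rightarrow> real \<Rightarrow> bool" where
  "has_jd P J v d \<longleftrightarrow> ((\<lambda>s. P (jmove J v s)) has_real_derivative d) (at 0)"

text \<open>The vector fields on jet space that make \<open>Dx\<close>, \<open>Dt\<close> and
  \<open>prolong\<close> instances of the one directional derivative \<open>jd\<close>, so that all
  their commutators come from a single lemma.\<close>

definition Xx :: "jet \<Rightarrow> jet" where "Xx J = (0, 1, \<lambda>i j. jc J i (Suc j))"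
definition Xt :: "jet \<Rightarrow> jet" where "Xt J = (1, 0, \<lambda>i j. jc J (Suc i) j)"
definition pv :: "vfield \<Rightarrow> jet \<Rightarrow> jet" where
  "pv V J = (vtau V (point_of_jet J), vxi V (point_of_jet J), \<lambda>i j. prol_coeff V i j J)"

lemma point_of_jet_eq: "point_of_jet J = (fst J, fst (snd J), jc J 0 0)"
  by (cases J) simp

lemma jet3_of_jet_eq: "jet3_of_jet J = (fst J, fst (snd J), jc J 0 0, jc J 0 1, jc J 0 2, jc J 0 3)"
  by (cases J) simp

lemma Dx_jd: "Dx P J = jd P J (Xx J)"
  by (cases J) (simp add: jd_def Xx_def jmove_def)

lemma Dt_jd: "Dt P J = jd P J (Xt J)"
  by (cases J) (simp add: jd_def Xt_def jmove_def)

lemma prolong_jd: "prolong V P J = jd P J (pv V J)"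
  by (cases J) (simp add: jd_def pv_def jmove_def)

lemma jmove_0 [simp]: "jmove J v 0 = J"
  by (simp add: jmove_def)

lemma point_jmove: "point_of_jet (jmove J v s) = point_of_jet J + s *\<^sub>R (fst v, fst (snd v), jc v 0 0)"
  by (simp add: jmove_def point_of_jet_eq)

lemma jet3_jmove: "jet3_of_jet (jmove J v s) = jet3_of_jet J + s *\<^sub>R (fst v, fst (snd v), jc v 0 0, jc v 0 1, jc v 0 2, jc v 0 3)"
  by (simp add: jmove_def jet3_of_jet_eq)

lemma has_jd_imp: "has_jd P J v d \<Longrightarrow> jd P J v = d"
  unfolding has_jd_def jd_def by (rule DERIV_imp_deriv)

lemma has_jd_frechet:
  assumes "(f has_derivative f') (at (h J))" "\<And>s. h (jmove J v s) = h J + s *\<^sub>R k"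
  shows "has_jd (\<lambda>J. f (h J)) J v (f' k)"
  using frechet_directional[OF assms(1), of k] assms(2)
  by (simp add: has_jd_def has_real_derivative_iff_has_vector_derivative)

lemma has_jd_coord: "has_jd (\<lambda>J. jc J i j) J v (jc v i j)"
  unfolding has_jd_def jmove_def by (auto intro!: derivative_eq_intros)

lemma has_jd_const: "has_jd (\<lambda>J. c) J v 0"
  unfolding has_jd_def by simp

lemma has_jd_add: "has_jd P J v d \<Longrightarrow> has_jd Q J v e \<Longrightarrow> has_jd (\<lambda>J. P J + Q J) J v (d + e)"
  unfolding has_jd_def by (rule DERIV_add)

lemma has_jd_mult: "has_jd P J v d \<Longrightarrow> has_jd Q J v e \<Longrightarrow> has_jd (\<lambda>J. P J * Q J) J v (d * Q J + e * P J)"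
  unfolding has_jd_def using DERIV_mult[of "\<lambda>s. P (jmove J v s)" d 0 UNIV "\<lambda>s. Q (jmove J v s)" e] by simp

lemma has_jd_inverse: "has_jd P J v d \<Longrightarrow> P J \<noteq> 0 \<Longrightarrow> has_jd (\<lambda>J. inverse (P J)) J v (- (inverse (P J) * d * inverse (P J)))"
  unfolding has_jd_def using DERIV_inverse'[of "\<lambda>s. P (jmove J v s)" d 0 UNIV] by simp

lemma linear_point_split:
  fixes f :: "point \<Rightarrow> real"
  assumes l: "linear f"
  shows "f (a, b, c) = a * f (1, 0, 0) + b * f (0, 1, 0) + c * f (0, 0, 1)"
proof -
  have e: "(a, b, c) = a *\<^sub>R (1, 0, 0) + (b *\<^sub>R (0, 1, 0) + c *\<^sub>R (0, 0, 1::real))"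
    unfolding scaleR_Pair add_Pair by simp
  have "f (a, b, c) = f (a *\<^sub>R (1, 0, 0) + (b *\<^sub>R (0, 1, 0) + c *\<^sub>R (0, 0, 1::real)))"
    by (rule arg_cong[OF e])
  also have "\<dots> = a * f (1, 0, 0) + (b * f (0, 1, 0) + c * f (0, 0, 1))"
    by (simp only: linear_add[OF l] linear_cmul[OF l] real_scaleR_def)
  finally show ?thesis by (simp only: add.assoc)
qed

text \<open>Rational expressions in the jet coordinates listed in K, with smooth functions of (t, x,
  u) as coefficients. Inductive generation allows linearity and the commutator formula to be proved
  by induction, and K records on which derivatives of u a function depends. \<open>cong\<close>
  admits functions that have such a form on \<Omega> only.\<close>

inductive dfun :: "jet set \<Rightarrow> point set \<Rightarrow> (nat \<times> nat) set \<Rightarrow> (jet \<Rightarrow> real) \<Rightarrow> bool"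
  for \<Omega> D K where
  base: "smooth_on f D \<Longrightarrow> dfun \<Omega> D K (\<lambda>J. f (point_of_jet J))"
| coord: "(i, j) \<in> K \<Longrightarrow> dfun \<Omega> D K (\<lambda>J. jc J i j)"
| add: "dfun \<Omega> D K P \<Longrightarrow> dfun \<Omega> D K Q \<Longrightarrow> dfun \<Omega> D K (\<lambda>J. P J + Q J)"
| mult: "dfun \<Omega> D K P \<Longrightarrow> dfun \<Omega> D K Q \<Longrightarrow> dfun \<Omega> D K (\<lambda>J. P J * Q J)"
| inverse: "dfun \<Omega> D K P \<Longrightarrow> (\<And>J. J \<in> \<Omega> \<Longrightarrow> P J \<noteq> 0) \<Longrightarrow> dfun \<Omega> D K (\<lambda>J. inverse (P J))"
| cong: "dfun \<Omega> D K P \<Longrightarrow> (\<And>J. J \<in> \<Omega> \<Longrightarrow> P J = Q J) \<Longrightarrow> dfun \<Omega> D K Q"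

lemma dfun_mono: "dfun \<Omega> D K P \<Longrightarrow> K \<subseteq> K' \<Longrightarrow> dfun \<Omega> D K' P"
proof (induction rule: dfun.induct)
  case (cong P Q) then show ?case using dfun.cong by blast
qed (auto intro: dfun.intros)

lemma dfun_const: "dfun \<Omega> D K (\<lambda>J. c)"
  using dfun.base[of "\<lambda>p. c"] by simp

lemma dfun_uminus: "dfun \<Omega> D K P \<Longrightarrow> dfun \<Omega> D K (\<lambda>J. - P J)"
  using dfun.mult[OF dfun_const[of \<Omega> D K "-1"]] by simp

lemma dfun_diff: "dfun \<Omega> D K P \<Longrightarrow> dfun \<Omega> D K Q \<Longrightarrow> dfun \<Omega> D K (\<lambda>J. P J - Q J)"
  using dfun.add[OF _ dfun_uminus] by simp

lemma dfun_divide: "dfun \<Omega> D K P \<Longrightarrow> dfun \<Omega> D K Q \<Longrightarrow> (\<And>J. J \<in> \<Omega> \<Longrightarrow> Q J \<noteq> 0) \<Longrightarrow> dfun \<Omega> D K (\<lambda>J. P J / Q J)"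
  using dfun.mult[OF _ dfun.inverse] by (simp add: divide_inverse)

lemma dfun_local:
  assumes "dfun \<Omega> D K P" "J \<in> \<Omega>" "J' \<in> \<Omega>" "point_of_jet J = point_of_jet J'" "\<And>i j. (i, j) \<in> K \<Longrightarrow> jc J i j = jc J' i j"
  shows "P J = P J'"
  using assms by (induction rule: dfun.induct) metis+

lemma frechet_split:
  fixes f :: "point \<Rightarrow> real"
  assumes "smooth_on f D" "p \<in> D"
  shows "frechet_derivative f (at p) (a, b, c) = a * frechet_derivative f (at p) (1, 0, 0)
    + b * frechet_derivative f (at p) (0, 1, 0) + c * frechet_derivative f (at p) (0, 0, 1)"
  by (rule linear_point_split) (rule has_derivative_linear[OF smooth_on_has_derivative[OF assms]])

text \<open>Openness of \<Omega> is asked along straight lines, which is all that \<open>jd\<close>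
  sees.\<close>

locale jets =
  fixes \<Omega> :: "jet set" and D :: "point set"
  assumes D: "open D" and pt: "\<And>J. J \<in> \<Omega> \<Longrightarrow> point_of_jet J \<in> D"
    and \<Omega>: "\<And>J v. J \<in> \<Omega> \<Longrightarrow> \<forall>\<^sub>F s in nhds 0. jmove J v s \<in> \<Omega>"
begin

lemma has_jd_cong:
  assumes "has_jd P J v d" "J \<in> \<Omega>" "\<And>J. J \<in> \<Omega> \<Longrightarrow> P J = Q J" shows "has_jd Q J v d"
proof -
  have "\<forall>\<^sub>F s in nhds 0. P (jmove J v s) = Q (jmove J v s)"
    using \<Omega>[OF assms(2), of v] by eventually_elim (rule assms(3))
  from DERIV_cong_ev[OF refl this refl] show ?thesis using assms(1) unfolding has_jd_def by blast
qed

lemma has_jd_base: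
  "smooth_on f D \<Longrightarrow> J \<in> \<Omega> \<Longrightarrow> has_jd (\<lambda>J. f (point_of_jet J)) J v
     (frechet_derivative f (at (point_of_jet J)) (fst v, fst (snd v), jc v 0 0))"
  by (rule has_jd_frechet[OF smooth_on_has_derivative[OF _ pt] point_jmove])

lemma dfun_has_jd: "dfun \<Omega> D K P \<Longrightarrow> J \<in> \<Omega> \<Longrightarrow> has_jd P J v (jd P J v)"
proof -
  assume "dfun \<Omega> D K P" "J \<in> \<Omega>"
  then have "\<exists>d. has_jd P J v d"
    by (induction rule: dfun.induct)
       (blast intro: has_jd_base has_jd_coord has_jd_add has_jd_mult has_jd_inverse has_jd_cong)+
  then show ?thesis using has_jd_imp by blast
qed

lemma jd_base: "smooth_on f D \<Longrightarrow> J \<in> \<Omega> \<Longrightarrow> jd (\<lambda>J. f (point_of_jet J)) J v =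
    frechet_derivative f (at (point_of_jet J)) (fst v, fst (snd v), jc v 0 0)"
  by (rule has_jd_imp[OF has_jd_base])

lemma jd_coord: "jd (\<lambda>J. jc J i j) J v = jc v i j"
  by (rule has_jd_imp[OF has_jd_coord])

lemma jd_const: "jd (\<lambda>J. c) J v = 0"
  by (rule has_jd_imp[OF has_jd_const])

lemma jd_add: "dfun \<Omega> D K P \<Longrightarrow> dfun \<Omega> D K' Q \<Longrightarrow> J \<in> \<Omega> \<Longrightarrow> jd (\<lambda>J. P J + Q J) J v = jd P J v + jd Q J v"
  by (rule has_jd_imp[OF has_jd_add[OF dfun_has_jd dfun_has_jd]])

lemma jd_mult: "dfun \<Omega> D K P \<Longrightarrow> dfun \<Omega> D K' Q \<Longrightarrow> J \<in> \<Omega> \<Longrightarrow> jd (\<lambda>J. P J * Q J) J v = jd P J v * Q J + jd Q J v * P J"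
  by (rule has_jd_imp[OF has_jd_mult[OF dfun_has_jd dfun_has_jd]])

lemma jd_uminus: "dfun \<Omega> D K P \<Longrightarrow> J \<in> \<Omega> \<Longrightarrow> jd (\<lambda>J. - P J) J v = - jd P J v"
  using jd_mult[OF dfun_const[of \<Omega> D K "-1"], of K P J v] by (simp add: jd_const)

lemma jd_diff: "dfun \<Omega> D K P \<Longrightarrow> dfun \<Omega> D K' Q \<Longrightarrow> J \<in> \<Omega> \<Longrightarrow> jd (\<lambda>J. P J - Q J) J v = jd P J v - jd Q J v"
  using jd_add[OF _ dfun_uminus, of K P K' Q J v] jd_uminus[of K' Q J v] by simp

lemma jd_inverse:
  "dfun \<Omega> D K P \<Longrightarrow> P J \<noteq> 0 \<Longrightarrow> J \<in> \<Omega> \<Longrightarrow> jd (\<lambda>J. inverse (P J)) J v = - (inverse (P J) * jd P J v * inverse (P J))"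
  by (rule has_jd_imp[OF has_jd_inverse[OF dfun_has_jd]])

lemma jd_divide:
  assumes "dfun \<Omega> D K P" "dfun \<Omega> D K' Q" "\<And>J. J \<in> \<Omega> \<Longrightarrow> Q J \<noteq> 0" "J \<in> \<Omega>"
  shows "jd (\<lambda>J. P J / Q J) J v = (jd P J v * Q J - P J * jd Q J v) / (Q J)\<^sup>2"
proof -
  have "jd (\<lambda>J. P J * inverse (Q J)) J v = jd P J v * inverse (Q J) + jd (\<lambda>J. inverse (Q J)) J v * P J"
    by (rule jd_mult[OF assms(1) dfun.inverse[OF assms(2,3)] assms(4)])
  also have "\<dots> = (jd P J v * Q J - P J * jd Q J v) / (Q J)\<^sup>2"
    using assms(3)[OF assms(4)] jd_inverse[OF assms(2) assms(3) assms(4), OF assms(4)]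
    by (simp add: field_simps power2_eq_square)
  finally show ?thesis by (simp add: divide_inverse)
qed

lemma jd_cong: "dfun \<Omega> D K P \<Longrightarrow> J \<in> \<Omega> \<Longrightarrow> (\<And>J. J \<in> \<Omega> \<Longrightarrow> P J = Q J) \<Longrightarrow> jd Q J v = jd P J v"
  by (rule has_jd_imp[OF has_jd_cong[OF dfun_has_jd]])

lemma jd_base_split:
  assumes "smooth_on f D" "J \<in> \<Omega>"
  shows "jd (\<lambda>J. f (point_of_jet J)) J v = fst v * frechet_derivative f (at (point_of_jet J)) (1, 0, 0)
    + fst (snd v) * frechet_derivative f (at (point_of_jet J)) (0, 1, 0) + jc v 0 0 * frechet_derivative f (at (point_of_jet J)) (0, 0, 1)"
  unfolding jd_base[OF assms] by (rule frechet_split[OF assms(1) pt[OF assms(2)]])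

lemma jd_linear: "dfun \<Omega> D K P \<Longrightarrow> J \<in> \<Omega> \<Longrightarrow> jd P J (jmove v w c) = jd P J v + c * jd P J w"
proof (induction rule: dfun.induct)
  case (base f)
  then show ?case
    by (simp add: jd_base_split jmove_def algebra_simps)
next
  case (coord i j)
  then show ?case by (simp add: jd_coord jmove_def)
next
  case (add P Q)
  then show ?case by (simp add: jd_add algebra_simps)
next
  case (mult P Q)
  then show ?case by (simp add: jd_mult algebra_simps)
next
  case (inverse P)
  then show ?case by (simp add: jd_inverse algebra_simps)
next
  case (cong P Q)
  then show ?case using jd_cong[OF cong(1) cong(4) cong(2)] by simp
qed

text \<open>The coefficients of Z may involve more coordinates than P, as for total derivatives;
  hence the second set K'.\<close>

lemma dfun_jd:
  assumes "dfun \<Omega> D K P" "dfun \<Omega> D K' (\<lambda>J. fst (Z J))" "dfun \<Omega> D K' (\<lambda>J. fst (snd (Z J)))" "dfun \<Omega> D K' (\<lambda>J. jc (Z J) 0 0)"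
    "\<And>i j. (i, j) \<in> K \<Longrightarrow> dfun \<Omega> D K' (\<lambda>J. jc (Z J) i j)" "K \<subseteq> K'"
  shows "dfun \<Omega> D K' (\<lambda>J. jd P J (Z J))"
  using assms
proof (induction rule: dfun.induct)
  case (base f)
  have "dfun \<Omega> D K' (\<lambda>J. fst (Z J) * frechet_derivative f (at (point_of_jet J)) (1, 0, 0)
    + fst (snd (Z J)) * frechet_derivative f (at (point_of_jet J)) (0, 1, 0) + jc (Z J) 0 0 * frechet_derivative f (at (point_of_jet J)) (0, 0, 1))"
    by (intro dfun.add dfun.mult base(2-4) dfun.base smooth_on_frechet base(1))
  then show ?case
    by (rule dfun.cong) (simp only: jd_base_split[OF base(1)])
next
  case (coord i j)
  then show ?case by (simp add: jd_coord)
next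
  case (add P Q)
  have "dfun \<Omega> D K' (\<lambda>J. jd P J (Z J) + jd Q J (Z J))" using add by (intro dfun.add) auto
  then show ?case by (rule dfun.cong) (simp add: jd_add[OF add(1,2)])
next
  case (mult P Q)
  have "dfun \<Omega> D K' (\<lambda>J. jd P J (Z J) * Q J + jd Q J (Z J) * P J)"
    using mult dfun_mono[OF _ mult(9)] by (intro dfun.add dfun.mult) auto
  then show ?case by (rule dfun.cong) (simp add: jd_mult[OF mult(1,2)])
next
  case (inverse P)
  have "dfun \<Omega> D K' (\<lambda>J. - (inverse (P J) * jd P J (Z J) * inverse (P J)))"
    using inverse dfun_mono[OF inverse(1) inverse(8)] by (intro dfun_uminus dfun.mult dfun.inverse) auto
  then show ?case by (rule dfun.cong) (simp add: jd_inverse[OF inverse(1,2)])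
next
  case (cong P Q)
  have "dfun \<Omega> D K' (\<lambda>J. jd P J (Z J))" using cong by blast
  then show ?case by (rule dfun.cong) (simp add: jd_cong[OF cong(1) _ cong(2)])
qed

definition jfield :: "(jet \<Rightarrow> jet) \<Rightarrow> bool" where
  "jfield Z \<longleftrightarrow> dfun \<Omega> D UNIV (\<lambda>J. fst (Z J)) \<and> dfun \<Omega> D UNIV (\<lambda>J. fst (snd (Z J))) \<and> (\<forall>i j. dfun \<Omega> D UNIV (\<lambda>J. jc (Z J) i j))"

lemma dfun_field: "dfun \<Omega> D UNIV P \<Longrightarrow> jfield Z \<Longrightarrow> dfun \<Omega> D UNIV (\<lambda>J. jd P J (Z J))"
  unfolding jfield_def by (rule dfun_jd) auto

definition bracket :: "(jet \<Rightarrow> jet) \<Rightarrow> (jet \<Rightarrow> jet) \<Rightarrow> jet \<Rightarrow> jet" where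
  "bracket Z Z' J = (jd (\<lambda>J. fst (Z' J)) J (Z J) - jd (\<lambda>J. fst (Z J)) J (Z' J),
     jd (\<lambda>J. fst (snd (Z' J))) J (Z J) - jd (\<lambda>J. fst (snd (Z J))) J (Z' J),
     \<lambda>i j. jd (\<lambda>J. jc (Z' J) i j) J (Z J) - jd (\<lambda>J. jc (Z J) i j) J (Z' J))"

text \<open>Both sides behave as derivations in P, so the identity passes through sums, products and
  inverses. For functions of the base point it reduces to the symmetry of second
  derivatives.\<close>

lemma commutator:
  assumes "dfun \<Omega> D UNIV P" "jfield Z" "jfield Z'" "J \<in> \<Omega>"
  shows "jd (\<lambda>J. jd P J (Z' J)) J (Z J) - jd (\<lambda>J. jd P J (Z J)) J (Z' J) = jd P J (bracket Z Z' J)"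
  using assms(1,4)
proof (induction rule: dfun.induct)
  case (base f)
  \<comment> \<open>The coordinate directions t, x, u are numbered 0, 1, 2, so that the symmetry of
    \<open>f2\<close> can be stated once.\<close>
  define e :: "nat \<Rightarrow> point" where "e k = (if k = 0 then (1, 0, 0) else if k = 1 then (0, 1, 0) else (0, 0, 1))" for k
  define f1 where "f1 k J = frechet_derivative f (at (point_of_jet J)) (e k)" for k and J
  define f2 where "f2 k l = frechet_derivative (\<lambda>p. frechet_derivative f (at p) (e k)) (at (point_of_jet J)) (e l)" for k l
  have sm: "smooth_on (\<lambda>p. frechet_derivative f (at p) (e k)) D" for k using base(1) by (rule smooth_on_frechet)
  have sym: "f2 k l = f2 l k" for k l
    unfolding f2_def by (rule second_derivative_symmetric[OF D _ pt[OF base(2)]]) (use base(1) in \<open>simp add: smooth_on_def\<close>)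
  have df1: "dfun \<Omega> D UNIV (f1 k)" for k unfolding f1_def[abs_def] by (rule dfun.base[OF sm])
  have jf1: "jd (f1 k) J v = fst v * f2 k 0 + fst (snd v) * f2 k 1 + jc v 0 0 * f2 k 2" for k v
    unfolding f1_def[abs_def] f2_def jd_base_split[OF sm base(2)] by (simp add: e_def)
  have exp: "jd (\<lambda>J. f (point_of_jet J)) J v = fst v * f1 0 J + fst (snd v) * f1 1 J + jc v 0 0 * f1 2 J" if "J \<in> \<Omega>" for J v
    unfolding jd_base_split[OF base(1) that] f1_def by (simp add: e_def)
  have second: "jd (\<lambda>J. jd (\<lambda>J. f (point_of_jet J)) J (Y J)) J v =
      (jd (\<lambda>J. fst (Y J)) J v * f1 0 J + jd (f1 0) J v * fst (Y J)) + (jd (\<lambda>J. fst (snd (Y J))) J v * f1 1 J + jd (f1 1) J v * fst (snd (Y J)))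
      + (jd (\<lambda>J. jc (Y J) 0 0) J v * f1 2 J + jd (f1 2) J v * jc (Y J) 0 0)" if Y: "jfield Y" for Y v
  proof -
    have dY: "dfun \<Omega> D UNIV (\<lambda>J. fst (Y J))" "dfun \<Omega> D UNIV (\<lambda>J. fst (snd (Y J)))" "dfun \<Omega> D UNIV (\<lambda>J. jc (Y J) 0 0)"
      using Y by (auto simp: jfield_def)
    have m: "dfun \<Omega> D UNIV (\<lambda>J. fst (Y J) * f1 0 J)" "dfun \<Omega> D UNIV (\<lambda>J. fst (snd (Y J)) * f1 1 J)" "dfun \<Omega> D UNIV (\<lambda>J. jc (Y J) 0 0 * f1 2 J)"
      by (rule dfun.mult[OF dY(1) df1], rule dfun.mult[OF dY(2) df1], rule dfun.mult[OF dY(3) df1])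
    have "jd (\<lambda>J. jd (\<lambda>J. f (point_of_jet J)) J (Y J)) J v = jd (\<lambda>J. fst (Y J) * f1 0 J + fst (snd (Y J)) * f1 1 J + jc (Y J) 0 0 * f1 2 J) J v"
      by (rule jd_cong[OF _ base(2), where K = UNIV]) (intro dfun.add m, simp only: exp)
    also have "\<dots> = jd (\<lambda>J. fst (Y J) * f1 0 J) J v + jd (\<lambda>J. fst (snd (Y J)) * f1 1 J) J v + jd (\<lambda>J. jc (Y J) 0 0 * f1 2 J) J v"
      by (simp only: jd_add[OF dfun.add[OF m(1,2)] m(3) base(2)] jd_add[OF m(1,2) base(2)])
    finally show ?thesis
      by (simp only: jd_mult[OF dY(1) df1 base(2)] jd_mult[OF dY(2) df1 base(2)] jd_mult[OF dY(3) df1 base(2)])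
  qed
  show ?case
    unfolding second[OF assms(2)] second[OF assms(3)] exp[OF base(2)] jf1 bracket_def
    by (simp only: fst_conv snd_conv sym[of 1 0] sym[of 2 0] sym[of 2 1]) (simp only: algebra_simps)
next
  case (coord i j)
  then show ?case by (simp add: jd_coord bracket_def)
next
  case (add P Q)
  have "jd (\<lambda>J. jd (\<lambda>J. P J + Q J) J (Y J)) J v = jd (\<lambda>J. jd P J (Y J)) J v + jd (\<lambda>J. jd Q J (Y J)) J v" if "jfield Y" for Y v
  proof -
    have "jd (\<lambda>J. jd (\<lambda>J. P J + Q J) J (Y J)) J v = jd (\<lambda>J. jd P J (Y J) + jd Q J (Y J)) J v"
      by (rule jd_cong[OF _ add(5), where K = UNIV]) (intro dfun.add dfun_field[OF _ that] add(1,2), simp only: jd_add[OF add(1,2)])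
    then show ?thesis by (simp add: jd_add[OF dfun_field dfun_field] add that)
  qed
  then show ?case using add by (simp add: jd_add[OF add(1,2)] assms)
next
  case (mult P Q)
  have "jd (\<lambda>J. jd (\<lambda>J. P J * Q J) J (Y J)) J v = (jd (\<lambda>J. jd P J (Y J)) J v * Q J + jd Q J v * jd P J (Y J))
      + (jd (\<lambda>J. jd Q J (Y J)) J v * P J + jd P J v * jd Q J (Y J))" if "jfield Y" for Y v
  proof -
    have d: "dfun \<Omega> D UNIV (\<lambda>J. jd P J (Y J))" "dfun \<Omega> D UNIV (\<lambda>J. jd Q J (Y J))" by (rule dfun_field[OF mult(1) that], rule dfun_field[OF mult(2) that])
    have "jd (\<lambda>J. jd (\<lambda>J. P J * Q J) J (Y J)) J v = jd (\<lambda>J. jd P J (Y J) * Q J + jd Q J (Y J) * P J) J v"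
      by (rule jd_cong[OF _ mult(5), where K = UNIV]) (intro dfun.add dfun.mult d mult(1,2), simp only: jd_mult[OF mult(1,2)])
    then show ?thesis
      by (simp add: jd_add[OF dfun.mult[OF d(1) mult(2)] dfun.mult[OF d(2) mult(1)] mult(5)] jd_mult[OF d(1) mult(2,5)] jd_mult[OF d(2) mult(1,5)])
  qed
  then show ?case using mult(3,4)[OF mult(5)] by (simp add: jd_mult[OF mult(1,2,5)] assms algebra_simps)
next
  case (inverse P)
  have nz: "P J \<noteq> 0" using inverse by blast
  have second: "jd (\<lambda>J. jd (\<lambda>J. inverse (P J)) J (Y J)) J v =
      - (jd (\<lambda>J. jd P J (Y J)) J v * (inverse (P J))\<^sup>2 - 2 * jd P J v * jd P J (Y J) * (inverse (P J)) ^ 3)" if "jfield Y" for Y v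
  proof -
    have d: "dfun \<Omega> D UNIV (\<lambda>J. jd P J (Y J))" "dfun \<Omega> D UNIV (\<lambda>J. inverse (P J))"
      by (rule dfun_field[OF inverse(1) that], rule dfun.inverse[OF inverse(1,2)])
    have "jd (\<lambda>J. jd (\<lambda>J. inverse (P J)) J (Y J)) J v = jd (\<lambda>J. - (inverse (P J) * jd P J (Y J) * inverse (P J))) J v"
      by (rule jd_cong[OF _ inverse(4), where K = UNIV]) (intro dfun_uminus dfun.mult d, simp only: jd_inverse[OF inverse(1,2)])
    then show ?thesis
      using jd_uminus[OF dfun.mult[OF dfun.mult[OF d(2,1)] d(2)] inverse(4)] jd_mult[OF dfun.mult[OF d(2,1)] d(2) inverse(4)]
        jd_mult[OF d(2,1) inverse(4)] jd_inverse[OF inverse(1) nz inverse(4)]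
      by (simp add: power2_eq_square power3_eq_cube algebra_simps)
  qed
  show ?case
    unfolding second[OF assms(2)] second[OF assms(3)] jd_inverse[OF inverse(1) nz inverse(4)] inverse(3)[OF inverse(4), symmetric]
    by (simp add: power2_eq_square algebra_simps)
next
  case (cong P Q)
  have "jd (\<lambda>J. jd Q J (Y J)) J v = jd (\<lambda>J. jd P J (Y J)) J v" if "jfield Y" for Y v
    by (rule jd_cong[OF dfun_field[OF cong(1) that] cong(4)]) (simp add: jd_cong[OF cong(1) _ cong(2)])
  then show ?case using cong by (simp add: assms jd_cong[OF cong(1,4,2)])
qed

end

section \<open>Prolongations\<close>

definition low :: "nat \<Rightarrow> (nat \<times> nat) set" where "low k = {(0, j) |j. j \<le> k}"

text \<open>As a constant vector field this is d/du_k, with u_k the k-th x-derivative of u.\<close>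

definition unit :: "nat \<Rightarrow> jet" where "unit k = (0, 0, \<lambda>i j. if i = 0 \<and> j = k then 1 else 0)"

lemma unit_simps [simp]: "fst (unit k) = 0" "fst (snd (unit k)) = 0" "jc (unit k) i j = (if i = 0 \<and> j = k then 1 else 0)"
  by (simp_all add: unit_def)

lemma Xx_simps [simp]: "fst (Xx J) = 0" "fst (snd (Xx J)) = 1" "jc (Xx J) i j = jc J i (Suc j)"
  by (simp_all add: Xx_def)

lemma Xt_simps [simp]: "fst (Xt J) = 1" "fst (snd (Xt J)) = 0" "jc (Xt J) i j = jc J (Suc i) j"
  by (simp_all add: Xt_def)

lemma pv_simps [simp]: "fst (pv V J) = vtau V (point_of_jet J)" "fst (snd (pv V J)) = vxi V (point_of_jet J)"
  "jc (pv V J) i j = prol_coeff V i j J"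
  by (simp_all add: pv_def)

lemma Dx_fun: "Dx P = (\<lambda>J. jd P J (Xx J))" by (rule ext) (rule Dx_jd)
lemma Dt_fun: "Dt P = (\<lambda>J. jd P J (Xt J))" by (rule ext) (rule Dt_jd)

lemma jd_zero_direction: "jd P J (0, 0, \<lambda>i j. 0) = 0"
  by (simp add: jd_def jmove_def)

lemma prol_coeff_eq: "prol_coeff V i j J = (Dt ^^ i) ((Dx ^^ j) (characteristic V)) J
    + vtau V (point_of_jet J) * jc J (Suc i) j + vxi V (point_of_jet J) * jc J i (Suc j)"
  by (cases J) simp

lemma characteristic_eq: "characteristic V = (\<lambda>J. veta V (point_of_jet J) - vtau V (point_of_jet J) * jc J 1 0
    - vxi V (point_of_jet J) * jc J 0 1)"
  by (rule ext) (metis (no_types, lifting) characteristic.simps point_of_jet.simps prod.collapse snd_conv)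

lemma low_mono: "k \<le> l \<Longrightarrow> low k \<subseteq> low l" by (auto simp: low_def)

context jets begin

lemma jfield_Xx: "jfield Xx"
  unfolding jfield_def by (auto intro: dfun_const dfun.coord)

lemma jfield_Xt: "jfield Xt"
  unfolding jfield_def by (auto intro: dfun_const dfun.coord)

lemma jfield_const: "jfield (\<lambda>J. v)"
  unfolding jfield_def by (auto intro: dfun_const)

lemma dfun_Dx: "dfun \<Omega> D UNIV P \<Longrightarrow> dfun \<Omega> D UNIV (Dx P)"
  unfolding Dx_fun by (rule dfun_field[OF _ jfield_Xx])

lemma dfun_Dt: "dfun \<Omega> D UNIV P \<Longrightarrow> dfun \<Omega> D UNIV (Dt P)"
  unfolding Dt_fun by (rule dfun_field[OF _ jfield_Xt])

lemma dfun_Dx_pow: "dfun \<Omega> D UNIV P \<Longrightarrow> dfun \<Omega> D UNIV ((Dx ^^ j) P)"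
  by (induction j) (auto intro: dfun_Dx)

lemma dfun_Dt_pow: "dfun \<Omega> D UNIV P \<Longrightarrow> dfun \<Omega> D UNIV ((Dt ^^ i) P)"
  by (induction i) (auto intro: dfun_Dt)

lemma dfun_Dx_low: "dfun \<Omega> D (low k) P \<Longrightarrow> dfun \<Omega> D (low (Suc k)) (Dx P)"
  unfolding Dx_fun
  by (rule dfun_jd[where K = "low k"]) (auto simp: low_def intro: dfun_const dfun.coord)

lemma Dt_cong: "dfun \<Omega> D K P \<Longrightarrow> J \<in> \<Omega> \<Longrightarrow> (\<And>J. J \<in> \<Omega> \<Longrightarrow> P J = Q J) \<Longrightarrow> Dt Q J = Dt P J"
  unfolding Dt_jd by (rule jd_cong)

lemma Dx_cong: "dfun \<Omega> D K P \<Longrightarrow> J \<in> \<Omega> \<Longrightarrow> (\<And>J. J \<in> \<Omega> \<Longrightarrow> P J = Q J) \<Longrightarrow> Dx Q J = Dx P J"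
  unfolding Dx_jd by (rule jd_cong)

lemma jd_eq_0:
  assumes "J \<in> \<Omega>" "\<And>J. J \<in> \<Omega> \<Longrightarrow> P J = c" shows "jd P J v = 0"
  using jd_cong[OF dfun_const[of \<Omega> D UNIV c] assms(1), of P v] assms(2) by (simp add: jd_const)

lemma Dx_Dt: "dfun \<Omega> D UNIV P \<Longrightarrow> J \<in> \<Omega> \<Longrightarrow> Dx (Dt P) J = Dt (Dx P) J"
proof -
  assume *: "dfun \<Omega> D UNIV P" "J \<in> \<Omega>"
  have "bracket Xx Xt J = (0, 0, \<lambda>i j. 0)"
    by (simp add: bracket_def jd_const jd_coord)
  then show ?thesis
    using commutator[OF *(1) jfield_Xx jfield_Xt *(2)] by (simp add: Dx_fun Dt_fun jd_zero_direction)
qed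

lemma Dx_Dt_pow: "dfun \<Omega> D UNIV P \<Longrightarrow> J \<in> \<Omega> \<Longrightarrow> Dx ((Dt ^^ i) P) J = (Dt ^^ i) (Dx P) J"
proof (induction i arbitrary: J)
  case (Suc i)
  have "Dx ((Dt ^^ Suc i) P) J = Dt (Dx ((Dt ^^ i) P)) J"
    using Dx_Dt[OF dfun_Dt_pow[OF Suc.prems(1)] Suc.prems(2)] by simp
  also have "\<dots> = Dt ((Dt ^^ i) (Dx P)) J"
    by (rule Dt_cong[OF dfun_Dt_pow[OF dfun_Dx[OF Suc.prems(1)]] Suc.prems(2)])
       (use Suc in auto)
  finally show ?case by simp
qed simp

lemma jd_unit_low:
  assumes "dfun \<Omega> D (low k) P" "J \<in> \<Omega>" "k < l" shows "jd P J (unit l) = 0"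
proof -
  have "\<forall>\<^sub>F s in nhds 0. P (jmove J (unit l) s) = P J"
    using \<Omega>[OF assms(2), of "unit l"]
  proof eventually_elim
    case (elim s)
    show ?case
      by (rule dfun_local[OF assms(1) elim assms(2)]) (use assms(3) in \<open>auto simp: jmove_def point_of_jet_eq low_def\<close>)
  qed
  from DERIV_cong_ev[OF refl this refl, of 0] have "has_jd P J (unit l) 0"
    unfolding has_jd_def by simp
  then show ?thesis by (rule has_jd_imp)
qed

text \<open>The commutator of d/du_(k+1) with D_x is d/du_k.\<close>

lemma jd_unit_Dx:
  assumes "dfun \<Omega> D UNIV P" "J \<in> \<Omega>"
  shows "jd (Dx P) J (unit (Suc k)) = Dx (\<lambda>J. jd P J (unit (Suc k))) J + jd P J (unit k)"
proof -
  have "bracket (\<lambda>J. unit (Suc k)) Xx J = unit k"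
    by (simp add: bracket_def jd_const jd_coord) (simp add: unit_def)
  then show ?thesis
    using commutator[OF assms(1) jfield_const[of "unit (Suc k)"] jfield_Xx assms(2)] by (simp add: Dx_fun)
qed

lemma jd_unit_Dx_top:
  assumes "dfun \<Omega> D (low k) P" "J \<in> \<Omega>"
  shows "jd (Dx P) J (unit (Suc k)) = jd P J (unit k)"
proof -
  have "Dx (\<lambda>J. jd P J (unit (Suc k))) J = 0"
    unfolding Dx_jd by (rule jd_eq_0[OF assms(2)]) (rule jd_unit_low[OF assms(1)], auto)
  then show ?thesis using jd_unit_Dx[OF dfun_mono[OF assms(1)] assms(2)] by simp
qed

text \<open>Applied in the directions u_xxx and u_xxxx, to functions whose slope does not change
  along the line.\<close>

lemma affine_along:
  assumes P: "dfun \<Omega> D K P" and J: "\<And>s. jmove J v s \<in> \<Omega>" and c: "\<And>s. jd P (jmove J v s) v = c"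
  shows "P (jmove J v s) = P J + s * c"
proof -
  have "((\<lambda>h. P (jmove J v h)) has_real_derivative c) (at h)" for h
  proof -
    have "has_jd P (jmove J v h) v c" using dfun_has_jd[OF P J] c by metis
    moreover have "jmove (jmove J v h) v r = jmove J v (h + r)" for r
      by (simp add: jmove_def algebra_simps)
    ultimately show ?thesis using DERIV_shift[of "\<lambda>h. P (jmove J v h)" c 0 h] by (simp add: has_jd_def add.commute)
  qed
  then have "((\<lambda>h. P (jmove J v h) - h * c) has_real_derivative 0) (at h)" for h
    by (auto intro!: derivative_eq_intros)
  from DERIV_isconst_all[of "\<lambda>h. P (jmove J v h) - h * c" s 0] this show ?thesis by auto
qed

end

locale jets_vf = jets +
  fixes V :: vfield
  assumes V: "smooth_on V D"
begin

lemma smooth_components: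
  "smooth_on (\<lambda>p. vtau V p) D" "smooth_on (\<lambda>p. vxi V p) D" "smooth_on (\<lambda>p. veta V p) D"
  using smooth_on_compose_linear[OF D bounded_linear_fst V]
    smooth_on_compose_linear[OF D bounded_linear_compose[OF bounded_linear_fst bounded_linear_snd] V]
    smooth_on_compose_linear[OF D bounded_linear_compose[OF bounded_linear_snd bounded_linear_snd] V]
  by auto

lemma dfun_components:
  "dfun \<Omega> D K (\<lambda>J. vtau V (point_of_jet J))" "dfun \<Omega> D K (\<lambda>J. vxi V (point_of_jet J))" "dfun \<Omega> D K (\<lambda>J. veta V (point_of_jet J))"
  by (rule dfun.base[OF smooth_components(1)], rule dfun.base[OF smooth_components(2)], rule dfun.base[OF smooth_components(3)])

lemma dfun_characteristic: "dfun \<Omega> D UNIV (characteristic V)"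
  unfolding characteristic_eq by (intro dfun_diff dfun.mult dfun_components dfun.coord) auto

lemma dfun_prol: "dfun \<Omega> D UNIV (prol_coeff V i j)"
  unfolding prol_coeff_eq[abs_def]
  by (intro dfun.add dfun.mult dfun_components dfun.coord dfun_Dt_pow dfun_Dx_pow dfun_characteristic) auto

lemma jfield_pv: "jfield (pv V)"
  unfolding jfield_def by (auto intro: dfun_components dfun_prol)

lemma jd_prol:
  assumes J: "J \<in> \<Omega>"
  shows "jd (prol_coeff V i j) J v = jd ((Dt ^^ i) ((Dx ^^ j) (characteristic V))) J v
     + (jd (\<lambda>J. vtau V (point_of_jet J)) J v * jc J (Suc i) j + jc v (Suc i) j * vtau V (point_of_jet J))
     + (jd (\<lambda>J. vxi V (point_of_jet J)) J v * jc J i (Suc j) + jc v i (Suc j) * vxi V (point_of_jet J))"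
proof -
  have d: "dfun \<Omega> D UNIV ((Dt ^^ i) ((Dx ^^ j) (characteristic V)))"
    by (intro dfun_Dt_pow dfun_Dx_pow dfun_characteristic)
  have c: "dfun \<Omega> D UNIV (\<lambda>J. jc J (Suc i) j)" "dfun \<Omega> D UNIV (\<lambda>J. jc J i (Suc j))" by (auto intro: dfun.coord)
  show ?thesis
    unfolding prol_coeff_eq[abs_def]
    by (simp only: jd_add[OF dfun.add[OF d dfun.mult[OF dfun_components(1) c(1)]] dfun.mult[OF dfun_components(2) c(2)] J]
        jd_add[OF d dfun.mult[OF dfun_components(1) c(1)] J] jd_mult[OF dfun_components(1) c(1) J] jd_mult[OF dfun_components(2) c(2) J] jd_coord)
qed

text \<open>The recursion formula of prolongation theory, recovered from the closed formula with the
  characteristic because D_x commutes with D_t.\<close>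

lemma Dx_prol:
  assumes J: "J \<in> \<Omega>"
  shows "Dx (prol_coeff V i j) J = prol_coeff V i (Suc j) J
     + Dx (\<lambda>J. vtau V (point_of_jet J)) J * jc J (Suc i) j + Dx (\<lambda>J. vxi V (point_of_jet J)) J * jc J i (Suc j)"
  using Dx_Dt_pow[OF dfun_Dx_pow[OF dfun_characteristic] J, of i j] jd_prol[OF J, of i j "Xx J", folded Dx_jd]
  by (simp add: prol_coeff_eq algebra_simps)

lemma Dt_prol:
  assumes J: "J \<in> \<Omega>"
  shows "Dt (prol_coeff V i j) J = prol_coeff V (Suc i) j J
     + Dt (\<lambda>J. vtau V (point_of_jet J)) J * jc J (Suc i) j + Dt (\<lambda>J. vxi V (point_of_jet J)) J * jc J i (Suc j)"
  using jd_prol[OF J, of i j "Xt J", folded Dt_jd] by (simp add: prol_coeff_eq algebra_simps)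

lemma prol_00: "prol_coeff V 0 0 J = veta V (point_of_jet J)"
  by (simp add: prol_coeff_eq characteristic_eq)

lemma bracket_combination:
  assumes P: "dfun \<Omega> D UNIV P" and J: "J \<in> \<Omega>"
  shows "jd P J (a, b, \<lambda>i j. a * jc J (Suc i) j + b * jc J i (Suc j)) = a * Dt P J + b * Dx P J"
proof -
  have "(a, b, \<lambda>i j. a * jc J (Suc i) j + b * jc J i (Suc j)) = jmove (jmove (0, 0, \<lambda>i j. 0) (Xt J) a) (Xx J) b"
    by (simp add: jmove_def)
  then show ?thesis by (simp only: jd_linear[OF P J] jd_zero_direction Dx_jd Dt_jd add_0_left)
qed

text \<open>The recursion \<open>Dx_prol\<close> identifies the bracket of D_x with the prolonged
  field as (D_x \<tau>) D_t + (D_x \<xi>) D_x.\<close>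

lemma prolong_Dx:
  assumes P: "dfun \<Omega> D UNIV P" and J: "J \<in> \<Omega>"
  shows "jd (Dx P) J (pv V J) = Dx (\<lambda>J. jd P J (pv V J)) J
    - Dx (\<lambda>J. vtau V (point_of_jet J)) J * Dt P J - Dx (\<lambda>J. vxi V (point_of_jet J)) J * Dx P J"
proof -
  let ?a = "Dx (\<lambda>J. vtau V (point_of_jet J)) J" and ?b = "Dx (\<lambda>J. vxi V (point_of_jet J)) J"
  have "bracket Xx (pv V) J = (?a, ?b, \<lambda>i j. ?a * jc J (Suc i) j + ?b * jc J i (Suc j))"
    using Dx_prol[OF J] by (simp add: bracket_def jd_const jd_coord Dx_jd[symmetric])
  from commutator[OF P jfield_Xx jfield_pv J, unfolded this bracket_combination[OF P J]]
  show ?thesis by (simp add: Dx_fun)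
qed

lemma prolong_Dt:
  assumes P: "dfun \<Omega> D UNIV P" and J: "J \<in> \<Omega>"
  shows "jd (Dt P) J (pv V J) = Dt (\<lambda>J. jd P J (pv V J)) J
    - Dt (\<lambda>J. vtau V (point_of_jet J)) J * Dt P J - Dt (\<lambda>J. vxi V (point_of_jet J)) J * Dx P J"
proof -
  let ?a = "Dt (\<lambda>J. vtau V (point_of_jet J)) J" and ?b = "Dt (\<lambda>J. vxi V (point_of_jet J)) J"
  have "bracket Xt (pv V) J = (?a, ?b, \<lambda>i j. ?a * jc J (Suc i) j + ?b * jc J i (Suc j))"
    using Dt_prol[OF J] by (simp add: bracket_def jd_const jd_coord Dt_jd[symmetric])
  from commutator[OF P jfield_Xt jfield_pv J, unfolded this bracket_combination[OF P J]]
  show ?thesis by (simp add: Dt_fun)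
qed

end

section \<open>Prolonged changes of variables\<close>

locale jet_change = jets +
  fixes \<Phi> :: ptrans
  assumes smT: "smooth_on (\<lambda>p. deriv (pT \<Phi>) (fst p)) D" and smX: "smooth_on (pX \<Phi>) D" and smU: "smooth_on (pU \<Phi>) D"
    and nzT: "\<And>J. J \<in> \<Omega> \<Longrightarrow> deriv (pT \<Phi>) (fst J) \<noteq> 0"
    and nzX: "\<And>J. J \<in> \<Omega> \<Longrightarrow> Dx (pX \<Phi> \<circ> point_of_jet) J \<noteq> 0"
begin

definition XJ where "XJ = pX \<Phi> \<circ> point_of_jet"
definition UJ where "UJ = pU \<Phi> \<circ> point_of_jet"
definition TJ :: "jet \<Rightarrow> real" where "TJ J = deriv (pT \<Phi>) (fst J)"
text \<open>\<open>m k\<close> is the k-th derivative of the new unknown with respect to the new x,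
  as a function of the old jet; \<open>mt\<close> is its first derivative with respect to the new
  t.\<close>

definition m :: "nat \<Rightarrow> jet \<Rightarrow> real" where "m k = (Dx_new \<Phi> ^^ k) UJ"
definition mt :: "jet \<Rightarrow> real" where "mt = Dt_new \<Phi> UJ"

lemma dfun_X: "dfun \<Omega> D K XJ" and dfun_U: "dfun \<Omega> D K UJ" and dfun_T: "dfun \<Omega> D K TJ"
  using dfun.base[OF smX] dfun.base[OF smU] dfun.base[OF smT]
  by (auto simp: XJ_def[abs_def] UJ_def[abs_def] TJ_def[abs_def] o_def point_of_jet_eq)

lemma nzB: "J \<in> \<Omega> \<Longrightarrow> Dx XJ J \<noteq> 0"
  using nzX by (simp add: XJ_def)

lemma Dx_new_fun: "Dx_new \<Phi> P = (\<lambda>J. Dx P J / Dx XJ J)"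
  by (rule ext) (simp add: Dx_new_def XJ_def)

lemma Dt_new_fun: "Dt_new \<Phi> P = (\<lambda>J. (Dt P J - Dt XJ J * Dx_new \<Phi> P J) / TJ J)"
  by (rule ext) (simp add: Dt_new_def XJ_def TJ_def)

lemma dfun_B: "1 \<le> k \<Longrightarrow> dfun \<Omega> D (low k) (Dx XJ)"
  using dfun_mono[OF dfun_Dx_low[OF dfun_X[of "low 0"]] low_mono[of "Suc 0" k]] by simp

lemma dfun_Dx_new: "dfun \<Omega> D UNIV P \<Longrightarrow> dfun \<Omega> D UNIV (Dx_new \<Phi> P)"
  unfolding Dx_new_fun by (intro dfun_divide dfun_Dx dfun_X nzB)

lemma dfun_Dt_new: "dfun \<Omega> D UNIV P \<Longrightarrow> dfun \<Omega> D UNIV (Dt_new \<Phi> P)"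
  unfolding Dt_new_fun
  by (intro dfun_divide dfun_diff dfun.mult dfun_Dt dfun_X dfun_T dfun_Dx_new) (auto simp: TJ_def nzT)

lemma dfun_m: "dfun \<Omega> D (low k) (m k)"
proof (induction k)
  case 0
  then show ?case by (simp add: m_def dfun_U)
next
  case (Suc k)
  have "dfun \<Omega> D (low (Suc k)) (Dx_new \<Phi> (m k))"
    unfolding Dx_new_fun by (intro dfun_divide dfun_Dx_low Suc dfun_B nzB) auto
  then show ?case by (simp add: m_def)
qed

lemma dfun_m': "dfun \<Omega> D UNIV (m k)"
  by (rule dfun_mono[OF dfun_m]) simp

lemma dfun_mt: "dfun \<Omega> D UNIV mt"
  unfolding mt_def by (rule dfun_Dt_new[OF dfun_U])

lemma prolong_trans_eq: "prolong_trans \<Phi> J = (pT \<Phi> (fst J), XJ J, \<lambda>i j. (Dt_new \<Phi> ^^ i) (m j) J)"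
  by (simp add: prolong_trans_def XJ_def UJ_def m_def)

lemma jet3_prolong_trans: "jet3_of_jet (prolong_trans \<Phi> J) = (pT \<Phi> (fst J), XJ J, m 0 J, m 1 J, m 2 J, m 3 J)"
  by (simp add: prolong_trans_eq)

lemma eq_fun_prolong_trans: "eq_fun E (prolong_trans \<Phi> J) =
   mt J - eF E (pT \<Phi> (fst J), XJ J, m 0 J, m 1 J, m 2 J, m 3 J) * m 4 J
    - eG E (pT \<Phi> (fst J), XJ J, m 0 J, m 1 J, m 2 J, m 3 J)"
  unfolding prolong_trans_eq by (simp add: mt_def m_def)

definition J_det :: "jet \<Rightarrow> real" where
  "J_det J = pderiv_x (pX \<Phi>) (point_of_jet J) * pderiv_u (pU \<Phi>) (point_of_jet J)
     - pderiv_u (pX \<Phi>) (point_of_jet J) * pderiv_x (pU \<Phi>) (point_of_jet J)"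

lemma Dx_X: "J \<in> \<Omega> \<Longrightarrow> Dx XJ J = pderiv_x (pX \<Phi>) (point_of_jet J) + jc J 0 1 * pderiv_u (pX \<Phi>) (point_of_jet J)"
  and Dx_U: "J \<in> \<Omega> \<Longrightarrow> Dx UJ J = pderiv_x (pU \<Phi>) (point_of_jet J) + jc J 0 1 * pderiv_u (pU \<Phi>) (point_of_jet J)"
  unfolding Dx_jd XJ_def UJ_def o_def jd_base_split[OF smX] jd_base_split[OF smU] by (simp_all add: pderiv_x_def pderiv_u_def)

text \<open>For the first derivative the quotient rule produces the Jacobian over (D_x X)^2. Each
  further differentiation moves the highest coordinate up by one (\<open>jd_unit_Dx_top\<close>) and
  divides by D_x X once more.\<close>

lemma m_unit:
  assumes J: "J \<in> \<Omega>"
  shows "jd (m (Suc k)) J (unit (Suc k)) = J_det J / Dx XJ J ^ (k + 2)"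
proof (induction k)
  case 0
  have U: "jd UJ J (unit 0) = pderiv_u (pU \<Phi>) (point_of_jet J)"
    unfolding UJ_def o_def jd_base_split[OF smU J] by (simp add: pderiv_u_def)
  have X: "jd XJ J (unit 0) = pderiv_u (pX \<Phi>) (point_of_jet J)"
    unfolding XJ_def o_def jd_base_split[OF smX J] by (simp add: pderiv_u_def)
  have "jd (m (Suc 0)) J (unit (Suc 0)) = (jd (Dx UJ) J (unit (Suc 0)) * Dx XJ J - Dx UJ J * jd (Dx XJ) J (unit (Suc 0))) / (Dx XJ J)\<^sup>2"
    unfolding m_def by (simp add: Dx_new_fun jd_divide[OF dfun_Dx[OF dfun_U] dfun_Dx[OF dfun_X] nzB J])
  also have "\<dots> = (pderiv_u (pU \<Phi>) (point_of_jet J) * Dx XJ J - Dx UJ J * pderiv_u (pX \<Phi>) (point_of_jet J)) / (Dx XJ J)\<^sup>2"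
    by (simp only: jd_unit_Dx_top[OF dfun_U J] jd_unit_Dx_top[OF dfun_X J] U X)
  also have "\<dots> = J_det J / (Dx XJ J)\<^sup>2"
    unfolding Dx_X[OF J] Dx_U[OF J] J_det_def by (simp add: algebra_simps)
  finally show ?case by (simp add: power2_eq_square)
next
  case (Suc k)
  have "jd (m (Suc (Suc k))) J (unit (Suc (Suc k))) =
      (jd (Dx (m (Suc k))) J (unit (Suc (Suc k))) * Dx XJ J - Dx (m (Suc k)) J * jd (Dx XJ) J (unit (Suc (Suc k)))) / (Dx XJ J)\<^sup>2"
    unfolding m_def by (simp add: Dx_new_fun[of "(Dx_new \<Phi> ^^ Suc k) UJ"]
        jd_divide[OF dfun_Dx[OF dfun_m'[of "Suc k", unfolded m_def]] dfun_Dx[OF dfun_X] nzB J] del: funpow.simps add: funpow.simps(2)[of "Suc k"])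
  also have "\<dots> = jd (m (Suc k)) J (unit (Suc k)) / Dx XJ J"
    using nzB[OF J] by (simp add: jd_unit_Dx_top[OF dfun_m J] jd_unit_low[OF dfun_B[OF order_refl] J] power2_eq_square)
  finally show ?case using Suc nzB[OF J] by (simp add: field_simps)
qed

text \<open>The coefficient of u_t is (U_u - X_u m_1) / T', and m_1 = D_x U / D_x X turns its
  numerator into the Jacobian over D_x X.\<close>

lemma mt_eq:
  assumes J: "J \<in> \<Omega>"
  shows "mt J = (frechet_derivative (pU \<Phi>) (at (point_of_jet J)) (1, 0, 0) - frechet_derivative (pX \<Phi>) (at (point_of_jet J)) (1, 0, 0) * m 1 J) / TJ J
     + J_det J / (TJ J * Dx XJ J) * jc J 1 0"
proof -
  have U: "Dt UJ J = frechet_derivative (pU \<Phi>) (at (point_of_jet J)) (1, 0, 0) + jc J 1 0 * pderiv_u (pU \<Phi>) (point_of_jet J)"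
    unfolding Dt_jd UJ_def o_def jd_base_split[OF smU J] by (simp add: pderiv_u_def)
  have X: "Dt XJ J = frechet_derivative (pX \<Phi>) (at (point_of_jet J)) (1, 0, 0) + jc J 1 0 * pderiv_u (pX \<Phi>) (point_of_jet J)"
    unfolding Dt_jd XJ_def o_def jd_base_split[OF smX J] by (simp add: pderiv_u_def)
  have T: "TJ J \<noteq> 0" using nzT[OF J] by (simp add: TJ_def)
  have m1: "m 1 J = Dx UJ J / Dx XJ J" by (simp add: m_def Dx_new_fun)
  have "J_det J = pderiv_u (pU \<Phi>) (point_of_jet J) * Dx XJ J - pderiv_u (pX \<Phi>) (point_of_jet J) * Dx UJ J"
    unfolding Dx_X[OF J] Dx_U[OF J] J_det_def by (simp add: algebra_simps)
  then have "J_det J / Dx XJ J = pderiv_u (pU \<Phi>) (point_of_jet J) - pderiv_u (pX \<Phi>) (point_of_jet J) * m 1 J"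
    unfolding m1 using nzB[OF J] by (simp add: diff_divide_distrib)
  then have "J_det J / (TJ J * Dx XJ J) * jc J 1 0 = (pderiv_u (pU \<Phi>) (point_of_jet J) - pderiv_u (pX \<Phi>) (point_of_jet J) * m 1 J) * jc J 1 0 / TJ J"
    by (metis (no_types, opaque_lifting) divide_divide_eq_left mult.commute times_divide_eq_left)
  moreover have "mt J = (Dt UJ J - Dt XJ J * m 1 J) / TJ J"
    unfolding mt_def by (simp add: Dt_new_fun m_def)
  ultimately show ?thesis unfolding U X by (simp add: add_divide_distrib[symmetric] algebra_simps)
qed

end

text \<open>The invariance hypotheses say that \<open>V\<close> is sent to a constant multiple of \<open>\<partial>\<^sub>t\<close> or \<open>\<partial>\<^sub>x\<close>.\<close>

locale jet_straight = jets_vf + jet_change +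
  fixes cX :: real
  assumes VX: "\<And>J. J \<in> \<Omega> \<Longrightarrow> jd XJ J (pv V J) = cX"
    and VU: "\<And>J. J \<in> \<Omega> \<Longrightarrow> jd UJ J (pv V J) = 0"
    and tau_x: "\<And>J. J \<in> \<Omega> \<Longrightarrow> Dx (\<lambda>J. vtau V (point_of_jet J)) J = 0"
    and VT: "\<And>J. J \<in> \<Omega> \<Longrightarrow> jd TJ J (pv V J) = vtau V (point_of_jet J) * Dt TJ J"
    and tau_t: "\<And>J. J \<in> \<Omega> \<Longrightarrow> Dt (\<lambda>J. vtau V (point_of_jet J)) J * TJ J + vtau V (point_of_jet J) * Dt TJ J = 0"
begin

lemma prolong_Dx_const:
  assumes P: "dfun \<Omega> D UNIV P" and J: "J \<in> \<Omega>" and c: "\<And>J. J \<in> \<Omega> \<Longrightarrow> jd P J (pv V J) = c"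
  shows "jd (Dx P) J (pv V J) = - Dx (\<lambda>J. vxi V (point_of_jet J)) J * Dx P J"
    and "jd (Dt P) J (pv V J) = - Dt (\<lambda>J. vtau V (point_of_jet J)) J * Dt P J - Dt (\<lambda>J. vxi V (point_of_jet J)) J * Dx P J"
  using jd_eq_0[OF J c, where v = "Xx J"] jd_eq_0[OF J c, where v = "Xt J"] prolong_Dx[OF P J] prolong_Dt[OF P J] tau_x[OF J]
  by (simp_all add: Dx_jd Dt_jd)

text \<open>The prolonged field multiplies D_x P and D_x X by the same factor -D_x \<xi>, so their
  quotient is invariant.\<close>

lemma Dx_new_invariant:
  assumes P: "dfun \<Omega> D UNIV P" and c: "\<And>J. J \<in> \<Omega> \<Longrightarrow> jd P J (pv V J) = c" and J: "J \<in> \<Omega>"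
  shows "jd (Dx_new \<Phi> P) J (pv V J) = 0"
proof -
  have "jd (Dx_new \<Phi> P) J (pv V J) = (jd (Dx P) J (pv V J) * Dx XJ J - Dx P J * jd (Dx XJ) J (pv V J)) / (Dx XJ J)\<^sup>2"
    unfolding Dx_new_fun by (rule jd_divide[OF dfun_Dx[OF P] dfun_Dx[OF dfun_X] nzB J])
  also have "\<dots> = 0"
    by (simp add: prolong_Dx_const(1)[OF P J c] prolong_Dx_const(1)[OF dfun_X J VX])
  finally show ?thesis .
qed

lemma m_invariant: "J \<in> \<Omega> \<Longrightarrow> jd (m k) J (pv V J) = 0"
proof (induction k arbitrary: J)
  case 0
  then show ?case using VU by (simp add: m_def)
next
  case (Suc k)
  then show ?case using Dx_new_invariant[OF dfun_m' Suc.IH, of J] by (simp add: m_def)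
qed

text \<open>The \<xi> terms cancel because D_x U = m_1 D_x X. What is left of the numerator is
  scaled by -D_t \<tau>, and dividing by T' compensates this through \<open>VT\<close> and
  \<open>tau_t\<close>.\<close>

lemma mt_invariant:
  assumes J: "J \<in> \<Omega>" shows "jd mt J (pv V J) = 0"
proof -
  let ?\<tau> = "Dt (\<lambda>J. vtau V (point_of_jet J)) J" and ?\<xi> = "Dt (\<lambda>J. vxi V (point_of_jet J)) J" and ?N = "\<lambda>J. Dt UJ J - Dt XJ J * m 1 J"
  have m1: "m 1 = Dx_new \<Phi> UJ" by (simp add: m_def)
  have dX: "dfun \<Omega> D UNIV (Dt XJ)" and dU: "dfun \<Omega> D UNIV (Dt UJ)" by (intro dfun_Dt dfun_X dfun_U)+
  have N: "dfun \<Omega> D UNIV ?N" by (intro dfun_diff dfun.mult dX dU dfun_m')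
  have T: "TJ J \<noteq> 0" if "J \<in> \<Omega>" for J using nzT[OF that] by (simp add: TJ_def)
  have B: "Dx XJ J * m 1 J = Dx UJ J" unfolding m1 Dx_new_fun using nzB[OF J] by simp
  have "jd ?N J (pv V J) = jd (Dt UJ) J (pv V J) - (jd (Dt XJ) J (pv V J) * m 1 J + jd (m 1) J (pv V J) * Dt XJ J)"
    by (simp only: jd_diff[OF dU dfun.mult[OF dX dfun_m'] J] jd_mult[OF dX dfun_m' J])
  also have "\<dots> = - ?\<tau> * ?N J - ?\<xi> * (Dx UJ J - Dx XJ J * m 1 J)"
    by (simp add: prolong_Dx_const(2)[OF dfun_U J VU] prolong_Dx_const(2)[OF dfun_X J VX] m_invariant[OF J] algebra_simps)
  finally have "jd ?N J (pv V J) = - ?\<tau> * ?N J" using B by simp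
  moreover have "mt = (\<lambda>J. ?N J / TJ J)" unfolding mt_def Dt_new_fun m1 ..
  ultimately have "jd mt J (pv V J) = (- ?\<tau> * ?N J * TJ J - ?N J * (vtau V (point_of_jet J) * Dt TJ J)) / (TJ J)\<^sup>2"
    by (simp only: jd_divide[OF N dfun_T T J] VT[OF J])
  also have "\<dots> = - ?N J * (?\<tau> * TJ J + vtau V (point_of_jet J) * Dt TJ J) / (TJ J)\<^sup>2" by (simp add: algebra_simps)
  finally show ?thesis using tau_t[OF J] by simp
qed

end

section \<open>Transformed equations\<close>

lemma smooth_eqD:
  assumes "evolution_equation E"
  shows "open (edom E)" "smooth_on (eF E) (edom E)" "smooth_on (eG E) (edom E)" "\<And>z. z \<in> edom E \<Longrightarrow> eF E z \<noteq> 0"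
  using assms by (auto simp: evolution_equation_def)

lemma eq_fun_eq: "eq_fun E J = jc J 1 0 - eF E (jet3_of_jet J) * jc J 0 4 - eG E (jet3_of_jet J)"
  by (cases J) simp

lemma has_jd_uminus: "has_jd P J v d \<Longrightarrow> has_jd (\<lambda>J. - P J) J v (- d)"
  unfolding has_jd_def by (rule DERIV_minus)

lemma has_jd_diff: "has_jd P J v d \<Longrightarrow> has_jd Q J v e \<Longrightarrow> has_jd (\<lambda>J. P J - Q J) J v (d - e)"
  unfolding has_jd_def by (rule DERIV_diff)

definition tangent3 :: "jet \<Rightarrow> jet3" where
  "tangent3 v = (fst v, fst (snd v), jc v 0 0, jc v 0 1, jc v 0 2, jc v 0 3)"

lemma has_jd_eq_fun:
  assumes E: "evolution_equation E" and J: "jet3_of_jet J \<in> edom E"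
  shows "has_jd (eq_fun E) J v (jc v 1 0 - (frechet_derivative (eF E) (at (jet3_of_jet J)) (tangent3 v) * jc J 0 4 + jc v 0 4 * eF E (jet3_of_jet J))
      - frechet_derivative (eG E) (at (jet3_of_jet J)) (tangent3 v))"
proof -
  have F: "has_jd (\<lambda>J. eF E (jet3_of_jet J)) J v (frechet_derivative (eF E) (at (jet3_of_jet J)) (tangent3 v))"
    by (rule has_jd_frechet[where f = "eF E" and h = jet3_of_jet, OF smooth_on_has_derivative[OF smooth_eqD(2)[OF E] J]])
       (simp only: jet3_jmove tangent3_def)
  have G: "has_jd (\<lambda>J. eG E (jet3_of_jet J)) J v (frechet_derivative (eG E) (at (jet3_of_jet J)) (tangent3 v))"
    by (rule has_jd_frechet[where f = "eG E" and h = jet3_of_jet, OF smooth_on_has_derivative[OF smooth_eqD(3)[OF E] J]])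
       (simp only: jet3_jmove tangent3_def)
  show ?thesis
    unfolding eq_fun_eq[abs_def]
    by (intro has_jd_diff has_jd_mult[OF F] has_jd_coord G)
qed

lemma prolong_eq_fun:
  assumes "evolution_equation E" "jet3_of_jet J \<in> edom E"
  shows "prolong V (eq_fun E) J = prol_coeff V 1 0 J
     - (frechet_derivative (eF E) (at (jet3_of_jet J)) (tangent3 (pv V J)) * jc J 0 4 + prol_coeff V 0 4 J * eF E (jet3_of_jet J))
     - frechet_derivative (eG E) (at (jet3_of_jet J)) (tangent3 (pv V J))"
  unfolding prolong_jd using has_jd_imp[OF has_jd_eq_fun[OF assms, of "pv V J"]] by simp

section \<open>Functions independent of one variable, and the two families\<close>

lemma derivative_zero_direction:
  fixes f :: "'a::real_normed_vector \<Rightarrow> real"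
  assumes S: "open S" "z \<in> S" and f: "smooth_on f S" and c: "\<And>s. z + s *\<^sub>R e \<in> S \<Longrightarrow> f (z + s *\<^sub>R e) = f z"
  shows "frechet_derivative f (at z) e = 0"
proof -
  have "norm (frechet_derivative f (at z) e) \<le> 0"
    by (rule derivative_le_lipschitz[OF smooth_on_has_derivative[OF f S(2)] S]) (use c in auto)
  then show ?thesis by simp
qed

lemma constant_along_direction:
  fixes f :: "'a::real_normed_vector \<Rightarrow> real"
  assumes S: "open S" "convex S" and f: "smooth_on f S" and e: "\<And>z. z \<in> S \<Longrightarrow> frechet_derivative f (at z) e = 0"
    and z: "z \<in> S" "z + s *\<^sub>R e \<in> S"
  shows "f (z + s *\<^sub>R e) = f z"
proof -
  have "norm (f (z + s *\<^sub>R e) - f (z + 0 *\<^sub>R e)) \<le> 0 * \<bar>s - 0\<bar>"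
  proof (rule vector_derivative_bound[of "{s. z + s *\<^sub>R e \<in> S}" "\<lambda>s. f (z + s *\<^sub>R e)" "\<lambda>s. 0"])
    show "convex {s. z + s *\<^sub>R e \<in> S}"
    proof (rule convexI)
      fix a b u w :: real assume *: "a \<in> {s. z + s *\<^sub>R e \<in> S}" "b \<in> {s. z + s *\<^sub>R e \<in> S}" "0 \<le> u" "0 \<le> w" "u + w = 1"
      then have "u *\<^sub>R (z + a *\<^sub>R e) + w *\<^sub>R (z + b *\<^sub>R e) \<in> S" by (intro convexD[OF S(2)]) auto
      moreover have "u *\<^sub>R (z + a *\<^sub>R e) + w *\<^sub>R (z + b *\<^sub>R e) = (u + w) *\<^sub>R z + (u * a + w * b) *\<^sub>R e"
        by (simp add: algebra_simps)
      ultimately show "u *\<^sub>R a + w *\<^sub>R b \<in> {s. z + s *\<^sub>R e \<in> S}" using * by simp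
    qed
    fix r assume "r \<in> {s. z + s *\<^sub>R e \<in> S}"
    then have r: "z + r *\<^sub>R e \<in> S" by simp
    have "((\<lambda>s. z + s *\<^sub>R e) has_derivative (\<lambda>h. h *\<^sub>R e)) (at r)" by (auto intro!: derivative_eq_intros)
    from has_derivative_compose[OF this smooth_on_has_derivative[OF f r]]
    have "((\<lambda>s. f (z + s *\<^sub>R e)) has_derivative (\<lambda>h. 0)) (at r)"
      using e[OF r] linear_cmul[OF has_derivative_linear[OF smooth_on_has_derivative[OF f r]]] by simp
    then show "((\<lambda>s. f (z + s *\<^sub>R e)) has_vector_derivative 0) (at r within {s. z + s *\<^sub>R e \<in> S})"
      by (simp add: has_vector_derivative_def has_derivative_at_withinI)
  qed (use z in auto)
  then show ?thesis by simp
qed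

text \<open>Convexity makes each line in the direction of t meet the domain in an interval, on which
  a vanishing derivative means constancy. The value at one chosen t then defines a function of the
  other variables.\<close>

lemma family_tI:
  assumes E: "evolution_equation E" and c: "convex (edom E)"
    and d: "\<And>z. z \<in> edom E \<Longrightarrow> frechet_derivative (eF E) (at z) (1, 0, 0, 0, 0, 0) = 0"
      "\<And>z. z \<in> edom E \<Longrightarrow> frechet_derivative (eG E) (at z) (1, 0, 0, 0, 0, 0) = 0"
  shows "family_t E"
proof -
  have *: "f (t, q) = f (SOME t. (t, q) \<in> edom E, q)" if f: "smooth_on f (edom E)"
    "\<And>z. z \<in> edom E \<Longrightarrow> frechet_derivative f (at z) (1, 0, 0, 0, 0, 0) = 0" and t: "(t, q) \<in> edom E" for f :: "jet3 \<Rightarrow> real" and t q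
  proof -
    let ?t = "SOME t. (t, q) \<in> edom E"
    have t': "(?t, q) \<in> edom E" using t by (rule someI)
    have eq: "(?t, q) = (t, q) + (?t - t) *\<^sub>R (1, 0, 0, 0, 0, 0)"
      by (cases q) simp
    show ?thesis
      using constant_along_direction[OF smooth_eqD(1)[OF E] c f(1) f(2) t, of "?t - t"] t' eq by metis
  qed
  show ?thesis unfolding family_t_def
    using E *[OF smooth_eqD(2)[OF E] d(1)] *[OF smooth_eqD(3)[OF E] d(2)]
    by (intro conjI exI[of _ "\<lambda>q. eF E (SOME t. (t, q) \<in> edom E, q)"] exI[of _ "\<lambda>q. eG E (SOME t. (t, q) \<in> edom E, q)"]) auto
qed

lemma family_xI:
  assumes E: "evolution_equation E" and c: "convex (edom E)"
    and d: "\<And>z. z \<in> edom E \<Longrightarrow> frechet_derivative (eF E) (at z) (0, 1, 0, 0, 0, 0) = 0"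
      "\<And>z. z \<in> edom E \<Longrightarrow> frechet_derivative (eG E) (at z) (0, 1, 0, 0, 0, 0) = 0"
  shows "family_x E"
proof -
  have *: "f (t, x, q) = f (t, SOME x. (t, x, q) \<in> edom E, q)" if f: "smooth_on f (edom E)"
    "\<And>z. z \<in> edom E \<Longrightarrow> frechet_derivative f (at z) (0, 1, 0, 0, 0, 0) = 0" and t: "(t, x, q) \<in> edom E" for f :: "jet3 \<Rightarrow> real" and t x q
  proof -
    let ?x = "SOME x. (t, x, q) \<in> edom E"
    have t': "(t, ?x, q) \<in> edom E" using t by (rule someI)
    have eq: "(t, ?x, q) = (t, x, q) + (?x - x) *\<^sub>R (0, 1, 0, 0, 0, 0)"
      by (cases q) simp
    show ?thesis
      using constant_along_direction[OF smooth_eqD(1)[OF E] c f(1) f(2) t, of "?x - x"] t' eq by metis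
  qed
  show ?thesis unfolding family_x_def
    using E *[OF smooth_eqD(2)[OF E] d(1)] *[OF smooth_eqD(3)[OF E] d(2)]
    by (intro conjI exI[of _ "\<lambda>(t, q). eF E (t, SOME x. (t, x, q) \<in> edom E, q)"] exI[of _ "\<lambda>(t, q). eG E (t, SOME x. (t, x, q) \<in> edom E, q)"]) auto
qed

lemma family_t_direction:
  assumes "family_t E" "z \<in> edom E"
  shows "frechet_derivative (eF E) (at z) (1, 0, 0, 0, 0, 0) = 0" "frechet_derivative (eG E) (at z) (1, 0, 0, 0, 0, 0) = 0"
proof -
  have E: "evolution_equation E" using assms(1) by (simp add: family_t_def)
  obtain F G where FG: "\<And>t x u u1 u2 u3. (t, x, u, u1, u2, u3) \<in> edom E \<Longrightarrow>
     eF E (t, x, u, u1, u2, u3) = F (x, u, u1, u2, u3) \<and> eG E (t, x, u, u1, u2, u3) = G (x, u, u1, u2, u3)"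
    using assms(1) unfolding family_t_def by blast
  obtain t x u u1 u2 u3 where z: "z = (t, x, u, u1, u2, u3)" by (metis surj_pair)
  show "frechet_derivative (eF E) (at z) (1, 0, 0, 0, 0, 0) = 0"
    by (rule derivative_zero_direction[OF smooth_eqD(1)[OF E] assms(2) smooth_eqD(2)[OF E]]) (use assms(2) FG z in simp)
  show "frechet_derivative (eG E) (at z) (1, 0, 0, 0, 0, 0) = 0"
    by (rule derivative_zero_direction[OF smooth_eqD(1)[OF E] assms(2) smooth_eqD(3)[OF E]]) (use assms(2) FG z in simp)
qed

lemma family_x_direction:
  assumes "family_x E" "z \<in> edom E"
  shows "frechet_derivative (eF E) (at z) (0, 1, 0, 0, 0, 0) = 0" "frechet_derivative (eG E) (at z) (0, 1, 0, 0, 0, 0) = 0"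
proof -
  have E: "evolution_equation E" using assms(1) by (simp add: family_x_def)
  obtain F G where FG: "\<And>t x u u1 u2 u3. (t, x, u, u1, u2, u3) \<in> edom E \<Longrightarrow>
     eF E (t, x, u, u1, u2, u3) = F (t, u, u1, u2, u3) \<and> eG E (t, x, u, u1, u2, u3) = G (t, u, u1, u2, u3)"
    using assms(1) unfolding family_x_def by blast
  obtain t x u u1 u2 u3 where z: "z = (t, x, u, u1, u2, u3)" by (metis surj_pair)
  show "frechet_derivative (eF E) (at z) (0, 1, 0, 0, 0, 0) = 0"
    by (rule derivative_zero_direction[OF smooth_eqD(1)[OF E] assms(2) smooth_eqD(2)[OF E]]) (use assms(2) FG z in simp)
  show "frechet_derivative (eG E) (at z) (0, 1, 0, 0, 0, 0) = 0"
    by (rule derivative_zero_direction[OF smooth_eqD(1)[OF E] assms(2) smooth_eqD(3)[OF E]]) (use assms(2) FG z in simp)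
qed

text \<open>The characteristic is -u_t or -u_x, and its total derivatives cancel the transport terms
  of \<open>prol_coeff\<close>.\<close>

lemma prol_coeff_translation:
  "prol_coeff vf_t i j J = 0" "prol_coeff vf_x i j J = 0"
proof -
  have jdc: "jd (\<lambda>J. - jc J a b) J v = - jc v a b" for a b J v
    by (rule has_jd_imp[OF has_jd_uminus[OF has_jd_coord]])
  have x: "(Dx ^^ j) (\<lambda>J. - jc J a b) = (\<lambda>J. - jc J a (b + j))" for a b j
    by (induction j) (simp_all add: Dx_fun jdc)
  have t: "(Dt ^^ i) (\<lambda>J. - jc J a b) = (\<lambda>J. - jc J (a + i) b)" for a b i
    by (induction i) (simp_all add: Dt_fun jdc)
  have "characteristic vf_t = (\<lambda>J. - jc J 1 0)" "characteristic vf_x = (\<lambda>J. - jc J 0 1)"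
    by (auto simp: characteristic_eq vf_t_def vf_x_def)
  then show "prol_coeff vf_t i j J = 0" "prol_coeff vf_x i j J = 0"
    unfolding prol_coeff_eq by (simp_all only: x t) (simp_all add: vf_t_def vf_x_def)
qed

lemma family_t_admits: "family_t E \<Longrightarrow> admits E vf_t"
proof -
  assume E: "family_t E"
  have e: "evolution_equation E" using E by (simp add: family_t_def)
  have t: "tangent3 (pv vf_t J) = (1, 0, 0, 0, 0, 0)" for J
    by (simp add: tangent3_def prol_coeff_translation) (simp add: vf_t_def)
  show ?thesis
    unfolding admits_def
  proof (intro conjI allI impI)
    show "smooth_on vf_t (base E)" by (simp add: vf_t_def)
    fix J assume "jet3_of_jet J \<in> edom E \<and> eq_fun E J = 0"
    then have J: "jet3_of_jet J \<in> edom E" ..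
    show "prolong vf_t (eq_fun E) J = 0"
      unfolding prolong_eq_fun[OF e J] t family_t_direction[OF E J] prol_coeff_translation by simp
  qed
qed

lemma family_x_admits: "family_x E \<Longrightarrow> admits E vf_x"
proof -
  assume E: "family_x E"
  have e: "evolution_equation E" using E by (simp add: family_x_def)
  have t: "tangent3 (pv vf_x J) = (0, 1, 0, 0, 0, 0)" for J
    by (simp add: tangent3_def prol_coeff_translation) (simp add: vf_x_def)
  show ?thesis
    unfolding admits_def
  proof (intro conjI allI impI)
    show "smooth_on vf_x (base E)" by (simp add: vf_x_def)
    fix J assume "jet3_of_jet J \<in> edom E \<and> eq_fun E J = 0"
    then have J: "jet3_of_jet J \<in> edom E" ..
    show "prolong vf_x (eq_fun E) J = 0"
      unfolding prolong_eq_fun[OF e J] t family_x_direction[OF E J] prol_coeff_translation by simp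
  qed
qed

section \<open>Jets over an open set, and point transformations that straighten a field\<close>

definition jets_over :: "jet3 set \<Rightarrow> jet set" where "jets_over N = {J. jet3_of_jet J \<in> N}"

lemma point_of_jet3_jet3: "point_of_jet3 (jet3_of_jet J) = point_of_jet J"
  by (cases J) simp

lemma jets_over:
  assumes "open N" "open D" "point_of_jet3 ` N \<subseteq> D"
  shows "jets (jets_over N) D"
proof
  show "point_of_jet J \<in> D" if "J \<in> jets_over N" for J
    using that assms(3) unfolding jets_over_def by (metis (mono_tags, lifting) image_subset_iff mem_Collect_eq point_of_jet3_jet3)
  show "\<forall>\<^sub>F s in nhds 0. jmove J v s \<in> jets_over N" if "J \<in> jets_over N" for J v
  proof -
    have "((\<lambda>s. jet3_of_jet J + s *\<^sub>R tangent3 v) \<longlongrightarrow> jet3_of_jet J + 0 *\<^sub>R tangent3 v) (nhds (0::real))"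
      by (intro tendsto_intros filterlim_ident)
    then have "\<forall>\<^sub>F s in nhds (0::real). jet3_of_jet J + s *\<^sub>R tangent3 v \<in> N"
      using topological_tendstoD[of _ _ _ N] assms(1) that by (simp add: jets_over_def)
    then show ?thesis by (simp add: jets_over_def jet3_jmove tangent3_def)
  qed
qed (rule assms(2))

lemma point_transformation_T:
  assumes "point_transformation \<Phi> D" "p \<in> D"
  shows "((\<lambda>p. pT \<Phi> (fst p)) has_derivative (\<lambda>v. deriv (pT \<Phi>) (fst p) * fst v)) (at p)"
    and "smooth_on (\<lambda>p. deriv (pT \<Phi>) (fst p)) D" and "smooth_on (\<lambda>p. pT \<Phi> (fst p)) D"
proof -
  have D: "open D" "smooth_on (pT \<Phi>) (fst ` D)" using assms(1) by (auto simp: point_transformation_def)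
  have D1: "open (fst ` D)" using D(1) by (rule open_image_fst)
  have d: "(pT \<Phi> has_derivative frechet_derivative (pT \<Phi>) (at t)) (at t)" if "t \<in> fst ` D" for t
    using smooth_on_has_derivative[OF D(2) that] .
  have e: "frechet_derivative (pT \<Phi>) (at t) = (\<lambda>h. deriv (pT \<Phi>) t * h)" if "t \<in> fst ` D" for t
  proof -
    have l: "frechet_derivative (pT \<Phi>) (at t) h = frechet_derivative (pT \<Phi>) (at t) 1 * h" for h
      using linear_cmul[OF has_derivative_linear[OF d[OF that]], of h 1] by simp
    then have "frechet_derivative (pT \<Phi>) (at t) = (*) (frechet_derivative (pT \<Phi>) (at t) 1)" by (rule ext)
    then have "(pT \<Phi> has_real_derivative frechet_derivative (pT \<Phi>) (at t) 1) (at t)"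
      using d[OF that] unfolding has_field_derivative_def by simp
    then have "deriv (pT \<Phi>) t = frechet_derivative (pT \<Phi>) (at t) 1" by (rule DERIV_imp_deriv)
    then show ?thesis by (metis l ext)
  qed
  have p: "fst p \<in> fst ` D" using assms(2) by blast
  have f: "(fst has_derivative fst) (at p)" by (auto intro!: derivative_eq_intros)
  show "((\<lambda>p. pT \<Phi> (fst p)) has_derivative (\<lambda>v. deriv (pT \<Phi>) (fst p) * fst v)) (at p)"
    using has_derivative_compose[OF f d[OF p, unfolded e[OF p]]] .
  have dT: "smooth_on (deriv (pT \<Phi>)) (fst ` D)"
    by (rule smooth_on_cong[OF D1 _ smooth_on_frechet[OF D(2), of 1]]) (simp add: e)
  show "smooth_on (\<lambda>p. deriv (pT \<Phi>) (fst p)) D"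
    by (rule smooth_on_compose[OF D(1) D1 order_refl smooth_on_bounded_linear[OF bounded_linear_fst] dT])
  show "smooth_on (\<lambda>p. pT \<Phi> (fst p)) D"
    by (rule smooth_on_compose[OF D(1) D1 order_refl smooth_on_bounded_linear[OF bounded_linear_fst] D(2)])
qed

lemma pmap_has_derivative:
  assumes "point_transformation \<Phi> D" "p \<in> D"
  shows "(pmap \<Phi> has_derivative (\<lambda>v. (deriv (pT \<Phi>) (fst p) * fst v, frechet_derivative (pX \<Phi>) (at p) v, frechet_derivative (pU \<Phi>) (at p) v))) (at p)"
proof -
  have s: "smooth_on (pX \<Phi>) D" "smooth_on (pU \<Phi>) D" using assms(1) by (auto simp: point_transformation_def)
  show ?thesis
    unfolding pmap_def[abs_def]
    by (intro has_derivative_Pair point_transformation_T(1)[OF assms] smooth_on_has_derivative[OF s(1) assms(2)] smooth_on_has_derivative[OF s(2) assms(2)])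
qed

lemma pmap_frechet:
  assumes "point_transformation \<Phi> D" "p \<in> D"
  shows "frechet_derivative (pmap \<Phi>) (at p) v = (deriv (pT \<Phi>) (fst p) * fst v, frechet_derivative (pX \<Phi>) (at p) v, frechet_derivative (pU \<Phi>) (at p) v)"
  by (simp only: frechet_derivative_at[OF pmap_has_derivative[OF assms], symmetric])

text \<open>The t-component of a pushed-forward field is T' \<tau>, so the vanishing of \<tau> is
  preserved by every point transformation.\<close>

lemma not_equivalent_translations: "\<not> equivalent_algebras vf_t vf_x" "\<not> equivalent_algebras vf_x vf_t"
proof -
  have ne: "\<exists>p. p \<in> D" if "point_transformation \<Phi> D" for \<Phi> D using that by (auto simp: point_transformation_def)
  show "\<not> equivalent_algebras vf_t vf_x"
  proof
    assume "equivalent_algebras vf_t vf_x"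
    then obtain \<Phi> D c where *: "point_transformation \<Phi> D" "pushes_forward \<Phi> D vf_t (\<lambda>p. c *\<^sub>R vf_x p)"
      unfolding equivalent_algebras_def by blast
    obtain p where p: "p \<in> D" using ne[OF *(1)] by blast
    have "deriv (pT \<Phi>) (fst p) = 0"
      using *(2) p pmap_frechet[OF *(1) p, of "vf_t p"] by (simp add: pushes_forward_def vf_t_def vf_x_def)
    then show False using *(1) p by (simp add: point_transformation_def)
  qed
  show "\<not> equivalent_algebras vf_x vf_t"
  proof
    assume "equivalent_algebras vf_x vf_t"
    then obtain \<Phi> D c where *: "point_transformation \<Phi> D" "c \<noteq> 0" "pushes_forward \<Phi> D vf_x (\<lambda>p. c *\<^sub>R vf_t p)"
      unfolding equivalent_algebras_def by blast
    obtain p where p: "p \<in> D" using ne[OF *(1)] by blast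
    show False
      using *(2,3) p pmap_frechet[OF *(1) p, of "vf_x p"] by (simp add: pushes_forward_def vf_t_def vf_x_def)
  qed
qed

lemma jet_changeI:
  assumes \<Phi>: "point_transformation \<Phi> D" and N: "open N" "point_of_jet3 ` N \<subseteq> D"
    and B: "\<And>J. J \<in> jets_over N \<Longrightarrow> Dx (pX \<Phi> \<circ> point_of_jet) J \<noteq> 0"
  shows "jet_change (jets_over N) D \<Phi>"
proof -
  have D: "open D" "D \<noteq> {}" using \<Phi> by (auto simp: point_transformation_def)
  obtain p where "p \<in> D" using D(2) by blast
  interpret jets "jets_over N" D by (rule jets_over[OF N(1) D(1) N(2)])
  show ?thesis
  proof
    show "smooth_on (\<lambda>p. deriv (pT \<Phi>) (fst p)) D" using point_transformation_T(2)[OF \<Phi> \<open>p \<in> D\<close>] .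
    show "deriv (pT \<Phi>) (fst J) \<noteq> 0" if "J \<in> jets_over N" for J
      using pt[OF that] \<Phi> by (auto simp: point_transformation_def point_of_jet_eq)
  qed (use \<Phi> B in \<open>auto simp: point_transformation_def\<close>)
qed

text \<open>Constancy of the pushforward includes \<tau> T' = cT. Since T' depends on t only,
  differentiating this product along D_x and D_t yields the conditions on \<tau>.\<close>

lemma jet_straightI:
  assumes \<Phi>: "point_transformation \<Phi> D" and N: "open N" "point_of_jet3 ` N \<subseteq> D"
    and B: "\<And>J. J \<in> jets_over N \<Longrightarrow> Dx (pX \<Phi> \<circ> point_of_jet) J \<noteq> 0"
    and V: "smooth_on V D" and push: "pushes_forward \<Phi> D V (\<lambda>p. (cT, cX, 0))"
  shows "jet_straight (jets_over N) D V \<Phi> cX"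
    and "J \<in> jets_over N \<Longrightarrow> has_jd (\<lambda>J. pT \<Phi> (fst J)) J (pv V J) cT"
proof -
  interpret jet_change "jets_over N" D \<Phi> by (rule jet_changeI[OF \<Phi> N B])
  interpret jets_vf "jets_over N" D V by unfold_locales (rule V)
  have \<Phi>V: "deriv (pT \<Phi>) (fst p) * vtau V p = cT" "frechet_derivative (pX \<Phi>) (at p) (V p) = cX" "frechet_derivative (pU \<Phi>) (at p) (V p) = 0"
    if "p \<in> D" for p using push that pmap_frechet[OF \<Phi> that, of "V p"] by (auto simp: pushes_forward_def)
  have pvV: "(fst (pv V J), fst (snd (pv V J)), jc (pv V J) 0 0) = V (point_of_jet J)" for J
    by (simp add: prol_00)
  have T0: "jd TJ J v = fst v * Dt TJ J" if J: "J \<in> jets_over N" for J v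
  proof -
    have TJ: "TJ = (\<lambda>J. (\<lambda>p. deriv (pT \<Phi>) (fst p)) (point_of_jet J))" by (simp add: TJ_def[abs_def] point_of_jet_eq)
    have p: "point_of_jet J \<in> D" by (rule pt[OF J])
    have z: "frechet_derivative (\<lambda>p. deriv (pT \<Phi>) (fst p)) (at (point_of_jet J)) (0, a, b) = 0" for a b
      by (rule derivative_zero_direction[OF D p smT]) simp
    show ?thesis unfolding Dt_jd TJ jd_base_split[OF smT J] by (simp add: z)
  qed
  have c: "vtau V (point_of_jet J) * TJ J = cT" if "J \<in> jets_over N" for J
    using \<Phi>V(1)[OF pt[OF that]] by (simp add: TJ_def mult.commute point_of_jet_eq)
  have prod: "jd (\<lambda>J. vtau V (point_of_jet J)) J v * TJ J + jd TJ J v * vtau V (point_of_jet J) = 0" if J: "J \<in> jets_over N" for J v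
    using jd_mult[OF dfun_components(1) dfun_T J, of v] jd_eq_0[OF J c, where v = v] by simp
  show "jet_straight (jets_over N) D V \<Phi> cX"
  proof
    fix J assume J: "J \<in> jets_over N"
    show "jd XJ J (pv V J) = cX" unfolding XJ_def o_def jd_base[OF smX J] pvV by (rule \<Phi>V(2)[OF pt[OF J]])
    show "jd UJ J (pv V J) = 0" unfolding UJ_def o_def jd_base[OF smU J] pvV by (rule \<Phi>V(3)[OF pt[OF J]])
    have "TJ J \<noteq> 0" using nzT[OF J] by (simp add: TJ_def)
    then show "Dx (\<lambda>J. vtau V (point_of_jet J)) J = 0"
      using prod[OF J, of "Xx J"] T0[OF J, of "Xx J"] by (simp add: Dx_jd)
    show "jd TJ J (pv V J) = vtau V (point_of_jet J) * Dt TJ J" using T0[OF J, of "pv V J"] by simp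
    show "Dt (\<lambda>J. vtau V (point_of_jet J)) J * TJ J + vtau V (point_of_jet J) * Dt TJ J = 0"
      using prod[OF J, of "Xt J"] by (simp add: Dt_jd mult.commute)
  qed
  show "has_jd (\<lambda>J. pT \<Phi> (fst J)) J (pv V J) cT" if J: "J \<in> jets_over N"
  proof -
    have p: "point_of_jet J \<in> D" by (rule pt[OF J])
    have "has_jd (\<lambda>J. (\<lambda>p. pT \<Phi> (fst p)) (point_of_jet J)) J (pv V J) (deriv (pT \<Phi>) (fst (point_of_jet J)) * fst (fst (pv V J), fst (snd (pv V J)), jc (pv V J) 0 0))"
      by (rule has_jd_frechet[OF point_transformation_T(1)[OF \<Phi> p] point_jmove])
    then show ?thesis using \<Phi>V(1)[OF p] by (simp add: point_of_jet_eq)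
  qed
qed

section \<open>Transport of symmetries\<close>

lemma has_jd_derivative: "has_jd P J v d \<Longrightarrow> ((\<lambda>s. P (jmove J v s)) has_derivative (\<lambda>s. s *\<^sub>R d)) (at 0)"
  unfolding has_jd_def by (simp add: has_field_derivative_def mult_commute_abs)

context jet_change begin

text \<open>The slope of the new u_t in the old one, by \<open>mt_eq\<close>. It is the factor
  between the transformed and the original equation.\<close>

definition multiplier :: "jet \<Rightarrow> real" where "multiplier J = J_det J / (TJ J * Dx XJ J)"

lemma TJ_nz: "J \<in> \<Omega> \<Longrightarrow> TJ J \<noteq> 0" by (simp add: TJ_def nzT)

lemma smooth_pderiv: "smooth_on f D \<Longrightarrow> smooth_on (pderiv_x f) D" "smooth_on f D \<Longrightarrow> smooth_on (pderiv_u f) D"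
  using smooth_on_frechet[of f D "(0, 1, 0)"] smooth_on_frechet[of f D "(0, 0, 1)"]
  by (simp_all add: pderiv_x_def[abs_def] pderiv_u_def[abs_def])

lemma dfun_J_det: "dfun \<Omega> D K J_det"
  unfolding J_det_def[abs_def]
  by (intro dfun_diff dfun.mult dfun.base[OF smooth_pderiv(1)[OF smX]] dfun.base[OF smooth_pderiv(2)[OF smX]]
      dfun.base[OF smooth_pderiv(1)[OF smU]] dfun.base[OF smooth_pderiv(2)[OF smU]])

lemma dfun_multiplier: "dfun \<Omega> D (low 1) multiplier"
  unfolding multiplier_def[abs_def]
  by (intro dfun_divide dfun_J_det dfun.mult dfun_T dfun_B) (auto simp: TJ_nz nzB)

text \<open>All these quantities have order at most three and contain no time derivative, so they
  can be read off at any jet over the same \<open>jet3\<close>.\<close>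

lemma local_values:
  assumes "J \<in> \<Omega>" "J' \<in> \<Omega>" "jet3_of_jet J = jet3_of_jet J'"
  shows "k \<le> 3 \<Longrightarrow> m k J = m k J'" and "XJ J = XJ J'" and "fst J = fst J'" and "TJ J = TJ J'"
    and "Dx XJ J = Dx XJ J'" and "J_det J = J_det J'" and "multiplier J = multiplier J'"
proof -
  have e: "point_of_jet J = point_of_jet J'" "\<And>i j. (i, j) \<in> low 3 \<Longrightarrow> jc J i j = jc J' i j"
    using assms(3) by (auto simp: jet3_of_jet_eq point_of_jet_eq low_def numeral_3_eq_3 le_Suc_eq numeral_2_eq_2)
  have l: "P J = P J'" if "dfun \<Omega> D (low k) P" "k \<le> 3" for P k
    by (rule dfun_local[OF that(1) assms(1,2) e(1) e(2)]) (use low_mono[OF that(2)] in auto)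
  show "k \<le> 3 \<Longrightarrow> m k J = m k J'" using l[OF dfun_m] .
  show "XJ J = XJ J'" "TJ J = TJ J'" "J_det J = J_det J'" using l[OF dfun_X, of 0] l[OF dfun_T, of 0] l[OF dfun_J_det, of 0] by auto
  show "fst J = fst J'" using e(1) by (simp add: point_of_jet_eq)
  show "Dx XJ J = Dx XJ J'" "multiplier J = multiplier J'" using l[OF dfun_B[of 1]] l[OF dfun_multiplier] by auto
qed

lemma mt_affine:
  assumes "J \<in> \<Omega>" "J' \<in> \<Omega>" "jet3_of_jet J = jet3_of_jet J'"
  shows "mt J' = mt J + multiplier J * (jc J' 1 0 - jc J 1 0)"
proof -
  have "point_of_jet J = point_of_jet J'" using assms(3) by (simp add: jet3_of_jet_eq point_of_jet_eq)
  then show ?thesis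
    unfolding mt_eq[OF assms(1)] mt_eq[OF assms(2)] multiplier_def[symmetric]
    using local_values[OF assms] by (simp add: algebra_simps)
qed

text \<open>Equality of zero sets becomes a factorisation because both sides are affine in u_t:
  shift u_t until the original equation holds, where both vanish, and compare slopes.\<close>

lemma equation_multiplier:
  assumes \<Omega>: "\<Omega> = jets_over N"
    and iff: "\<And>J. J \<in> \<Omega> \<Longrightarrow> eq_fun E J = 0 \<longleftrightarrow> eq_fun E' (prolong_trans \<Phi> J) = 0" and J: "J \<in> \<Omega>"
  shows "eq_fun E' (prolong_trans \<Phi> J) = multiplier J * eq_fun E J"
proof -
  define J' where "J' = jmove J (0, 0, \<lambda>i j. if i = 1 \<and> j = 0 then 1 else 0) (- eq_fun E J)"
  have j3: "jet3_of_jet J' = jet3_of_jet J" unfolding J'_def jet3_jmove by (simp add: jet3_of_jet_eq)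
  have c: "jc J' 1 0 = jc J 1 0 - eq_fun E J" "jc J' 0 j = jc J 0 j" for j by (simp_all add: J'_def jmove_def)
  have J': "J' \<in> \<Omega>" using J j3 by (simp add: \<Omega> jets_over_def)
  have "eq_fun E J' = 0" using c unfolding eq_fun_eq[of E J'] j3 by (simp add: eq_fun_eq[of E J])
  then have "eq_fun E' (prolong_trans \<Phi> J') = 0" using iff[OF J'] by simp
  moreover have "m 4 J' = m 4 J"
    by (rule dfun_local[OF dfun_m J' J]) (use j3 c(2) in \<open>auto simp: jet3_of_jet_eq point_of_jet_eq low_def\<close>)
  moreover have "mt J' = mt J - multiplier J * eq_fun E J"
    using mt_affine[OF J J' j3[symmetric]] c(1) by simp
  ultimately show ?thesis
    using local_values[OF J J' j3[symmetric]] unfolding eq_fun_prolong_trans by simp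
qed

end

context jet_straight begin

text \<open>Of the new jet coordinates that enter the equation only t and x move along the prolonged
  field, at rates cT and cX; the new derivatives of u are invariant.\<close>

lemma transformed_derivative:
  assumes J: "J \<in> \<Omega>" and E': "evolution_equation E'" and in': "jet3_of_jet (prolong_trans \<Phi> J) \<in> edom E'"
    and T: "has_jd (\<lambda>J. pT \<Phi> (fst J)) J (pv V J) cT"
  shows "has_jd (\<lambda>J. eq_fun E' (prolong_trans \<Phi> J)) J (pv V J)
    (- (frechet_derivative (eF E') (at (jet3_of_jet (prolong_trans \<Phi> J))) (cT, cX, 0, 0, 0, 0) * m 4 J)
     - frechet_derivative (eG E') (at (jet3_of_jet (prolong_trans \<Phi> J))) (cT, cX, 0, 0, 0, 0))"
proof -
  define h where "h J = (pT \<Phi> (fst J), XJ J, m 0 J, m 1 J, m 2 J, m 3 J)" for J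
  have hJ: "h J = jet3_of_jet (prolong_trans \<Phi> J)" for J by (simp only: h_def jet3_prolong_trans)
  have mk: "((\<lambda>s. m k (jmove J (pv V J) s)) has_derivative (\<lambda>s. s *\<^sub>R 0)) (at 0)" for k
    using has_jd_derivative[OF dfun_has_jd[OF dfun_m' J]] m_invariant[OF J] by metis
  have X: "((\<lambda>s. XJ (jmove J (pv V J) s)) has_derivative (\<lambda>s. s *\<^sub>R cX)) (at 0)"
    using has_jd_derivative[OF dfun_has_jd[OF dfun_X J]] VX[OF J] by metis
  have "((\<lambda>s. h (jmove J (pv V J) s)) has_derivative (\<lambda>s. (s *\<^sub>R cT, s *\<^sub>R cX, s *\<^sub>R 0, s *\<^sub>R 0, s *\<^sub>R 0, s *\<^sub>R 0))) (at 0)"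
    unfolding h_def by (intro has_derivative_Pair has_jd_derivative[OF T] X mk)
  then have hd: "((\<lambda>s. h (jmove J (pv V J) s)) has_derivative (\<lambda>s. s *\<^sub>R (cT, cX, 0, 0, 0, 0))) (at 0)"
    by (simp only: scaleR_Pair)
  have comp: "has_jd (\<lambda>J. f (h J)) J (pv V J) (frechet_derivative f (at (h J)) (cT, cX, 0, 0, 0, 0))"
    if f: "smooth_on f (edom E')" for f :: "jet3 \<Rightarrow> real"
  proof -
    have f': "(f has_derivative frechet_derivative f (at (h J))) (at (h (jmove J (pv V J) 0)))"
      using smooth_on_has_derivative[OF f in'] by (simp only: hJ jmove_0)
    show ?thesis
      using has_derivative_compose[OF hd f'] unfolding linear_cmul[OF has_derivative_linear[OF f']]
      by (simp add: has_jd_def has_field_derivative_def mult_commute_abs)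
  qed
  have 4: "has_jd (m 4) J (pv V J) 0" and t: "has_jd mt J (pv V J) 0"
    using dfun_has_jd[OF dfun_m' J, of 4 "pv V J"] m_invariant[OF J, of 4] dfun_has_jd[OF dfun_mt J, of "pv V J"] mt_invariant[OF J] by auto
  have "has_jd (\<lambda>J. mt J - eF E' (h J) * m 4 J - eG E' (h J)) J (pv V J)
     (0 - (frechet_derivative (eF E') (at (h J)) (cT, cX, 0, 0, 0, 0) * m 4 J + 0 * eF E' (h J)) - frechet_derivative (eG E') (at (h J)) (cT, cX, 0, 0, 0, 0))"
    by (intro has_jd_diff has_jd_mult comp smooth_eqD[OF E'] 4 t)
  moreover have "(\<lambda>J. eq_fun E' (prolong_trans \<Phi> J)) = (\<lambda>J. mt J - eF E' (h J) * m 4 J - eG E' (h J))"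
    unfolding eq_fun_prolong_trans h_def ..
  ultimately show ?thesis by (simp add: hJ)
qed

text \<open>On solutions, differentiating the factorisation of the transformed equation along the prolonged field
  leaves only the term in which the original equation is differentiated.\<close>

lemma prolong_transformed:
  assumes J: "J \<in> \<Omega>" and E': "evolution_equation E'" and in': "jet3_of_jet (prolong_trans \<Phi> J) \<in> edom E'"
    and T: "has_jd (\<lambda>J. pT \<Phi> (fst J)) J (pv V J) cT"
    and E: "evolution_equation E" "jet3_of_jet J \<in> edom E" "eq_fun E J = 0"
    and mult: "\<And>J. J \<in> \<Omega> \<Longrightarrow> eq_fun E' (prolong_trans \<Phi> J) = multiplier J * eq_fun E J"
  shows "- (frechet_derivative (eF E') (at (jet3_of_jet (prolong_trans \<Phi> J))) (cT, cX, 0, 0, 0, 0) * m 4 J)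
     - frechet_derivative (eG E') (at (jet3_of_jet (prolong_trans \<Phi> J))) (cT, cX, 0, 0, 0, 0) = prolong V (eq_fun E) J * multiplier J"
proof -
  have "has_jd (eq_fun E) J (pv V J) (prolong V (eq_fun E) J)"
    using has_jd_eq_fun[OF E(1,2), of "pv V J"] has_jd_imp unfolding prolong_jd by metis
  from has_jd_mult[OF dfun_has_jd[OF dfun_multiplier J] this]
  have "has_jd (\<lambda>J. multiplier J * eq_fun E J) J (pv V J) (prolong V (eq_fun E) J * multiplier J)"
    using E(3) by simp
  then have "has_jd (\<lambda>J. eq_fun E' (prolong_trans \<Phi> J)) J (pv V J) (prolong V (eq_fun E) J * multiplier J)"
    by (rule has_jd_cong[OF _ J]) (simp add: mult)
  from has_jd_imp[OF this] has_jd_imp[OF transformed_derivative[OF J E' in' T]] show ?thesis by simp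
qed

end

text \<open>On solutions, the prolonged field applied to the equation, times the non-zero
  multiplier, is the derivative of the transformed equation along (cT, cX), which vanishes by
  \<open>dir\<close>.\<close>

lemma pullback_symmetry:
  assumes \<Phi>: "point_transformation \<Phi> D" and N: "open N" "N \<noteq> {}" "N \<subseteq> edom E" "point_of_jet3 ` N \<subseteq> D"
    and E: "evolution_equation E" and E': "evolution_equation E'"
    and tr: "\<And>J. jet3_of_jet J \<in> N \<Longrightarrow> Dx (pX \<Phi> \<circ> point_of_jet) J \<noteq> 0 \<and>
           jet3_of_jet (prolong_trans \<Phi> J) \<in> edom E' \<and> (eq_fun E J = 0 \<longleftrightarrow> eq_fun E' (prolong_trans \<Phi> J) = 0)"
    and dir: "\<And>z. z \<in> edom E' \<Longrightarrow> frechet_derivative (eF E') (at z) (cT, cX, 0, 0, 0, 0) = 0"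
      "\<And>z. z \<in> edom E' \<Longrightarrow> frechet_derivative (eG E') (at z) (cT, cX, 0, 0, 0, 0) = 0"
    and V: "smooth_on V D" and push: "pushes_forward \<Phi> D V (\<lambda>p. (cT, cX, 0))"
  shows "admits (E\<lparr>edom := N\<rparr>) V"
proof -
  have B: "Dx (pX \<Phi> \<circ> point_of_jet) J \<noteq> 0" if "J \<in> jets_over N" for J using tr that by (simp add: jets_over_def)
  interpret jet_straight "jets_over N" D V \<Phi> cX by (rule jet_straightI(1)[OF \<Phi> N(1,4) B V push])
  have EN: "evolution_equation (E\<lparr>edom := N\<rparr>)"
    using E N by (auto simp: evolution_equation_def intro: smooth_on_subset)
  have eqN: "eq_fun (E\<lparr>edom := N\<rparr>) = eq_fun E" by (rule ext) (simp add: eq_fun_eq)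
  have "prolong V (eq_fun (E\<lparr>edom := N\<rparr>)) J = 0" if J: "jet3_of_jet J \<in> N" "eq_fun (E\<lparr>edom := N\<rparr>) J = 0" for J
  proof -
    have J': "J \<in> jets_over N" using J by (simp add: jets_over_def)
    have T: "has_jd (\<lambda>J. pT \<Phi> (fst J)) J (pv V J) cT" by (rule jet_straightI(2)[OF \<Phi> N(1,4) B V push J'])
    have mult: "eq_fun E' (prolong_trans \<Phi> J) = multiplier J * eq_fun (E\<lparr>edom := N\<rparr>) J" if "J \<in> jets_over N" for J
      unfolding eqN by (rule equation_multiplier[OF refl _ that]) (use tr in \<open>simp add: jets_over_def\<close>)
    have in': "jet3_of_jet (prolong_trans \<Phi> J) \<in> edom E'" using tr[OF J(1)] by blast
    have "prolong V (eq_fun (E\<lparr>edom := N\<rparr>)) J * multiplier J = 0"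
      using prolong_transformed[OF J' E' in' T EN _ J(2) mult] J(1) dir[OF in'] by simp
    moreover have "J_det J \<noteq> 0" using \<Phi> pt[OF J'] unfolding point_transformation_def J_det_def by blast
    then have "multiplier J \<noteq> 0" using TJ_nz[OF J'] nzB[OF J'] by (simp add: multiplier_def)
    ultimately show ?thesis by simp
  qed
  then show ?thesis
    unfolding admits_def using V N(4) by (auto simp: base_def intro: smooth_on_subset)
qed

text \<open>A right inverse of \<open>jet3_of_jet\<close> that fills the remaining coordinates with
  0. Through it a \<open>dfun\<close> becomes a smooth function on the finite dimensional space
  \<open>jet3\<close>.\<close>

definition emb :: "jet3 \<Rightarrow> jet" where
  "emb = (\<lambda>(t, x, u, u1, u2, u3). (t, x, \<lambda>i j. if i = 0 then
     (if j = 0 then u else if j = 1 then u1 else if j = 2 then u2 else if j = 3 then u3 else 0) else 0))"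

lemma jet3_emb [simp]: "jet3_of_jet (emb z) = z"
  by (cases z) (simp add: emb_def)

lemma point_emb: "point_of_jet (emb z) = point_of_jet3 z"
  by (cases z) (simp add: emb_def)

lemma emb_move: "emb (z + s *\<^sub>R v) = jmove (emb z) (emb v) s"
  by (cases z; cases v) (auto simp: emb_def jmove_def fun_eq_iff)

lemma bounded_linear_point3: "bounded_linear point_of_jet3"
proof -
  have "bounded_linear (\<lambda>z::jet3. (fst z, fst (snd z), fst (snd (snd z))))"
    by (intro bounded_linear_Pair bounded_linear_fst bounded_linear_fst_comp bounded_linear_snd_comp bounded_linear_snd)
  moreover have "(\<lambda>z::jet3. (fst z, fst (snd z), fst (snd (snd z)))) = point_of_jet3" by (auto simp: fun_eq_iff)
  ultimately show ?thesis by simp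
qed

lemma bounded_linear_emb_coord: "bounded_linear (\<lambda>z. jc (emb z) i j)"
proof -
  have "linear (\<lambda>z. jc (emb z) i j)"
    by (rule linearI) (auto simp: emb_def)
  then show ?thesis by (simp add: linear_conv_bounded_linear)
qed

lemma fst_emb: "fst (emb z) = fst z" by (cases z) (simp add: emb_def)

context jets begin

lemma smooth_emb:
  assumes P: "dfun \<Omega> D K P" and N: "open N" "\<And>z. z \<in> N \<Longrightarrow> emb z \<in> \<Omega>"
  shows "smooth_on (\<lambda>z. P (emb z)) N"
  using P
proof (induction rule: dfun.induct)
  case (base f)
  have "point_of_jet3 ` N \<subseteq> D" using pt[OF N(2)] by (auto simp: point_emb)
  from smooth_on_compose[OF N(1) D this smooth_on_bounded_linear[OF bounded_linear_point3] base] show ?case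
    by (simp add: point_emb)
next
  case (coord i j)
  then show ?case by (intro smooth_on_bounded_linear bounded_linear_emb_coord)
next
  case (add P Q)
  then show ?case by (intro smooth_on_add N)
next
  case (mult P Q)
  then show ?case by (intro smooth_on_mult N)
next
  case (inverse P)
  then show ?case by (intro smooth_on_inverse N) (auto simp: N(2))
next
  case (cong P Q)
  show ?case by (rule smooth_on_cong[OF N(1) _ cong(3)]) (use cong(2) N(2) in auto)
qed

lemma emb_derivative:
  assumes P: "dfun \<Omega> D K P" and N: "open N" "\<And>z. z \<in> N \<Longrightarrow> emb z \<in> \<Omega>" and z: "z \<in> N"
  shows "((\<lambda>z. P (emb z)) has_derivative (\<lambda>v. jd P (emb z) (emb v))) (at z)"
proof -
  have h: "((\<lambda>z. P (emb z)) has_derivative frechet_derivative (\<lambda>z. P (emb z)) (at z)) (at z)"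
    by (rule smooth_on_has_derivative[OF smooth_emb[OF P N] z])
  have "frechet_derivative (\<lambda>z. P (emb z)) (at z) v = jd P (emb z) (emb v)" for v
  proof -
    have "has_jd P (emb z) (emb v) (frechet_derivative (\<lambda>z. P (emb z)) (at z) v)"
      using frechet_directional[OF h, of v] by (simp add: has_jd_def has_real_derivative_iff_has_vector_derivative emb_move)
    then show ?thesis using has_jd_imp by metis
  qed
  then have "frechet_derivative (\<lambda>z. P (emb z)) (at z) = (\<lambda>v. jd P (emb z) (emb v))" by (rule ext)
  then show ?thesis using h by simp
qed

end

text \<open>The prolongation M of the change of variables to \<open>jet3\<close> is a local
  diffeomorphism. The new u_t and u_xxxx are affine in the old ones, so solving for the new u_t
  gives an evolution equation again, with coefficients carried over by the inverse of M.\<close>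

lemma straighten_equation:
  assumes \<Phi>: "point_transformation \<Phi> D" and E: "evolution_equation E" and adm: "admits E V"
    and z: "z \<in> edom E" "point_of_jet3 z \<in> D" and V: "smooth_on V D"
    and push: "pushes_forward \<Phi> D V (\<lambda>p. (cT, cX, 0))"
    and B: "Dx (pX \<Phi> \<circ> point_of_jet) (emb z) \<noteq> 0"
  obtains E' where "evolution_equation E'" "convex (edom E')" "transforms_near \<Phi> D E z E'"
    "\<And>z. z \<in> edom E' \<Longrightarrow> frechet_derivative (eF E') (at z) (cT, cX, 0, 0, 0, 0) = 0"
    "\<And>z. z \<in> edom E' \<Longrightarrow> frechet_derivative (eG E') (at z) (cT, cX, 0, 0, 0, 0) = 0"
proof -
  have D: "open D" and smX: "smooth_on (pX \<Phi>) D" using \<Phi> by (auto simp: point_transformation_def)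
  define S where "S = edom E \<inter> point_of_jet3 -` D"
  have S: "open S" "z \<in> S" "S \<subseteq> edom E" "point_of_jet3 ` S \<subseteq> D"
    using z smooth_eqD(1)[OF E] open_vimage[OF D linear_continuous_on[OF bounded_linear_point3]] by (auto simp: S_def)
  interpret JS: jets "jets_over S" D by (rule jets_over[OF S(1) D S(4)])
  have dB: "dfun (jets_over S) D UNIV (Dx (pX \<Phi> \<circ> point_of_jet))"
    using JS.dfun_Dx[OF dfun.base[OF smX]] by (simp add: o_def)
  have embS: "emb z \<in> jets_over S" if "z \<in> S" for z using that by (simp add: jets_over_def)
  have "continuous_on S (\<lambda>z. Dx (pX \<Phi> \<circ> point_of_jet) (emb z))"
    by (rule smooth_on_continuous_on[OF JS.smooth_emb[OF dB S(1) embS]])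
  define N where "N = {z \<in> S. Dx (pX \<Phi> \<circ> point_of_jet) (emb z) \<noteq> 0}"
  have "N = S \<inter> (\<lambda>z. Dx (pX \<Phi> \<circ> point_of_jet) (emb z)) -` (- {0})" by (auto simp: N_def)
  then have N: "open N"
    using continuous_open_preimage[OF \<open>continuous_on S _\<close> S(1) open_Compl[OF closed_singleton]] by simp
  have N': "z \<in> N" "N \<subseteq> S" using S(2) B by (auto simp: N_def)
  have NE: "N \<subseteq> edom E" "point_of_jet3 ` N \<subseteq> D" using N' S by auto
  \<comment> \<open>N was cut out by a condition at \<open>emb z\<close>. Since D_x X has order one,
    the condition holds at every jet over N.\<close>
  have BN: "Dx (pX \<Phi> \<circ> point_of_jet) J \<noteq> 0" if "J \<in> jets_over N" for J
  proof -
    have j: "jet3_of_jet J \<in> N" using that by (simp add: jets_over_def)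
    then have js: "J \<in> jets_over S" "emb (jet3_of_jet J) \<in> jets_over S" using N' by (auto simp: jets_over_def)
    have "dfun (jets_over S) D (low 1) (Dx (pX \<Phi> \<circ> point_of_jet))"
      using JS.dfun_Dx_low[OF dfun.base[OF smX], of 0] by (simp add: o_def)
    then have "Dx (pX \<Phi> \<circ> point_of_jet) J = Dx (pX \<Phi> \<circ> point_of_jet) (emb (jet3_of_jet J))"
    proof (rule dfun_local[OF _ js])
      show "point_of_jet J = point_of_jet (emb (jet3_of_jet J))" by (simp add: point_emb point_of_jet3_jet3)
      show "jc J i j = jc (emb (jet3_of_jet J)) i j" if "(i, j) \<in> low 1" for i j
        using that by (auto simp: low_def emb_def jet3_of_jet_eq le_Suc_eq)
    qed
    then show ?thesis using j by (simp add: N_def)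
  qed
  interpret jet_straight "jets_over N" D V \<Phi> cX by (rule jet_straightI(1)[OF \<Phi> N NE(2) BN V push])
  have embN: "emb z \<in> jets_over N" if "z \<in> N" for z using that by (simp add: jets_over_def)
  have detnz: "J_det J \<noteq> 0" if "J \<in> jets_over N" for J
    using \<Phi> pt[OF that] unfolding point_transformation_def J_det_def by blast
  define M where "M z = (pT \<Phi> (fst z), XJ (emb z), m 0 (emb z), m 1 (emb z), m 2 (emb z), m 3 (emb z))" for z
  have M: "jet3_of_jet (prolong_trans \<Phi> J) = M (jet3_of_jet J)" if J: "J \<in> jets_over N" for J
  proof -
    have j: "jet3_of_jet J = jet3_of_jet (emb (jet3_of_jet J))" and e: "emb (jet3_of_jet J) \<in> jets_over N"
      using J by (auto simp: jets_over_def)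
    show ?thesis
      unfolding jet3_prolong_trans M_def using local_values[OF J e j] by (simp add: fst_emb)
  qed
  have smT: "smooth_on (\<lambda>z::jet3. pT \<Phi> (fst z)) N"
  proof -
    have "fst (point_of_jet3 z) = fst z" for z by (cases z) simp
    then show ?thesis
      using smooth_on_compose[OF N D NE(2) smooth_on_bounded_linear[OF bounded_linear_point3] point_transformation_T(3)[OF \<Phi> z(2)]]
      by simp
  qed
  have smM: "smooth_on M N"
    unfolding M_def[abs_def] by (intro smooth_on_Pair N smT smooth_emb[OF dfun_X N embN] smooth_emb[OF dfun_m N embN])
  have hdM: "(M has_derivative (\<lambda>v. (deriv (pT \<Phi>) (fst z) * fst v, jd XJ (emb z) (emb v), jd (m 0) (emb z) (emb v),
      jd (m 1) (emb z) (emb v), jd (m 2) (emb z) (emb v), jd (m 3) (emb z) (emb v)))) (at z)" if zN: "z \<in> N" for z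
  proof -
    have p: "point_of_jet3 z \<in> D" using zN NE by blast
    have "(point_of_jet3 has_derivative point_of_jet3) (at z)" by (rule bounded_linear_imp_has_derivative[OF bounded_linear_point3])
    from has_derivative_compose[OF this point_transformation_T(1)[OF \<Phi> p]]
    have "((\<lambda>z::jet3. pT \<Phi> (fst (point_of_jet3 z))) has_derivative (\<lambda>v. deriv (pT \<Phi>) (fst (point_of_jet3 z)) * fst (point_of_jet3 v))) (at z)" .
    moreover have "fst (point_of_jet3 z) = fst z" for z by (cases z) simp
    ultimately have "((\<lambda>z::jet3. pT \<Phi> (fst z)) has_derivative (\<lambda>v. deriv (pT \<Phi>) (fst z) * fst v)) (at z)" by simp
    then show ?thesis
      unfolding M_def[abs_def]
      by (intro has_derivative_Pair emb_derivative[OF dfun_X N embN zN] emb_derivative[OF dfun_m N embN zN])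
  qed
  \<comment> \<open>The Jacobian of M is block triangular: T', then the Jacobian of (X, U) in (x,
    u), then the non-zero diagonal entries given by \<open>m_unit\<close>.\<close>
  have inj: "v = 0" if zN: "z \<in> N" and v: "frechet_derivative M (at z) v = 0" for z v
  proof -
    let ?J = "emb z"
    have J: "?J \<in> jets_over N" by (rule embN[OF zN])
    obtain a b c v1 v2 v3 where vv: "v = (a, b, c, v1, v2, v3)" by (metis surj_pair)
    have eq: "deriv (pT \<Phi>) (fst z) * a = 0" "jd XJ ?J (emb v) = 0" "jd (m 0) ?J (emb v) = 0" "jd (m 1) ?J (emb v) = 0"
      "jd (m 2) ?J (emb v) = 0" "jd (m 3) ?J (emb v) = 0"
      using v vv unfolding frechet_derivative_at[OF hdM[OF zN], symmetric] by (auto simp: zero_prod_def)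
    have "a = 0" using eq(1) nzT[OF J] by (simp add: fst_emb)
    have c0: "fst (emb v) = a" "fst (snd (emb v)) = b" "jc (emb v) 0 0 = c" by (simp_all add: vv emb_def)
    have m0: "m 0 = UJ" by (simp add: m_def)
    let ?p = "point_of_jet ?J"
    have smU: "smooth_on (pU \<Phi>) D" using \<Phi> by (simp add: point_transformation_def)
    have X0: "b * pderiv_x (pX \<Phi>) ?p + c * pderiv_u (pX \<Phi>) ?p = 0"
      using eq(2) \<open>a = 0\<close> unfolding XJ_def o_def jd_base_split[OF \<open>smooth_on (pX \<Phi>) D\<close> J] c0 by (simp add: pderiv_x_def pderiv_u_def)
    have U0: "b * pderiv_x (pU \<Phi>) ?p + c * pderiv_u (pU \<Phi>) ?p = 0"
      using eq(3) \<open>a = 0\<close> unfolding m0 UJ_def o_def jd_base_split[OF smU J] c0 by (simp add: pderiv_x_def pderiv_u_def)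
    have "b * J_det ?J = 0" "c * J_det ?J = 0"
      unfolding J_det_def using X0 U0 by algebra+
    then have bc: "b = 0" "c = 0" using detnz[OF J] by auto
    have ev: "emb v = jmove (jmove (jmove (0, 0, \<lambda>i j. 0) (unit 1) v1) (unit 2) v2) (unit 3) v3"
      using \<open>a = 0\<close> bc by (auto simp: vv emb_def jmove_def fun_eq_iff)
    have lin: "jd (m k) ?J (emb v) = v1 * jd (m k) ?J (unit 1) + v2 * jd (m k) ?J (unit 2) + v3 * jd (m k) ?J (unit 3)" for k
      unfolding ev by (simp only: jd_linear[OF dfun_m J] jd_zero_direction add_0_left)
    have unz: "jd (m (Suc k)) ?J (unit (Suc k)) \<noteq> 0" for k
      unfolding m_unit[OF J] using detnz[OF J] nzB[OF J] by simp
    have "v1 = 0"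
      using eq(4) lin[of 1] unz[of 0] jd_unit_low[OF dfun_m[of 1] J, of 2] jd_unit_low[OF dfun_m[of 1] J, of 3] by simp
    moreover have "v2 = 0"
      using eq(5) lin[of 2] unz[of 1] jd_unit_low[OF dfun_m[of 2] J, of 3] \<open>v1 = 0\<close> by (simp add: numeral_2_eq_2)
    moreover have "v3 = 0"
      using eq(6) lin[of 3] unz[of 2] \<open>v1 = 0\<close> \<open>v2 = 0\<close> by (simp add: numeral_3_eq_3 numeral_2_eq_2)
    ultimately show ?thesis using \<open>a = 0\<close> bc vv by (simp add: zero_prod_def)
  qed
  obtain U W0 g where g: "open U" "z \<in> U" "U \<subseteq> N" "open W0" "homeomorphism U W0 M g" "smooth_on g W0"
    using smooth_inverse_function[OF N N'(1) smM inj[OF N'(1)]] by metis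
  have gM: "g (M z) = z" "M z \<in> W0" if "z \<in> U" for z using g(5) that by (auto simp: homeomorphism_def)
  have Mg: "M (g w) = w" "g w \<in> U" if "w \<in> W0" for w using g(5) that by (auto simp: homeomorphism_def)
  obtain r where r: "r > 0" "ball (M z) r \<subseteq> W0" using open_contains_ball g(4) gM(2)[OF g(2)] by blast
  \<comment> \<open>A ball, because \<open>family_tI\<close> and \<open>family_xI\<close> ask for a
    convex domain.\<close>
  define W where "W = ball (M z) r"
  have W: "open W" "convex W" "W \<subseteq> W0" "M z \<in> W" using r by (auto simp: W_def)
  define N1 where "N1 = U \<inter> M -` W"
  have N1: "open N1" "z \<in> N1" "N1 \<subseteq> N"
    using continuous_open_preimage[OF continuous_on_subset[OF smooth_on_continuous_on[OF smM] g(3)] g(1) W(1)] g W by (auto simp: N1_def)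
  \<comment> \<open>The slope of m_4 in u_xxxx, which is \<open>m_unit\<close> for k = 3.\<close>
  define \<beta> where "\<beta> J = J_det J / Dx XJ J ^ 5" for J
  have d\<beta>: "dfun (jets_over N) D (low 1) \<beta>"
  proof -
    have "dfun (jets_over N) D (low 1) (\<lambda>J. J_det J / (Dx XJ J * (Dx XJ J * (Dx XJ J * (Dx XJ J * Dx XJ J)))))"
      by (intro dfun_divide dfun_J_det dfun.mult dfun_B) (auto simp: nzB)
    then show ?thesis by (rule dfun.cong) (simp add: \<beta>_def eval_nat_numeral)
  qed
  have \<beta>nz: "\<beta> J \<noteq> 0" "multiplier J \<noteq> 0" if "J \<in> jets_over N" for J
    using detnz[OF that] nzB[OF that] TJ_nz[OF that] by (auto simp: \<beta>_def multiplier_def)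
  have mlt_sm: "smooth_on (\<lambda>z. multiplier (emb z)) N" "smooth_on (\<lambda>z. \<beta> (emb z)) N" "smooth_on (\<lambda>z. m 4 (emb z)) N" "smooth_on (\<lambda>z. mt (emb z)) N"
    by (rule smooth_emb[OF dfun_multiplier N embN], assumption, rule smooth_emb[OF d\<beta> N embN], assumption,
        rule smooth_emb[OF dfun_m N embN], assumption, rule smooth_emb[OF dfun_mt N embN])
  have EFG: "smooth_on (eF E) N" "smooth_on (eG E) N" using smooth_eqD(2,3)[OF E] NE(1) smooth_on_subset by blast+
  \<comment> \<open>Found by comparing coefficients in multiplier * (u_t - F u_xxxx - G) = mt - F1
    m_4 - G1: those of u_xxxx give F1, and the values at \<open>emb z\<close>, where u_t = u_xxxx =
    0, give G1.\<close>
  define F1 where "F1 z = multiplier (emb z) * eF E z * inverse (\<beta> (emb z))" for z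
  define G1 where "G1 z = mt (emb z) + multiplier (emb z) * eG E z - F1 z * m 4 (emb z)" for z
  have F1: "smooth_on F1 N" unfolding F1_def[abs_def]
    by (intro smooth_on_mult smooth_on_inverse N mlt_sm EFG) (rule \<beta>nz(1)[OF embN])
  have G1: "smooth_on G1 N" unfolding G1_def[abs_def]
    by (intro smooth_on_mult smooth_on_add smooth_on_diff N mlt_sm EFG F1)
  define E' where "E' = \<lparr>edom = W, eF = (\<lambda>w. F1 (g w)), eG = (\<lambda>w. G1 (g w))\<rparr>"
  have gW: "g ` W \<subseteq> N" using Mg W g(3) by blast
  have sg: "smooth_on g W" using g(6) W(3) smooth_on_subset by blast
  have E': "evolution_equation E'"
    unfolding evolution_equation_def E'_def
  proof (simp, intro conjI ballI)
    show "smooth_on (\<lambda>w. F1 (g w)) W" by (rule smooth_on_compose[OF W(1) N gW sg F1])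
    show "smooth_on (\<lambda>w. G1 (g w)) W" by (rule smooth_on_compose[OF W(1) N gW sg G1])
    fix w assume "w \<in> W"
    then have w: "g w \<in> N" using gW by blast
    show "F1 (g w) \<noteq> 0"
      using smooth_eqD(4)[OF E subsetD[OF NE(1) w]] \<beta>nz[OF embN[OF w]] unfolding F1_def by simp
  qed (use W in auto)
  have m4: "m 4 J = m 4 (emb (jet3_of_jet J)) + jc J 0 4 * \<beta> J" if J: "J \<in> jets_over N" for J
  proof -
    let ?e = "emb (jet3_of_jet J)"
    have mv: "jet3_of_jet (jmove ?e (unit 4) s) = jet3_of_jet J" for s unfolding jet3_jmove by (simp add: zero_prod_def[symmetric])
    then have mv': "jmove ?e (unit 4) s \<in> jets_over N" for s using J by (simp add: jets_over_def)
    have "jd (m 4) (jmove ?e (unit 4) s) (unit 4) = \<beta> J" for s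
      using m_unit[OF mv'[of s], of 3] local_values(5,6)[OF mv'[of s] J mv] by (simp add: \<beta>_def eval_nat_numeral)
    from affine_along[OF dfun_m mv' this]
    have "m 4 (jmove ?e (unit 4) (jc J 0 4)) = m 4 ?e + jc J 0 4 * \<beta> J" .
    moreover have "m 4 J = m 4 (jmove ?e (unit 4) (jc J 0 4))"
    proof (rule dfun_local[OF dfun_m J mv'])
      show "point_of_jet J = point_of_jet (jmove ?e (unit 4) (jc J 0 4))"
        using mv[of "jc J 0 4"] by (metis point_of_jet3_jet3)
      show "jc J i j = jc (jmove ?e (unit 4) (jc J 0 4)) i j" if "(i, j) \<in> low 4" for i j
        using that by (auto simp: low_def jmove_def emb_def jet3_of_jet_eq eval_nat_numeral le_Suc_eq)
    qed
    ultimately show ?thesis by simp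
  qed
  have mult: "eq_fun E' (prolong_trans \<Phi> J) = multiplier J * eq_fun E J" if J: "J \<in> jets_over N1" for J
  proof -
    let ?z = "jet3_of_jet J"
    have JN: "J \<in> jets_over N" and zU: "?z \<in> U" using J N1(3) by (auto simp: jets_over_def N1_def)
    have e: "emb ?z \<in> jets_over N" "jet3_of_jet J = jet3_of_jet (emb ?z)" using JN by (auto simp: jets_over_def)
    have gz: "g (jet3_of_jet (prolong_trans \<Phi> J)) = ?z" using M[OF JN] gM[OF zU] by simp
    have "eq_fun E' (prolong_trans \<Phi> J) = mt J - F1 ?z * m 4 J - G1 ?z"
      using gz unfolding eq_fun_prolong_trans jet3_prolong_trans by (simp add: E'_def)
    moreover have "mt J = mt (emb ?z) + multiplier J * jc J 1 0"
      using mt_affine[OF e(1) JN e(2)[symmetric]] local_values(7)[OF e(1) JN e(2)[symmetric]] by (simp add: emb_def case_prod_unfold)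
    moreover have \<mu>: "multiplier (emb ?z) = multiplier J" using local_values(7)[OF e(1) JN e(2)[symmetric]] .
    moreover have "F1 ?z * \<beta> J = multiplier J * eF E ?z"
      using local_values[OF e(1) JN e(2)[symmetric]] \<beta>nz(1)[OF JN] by (simp add: \<beta>_def F1_def)
    then have "F1 ?z * (jc J 0 4 * \<beta> J) = multiplier J * (eF E ?z * jc J 0 4)"
      by (metis mult.assoc mult.commute)
    ultimately show ?thesis
      unfolding eq_fun_eq[of E J] G1_def m4[OF JN] by (simp only: distrib_left right_diff_distrib)
  qed
  have tr: "transforms_near \<Phi> D E z E'"
    unfolding transforms_near_def
  proof (intro exI[of _ N1] conjI allI impI)
    fix J assume "jet3_of_jet J \<in> N1"
    then have J: "J \<in> jets_over N1" "J \<in> jets_over N" using N1(3) by (auto simp: jets_over_def)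
    show "Dx (pX \<Phi> \<circ> point_of_jet) J \<noteq> 0" by (rule BN[OF J(2)])
    show "jet3_of_jet (prolong_trans \<Phi> J) \<in> edom E'"
      using M[OF J(2)] J(1) by (simp add: E'_def jets_over_def N1_def)
    show "eq_fun E J = 0 \<longleftrightarrow> eq_fun E' (prolong_trans \<Phi> J) = 0"
      using mult[OF J(1)] \<beta>nz[OF J(2)] by simp
  qed (use N1 NE in auto)
  have N1D: "point_of_jet3 ` N1 \<subseteq> D" using N1 NE by auto
  have BN1: "Dx (pX \<Phi> \<circ> point_of_jet) J \<noteq> 0" if "J \<in> jets_over N1" for J
    by (rule BN) (use that N1(3) in \<open>auto simp: jets_over_def\<close>)
  interpret J1: jet_straight "jets_over N1" D V \<Phi> cX by (rule jet_straightI(1)[OF \<Phi> N1(1) N1D BN1 V push])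
  have "frechet_derivative (eF E') (at w) (cT, cX, 0, 0, 0, 0) = 0 \<and> frechet_derivative (eG E') (at w) (cT, cX, 0, 0, 0, 0) = 0"
    if w: "w \<in> W" for w
  proof -
    define zz where "zz = g w"
    have "w \<in> W0" using w W(3) by blast
    then have zz: "zz \<in> N1" "M zz = w" using Mg[of w] w by (simp_all add: zz_def N1_def)
    \<comment> \<open>A solution jet over \<open>zz\<close>: u_xxxx = c is free, and u_t is
      determined by the equation.\<close>
    define J where "J c = jmove (jmove (emb zz) (unit 4) c) (0, 0, \<lambda>i j. if i = 1 \<and> j = 0 then 1 else 0) (eF E zz * c + eG E zz)" for c
    have j3: "jet3_of_jet (J c) = zz" for c
      unfolding J_def jet3_jmove by (simp add: zero_prod_def[symmetric])
    have J: "J c \<in> jets_over N1" "J c \<in> jets_over N" for c using j3 zz N1(3) by (auto simp: jets_over_def)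
    have jc: "jc (J c) 0 4 = c" "jc (J c) 1 0 = eF E zz * c + eG E zz" for c
      by (simp_all add: J_def jmove_def emb_def case_prod_unfold)
    have sol: "eq_fun E (J c) = 0" for c unfolding eq_fun_eq j3 jc by simp
    have in': "jet3_of_jet (prolong_trans \<Phi> (J c)) = w" for c using M[OF J(2)] j3 zz by simp
    have inE: "jet3_of_jet (J c) \<in> edom E" for c unfolding j3 using zz N1(3) NE by blast
    have "prolong V (eq_fun E) (J c) = 0" for c using adm sol inE unfolding admits_def by blast
    then have eq: "- (frechet_derivative (eF E') (at w) (cT, cX, 0, 0, 0, 0) * m 4 (J c)) - frechet_derivative (eG E') (at w) (cT, cX, 0, 0, 0, 0) = 0" for c
      using J1.prolong_transformed[OF J(1) E' _ jet_straightI(2)[OF \<Phi> N1(1) N1D BN1 V push J(1)] E inE sol, of c] mult in' w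
      by (simp add: E'_def)
    \<comment> \<open>Two values of u_xxxx separate the derivatives of F and G in an identity that
      is affine in m_4.\<close>
    have "m 4 (J 1) = m 4 (J 0) + \<beta> (J 1)"
      using m4[OF J(2), of 1] m4[OF J(2), of 0] by (simp add: j3 jc)
    then have "m 4 (J 1) - m 4 (J 0) \<noteq> 0" using \<beta>nz(1)[OF J(2)[of 1]] by simp
    moreover have "frechet_derivative (eF E') (at w) (cT, cX, 0, 0, 0, 0) * (m 4 (J 1) - m 4 (J 0)) = 0"
      using eq[of 0] eq[of 1] unfolding right_diff_distrib by linarith
    ultimately show ?thesis using eq[of 0] by simp
  qed
  then show ?thesis using that[OF E' _ tr] W(2) by (simp add: E'_def)
qed

section \<open>Explicit prolongation coefficients\<close>

context jets begin

lemma Dx_pow_cong: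
  "dfun \<Omega> D UNIV P \<Longrightarrow> (\<And>J. J \<in> \<Omega> \<Longrightarrow> P J = Q J) \<Longrightarrow> J \<in> \<Omega> \<Longrightarrow> (Dx ^^ n) Q J = (Dx ^^ n) P J"
proof (induction n arbitrary: J)
  case (Suc n)
  show ?case by (simp, rule Dx_cong[OF dfun_Dx_pow[OF Suc.prems(1)] Suc.prems(3)]) (use Suc in auto)
qed simp

lemma Dx_pow_add:
  assumes P: "dfun \<Omega> D UNIV P" and Q: "dfun \<Omega> D UNIV Q"
  shows "J \<in> \<Omega> \<Longrightarrow> (Dx ^^ n) (\<lambda>J. P J + Q J) J = (Dx ^^ n) P J + (Dx ^^ n) Q J"
proof (induction n arbitrary: J)
  case (Suc n)
  have "(Dx ^^ Suc n) (\<lambda>J. P J + Q J) J = Dx (\<lambda>J. (Dx ^^ n) P J + (Dx ^^ n) Q J) J"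
    by (simp, rule Dx_cong[OF dfun.add[OF dfun_Dx_pow[OF P] dfun_Dx_pow[OF Q]] Suc.prems]) (simp add: Suc.IH)
  also have "\<dots> = Dx ((Dx ^^ n) P) J + Dx ((Dx ^^ n) Q) J"
    unfolding Dx_jd[of _ J] by (rule jd_add[OF dfun_Dx_pow[OF P] dfun_Dx_pow[OF Q] Suc.prems])
  finally show ?case by simp
qed simp

text \<open>Differentiating innermost first leaves products of the same shape with n derivatives to
  go, so the binomial formulas follow by repetition.\<close>

lemma Dx_pow_coord_mult:
  assumes P: "dfun \<Omega> D UNIV P" and J: "J \<in> \<Omega>"
  shows "(Dx ^^ Suc n) (\<lambda>J. P J * jc J i j) J = (Dx ^^ n) (\<lambda>J. Dx P J * jc J i j) J + (Dx ^^ n) (\<lambda>J. P J * jc J i (Suc j)) J"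
proof -
  have c: "dfun \<Omega> D UNIV (\<lambda>J. jc J i j)" for j by (rule dfun.coord) simp
  have d: "dfun \<Omega> D UNIV (\<lambda>J. Dx P J * jc J i j)" "dfun \<Omega> D UNIV (\<lambda>J. P J * jc J i (Suc j))"
    by (rule dfun.mult[OF dfun_Dx[OF P] c], rule dfun.mult[OF P c])
  have e: "Dx (\<lambda>J. P J * jc J i j) J = Dx P J * jc J i j + P J * jc J i (Suc j)" if "J \<in> \<Omega>" for J
    using jd_mult[OF P c that, of j "Xx J"] by (simp add: Dx_jd jd_coord)
  have "(Dx ^^ Suc n) (\<lambda>J. P J * jc J i j) J = (Dx ^^ n) (Dx (\<lambda>J. P J * jc J i j)) J" by (simp only: funpow_Suc_right o_apply)
  also have "\<dots> = (Dx ^^ n) (\<lambda>J. Dx P J * jc J i j + P J * jc J i (Suc j)) J"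
    by (rule Dx_pow_cong[OF dfun.add[OF d] _ J]) (simp add: e)
  finally show ?thesis by (simp only: Dx_pow_add[OF d J])
qed

lemma Dx_coord_mult:
  assumes P: "dfun \<Omega> D UNIV P" and J: "J \<in> \<Omega>"
  shows "Dx (\<lambda>J. P J * jc J i j) J = Dx P J * jc J i j + P J * jc J i (Suc j)"
    and "Dx (Dx (\<lambda>J. P J * jc J i j)) J = Dx (Dx P) J * jc J i j + 2 * Dx P J * jc J i (Suc j) + P J * jc J i (j + 2)"
    and "Dx (Dx (Dx (\<lambda>J. P J * jc J i j))) J = Dx (Dx (Dx P)) J * jc J i j + 3 * Dx (Dx P) J * jc J i (Suc j)
       + 3 * Dx P J * jc J i (j + 2) + P J * jc J i (j + 3)"
    and "Dx (Dx (Dx (Dx (\<lambda>J. P J * jc J i j)))) J = Dx (Dx (Dx (Dx P))) J * jc J i j + 4 * Dx (Dx (Dx P)) J * jc J i (Suc j)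
       + 6 * Dx (Dx P) J * jc J i (j + 2) + 4 * Dx P J * jc J i (j + 3) + P J * jc J i (j + 4)"
proof -
  have 1: "Dx (\<lambda>J. P J * jc J i j) J = Dx P J * jc J i j + P J * jc J i (Suc j)" if "dfun \<Omega> D UNIV P" for P j
    using Dx_pow_coord_mult[OF that J, of 0 i j] by simp
  have 2: "Dx (Dx (\<lambda>J. P J * jc J i j)) J = Dx (\<lambda>J. Dx P J * jc J i j) J + Dx (\<lambda>J. P J * jc J i (Suc j)) J" if "dfun \<Omega> D UNIV P" for P j
    using Dx_pow_coord_mult[OF that J, of 1 i j] by simp
  have 3: "Dx (Dx (Dx (\<lambda>J. P J * jc J i j))) J = Dx (Dx (\<lambda>J. Dx P J * jc J i j)) J + Dx (Dx (\<lambda>J. P J * jc J i (Suc j))) J" if "dfun \<Omega> D UNIV P" for P j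
    using Dx_pow_coord_mult[OF that J, of 2 i j] by (simp add: eval_nat_numeral)
  have 4: "Dx (Dx (Dx (Dx (\<lambda>J. P J * jc J i j)))) J = Dx (Dx (Dx (\<lambda>J. Dx P J * jc J i j))) J + Dx (Dx (Dx (\<lambda>J. P J * jc J i (Suc j)))) J" if "dfun \<Omega> D UNIV P" for P j
    using Dx_pow_coord_mult[OF that J, of 3 i j] by (simp add: eval_nat_numeral)
  note d = P dfun_Dx[OF P] dfun_Dx[OF dfun_Dx[OF P]] dfun_Dx[OF dfun_Dx[OF dfun_Dx[OF P]]]
  show "Dx (\<lambda>J. P J * jc J i j) J = Dx P J * jc J i j + P J * jc J i (Suc j)" by (rule 1[OF P])
  show "Dx (Dx (\<lambda>J. P J * jc J i j)) J = Dx (Dx P) J * jc J i j + 2 * Dx P J * jc J i (Suc j) + P J * jc J i (j + 2)"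
    by (simp add: 1[OF d(1)] 1[OF d(2)] 2[OF d(1)])
  show "Dx (Dx (Dx (\<lambda>J. P J * jc J i j))) J = Dx (Dx (Dx P)) J * jc J i j + 3 * Dx (Dx P) J * jc J i (Suc j)
       + 3 * Dx P J * jc J i (j + 2) + P J * jc J i (j + 3)"
    by (simp add: 1[OF d(1)] 1[OF d(2)] 1[OF d(3)] 2[OF d(1)] 2[OF d(2)] 3[OF d(1)] eval_nat_numeral)
  show "Dx (Dx (Dx (Dx (\<lambda>J. P J * jc J i j)))) J = Dx (Dx (Dx (Dx P))) J * jc J i j + 4 * Dx (Dx (Dx P)) J * jc J i (Suc j)
       + 6 * Dx (Dx P) J * jc J i (j + 2) + 4 * Dx P J * jc J i (j + 3) + P J * jc J i (j + 4)"
    by (simp add: 1[OF d(1)] 1[OF d(2)] 1[OF d(3)] 1[OF d(4)] 2[OF d(1)] 2[OF d(2)] 2[OF d(3)] 3[OF d(1)] 3[OF d(2)] 4[OF d(1)] eval_nat_numeral)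
qed

text \<open>The bracket of d/du with D_x is zero.\<close>

lemma jd_unit0_Dx:
  assumes "dfun \<Omega> D UNIV P" "J \<in> \<Omega>"
  shows "jd (Dx P) J (unit 0) = Dx (\<lambda>J. jd P J (unit 0)) J"
proof -
  have "bracket (\<lambda>J. unit 0) Xx J = (0, 0, \<lambda>i j. 0)"
    by (simp add: bracket_def jd_const jd_coord)
  then show ?thesis
    using commutator[OF assms(1) jfield_const[of "unit 0"] jfield_Xx assms(2)] by (simp add: Dx_fun jd_zero_direction)
qed

text \<open>\<open>D\<^sub>x\<^sup>3 f\<close> and, for \<open>u\<^sub>x\<^sub>x\<^sub>x\<^sub>x\<close> fixed, \<open>D\<^sub>x\<^sup>4 f\<close> are affine in \<open>u\<^sub>x\<^sub>x\<^sub>x\<close>.\<close>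

lemma Dx_pow_unit3:
  assumes f: "smooth_on f D" and J: "J \<in> \<Omega>"
  defines "P \<equiv> \<lambda>J. f (point_of_jet J)" and "Q \<equiv> \<lambda>J. pderiv_u f (point_of_jet J)"
  shows "jd (Dx (Dx (Dx P))) J (unit 3) = Q J" and "jd (Dx (Dx (Dx (Dx P)))) J (unit 3) = 4 * Dx Q J"
proof -
  have P0: "dfun \<Omega> D (low 0) P" unfolding P_def by (rule dfun.base[OF f])
  have low: "dfun \<Omega> D (low 0) P" "dfun \<Omega> D (low 1) (Dx P)" "dfun \<Omega> D (low 2) (Dx (Dx P))" "dfun \<Omega> D (low 3) (Dx (Dx (Dx P)))"
    using P0 dfun_Dx_low[OF P0] dfun_Dx_low[OF dfun_Dx_low[OF P0]] dfun_Dx_low[OF dfun_Dx_low[OF dfun_Dx_low[OF P0]]]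
    by (simp_all add: eval_nat_numeral)
  have U: "dfun \<Omega> D UNIV P" "dfun \<Omega> D UNIV (Dx P)" "dfun \<Omega> D UNIV (Dx (Dx P))" "dfun \<Omega> D UNIV (Dx (Dx (Dx P)))"
    using low dfun_mono[OF _ subset_UNIV] by blast+
  have smQ: "smooth_on (pderiv_u f) D" using smooth_on_frechet[OF f] by (simp add: pderiv_u_def[abs_def])
  have Q: "dfun \<Omega> D UNIV Q" unfolding Q_def by (rule dfun.base[OF smQ])
  have q0: "jd P J (unit 0) = Q J" if "J \<in> \<Omega>" for J
    unfolding P_def Q_def jd_base_split[OF f that] by (simp add: pderiv_u_def)
  have q1: "jd (Dx P) J (unit 1) = Q J" if "J \<in> \<Omega>" for J
    using jd_unit_Dx_top[OF low(1) that] q0[OF that] by simp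
  have q2: "jd (Dx (Dx P)) J (unit 2) = Q J" if "J \<in> \<Omega>" for J
    using jd_unit_Dx_top[OF low(2) that] q1[OF that] by (simp add: numeral_2_eq_2)
  have q3: "jd (Dx (Dx (Dx P))) J (unit 3) = Q J" if "J \<in> \<Omega>" for J
    using jd_unit_Dx_top[OF low(3) that] q2[OF that] by (simp add: numeral_3_eq_3 numeral_2_eq_2)
  have r0: "jd (Dx P) J (unit 0) = Dx Q J" if "J \<in> \<Omega>" for J
    unfolding jd_unit0_Dx[OF U(1) that] by (rule Dx_cong[OF Q that]) (simp add: q0)
  have r1: "jd (Dx (Dx P)) J (unit 1) = 2 * Dx Q J" if "J \<in> \<Omega>" for J
    using jd_unit_Dx[OF U(2) that, of 0] Dx_cong[OF Q that q1[symmetric]] r0[OF that] by simp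
  have r2: "jd (Dx (Dx (Dx P))) J (unit 2) = 3 * Dx Q J" if "J \<in> \<Omega>" for J
    using jd_unit_Dx[OF U(3) that, of 1] Dx_cong[OF Q that q2[symmetric]] r1[OF that] by (simp add: numeral_2_eq_2)
  show "jd (Dx (Dx (Dx P))) J (unit 3) = Q J" by (rule q3[OF J])
  show "jd (Dx (Dx (Dx (Dx P)))) J (unit 3) = 4 * Dx Q J"
    using jd_unit_Dx[OF U(4) J, of 2] Dx_cong[OF Q J q3[symmetric]] r2[OF J] by (simp add: numeral_3_eq_3 numeral_2_eq_2)
qed

end

context jets_vf begin

abbreviation "tauJ \<equiv> \<lambda>J. vtau V (point_of_jet J)"
abbreviation "xiJ \<equiv> \<lambda>J. vxi V (point_of_jet J)"
abbreviation "etaJ \<equiv> \<lambda>J. veta V (point_of_jet J)"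

text \<open>For the x-derivatives, apply Leibniz's rule to powers of D_x on the characteristic; the
  terms in which \<tau> and \<xi> are not differentiated cancel the transport terms of
  \<open>prol_coeff\<close>. The coefficient of u_t is the first step of the recursion
  \<open>Dt_prol\<close>.\<close>

lemma prol_explicit:
  assumes J: "J \<in> \<Omega>"
  shows "prol_coeff V 0 1 J = Dx etaJ J - Dx tauJ J * jc J 1 0 - Dx xiJ J * jc J 0 1"
    and "prol_coeff V 0 2 J = Dx (Dx etaJ) J - (Dx (Dx tauJ) J * jc J 1 0 + 2 * Dx tauJ J * jc J 1 1)
       - (Dx (Dx xiJ) J * jc J 0 1 + 2 * Dx xiJ J * jc J 0 2)"
    and "prol_coeff V 0 3 J = Dx (Dx (Dx etaJ)) J - (Dx (Dx (Dx tauJ)) J * jc J 1 0 + 3 * Dx (Dx tauJ) J * jc J 1 1 + 3 * Dx tauJ J * jc J 1 2)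
       - (Dx (Dx (Dx xiJ)) J * jc J 0 1 + 3 * Dx (Dx xiJ) J * jc J 0 2 + 3 * Dx xiJ J * jc J 0 3)"
    and "prol_coeff V 0 4 J = Dx (Dx (Dx (Dx etaJ))) J
       - (Dx (Dx (Dx (Dx tauJ))) J * jc J 1 0 + 4 * Dx (Dx (Dx tauJ)) J * jc J 1 1 + 6 * Dx (Dx tauJ) J * jc J 1 2 + 4 * Dx tauJ J * jc J 1 3)
       - (Dx (Dx (Dx (Dx xiJ))) J * jc J 0 1 + 4 * Dx (Dx (Dx xiJ)) J * jc J 0 2 + 6 * Dx (Dx xiJ) J * jc J 0 3 + 4 * Dx xiJ J * jc J 0 4)"
    and "prol_coeff V 1 0 J = Dt etaJ J - Dt tauJ J * jc J 1 0 - Dt xiJ J * jc J 0 1"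
proof -
  note d = dfun_components[of UNIV]
  have c: "dfun \<Omega> D UNIV (\<lambda>J. jc J i j)" for i j by (rule dfun.coord) simp
  let ?t = "\<lambda>J. (- vtau V (point_of_jet J)) * jc J 1 0" and ?x = "\<lambda>J. (- vxi V (point_of_jet J)) * jc J 0 1"
  have um: "dfun \<Omega> D UNIV (\<lambda>J. - vtau V (point_of_jet J))" "dfun \<Omega> D UNIV (\<lambda>J. - vxi V (point_of_jet J))"
    by (rule dfun_uminus[OF d(1)], rule dfun_uminus[OF d(2)])
  have dtx: "dfun \<Omega> D UNIV ?t" "dfun \<Omega> D UNIV ?x" by (rule dfun.mult[OF um(1) c], rule dfun.mult[OF um(2) c])
  have ch: "characteristic V = (\<lambda>J. (etaJ J + ?t J) + ?x J)" unfolding characteristic_eq by (rule ext) simp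
  have split: "(Dx ^^ n) (characteristic V) J = (Dx ^^ n) etaJ J + (Dx ^^ n) ?t J + (Dx ^^ n) ?x J" for n
    unfolding ch by (simp only: Dx_pow_add[OF dfun.add[OF d(3) dtx(1)] dtx(2) J] Dx_pow_add[OF d(3) dtx(1) J])
  have neg: "(Dx ^^ n) (\<lambda>J. - P J) J = - (Dx ^^ n) P J" if "dfun \<Omega> D UNIV P" for n P
  proof -
    have "(Dx ^^ n) (\<lambda>J. P J + - P J) J = (Dx ^^ n) (\<lambda>J. 0) J" by simp
    moreover have "(Dx ^^ n) (\<lambda>J. 0) = (\<lambda>J. 0)" by (induction n) (simp_all add: Dx_fun jd_const)
    ultimately show ?thesis using Dx_pow_add[OF that dfun_uminus[OF that] J, of n] by simp
  qed
  have n1: "Dx (\<lambda>J. - P J) J = - Dx P J" and n2: "Dx (Dx (\<lambda>J. - P J)) J = - Dx (Dx P) J"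
    and n3: "Dx (Dx (Dx (\<lambda>J. - P J))) J = - Dx (Dx (Dx P)) J" and n4: "Dx (Dx (Dx (Dx (\<lambda>J. - P J)))) J = - Dx (Dx (Dx (Dx P))) J"
    if "dfun \<Omega> D UNIV P" for P
    using neg[OF that, of 1] neg[OF that, of 2] neg[OF that, of 3] neg[OF that, of 4] by (simp_all add: eval_nat_numeral)
  note e = Dx_coord_mult[OF um(1) J, of 1 0] Dx_coord_mult[OF um(2) J, of 0 1] n1[OF d(1)] n2[OF d(1)] n3[OF d(1)] n4[OF d(1)]
    n1[OF d(2)] n2[OF d(2)] n3[OF d(2)] n4[OF d(2)]
  show "prol_coeff V 0 1 J = Dx etaJ J - Dx tauJ J * jc J 1 0 - Dx xiJ J * jc J 0 1"
    using split[of 1] e by (simp add: prol_coeff_eq eval_nat_numeral)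
  show "prol_coeff V 0 2 J = Dx (Dx etaJ) J - (Dx (Dx tauJ) J * jc J 1 0 + 2 * Dx tauJ J * jc J 1 1)
       - (Dx (Dx xiJ) J * jc J 0 1 + 2 * Dx xiJ J * jc J 0 2)"
    using split[of 2] e by (simp add: prol_coeff_eq eval_nat_numeral)
  show "prol_coeff V 0 3 J = Dx (Dx (Dx etaJ)) J - (Dx (Dx (Dx tauJ)) J * jc J 1 0 + 3 * Dx (Dx tauJ) J * jc J 1 1 + 3 * Dx tauJ J * jc J 1 2)
       - (Dx (Dx (Dx xiJ)) J * jc J 0 1 + 3 * Dx (Dx xiJ) J * jc J 0 2 + 3 * Dx xiJ J * jc J 0 3)"
    using split[of 3] e by (simp add: prol_coeff_eq eval_nat_numeral)
  show "prol_coeff V 0 4 J = Dx (Dx (Dx (Dx etaJ))) J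
       - (Dx (Dx (Dx (Dx tauJ))) J * jc J 1 0 + 4 * Dx (Dx (Dx tauJ)) J * jc J 1 1 + 6 * Dx (Dx tauJ) J * jc J 1 2 + 4 * Dx tauJ J * jc J 1 3)
       - (Dx (Dx (Dx (Dx xiJ))) J * jc J 0 1 + 4 * Dx (Dx (Dx xiJ)) J * jc J 0 2 + 6 * Dx (Dx xiJ) J * jc J 0 3 + 4 * Dx xiJ J * jc J 0 4)"
    using split[of 4] e by (simp add: prol_coeff_eq eval_nat_numeral)
  show "prol_coeff V 1 0 J = Dt etaJ J - Dt tauJ J * jc J 1 0 - Dt xiJ J * jc J 0 1"
    using Dt_prol[OF J, of 0 0] by (simp add: prol_00[abs_def])
qed

end

lemma base_open: "open N \<Longrightarrow> open (point_of_jet3 ` N)"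
proof -
  assume N: "open N"
  have "surj point_of_jet3" unfolding surj_def by (metis point_of_jet3.simps surj_pair)
  then show ?thesis
    using open_surjective_linear_image[OF N bounded_linear.linear[OF bounded_linear_point3]] by simp
qed

text \<open>The coordinate u_txxx enters Lie's criterion only through the prolongation coefficient
  of u_xxxx, as -4 (D_x \<tau>) u_txxx. It is free on the equation and F is non-zero, so D_x \<tau>
  = \<tau>_x + u_x \<tau>_u vanishes; varying u_x separates the two terms.\<close>

lemma admits_tau:
  assumes E: "evolution_equation E" and adm: "admits E V" and p: "p \<in> base E"
  shows "pderiv_x (vtau V) p = 0" "pderiv_u (vtau V) p = 0"
proof -
  let ?N = "edom E"
  have N: "open ?N" "open (base E)" using smooth_eqD(1)[OF E] base_open by (auto simp: base_def)
  have smV: "smooth_on V (base E)" using adm by (simp add: admits_def)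
  interpret jets "jets_over ?N" "base E" by (rule jets_over[OF N]) (simp add: base_def)
  interpret jets_vf "jets_over ?N" "base E" V by unfold_locales (rule smV)
  have key: "Dx tauJ (emb z) = 0" if z: "z \<in> ?N" for z
  proof -
    \<comment> \<open>With u_xxxx = 0 and u_t = G the jet lies on the equation for every value c of
      u_txxx.\<close>
    define J where "J c = (fst (emb z), fst (snd (emb z)), \<lambda>i j. if i = 1 \<and> j = 0 then eG E z else if i = 1 \<and> j = 3 then c else jc (emb z) i j)" for c
    have j3: "jet3_of_jet (J c) = z" for c
      using jet3_emb[of z] by (simp add: J_def jet3_of_jet_eq)
    have J: "J c \<in> jets_over ?N" for c using z j3 by (simp add: jets_over_def)
    have e4: "jc (J c) 0 4 = 0" for c by (simp add: J_def emb_def case_prod_unfold)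
    have sol: "eq_fun E (J c) = 0" for c unfolding eq_fun_eq j3 e4 by (simp add: J_def)
    have pr: "prolong V (eq_fun E) (J c) = 0" for c using adm sol j3 z unfolding admits_def by metis
    \<comment> \<open>All coordinates except u_txxx: functions over this set do not change with
      c.\<close>
    let ?L = "{(i, j) |i j. \<not> (i = Suc 0 \<and> j = 3)}"
    have loc: "P (J c) = P (J 0)" if "dfun (jets_over ?N) (base E) ?L P" for P c
      by (rule dfun_local[OF that J J]) (auto simp: J_def point_of_jet_eq)
    have lL: "low k \<subseteq> ?L" for k by (auto simp: low_def)
    have dl: "dfun (jets_over ?N) (base E) ?L (\<lambda>J. f (point_of_jet J))" "dfun (jets_over ?N) (base E) ?L (Dx (\<lambda>J. f (point_of_jet J)))"
      "dfun (jets_over ?N) (base E) ?L (Dx (Dx (\<lambda>J. f (point_of_jet J))))" "dfun (jets_over ?N) (base E) ?L (Dx (Dx (Dx (\<lambda>J. f (point_of_jet J)))))"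
      "dfun (jets_over ?N) (base E) ?L (Dx (Dx (Dx (Dx (\<lambda>J. f (point_of_jet J))))))" "dfun (jets_over ?N) (base E) ?L (Dt (\<lambda>J. f (point_of_jet J)))"
      if f: "smooth_on f (base E)" for f
    proof -
      note a = dfun.base[OF f, of "jets_over ?N" "low 0"]
      note b = dfun_Dx_low[OF a] note c = dfun_Dx_low[OF b] note d = dfun_Dx_low[OF c] note e = dfun_Dx_low[OF d]
      show "dfun (jets_over ?N) (base E) ?L (\<lambda>J. f (point_of_jet J))" by (rule dfun_mono[OF a lL])
      show "dfun (jets_over ?N) (base E) ?L (Dx (\<lambda>J. f (point_of_jet J)))" by (rule dfun_mono[OF b lL])
      show "dfun (jets_over ?N) (base E) ?L (Dx (Dx (\<lambda>J. f (point_of_jet J))))" by (rule dfun_mono[OF c lL])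
      show "dfun (jets_over ?N) (base E) ?L (Dx (Dx (Dx (\<lambda>J. f (point_of_jet J)))))" by (rule dfun_mono[OF d lL])
      show "dfun (jets_over ?N) (base E) ?L (Dx (Dx (Dx (Dx (\<lambda>J. f (point_of_jet J))))))" by (rule dfun_mono[OF e lL])
      show "dfun (jets_over ?N) (base E) ?L (Dt (\<lambda>J. f (point_of_jet J)))"
        unfolding Dt_fun by (rule dfun_jd[OF dfun.base[OF f, of _ "{}"]]) (auto intro: dfun_const dfun.coord)
    qed
    have cJ: "jc (J c) i j = jc (J 0) i j" if "\<not> (i = 1 \<and> j = 3)" for c i j
      unfolding J_def by (simp only: snd_conv that if_False)
    note l = loc[OF dl(1)] loc[OF dl(2)] loc[OF dl(3)] loc[OF dl(4)] loc[OF dl(5)] loc[OF dl(6)]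
    note ll = l[OF smooth_components(1)] l[OF smooth_components(2)] l[OF smooth_components(3)]
    have same: "prol_coeff V 0 1 (J c) = prol_coeff V 0 1 (J 0)" "prol_coeff V 0 2 (J c) = prol_coeff V 0 2 (J 0)"
      "prol_coeff V 0 3 (J c) = prol_coeff V 0 3 (J 0)" "prol_coeff V 1 0 (J c) = prol_coeff V 1 0 (J 0)"
      "prol_coeff V 0 0 (J c) = prol_coeff V 0 0 (J 0)" for c
      unfolding prol_explicit[OF J] prol_00 using ll[of c] cJ[of _ _ c] by simp_all
    have diff: "prol_coeff V 0 4 (J c) = prol_coeff V 0 4 (J 0) - 4 * Dx tauJ (J 0) * c" for c
      unfolding prol_explicit[OF J] using ll[of c] cJ[of _ _ c] by (simp add: J_def)
    have t3: "tangent3 (pv V (J c)) = tangent3 (pv V (J 0))" for c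
      unfolding tangent3_def pv_simps using same[of c] ll[of c] by simp
    have "prolong V (eq_fun E) (J 1) - prolong V (eq_fun E) (J 0) = 4 * Dx tauJ (J 0) * eF E z"
      using prolong_eq_fun[OF E, of "J 1" V] prolong_eq_fun[OF E, of "J 0" V] z
      unfolding j3 t3[of 1] same[of 1] diff[of 1] e4 by (simp add: algebra_simps)
    then have "Dx tauJ (J 0) = 0" using pr smooth_eqD(4)[OF E z] by simp
    moreover have "Dx tauJ (J 0) = Dx tauJ (emb z)"
    proof (rule dfun_local[OF dfun_Dx_low[OF dfun.base[OF smooth_components(1), of _ "low 0"]] J])
      show "emb z \<in> jets_over ?N" using z by (simp add: jets_over_def)
    qed (auto simp: J_def point_of_jet_eq low_def)
    ultimately show ?thesis by simp
  qed
  obtain z where z: "z \<in> ?N" "p = point_of_jet3 z" using p by (auto simp: base_def)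
  obtain t x u u1 u2 u3 where zz: "z = (t, x, u, u1, u2, u3)" by (metis surj_pair)
  have expand: "Dx tauJ (emb (t, x, u, v, u2, u3)) = pderiv_x (vtau V) p + v * pderiv_u (vtau V) p" if "(t, x, u, v, u2, u3) \<in> ?N" for v
  proof -
    have "emb (t, x, u, v, u2, u3) \<in> jets_over ?N" using that by (simp add: jets_over_def)
    from jd_base_split[OF smooth_components(1) this, of "Xx (emb (t, x, u, v, u2, u3))"] show ?thesis
      using z zz by (simp add: Dx_jd point_emb pderiv_x_def pderiv_u_def emb_def)
  qed
  \<comment> \<open>Openness of the domain supplies a second value of u_x over the same
    point.\<close>
  have lim: "((\<lambda>h. z + h *\<^sub>R (0, 0, 0, 1, 0, 0)) \<longlongrightarrow> z + 0 *\<^sub>R (0, 0, 0, 1, 0, 0)) (at (0::real))" by (intro tendsto_intros)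
  have "\<forall>\<^sub>F h in at (0::real). z + h *\<^sub>R (0, 0, 0, 1, 0, 0) \<in> ?N"
    by (rule topological_tendstoD[OF lim N(1)]) (use z(1) in \<open>simp only: scaleR_zero_left add_0_right\<close>)
  then have "\<forall>\<^sub>F h in at (0::real). h \<noteq> 0 \<and> z + h *\<^sub>R (0, 0, 0, 1, 0, 0) \<in> ?N"
    by (auto simp: eventually_at_filter elim: eventually_mono)
  then obtain h :: real where h: "h \<noteq> 0" "z + h *\<^sub>R (0, 0, 0, 1, 0, 0) \<in> ?N" using eventually_happens' trivial_limit_at by blast
  have 1: "pderiv_x (vtau V) p + u1 * pderiv_u (vtau V) p = 0" using expand[of u1] key z zz by simp
  have 2: "pderiv_x (vtau V) p + (u1 + h) * pderiv_u (vtau V) p = 0"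
    using expand[of "u1 + h"] key[OF h(2)] h(2) zz by simp
  have "h * pderiv_u (vtau V) p = 0" using 1 2 by algebra
  then show "pderiv_u (vtau V) p = 0" using h(1) by simp
  then show "pderiv_x (vtau V) p = 0" using 1 by simp
qed

section \<open>Straightening of vector fields\<close>

text \<open>The coordinates g invert the map that sends q to the flow for time l q started at p0 + L
  q: l is the time coordinate, L parametrises a transversal through \<open>p0\<close>, and e is the
  coordinate direction of the flow. The last clause retains the integral curve from the transversal
  to p, along which the first coordinate of g is identified later.\<close>

lemma flow_box:
  fixes v :: "'e::euclidean_space \<Rightarrow> 'e"
  assumes S: "open S" "p0 \<in> S" and v: "smooth_on v S"
    and l: "bounded_linear (l :: 'e \<Rightarrow> real)" and L: "bounded_linear (L :: 'e \<Rightarrow> 'e)"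
    and e: "l e = 1" "L e = 0"
    and inj: "\<And>q. l q *\<^sub>R v p0 + L q = 0 \<Longrightarrow> q = 0"
  obtains B g where "open B" "p0 \<in> B" "B \<subseteq> S" "smooth_on g B" "inj_on g B"
    "\<And>p. p \<in> B \<Longrightarrow> frechet_derivative g (at p) (v p) = e"
    "\<And>p w. p \<in> B \<Longrightarrow> frechet_derivative g (at p) w = 0 \<Longrightarrow> w = 0"
    "\<And>p. p \<in> B \<Longrightarrow> \<exists>a>0. \<exists>c. c 0 = p0 + L (g p) \<and> c (l (g p)) = p \<and> \<bar>l (g p)\<bar> < a \<and>
       (\<forall>s\<in>{-a<..<a}. c s \<in> S \<and> (c has_vector_derivative v (c s)) (at s))"
proof -
  obtain a r \<phi> where \<phi>: "a > 0" "r > 0" "smooth_on \<phi> ({-a<..<a} \<times> ball p0 r)"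
    "\<And>p. p \<in> ball p0 r \<Longrightarrow> \<phi> (0, p) = p"
    "\<And>s p. s \<in> {-a<..<a} \<Longrightarrow> p \<in> ball p0 r \<Longrightarrow> \<phi> (s, p) \<in> S"
    "\<And>s p. s \<in> {-a<..<a} \<Longrightarrow> p \<in> ball p0 r \<Longrightarrow> ((\<lambda>s. \<phi> (s, p)) has_vector_derivative v (\<phi> (s, p))) (at s)"
    by (rule smooth_flow[OF S v]) (rule that; assumption)
  let ?\<Omega> = "{-a<..<a} \<times> ball p0 r"
  have \<Omega>: "open ?\<Omega>" by (intro open_Times) auto
  define k where "k q = (l q, p0 + L q)" for q
  have dk: "(k has_derivative (\<lambda>w. (l w, L w))) (at q)" for q
    unfolding k_def[abs_def]
    by (auto intro!: derivative_eq_intros bounded_linear_imp_has_derivative[OF l] bounded_linear_imp_has_derivative[OF L])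
  have smk: "smooth_on k T" if "open T" for T
    unfolding k_def[abs_def] by (intro smooth_on_Pair smooth_on_add smooth_on_const smooth_on_bounded_linear l L that)
  have contk: "continuous_on UNIV k" using smooth_on_continuous_on[OF smk] by blast
  define Q where "Q = k -` ?\<Omega>"
  have Q: "open Q" unfolding Q_def by (rule open_vimage[OF \<Omega> contk])
  have k0: "k 0 = (0, p0)" using linear_0[OF bounded_linear.linear[OF l]] linear_0[OF bounded_linear.linear[OF L]] by (simp add: k_def)
  have Q0: "0 \<in> Q" unfolding Q_def using k0 \<phi>(1,2) by simp
  define \<Psi> where "\<Psi> q = \<phi> (k q)" for q
  have sm\<Psi>: "smooth_on \<Psi> Q"
    unfolding \<Psi>_def[abs_def] by (rule smooth_on_compose[OF Q \<Omega> _ smk[OF Q] \<phi>(3)]) (auto simp: Q_def)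
  have h\<phi>: "(\<phi> has_derivative frechet_derivative \<phi> (at x)) (at x)" if "x \<in> ?\<Omega>" for x
    using smooth_on_has_derivative[OF \<phi>(3) that] .
  have d\<Psi>: "(\<Psi> has_derivative (\<lambda>w. frechet_derivative \<phi> (at (k q)) (l w, L w))) (at q)" if "q \<in> Q" for q
    unfolding \<Psi>_def[abs_def] by (rule has_derivative_compose[OF dk h\<phi>]) (use that in \<open>simp add: Q_def\<close>)
  have time: "frechet_derivative \<phi> (at (s, p)) (1, 0) = v (\<phi> (s, p))" if "(s, p) \<in> ?\<Omega>" for s p
  proof -
    have "((\<lambda>s. \<phi> (s, p)) has_derivative (\<lambda>h. h *\<^sub>R v (\<phi> (s, p)))) (at s)"
      using \<phi>(6)[of s p] that by (simp add: has_vector_derivative_def)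
    from frechet_directional[OF this, of 1] frechet_directional[OF h\<phi>[OF that], of "(1, 0)"]
    show ?thesis using vector_derivative_unique_at by fastforce
  qed
  have d\<Psi>e: "frechet_derivative \<Psi> (at q) e = v (\<Psi> q)" if "q \<in> Q" for q
    using time[of "l q" "p0 + L q"] that e
    unfolding frechet_derivative_at[OF d\<Psi>[OF that], symmetric] by (simp add: Q_def k_def \<Psi>_def)
  have space: "frechet_derivative \<phi> (at (0, p0)) (0, w) = w" for w
  proof -
    have x0: "(0, p0) \<in> ?\<Omega>" using \<phi>(1,2) by simp
    have 1: "((\<lambda>h. \<phi> (0, p0 + h *\<^sub>R w)) has_vector_derivative frechet_derivative \<phi> (at (0, p0)) (0, w)) (at 0)"
      using frechet_directional[OF h\<phi>[OF x0], of "(0, w)"] by simp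
    have "((\<lambda>h. p0 + h *\<^sub>R w) \<longlongrightarrow> p0 + 0 *\<^sub>R w) (nhds (0::real))" by (intro tendsto_intros filterlim_ident)
    then have "\<forall>\<^sub>F h in nhds (0::real). p0 + h *\<^sub>R w \<in> ball p0 r"
      using topological_tendstoD[OF _ open_ball, of _ p0] \<phi>(2) by fastforce
    then have ev: "\<forall>\<^sub>F h in nhds (0::real). \<phi> (0, p0 + h *\<^sub>R w) = p0 + h *\<^sub>R w"
      by eventually_elim (rule \<phi>(4))
    have "((\<lambda>h. p0 + h *\<^sub>R w) has_vector_derivative w) (at 0)" by (auto intro!: derivative_eq_intros)
    then have "((\<lambda>h. \<phi> (0, p0 + h *\<^sub>R w)) has_vector_derivative w) (at 0)"
      using has_vector_derivative_cong_ev[OF ev[THEN eventually_mono, of "\<lambda>h. h \<in> UNIV \<longrightarrow> \<phi> (0, p0 + h *\<^sub>R w) = p0 + h *\<^sub>R w"], of w]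
        eventually_nhds_x_imp_x[OF ev] by simp
    with 1 show ?thesis using vector_derivative_unique_at by blast
  qed
  have inj0: "w = 0" if w: "frechet_derivative \<Psi> (at 0) w = 0" for w
  proof (rule inj)
    have x0: "(0, p0) \<in> ?\<Omega>" using \<phi>(1,2) by simp
    have lin: "linear (frechet_derivative \<phi> (at (0, p0)))" using has_derivative_linear[OF h\<phi>[OF x0]] .
    have "(l w, L w) = l w *\<^sub>R (1, 0) + (0, L w)" by simp
    then have "frechet_derivative \<phi> (at (0, p0)) (l w, L w) = l w *\<^sub>R v p0 + L w"
      using linear_add[OF lin, of "l w *\<^sub>R (1, 0)" "(0, L w)"] linear_cmul[OF lin, of "l w" "(1, 0)"] time[OF x0] \<phi>(4)[of p0] space[of "L w"] \<phi>(2)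
      by simp
    then show "l w *\<^sub>R v p0 + L w = 0" using w unfolding frechet_derivative_at[OF d\<Psi>[OF Q0], symmetric] k0 by simp
  qed
  obtain U W g where g: "open U" "0 \<in> U" "U \<subseteq> Q" "open W" "homeomorphism U W \<Psi> g" "smooth_on g W"
    by (rule smooth_inverse_function[OF Q Q0 sm\<Psi> inj0], assumption) (rule that; assumption)
  have \<Psi>0: "\<Psi> 0 = p0" using k0 \<phi>(2,4) by (simp add: \<Psi>_def)
  have gW: "g p \<in> U" "\<Psi> (g p) = p" if "p \<in> W" for p using g(5) that by (auto simp: homeomorphism_def)
  have gU: "g (\<Psi> q) = q" "\<Psi> q \<in> W" if "q \<in> U" for q using g(5) that by (auto simp: homeomorphism_def)
  have hg: "(g has_derivative frechet_derivative g (at p)) (at p)" if "p \<in> W" for p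
    using smooth_on_has_derivative[OF g(6) that] .
  have h\<Psi>: "(\<Psi> has_derivative frechet_derivative \<Psi> (at q)) (at q)" if "q \<in> U" for q
    using smooth_on_has_derivative[OF sm\<Psi>] that g(3) by blast
  have inv1: "frechet_derivative g (at p) (frechet_derivative \<Psi> (at (g p)) w) = w" if p: "p \<in> W" for p w
  proof -
    have "(g has_derivative frechet_derivative g (at p)) (at (\<Psi> (g p)))" using hg[OF p] gW(2)[OF p] by simp
    from has_derivative_compose[OF h\<Psi>[OF gW(1)[OF p]] this]
    have "((\<lambda>q. g (\<Psi> q)) has_derivative (\<lambda>w. frechet_derivative g (at p) (frechet_derivative \<Psi> (at (g p)) w))) (at (g p))" .
    moreover have "((\<lambda>q. g (\<Psi> q)) has_derivative (\<lambda>w. w)) (at (g p))"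
      by (rule has_derivative_transform_within_open[OF has_derivative_ident g(1) gW(1)[OF p]]) (simp add: gU)
    ultimately show ?thesis using has_derivative_unique by metis
  qed
  have inv2: "frechet_derivative \<Psi> (at (g p)) (frechet_derivative g (at p) w) = w" if p: "p \<in> W" for p w
  proof -
    from has_derivative_compose[OF hg[OF p] h\<Psi>[OF gW(1)[OF p]]]
    have "((\<lambda>p. \<Psi> (g p)) has_derivative (\<lambda>w. frechet_derivative \<Psi> (at (g p)) (frechet_derivative g (at p) w))) (at p)" .
    moreover have "((\<lambda>p. \<Psi> (g p)) has_derivative (\<lambda>w. w)) (at p)"
      by (rule has_derivative_transform_within_open[OF has_derivative_ident g(4) p]) (simp add: gW)
    ultimately show ?thesis using has_derivative_unique by metis
  qed
  show ?thesis
  proof (rule that[of W g])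
    show "p0 \<in> W" using gU(2)[OF g(2)] \<Psi>0 by simp
    have kin: "k (g p) \<in> ?\<Omega>" if "p \<in> W" for p using gW(1)[OF that] g(3) by (auto simp: Q_def)
    show "W \<subseteq> S"
    proof
      fix p assume p: "p \<in> W"
      have "\<phi> (l (g p), p0 + L (g p)) \<in> S" by (rule \<phi>(5)) (use kin[OF p] in \<open>auto simp: k_def\<close>)
      then show "p \<in> S" using gW(2)[OF p] by (simp add: \<Psi>_def k_def)
    qed
    show "inj_on g W" using gW(2) by (metis inj_onI)
    show "frechet_derivative g (at p) (v p) = e" if "p \<in> W" for p
      using inv1[OF that, of e] d\<Psi>e[of "g p"] gW[OF that] g(3) by auto
    show "w = 0" if "p \<in> W" "frechet_derivative g (at p) w = 0" for p w
      using inv2[OF that(1), of w] that(2) linear_0[OF has_derivative_linear[OF h\<Psi>[OF gW(1)[OF that(1)]]]] by simp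
    show "\<exists>a>0. \<exists>c. c 0 = p0 + L (g p) \<and> c (l (g p)) = p \<and> \<bar>l (g p)\<bar> < a \<and>
       (\<forall>s\<in>{-a<..<a}. c s \<in> S \<and> (c has_vector_derivative v (c s)) (at s))" if p: "p \<in> W" for p
    proof (intro exI[of _ a] exI[of _ "\<lambda>s. \<phi> (s, p0 + L (g p))"] conjI ballI)
      have k: "l (g p) \<in> {-a<..<a}" "p0 + L (g p) \<in> ball p0 r" using kin[OF p] by (auto simp: k_def)
      show "\<phi> (0, p0 + L (g p)) = p0 + L (g p)" by (rule \<phi>(4)[OF k(2)])
      show "\<phi> (l (g p), p0 + L (g p)) = p" using gW(2)[OF p] by (simp add: \<Psi>_def k_def)
      show "\<bar>l (g p)\<bar> < a" using k(1) by auto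
      show "\<phi> (s, p0 + L (g p)) \<in> S" if "s \<in> {-a<..<a}" for s by (rule \<phi>(5)[OF that k(2)])
      show "((\<lambda>s. \<phi> (s, p0 + L (g p))) has_vector_derivative v (\<phi> (s, p0 + L (g p)))) (at s)" if "s \<in> {-a<..<a}" for s
        by (rule \<phi>(6)[OF that k(2)])
    qed (rule \<phi>(1))
  qed (use g in auto)
qed

text \<open>U is constant along V, so replacing X by X + k U leaves the pushforward unchanged. If
  D_x X vanished for k = 0 and k = 1, then D_x would annihilate both X and U, contradicting the
  Jacobian.\<close>

lemma shear:
  assumes \<Phi>: "point_transformation \<Phi> D" and push: "pushes_forward \<Phi> D V (\<lambda>p. (cT, cX, 0))" and z: "point_of_jet3 z \<in> D"
  obtains \<Phi>' where "point_transformation \<Phi>' D" "pushes_forward \<Phi>' D V (\<lambda>p. (cT, cX, 0))"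
    "Dx (pX \<Phi>' \<circ> point_of_jet) (emb z) \<noteq> 0"
proof -
  have D: "open D" and sm: "smooth_on (pX \<Phi>) D" "smooth_on (pU \<Phi>) D" using \<Phi> by (auto simp: point_transformation_def)
  define N where "N = point_of_jet3 -` D"
  have N: "open N" "point_of_jet3 ` N \<subseteq> D" "z \<in> N"
    using open_vimage[OF D linear_continuous_on[OF bounded_linear_point3]] z by (auto simp: N_def)
  interpret jets "jets_over N" D by (rule jets_over[OF N(1) D N(2)])
  define \<Phi>k where "\<Phi>k k = \<Phi>\<lparr>pX := \<lambda>p. pX \<Phi> p + k * pU \<Phi> p\<rparr>" for k
  have fr: "frechet_derivative (pX (\<Phi>k k)) (at p) w = frechet_derivative (pX \<Phi>) (at p) w + k * frechet_derivative (pU \<Phi>) (at p) w"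
    if "p \<in> D" for k p w
  proof -
    have "(pX (\<Phi>k k) has_derivative (\<lambda>w. frechet_derivative (pX \<Phi>) (at p) w + k * frechet_derivative (pU \<Phi>) (at p) w)) (at p)"
      unfolding \<Phi>k_def
      by (simp, intro has_derivative_add has_derivative_mult_right smooth_on_has_derivative[OF sm(1) that] smooth_on_has_derivative[OF sm(2) that])
    from frechet_derivative_at[OF this] show ?thesis by metis
  qed
  have pt: "point_transformation (\<Phi>k k) D" for k
    unfolding point_transformation_def
  proof (intro conjI ballI)
    show "smooth_on (pX (\<Phi>k k)) D"
      unfolding \<Phi>k_def by (simp, intro smooth_on_add smooth_on_mult D sm smooth_on_const)
    show "pderiv_x (pX (\<Phi>k k)) p * pderiv_u (pU (\<Phi>k k)) p - pderiv_u (pX (\<Phi>k k)) p * pderiv_x (pU (\<Phi>k k)) p \<noteq> 0" if p: "p \<in> D" for p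
    proof -
      have "pderiv_x (pX (\<Phi>k k)) p * pderiv_u (pU (\<Phi>k k)) p - pderiv_u (pX (\<Phi>k k)) p * pderiv_x (pU (\<Phi>k k)) p
         = pderiv_x (pX \<Phi>) p * pderiv_u (pU \<Phi>) p - pderiv_u (pX \<Phi>) p * pderiv_x (pU \<Phi>) p"
        unfolding pderiv_x_def pderiv_u_def fr[OF p] by (simp add: \<Phi>k_def algebra_simps)
      then show ?thesis using \<Phi> p by (simp add: point_transformation_def)
    qed
    show "inj_on (pmap (\<Phi>k k)) D"
    proof (rule inj_onI)
      fix p q assume pq: "p \<in> D" "q \<in> D" "pmap (\<Phi>k k) p = pmap (\<Phi>k k) q"
      then have "pmap \<Phi> p = pmap \<Phi> q" by (auto simp: pmap_def \<Phi>k_def)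
      then show "p = q" using \<Phi> pq(1,2) unfolding point_transformation_def by (auto dest: inj_onD)
    qed
  qed (use \<Phi> in \<open>auto simp: point_transformation_def \<Phi>k_def\<close>)
  have pk: "pushes_forward (\<Phi>k k) D V (\<lambda>p. (cT, cX, 0))" for k
    unfolding pushes_forward_def
  proof
    fix p assume p: "p \<in> D"
    have "frechet_derivative (pmap \<Phi>) (at p) (V p) = (cT, cX, 0)" using push p by (simp add: pushes_forward_def)
    then show "frechet_derivative (pmap (\<Phi>k k)) (at p) (V p) = (cT, cX, 0)"
      unfolding pmap_frechet[OF \<Phi> p] pmap_frechet[OF pt p] fr[OF p] by (simp add: \<Phi>k_def)
  qed
  have J: "emb z \<in> jets_over N" using N(3) by (simp add: jets_over_def)
  let ?p = "point_of_jet (emb z)" and ?u = "jc (emb z) 0 1"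
  have pD: "?p \<in> D" using z by (simp add: point_emb)
  have dx: "Dx (pX (\<Phi>k k) \<circ> point_of_jet) (emb z) = (pderiv_x (pX \<Phi>) ?p + k * pderiv_x (pU \<Phi>) ?p) + ?u * (pderiv_u (pX \<Phi>) ?p + k * pderiv_u (pU \<Phi>) ?p)" for k
  proof -
    have smk: "smooth_on (pX (\<Phi>k k)) D" using pt by (simp add: point_transformation_def)
    show ?thesis
      unfolding Dx_jd o_def jd_base_split[OF smk J] fr[OF pD] by (simp add: pderiv_x_def pderiv_u_def)
  qed
  have det: "pderiv_x (pX \<Phi>) ?p * pderiv_u (pU \<Phi>) ?p - pderiv_u (pX \<Phi>) ?p * pderiv_x (pU \<Phi>) ?p \<noteq> 0"
    using \<Phi> pD by (simp add: point_transformation_def)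
  show ?thesis
  proof (cases "Dx (pX (\<Phi>k 0) \<circ> point_of_jet) (emb z) = 0")
    case False
    then show ?thesis using that pt pk by blast
  next
    case True
    have "Dx (pX (\<Phi>k 1) \<circ> point_of_jet) (emb z) \<noteq> 0"
    proof
      assume "Dx (pX (\<Phi>k 1) \<circ> point_of_jet) (emb z) = 0"
      then have X: "pderiv_x (pX \<Phi>) ?p = - ?u * pderiv_u (pX \<Phi>) ?p" and U: "pderiv_x (pU \<Phi>) ?p = - ?u * pderiv_u (pU \<Phi>) ?p"
        using True unfolding dx by (simp_all add: algebra_simps)
      show False using det unfolding X U by simp
    qed
    then show ?thesis using that pt pk by blast
  qed
qed

text \<open>A first component that is a function of t alone makes g fibre-preserving. Injectivity of
  the derivative of g then forces a non-zero Jacobian in (x, u), since vectors without t-component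
  are mapped to such vectors.\<close>

lemma box_transformation:
  assumes B: "open B" "B \<noteq> {}" and g: "smooth_on g B" "inj_on g B"
    and inj: "\<And>p w. p \<in> B \<Longrightarrow> frechet_derivative g (at p) w = 0 \<Longrightarrow> w = 0"
    and push: "\<And>p. p \<in> B \<Longrightarrow> frechet_derivative g (at p) (V p) = e"
    and T: "smooth_on T (fst ` B)" "\<And>p. p \<in> B \<Longrightarrow> deriv T (fst p) \<noteq> 0" "\<And>p. p \<in> B \<Longrightarrow> T (fst p) = fst (g p)"
  shows "\<exists>\<Phi>. point_transformation \<Phi> B \<and> pushes_forward \<Phi> B V (\<lambda>p. e)"
proof -
  define \<Phi> where "\<Phi> = \<lparr>pT = T, pX = (\<lambda>p. fst (snd (g p))), pU = (\<lambda>p. snd (snd (g p)))\<rparr>"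
  have hg: "(g has_derivative frechet_derivative g (at p)) (at p)" if "p \<in> B" for p
    using smooth_on_has_derivative[OF g(1) that] .
  have lin: "linear (frechet_derivative g (at p))" if "p \<in> B" for p using has_derivative_linear[OF hg[OF that]] .
  have bl: "bounded_linear (\<lambda>q::point. fst (snd q))" "bounded_linear (\<lambda>q::point. snd (snd q))" "bounded_linear (\<lambda>q::point. fst q)"
    by (intro bounded_linear_fst_comp bounded_linear_snd_comp bounded_linear_snd bounded_linear_fst)+
  have sm: "smooth_on (pX \<Phi>) B" "smooth_on (pU \<Phi>) B" "smooth_on (\<lambda>p. fst (g p)) B"
    unfolding \<Phi>_def using smooth_on_compose_linear[OF B(1) bl(1) g(1)] smooth_on_compose_linear[OF B(1) bl(2) g(1)]
      smooth_on_compose_linear[OF B(1) bl(3) g(1)] by simp_all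
  have fX: "frechet_derivative (pX \<Phi>) (at p) w = fst (snd (frechet_derivative g (at p) w))"
    and fU: "frechet_derivative (pU \<Phi>) (at p) w = snd (snd (frechet_derivative g (at p) w))"
    and f1: "frechet_derivative (\<lambda>p. fst (g p)) (at p) w = fst (frechet_derivative g (at p) w)" if p: "p \<in> B" for p w
    using fun_cong[OF frechet_derivative_at[OF bounded_linear.has_derivative[OF bl(1) hg[OF p]]], of w]
      fun_cong[OF frechet_derivative_at[OF bounded_linear.has_derivative[OF bl(2) hg[OF p]]], of w]
      fun_cong[OF frechet_derivative_at[OF bounded_linear.has_derivative[OF bl(3) hg[OF p]]], of w]
    unfolding \<Phi>_def by simp_all
  have pm: "pmap \<Phi> p = g p" if "p \<in> B" for p using T(3)[OF that] by (simp add: pmap_def \<Phi>_def)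
  have det: "pderiv_x (pX \<Phi>) p * pderiv_u (pU \<Phi>) p - pderiv_u (pX \<Phi>) p * pderiv_x (pU \<Phi>) p \<noteq> 0" if p: "p \<in> B" for p
  proof
    assume z: "pderiv_x (pX \<Phi>) p * pderiv_u (pU \<Phi>) p - pderiv_u (pX \<Phi>) p * pderiv_x (pU \<Phi>) p = 0"
    have F: "frechet_derivative g (at p) (0, b, c) =
       (0, b * pderiv_x (pX \<Phi>) p + c * pderiv_u (pX \<Phi>) p, b * pderiv_x (pU \<Phi>) p + c * pderiv_u (pU \<Phi>) p)" for b c
    proof -
      have "(0, b, c) = b *\<^sub>R (0::real, 1::real, 0::real) + c *\<^sub>R (0, 0, 1)" by simp
      then have "frechet_derivative g (at p) (0, b, c) = b *\<^sub>R frechet_derivative g (at p) (0, 1, 0) + c *\<^sub>R frechet_derivative g (at p) (0, 0, 1)"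
        by (simp only: linear_add[OF lin[OF p]] linear_cmul[OF lin[OF p]])
      moreover have "fst (frechet_derivative g (at p) (0, b, c)) = 0"
        unfolding f1[OF p, symmetric]
        by (rule derivative_zero_direction[OF B(1) p sm(3)]) (use T(3) p in \<open>simp flip: T(3)\<close>)
      ultimately show ?thesis
        unfolding pderiv_x_def pderiv_u_def fX[OF p] fU[OF p] by (simp add: prod_eq_iff)
    qed
    \<comment> \<open>With a vanishing determinant these cofactor vectors lie in the kernel of the
      derivative: first the derivatives of U vanish, then those of X, and finally the x-direction
      itself is in the kernel.\<close>
    have "frechet_derivative g (at p) (0, pderiv_u (pU \<Phi>) p, - pderiv_x (pU \<Phi>) p) = 0"
      using z unfolding F by (simp add: zero_prod_def algebra_simps)
    from inj[OF p this] have U: "pderiv_u (pU \<Phi>) p = 0" "pderiv_x (pU \<Phi>) p = 0" by (auto simp: zero_prod_def)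
    have "frechet_derivative g (at p) (0, pderiv_u (pX \<Phi>) p, - pderiv_x (pX \<Phi>) p) = 0"
      using z U unfolding F by (simp add: zero_prod_def algebra_simps)
    from inj[OF p this] have X: "pderiv_u (pX \<Phi>) p = 0" "pderiv_x (pX \<Phi>) p = 0" by (auto simp: zero_prod_def)
    have "frechet_derivative g (at p) (0, 1, 0) = 0" unfolding F using U X by (simp add: zero_prod_def)
    from inj[OF p this] show False by (simp add: zero_prod_def)
  qed
  have pt: "point_transformation \<Phi> B"
    unfolding point_transformation_def
  proof (intro conjI ballI)
    show "inj_on (pmap \<Phi>) B" using g(2) pm by (metis inj_on_cong)
  qed (use B T sm det in \<open>auto simp: \<Phi>_def\<close>)
  have "pushes_forward \<Phi> B V (\<lambda>p. e)"
    unfolding pushes_forward_def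
  proof
    fix p assume p: "p \<in> B"
    have "(pmap \<Phi> has_derivative frechet_derivative g (at p)) (at p)"
      by (rule has_derivative_transform_within_open[OF hg[OF p] B(1) p]) (simp add: pm)
    then show "frechet_derivative (pmap \<Phi>) (at p) (V p) = e" using frechet_derivative_at push[OF p] by metis
  qed
  then show ?thesis using pt by blast
qed

text \<open>With \<tau> = 0 the flow preserves t, so the first box coordinate is t minus its value
  at \<open>p0\<close>.\<close>

lemma straighten_case_x:
  assumes S: "open S" "p0 \<in> S" and V: "smooth_on V S" and t0: "\<And>p. p \<in> S \<Longrightarrow> vtau V p = 0"
    and nz: "vxi V p0 \<noteq> 0 \<or> veta V p0 \<noteq> 0"
  obtains \<Phi> B where "p0 \<in> B" "B \<subseteq> S" "point_transformation \<Phi> B" "pushes_forward \<Phi> B V (\<lambda>p. (0, 1, 0))"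
proof -
  \<comment> \<open>The transversal is a slice of constant x where \<xi> is non-zero, and otherwise
    one of constant u, where \<eta> is non-zero. Both keep the t-component of q.\<close>
  define L where "L = (if vxi V p0 \<noteq> 0 then (\<lambda>q::point. (fst q, 0::real, snd (snd q))) else (\<lambda>q. (fst q, snd (snd q), 0)))"
  have L: "bounded_linear L"
    unfolding L_def by (auto intro!: bounded_linear_Pair bounded_linear_fst bounded_linear_zero bounded_linear_snd_comp bounded_linear_snd)
  have l: "bounded_linear (\<lambda>q::point. fst (snd q))" by (intro bounded_linear_fst_comp bounded_linear_snd)
  have L1: "fst (L q) = fst q" for q by (simp add: L_def)
  have inj: "q = 0" if q: "fst (snd q) *\<^sub>R V p0 + L q = 0" for q
  proof -
    have v0: "fst (V p0) = 0" using t0[OF S(2)] .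
    have "fst (fst (snd q) *\<^sub>R V p0 + L q) = 0" "fst (snd (fst (snd q) *\<^sub>R V p0 + L q)) = 0" "snd (snd (fst (snd q) *\<^sub>R V p0 + L q)) = 0"
      unfolding q by simp_all
    then show ?thesis using v0 nz by (cases q) (auto simp: L_def zero_prod_def split: if_splits)
  qed
  obtain B g where g: "open B" "p0 \<in> B" "B \<subseteq> S" "smooth_on g B" "inj_on g B"
    "\<And>p. p \<in> B \<Longrightarrow> frechet_derivative g (at p) (V p) = (0, 1, 0)"
    "\<And>p w. p \<in> B \<Longrightarrow> frechet_derivative g (at p) w = 0 \<Longrightarrow> w = 0"
    "\<And>p. p \<in> B \<Longrightarrow> \<exists>a>0. \<exists>c. c 0 = p0 + L (g p) \<and> c (fst (snd (g p))) = p \<and> \<bar>fst (snd (g p))\<bar> < a \<and>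
       (\<forall>s\<in>{-a<..<a}. c s \<in> S \<and> (c has_vector_derivative V (c s)) (at s))"
    by (rule flow_box[OF S V l L, of "(0, 1, 0)"], simp, simp add: L_def zero_prod_def, erule inj, rule that; assumption)
  have T: "fst p - fst p0 = fst (g p)" if p: "p \<in> B" for p
  proof -
    obtain a c where c: "a > 0" "c 0 = p0 + L (g p)" "c (fst (snd (g p))) = p" "\<bar>fst (snd (g p))\<bar> < a"
      "\<And>s. s \<in> {-a<..<a} \<Longrightarrow> c s \<in> S \<and> (c has_vector_derivative V (c s)) (at s)" using g(8)[OF p] by blast
    have "norm (fst (c (fst (snd (g p)))) - fst (c 0)) \<le> 0 * \<bar>fst (snd (g p)) - 0\<bar>"
    proof (rule vector_derivative_bound[of "{-a<..<a}" "\<lambda>s. fst (c s)" "\<lambda>s. vtau V (c s)"])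
      fix s assume s: "s \<in> {-a<..<a}"
      show "((\<lambda>s. fst (c s)) has_vector_derivative vtau V (c s)) (at s within {-a<..<a})"
        using bounded_linear.has_vector_derivative[OF bounded_linear_fst conjunct2[OF c(5)[OF s]]] has_vector_derivative_at_within by blast
      show "norm (vtau V (c s)) \<le> 0" using t0 c(5)[OF s] by simp
    qed (use c(1,4) in auto)
    then show ?thesis using c(2,3) L1 by simp
  qed
  have B1: "open (fst ` B)" using g(1) by (rule open_image_fst)
  have dT: "deriv (\<lambda>t. t - fst p0) t = 1" for t :: real by (rule DERIV_imp_deriv) (auto intro!: derivative_eq_intros)
  have "\<exists>\<Phi>. point_transformation \<Phi> B \<and> pushes_forward \<Phi> B V (\<lambda>p. (0, 1, 0))"
  proof (rule box_transformation[OF g(1) _ g(4,5) _ g(6), where T = "\<lambda>t. t - fst p0"])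
    show "w = 0" if "p \<in> B" "frechet_derivative g (at p) w = 0" for p w by (rule g(7)[OF that])
    show "smooth_on (\<lambda>t. t - fst p0) (fst ` B)"
      by (intro smooth_on_diff B1 smooth_on_const smooth_on_bounded_linear bounded_linear_ident)
    show "fst p - fst p0 = fst (g p)" if "p \<in> B" for p by (rule T[OF that])
  qed (use g(2) dT in auto)
  then show ?thesis using that[OF g(2,3)] by blast
qed

text \<open>\<tau> depends on t alone, so an antiderivative T of 1/\<tau> grows at unit rate along
  the flow. Vanishing on the slice through \<open>p0\<close> with constant t, it equals the flow
  time, which is the first box coordinate.\<close>

lemma straighten_case_t:
  assumes r: "0 < r" "ball p0 (2 * r) \<subseteq> S" and S: "open S" and V: "smooth_on V S" and nz: "\<And>p. p \<in> S \<Longrightarrow> vtau V p \<noteq> 0"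
    and tx: "\<And>p. p \<in> S \<Longrightarrow> pderiv_x (vtau V) p = 0" "\<And>p. p \<in> S \<Longrightarrow> pderiv_u (vtau V) p = 0"
  obtains \<Phi> B where "p0 \<in> B" "B \<subseteq> S" "point_transformation \<Phi> B" "pushes_forward \<Phi> B V (\<lambda>p. (1, 0, 0))"
proof -
  let ?S = "ball p0 r"
  have sub: "?S \<subseteq> S" using r by auto
  \<comment> \<open>\<tau> is read off along the line through \<open>p0\<close> in the direction of
    t. The radius 2 r leaves room for a closed interval of radius r on which 1/\<tau> is continuous
    up to the ends.\<close>
  define q0 where "q0 t = (t, snd p0)" for t :: real
  have dq0: "dist p0 (q0 t) = \<bar>fst p0 - t\<bar>" for t by (cases p0) (simp add: q0_def dist_prod_def dist_real_def)
  let ?I = "{fst p0 - 2 * r<..<fst p0 + 2 * r}"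
  have q0S: "q0 t \<in> S" if "t \<in> ?I" for t
  proof -
    have "q0 t \<in> ball p0 (2 * r)" using that unfolding mem_ball dq0 by auto
    then show ?thesis using r(2) by blast
  qed
  have smtau: "smooth_on (vtau V) S" using smooth_on_compose_linear[OF S bounded_linear_fst V] by simp
  have smf: "smooth_on (\<lambda>t. inverse (vtau V (q0 t))) ?I"
  proof (rule smooth_on_inverse)
    have "smooth_on q0 ?I" unfolding q0_def[abs_def]
      by (intro smooth_on_Pair smooth_on_bounded_linear bounded_linear_ident smooth_on_const) auto
    moreover have "q0 ` ?I \<subseteq> S" using q0S by (rule image_subsetI)
    ultimately show "smooth_on (\<lambda>t. vtau V (q0 t)) ?I" using smooth_on_compose[OF _ S _ _ smtau, of ?I q0] by simp
    show "vtau V (q0 t) \<noteq> 0" if "t \<in> ?I" for t using nz q0S[OF that] by blast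
  qed auto
  have cf: "continuous_on {fst p0 - r..fst p0 + r} (\<lambda>t. inverse (vtau V (q0 t)))"
    by (rule continuous_on_subset[OF smooth_on_continuous_on[OF smf]]) (use r in auto)
  obtain T0 where T0: "\<And>t. t \<in> {fst p0 - r..fst p0 + r} \<Longrightarrow> (T0 has_vector_derivative inverse (vtau V (q0 t))) (at t within {fst p0 - r..fst p0 + r})"
    using antiderivative_continuous[OF cf] by blast
  define T where "T t = T0 t - T0 (fst p0)" for t
  let ?I1 = "{fst p0 - r<..<fst p0 + r}"
  have dT: "(T has_real_derivative inverse (vtau V (q0 t))) (at t)" if t: "t \<in> ?I1" for t
  proof -
    have "(T0 has_vector_derivative inverse (vtau V (q0 t))) (at t within {fst p0 - r..fst p0 + r})" by (rule T0) (use t in auto)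
    then have "(T0 has_vector_derivative inverse (vtau V (q0 t))) (at t)"
      by (subst (asm) at_within_interior) (use t in auto)
    then have "(T0 has_real_derivative inverse (vtau V (q0 t))) (at t)" by (simp add: has_real_derivative_iff_has_vector_derivative)
    then show ?thesis unfolding T_def[abs_def] by (auto intro!: derivative_eq_intros)
  qed
  have smT: "smooth_on T ?I1"
    unfolding smooth_on_def
  proof
    fix k
    have "Ck_on (Suc k) T ?I1"
    proof (rule Ck_on_SucI)
      show "(T has_derivative (\<lambda>h. inverse (vtau V (q0 t)) * h)) (at t)" if "t \<in> ?I1" for t
        using dT[OF that] by (simp add: has_field_derivative_def)
      have "smooth_on (\<lambda>t. inverse (vtau V (q0 t)) * h) ?I1" for h
        by (intro smooth_on_mult smooth_on_subset[OF smf] smooth_on_const) (use r in auto)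
      then show "Ck_on k (\<lambda>t. inverse (vtau V (q0 t)) * h) ?I1" for h by (simp add: smooth_on_def)
    qed auto
    then show "Ck_on k T ?I1" by (rule Ck_on_Suc_imp)
  qed
  have fst_ball: "fst p \<in> ?I1" if "p \<in> ?S" for p
    using that dist_fst_le[of p0 p] by (auto simp: dist_real_def)
  have tau: "vtau V p = vtau V (q0 (fst p))" if p: "p \<in> ?S" for p
  proof -
    let ?q = "q0 (fst p)"
    have q: "?q \<in> ?S" using fst_ball[OF p] dq0[of "fst p"] by (auto simp: abs_less_iff)
    obtain b c where bc: "p = ?q + 1 *\<^sub>R (0, b, c)"
      by (rule that[of "fst (snd p) - fst (snd p0)" "snd (snd p) - snd (snd p0)"]) (cases p; cases p0; simp add: q0_def)
    show ?thesis
    proof (subst bc, rule constant_along_direction[OF open_ball convex_ball smooth_on_subset[OF smtau sub] _ q])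
      show "?q + 1 *\<^sub>R (0, b, c) \<in> ?S" using p bc by metis
      fix x assume x: "x \<in> ?S"
      have "linear (frechet_derivative (vtau V) (at x))"
        using has_derivative_linear[OF smooth_on_has_derivative[OF smtau]] x sub by blast
      from linear_point_split[OF this, of 0 b c] show "frechet_derivative (vtau V) (at x) (0, b, c) = 0"
        using tx[of x] x sub unfolding pderiv_x_def pderiv_u_def by auto
    qed
  qed
  define L where "L q = (0::real, snd q)" for q :: point
  have L: "bounded_linear L" unfolding L_def[abs_def] by (intro bounded_linear_Pair bounded_linear_zero bounded_linear_snd)
  have p0: "p0 \<in> ?S" using r(1) by simp
  have inj: "q = 0" if q: "fst q *\<^sub>R V p0 + L q = 0" for q
  proof -
    have "fst (fst q *\<^sub>R V p0 + L q) = 0" "snd (fst q *\<^sub>R V p0 + L q) = 0" unfolding q by simp_all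
    note * = this
    have "vtau V p0 \<noteq> 0" using nz p0 sub by blast
    then have "fst q = 0" using *(1) by (simp add: L_def)
    moreover from this have "snd q = 0" using *(2) by (simp add: L_def)
    ultimately show ?thesis by (simp add: prod_eq_iff)
  qed
  obtain B g where g: "open B" "p0 \<in> B" "B \<subseteq> ?S" "smooth_on g B" "inj_on g B"
    "\<And>p. p \<in> B \<Longrightarrow> frechet_derivative g (at p) (V p) = (1, 0, 0)"
    "\<And>p w. p \<in> B \<Longrightarrow> frechet_derivative g (at p) w = 0 \<Longrightarrow> w = 0"
    "\<And>p. p \<in> B \<Longrightarrow> \<exists>a>0. \<exists>c. c 0 = p0 + L (g p) \<and> c (fst (g p)) = p \<and> \<bar>fst (g p)\<bar> < a \<and>
       (\<forall>s\<in>{-a<..<a}. c s \<in> ?S \<and> (c has_vector_derivative V (c s)) (at s))"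
    by (rule flow_box[OF open_ball p0 smooth_on_subset[OF V sub] bounded_linear_fst L, of "(1, 0, 0)"], simp, simp add: L_def zero_prod_def, erule inj, rule that; assumption)
  have TB: "T (fst p) = fst (g p)" if p: "p \<in> B" for p
  proof -
    obtain a c where c: "a > 0" "c 0 = p0 + L (g p)" "c (fst (g p)) = p" "\<bar>fst (g p)\<bar> < a"
      "\<And>s. s \<in> {-a<..<a} \<Longrightarrow> c s \<in> ?S \<and> (c has_vector_derivative V (c s)) (at s)" using g(8)[OF p] by blast
    have "norm ((T (fst (c (fst (g p)))) - fst (g p)) - (T (fst (c 0)) - 0)) \<le> 0 * \<bar>fst (g p) - 0\<bar>"
    proof (rule vector_derivative_bound[of "{-a<..<a}" "\<lambda>s. T (fst (c s)) - s" "\<lambda>s. 0"])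
      fix s assume s: "s \<in> {-a<..<a}"
      have cs: "c s \<in> ?S" using c(5)[OF s] by blast
      have "((\<lambda>s. fst (c s)) has_vector_derivative vtau V (c s)) (at s)"
        using bounded_linear.has_vector_derivative[OF bounded_linear_fst conjunct2[OF c(5)[OF s]]] .
      then have "((\<lambda>s. fst (c s)) has_real_derivative vtau V (c s)) (at s)"
        by (simp add: has_real_derivative_iff_has_vector_derivative)
      from DERIV_chain2[OF dT[OF fst_ball[OF cs]] this]
      have "((\<lambda>s. T (fst (c s))) has_real_derivative 1) (at s)"
        using tau[OF cs] nz[of "c s"] cs sub by auto
      then have "((\<lambda>s. T (fst (c s)) - s) has_real_derivative 0) (at s)" by (auto intro!: derivative_eq_intros)
      then show "((\<lambda>s. T (fst (c s)) - s) has_vector_derivative 0) (at s within {-a<..<a})"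
        by (simp add: has_real_derivative_iff_has_vector_derivative[symmetric] has_field_derivative_at_within)
    qed (use c(1,4) in auto)
    then show ?thesis using c(2,3) by (simp add: T_def L_def)
  qed
  have "fst ` B \<subseteq> ?I1" using g(3) fst_ball by blast
  then have smTB: "smooth_on T (fst ` B)" using smooth_on_subset[OF smT] by blast
  have dTnz: "deriv T (fst p) \<noteq> 0" if "p \<in> B" for p
    using DERIV_imp_deriv[OF dT[OF fst_ball]] nz[OF q0S, of "fst p"] fst_ball[of p] that g(3) r(1) by fastforce
  have "\<exists>\<Phi>. point_transformation \<Phi> B \<and> pushes_forward \<Phi> B V (\<lambda>p. (1, 0, 0))"
  proof (rule box_transformation[OF g(1) _ g(4,5) _ g(6) smTB dTnz TB])
    show "w = 0" if "p \<in> B" "frechet_derivative g (at p) w = 0" for p w by (rule g(7)[OF that])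
  qed (use g(2) in auto)
  then show ?thesis using that[OF g(2)] g(3) sub by blast
qed

lemma one_parameter_symmetry:
  assumes E: "evolution_equation E" and adm: "admits E V" and nz: "\<exists>p\<in>base E. V p \<noteq> 0" and gen: "generic_on V (base E)"
    and z: "z \<in> edom E"
  shows "\<exists>\<Phi> D E'. point_transformation \<Phi> D \<and> transforms_near \<Phi> D E z E' \<and>
         (family_t E' \<and> pushes_forward \<Phi> (D \<inter> base E) V vf_t \<or>
          family_x E' \<and> pushes_forward \<Phi> (D \<inter> base E) V vf_x)"
proof -
  let ?p = "point_of_jet3 z"
  have b: "open (base E)" "?p \<in> base E" using base_open[OF smooth_eqD(1)[OF E]] z by (auto simp: base_def)
  have smV: "smooth_on V (base E)" using adm by (simp add: admits_def)
  have go: "\<exists>\<Phi> D E'. point_transformation \<Phi> D \<and> transforms_near \<Phi> D E z E' \<and> evolution_equation E' \<and> convex (edom E') \<and>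
      pushes_forward \<Phi> (D \<inter> base E) V (\<lambda>p. (cT, cX, 0)) \<and>
      (\<forall>z\<in>edom E'. frechet_derivative (eF E') (at z) (cT, cX, 0, 0, 0, 0) = 0 \<and> frechet_derivative (eG E') (at z) (cT, cX, 0, 0, 0, 0) = 0)"
    if B: "?p \<in> B" "B \<subseteq> base E" "point_transformation \<Phi> B" "pushes_forward \<Phi> B V (\<lambda>p. (cT, cX, 0))" for \<Phi> B cT cX
  proof -
    obtain \<Phi>' where \<Phi>': "point_transformation \<Phi>' B" "pushes_forward \<Phi>' B V (\<lambda>p. (cT, cX, 0))" "Dx (pX \<Phi>' \<circ> point_of_jet) (emb z) \<noteq> 0"
      by (rule shear[OF B(3,4,1)]) (rule that; assumption)
    obtain E' where E': "evolution_equation E'" "convex (edom E')" "transforms_near \<Phi>' B E z E'"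
      "\<And>z. z \<in> edom E' \<Longrightarrow> frechet_derivative (eF E') (at z) (cT, cX, 0, 0, 0, 0) = 0"
      "\<And>z. z \<in> edom E' \<Longrightarrow> frechet_derivative (eG E') (at z) (cT, cX, 0, 0, 0, 0) = 0"
      by (rule straighten_equation[OF \<Phi>'(1) E adm z B(1) smooth_on_subset[OF smV B(2)] \<Phi>'(2,3)]) (rule that; assumption)
    have "pushes_forward \<Phi>' (B \<inter> base E) V (\<lambda>p. (cT, cX, 0))" using \<Phi>'(2) by (simp add: pushes_forward_def)
    then show ?thesis using \<Phi>' E' by blast
  qed
  consider "\<And>p. p \<in> base E \<Longrightarrow> vtau V p \<noteq> 0" | "\<And>p. p \<in> base E \<Longrightarrow> vtau V p = 0"
    using gen unfolding generic_on_def zero_or_nonvanishing_def by blast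
  then show ?thesis
  proof cases
    case 1
    obtain R where R: "R > 0" "ball ?p R \<subseteq> base E" using b open_contains_ball by blast
    have R2: "0 < R / 2" "ball ?p (2 * (R / 2)) \<subseteq> base E" using R by auto
    obtain \<Phi> B where "?p \<in> B" "B \<subseteq> base E" "point_transformation \<Phi> B" "pushes_forward \<Phi> B V (\<lambda>p. (1, 0, 0))"
      by (rule straighten_case_t[OF R2 b(1) smV 1 admits_tau[OF E adm]], assumption, assumption, assumption) (rule that; assumption)
    from go[OF this] show ?thesis using family_tI unfolding vf_t_def by blast
  next
    case 2
    obtain q where "q \<in> base E" "V q \<noteq> 0" using nz by blast
    then have "vxi V q \<noteq> 0 \<or> veta V q \<noteq> 0" using 2[of q] by (cases "V q") (auto simp: zero_prod_def)
    \<comment> \<open>Genericity carries a component that is non-zero at q over to the point below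
      z.\<close>
    then have nz': "vxi V ?p \<noteq> 0 \<or> veta V ?p \<noteq> 0"
      using gen b(2) \<open>q \<in> base E\<close> unfolding generic_on_def zero_or_nonvanishing_def by blast
    obtain \<Phi> B where "?p \<in> B" "B \<subseteq> base E" "point_transformation \<Phi> B" "pushes_forward \<Phi> B V (\<lambda>p. (0, 1, 0))"
      by (rule straighten_case_x[OF b smV 2 nz'], assumption) (rule that; assumption)
    from go[OF this] show ?thesis using family_xI unfolding vf_x_def by blast
  qed
qed

section \<open>Exceptional parameters\<close>

text \<open>Applying d/dv - \<mu>0 lowers the degree of the polynomial at \<mu>0, or removes it, and
  keeps the leading terms of all others up to non-zero factors. Repetition reduces to the smaller
  set S.\<close>

lemma exp_poly_independent:
  fixes p :: "real \<Rightarrow> real poly"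
  assumes ab: "a < b" and S: "finite S"
    and zero: "\<And>v. v \<in> {a<..<b} \<Longrightarrow> (\<Sum>\<mu>\<in>S. poly (p \<mu>) v * exp (\<mu> * v)) = 0"
  shows "\<forall>\<mu>\<in>S. p \<mu> = 0"
  using S zero
proof (induction S arbitrary: p rule: finite_induct)
  case (insert \<mu>0 S)
  \<comment> \<open>Unlike the degree, this also drops when a non-zero constant becomes
    zero.\<close>
  define size where "size q = (if q = 0 then 0 else Suc (degree q))" for q :: "real poly"
  have "\<forall>\<mu>\<in>insert \<mu>0 S. p \<mu> = 0"
    if "\<And>v. v \<in> {a<..<b} \<Longrightarrow> (\<Sum>\<mu>\<in>insert \<mu>0 S. poly (p \<mu>) v * exp (\<mu> * v)) = 0" for p
    using that
  proof (induction "size (p \<mu>0)" arbitrary: p rule: less_induct)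
    case less
    show ?case
    proof (cases "p \<mu>0 = 0")
      case True
      then have "(\<Sum>\<mu>\<in>S. poly (p \<mu>) v * exp (\<mu> * v)) = 0" if "v \<in> {a<..<b}" for v
        using less.prems[OF that] insert by simp
      then show ?thesis using insert.IH[of p] True by simp
    next
      case False
      \<comment> \<open>The polynomial coefficients of the sum after applying d/dv - \<mu>0.\<close>
      define p' where "p' \<mu> = pderiv (p \<mu>) + smult (\<mu> - \<mu>0) (p \<mu>)" for \<mu>
      have zero': "(\<Sum>\<mu>\<in>insert \<mu>0 S. poly (p' \<mu>) v * exp (\<mu> * v)) = 0" if v: "v \<in> {a<..<b}" for v
      proof -
        let ?F = "\<lambda>v. \<Sum>\<mu>\<in>insert \<mu>0 S. poly (p \<mu>) v * exp (\<mu> * v)"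
        have "((\<lambda>v. poly (p \<mu>) v * exp (\<mu> * v)) has_real_derivative
            (poly (pderiv (p \<mu>)) v + \<mu> * poly (p \<mu>) v) * exp (\<mu> * v)) (at v)" for \<mu>
          by (auto intro!: derivative_eq_intros simp: algebra_simps)
        then have "(?F has_real_derivative (\<Sum>\<mu>\<in>insert \<mu>0 S. (poly (pderiv (p \<mu>)) v + \<mu> * poly (p \<mu>) v) * exp (\<mu> * v))) (at v)"
          by (intro DERIV_sum)
        moreover have "(?F has_real_derivative 0) (at v)"
          by (rule has_field_derivative_transform_within_open[OF DERIV_const[of 0] open_greaterThanLessThan v]) (simp only: less.prems)
        ultimately have "(\<Sum>\<mu>\<in>insert \<mu>0 S. (poly (pderiv (p \<mu>)) v + \<mu> * poly (p \<mu>) v) * exp (\<mu> * v)) = 0"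
          by (rule DERIV_unique)
        moreover have "\<mu>0 * ?F v = 0" using less.prems[OF v] by simp
        ultimately have "(\<Sum>\<mu>\<in>insert \<mu>0 S. (poly (pderiv (p \<mu>)) v + \<mu> * poly (p \<mu>) v) * exp (\<mu> * v)) - \<mu>0 * ?F v = 0" by simp
        then show ?thesis
          unfolding sum_distrib_left sum_subtractf[symmetric] p'_def by (simp add: algebra_simps)
      qed
      have "size (p' \<mu>0) < size (p \<mu>0)"
      proof (cases "pderiv (p \<mu>0) = 0")
        case True then show ?thesis using False by (simp add: p'_def size_def)
      next
        case nz: False
        then have "degree (p \<mu>0) \<noteq> 0" using pderiv_eq_0_iff by blast
        then show ?thesis using False nz by (simp add: p'_def size_def degree_pderiv)
      qed
      from less.hyps[OF this zero'] have p'0: "\<forall>\<mu>\<in>insert \<mu>0 S. p' \<mu> = 0" by blast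
      \<comment> \<open>For \<mu> different from \<mu>0 the leading coefficient is multiplied by
        \<mu> - \<mu>0, so \<open>p' \<mu>\<close> vanishes only if \<open>p \<mu>\<close>
        does.\<close>
      have pS: "p \<mu> = 0" if \<mu>: "\<mu> \<in> S" for \<mu>
      proof (rule ccontr)
        assume nz: "p \<mu> \<noteq> 0"
        have "coeff (p' \<mu>) (degree (p \<mu>)) = (\<mu> - \<mu>0) * lead_coeff (p \<mu>)"
          by (simp add: p'_def coeff_pderiv coeff_eq_0)
        then show False using p'0 \<mu> nz insert.hyps by auto
      qed
      have "poly (p \<mu>0) v = 0" if "v \<in> {a<..<b}" for v
        using less.prems[OF that] insert.hyps pS by simp
      then have "{a<..<b} \<subseteq> {v. poly (p \<mu>0) v = 0}" by blast
      then have "infinite {v. poly (p \<mu>0) v = 0}" using infinite_Ioo[OF ab] finite_subset by blast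
      then show ?thesis using poly_roots_finite False by blast
    qed
  qed
  then show ?case using insert.prems by blast
qed simp

text \<open>Independence is asked of the indexed family. It makes f injective and its image an
  independent set, which is finite in finite dimension.\<close>

lemma finite_if_independent_family:
  fixes f :: "'x \<Rightarrow> 'e::euclidean_space"
  assumes indep: "\<And>T c. finite T \<Longrightarrow> T \<subseteq> S \<Longrightarrow> (\<Sum>x\<in>T. c x *\<^sub>R f x) = 0 \<Longrightarrow> \<forall>x\<in>T. c x = (0::real)"
  shows "finite S"
proof -
  have inj: "inj_on f S"
  proof (rule inj_onI, rule ccontr)
    fix x y assume *: "x \<in> S" "y \<in> S" "f x = f y" "x \<noteq> y"
    have "(\<Sum>z\<in>{x, y}. (if z = x then 1 else - 1) *\<^sub>R f z) = 0" using * by simp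
    from indep[OF _ _ this] * show False by auto
  qed
  have "independent (f ` S)"
  proof
    assume "dependent (f ` S)"
    then obtain T u where T: "finite T" "T \<subseteq> f ` S" "(\<Sum>v\<in>T. u v *\<^sub>R v) = 0" "\<exists>v\<in>T. u v \<noteq> 0"
      unfolding dependent_explicit by blast
    obtain T' where T': "T' \<subseteq> S" "finite T'" "T = f ` T'" using finite_subset_image[OF T(1,2)] by blast
    have "(\<Sum>x\<in>T'. u (f x) *\<^sub>R f x) = 0"
      using T(3) unfolding T'(3) sum.reindex[OF inj_on_subset[OF inj T'(1)]] by simp
    from indep[OF T'(2,1) this] T(4) T'(3) show False by blast
  qed
  then have "finite (f ` S)" using independent_bound by blast
  then show ?thesis using inj by (simp add: finite_image_iff)
qed

text \<open>Kernel vectors of \<open>A + s B\<close> modulo \<open>W\<close> for distinct \<open>s\<close> are linearly independent, like eigenvectors.\<close>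

lemma pencil_exceptional_finite:
  fixes A B W :: "real \<Rightarrow> 'e::euclidean_space"
  assumes B: "\<And>Y w. (\<And>v. v \<in> I \<Longrightarrow> Y \<bullet> B v = w \<bullet> W v) \<Longrightarrow> Y = 0"
  shows "finite {s. \<exists>Y w. Y \<noteq> 0 \<and> (\<forall>v\<in>I. Y \<bullet> (A v + s *\<^sub>R B v) = w \<bullet> W v)}" (is "finite ?S")
proof -
  define Q where "Q s Y w \<longleftrightarrow> Y \<noteq> 0 \<and> (\<forall>v\<in>I. Y \<bullet> (A v + s *\<^sub>R B v) = w \<bullet> W v)" for s Y w
  define Y where "Y s = (SOME Y. \<exists>w. Q s Y w)" for s
  define w where "w s = (SOME w. Q s (Y s) w)" for s
  have QYw: "Q s (Y s) (w s)" if "s \<in> ?S" for s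
  proof -
    have "\<exists>Y w. Q s Y w" using that unfolding Q_def mem_Collect_eq .
    then have "\<exists>w. Q s (Y s) w" unfolding Y_def by (rule someI_ex)
    then show ?thesis unfolding w_def by (rule someI_ex)
  qed
  then have Yw: "\<And>s. s \<in> ?S \<Longrightarrow> Y s \<noteq> 0" "\<And>s v. s \<in> ?S \<Longrightarrow> v \<in> I \<Longrightarrow> Y s \<bullet> (A v + s *\<^sub>R B v) = w s \<bullet> W v"
    unfolding Q_def by blast+
  have "\<forall>s\<in>T. c s = (0::real)" if "finite T" "T \<subseteq> ?S" "(\<Sum>s\<in>T. c s *\<^sub>R Y s) = 0" for T c
    using that
  proof (induction T arbitrary: c rule: finite_induct)
    case (insert t T)
    let ?T = "insert t T"
    \<comment> \<open>Pairing the relation with A gives zero, so by the pencil equations this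
      combination pairs with B as a vector pairs with W, and hypothesis B makes it vanish.
      Subtracting t times the original relation then removes the index t.\<close>
    have "(\<Sum>s\<in>?T. (c s * s) *\<^sub>R Y s) = 0"
    proof (rule B[where w = "\<Sum>s\<in>?T. c s *\<^sub>R w s"])
      fix v assume v: "v \<in> I"
      have "0 = (\<Sum>s\<in>?T. c s *\<^sub>R Y s) \<bullet> A v" using insert.prems(2) by simp
      also have "\<dots> = (\<Sum>s\<in>?T. c s * (Y s \<bullet> A v))" by (simp only: inner_sum_left inner_scaleR_left)
      also have "\<dots> = (\<Sum>s\<in>?T. c s * (w s \<bullet> W v) - (c s * s) * (Y s \<bullet> B v))"
      proof (rule sum.cong[OF refl])
        fix s assume "s \<in> ?T"
        then have "Y s \<bullet> A v + s * (Y s \<bullet> B v) = w s \<bullet> W v"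
          using Yw(2)[OF subsetD[OF insert.prems(1)] v, of s] by (simp add: inner_add_right)
        then have eq: "Y s \<bullet> A v = w s \<bullet> W v - s * (Y s \<bullet> B v)" by simp
        show "c s * (Y s \<bullet> A v) = c s * (w s \<bullet> W v) - (c s * s) * (Y s \<bullet> B v)" unfolding eq by (simp add: algebra_simps)
      qed
      also have "\<dots> = (\<Sum>s\<in>?T. c s *\<^sub>R w s) \<bullet> W v - (\<Sum>s\<in>?T. (c s * s) *\<^sub>R Y s) \<bullet> B v"
        by (simp only: sum_subtractf inner_sum_left inner_scaleR_left)
      finally show "(\<Sum>s\<in>?T. (c s * s) *\<^sub>R Y s) \<bullet> B v = (\<Sum>s\<in>?T. c s *\<^sub>R w s) \<bullet> W v" by simp
    qed
    then have "(\<Sum>s\<in>?T. (c s * s) *\<^sub>R Y s) - t *\<^sub>R (\<Sum>s\<in>?T. c s *\<^sub>R Y s) = 0" using insert.prems(2) by simp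
    then have "(\<Sum>s\<in>?T. (c s * (s - t)) *\<^sub>R Y s) = 0"
      by (simp only: scaleR_sum_right sum_subtractf[symmetric] scaleR_scaleR scaleR_diff_left[symmetric]) (simp add: algebra_simps)
    then have "(\<Sum>s\<in>T. (c s * (s - t)) *\<^sub>R Y s) = 0" using insert.hyps by simp
    from insert.IH[OF _ this] insert.prems(1) have "\<forall>s\<in>T. c s * (s - t) = 0" by blast
    then have cT: "\<forall>s\<in>T. c s = 0" using insert.hyps(2) by auto
    then have "c t *\<^sub>R Y t = 0" using insert.prems(2) insert.hyps by simp
    then show ?case using cT Yw(1)[of t] insert.prems(1) by auto
  qed simp
  then show ?thesis by (rule finite_if_independent_family)
qed

section \<open>The perturbing function and its exceptional parameters\<close>

type_synonym real5 = "real \<times> real \<times> real \<times> real \<times> real"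

text \<open>The linear terms make the derivatives by y and u equal to exp (\<kappa> v) and v exp
  (\<kappa> v); the power v ^ 4 keeps h, its v-derivative and v times the latter independent of
  these two and of each other for \<kappa> non-zero. The exponential separates different
  \<kappa>.\<close>

definition gen_h :: "real \<Rightarrow> real \<Rightarrow> real \<Rightarrow> real \<Rightarrow> real" where
  "gen_h \<kappa> y u v = exp (\<kappa> * v) * (v ^ 4 + y + u * v)"

text \<open>The components are \<open>h\<close>, its derivatives with respect to \<open>y\<close>, \<open>u\<close>, \<open>v\<close>, and \<open>v\<close> times the last one.\<close>

definition gen_b :: "real \<Rightarrow> real \<Rightarrow> real \<Rightarrow> real \<Rightarrow> real5" where
  "gen_b \<kappa> y u v = (gen_h \<kappa> y u v, exp (\<kappa> * v), v * exp (\<kappa> * v),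
     exp (\<kappa> * v) * (\<kappa> * (v ^ 4 + y + u * v) + 4 * v ^ 3 + u),
     v * (exp (\<kappa> * v) * (\<kappa> * (v ^ 4 + y + u * v) + 4 * v ^ 3 + u)))"

lemma gen_b_independent:
  assumes ab: "a < b" and T: "finite T" "0 \<notin> T"
    and zero: "\<And>v. v \<in> {a<..<b} \<Longrightarrow> (\<Sum>\<kappa>\<in>T. Y \<kappa> \<bullet> gen_b \<kappa> y u v) = 0"
  shows "\<forall>\<kappa>\<in>T. Y \<kappa> = 0"
proof -
  \<comment> \<open>For \<kappa> non-zero the coefficients of v^5, v^3, v^4, v and 1, in this order,
    give c5 = c4 = c1 = c3 = c2 = 0.\<close>
  define p where "p \<kappa> = (case Y \<kappa> of (c1, c2, c3, c4, c5) \<Rightarrow>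
    [: c1 * y + c2 + c4 * (\<kappa> * y + u), c1 * u + c3 + c4 * \<kappa> * u + c5 * (\<kappa> * y + u), c5 * \<kappa> * u, c4 * 4,
       c1 + c4 * \<kappa> + c5 * 4, c5 * \<kappa> :])" for \<kappa>
  have eq: "Y \<kappa> \<bullet> gen_b \<kappa> y u v = poly (p \<kappa>) v * exp (\<kappa> * v)" for \<kappa> v
    unfolding p_def gen_b_def gen_h_def
    by (cases "Y \<kappa>") (simp add: algebra_simps power4_eq_xxxx power3_eq_cube)
  have "\<forall>\<kappa>\<in>T. p \<kappa> = 0"
    by (rule exp_poly_independent[OF ab T(1)]) (use zero eq in simp)
  moreover have "Y \<kappa> = 0" if "p \<kappa> = 0" "\<kappa> \<noteq> 0" for \<kappa>
    using that unfolding p_def by (cases "Y \<kappa>") (auto simp: zero_prod_def)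
  ultimately show ?thesis using T(2) by metis
qed

text \<open>At one index the vectors w belonging to bad \<kappa> are linearly independent: a
  relation among them would be a relation among the functions \<open>gen_b \<kappa>\<close>,
  excluded by \<open>gen_b_independent\<close>. So the bad \<kappa> are finite in number, one
  \<kappa> avoids them for all indices, and \<open>pencil_exceptional_finite\<close> bounds s at
  each index.\<close>

lemma generic_parameters:
  fixes A W :: "'i \<Rightarrow> real \<Rightarrow> real5"
  assumes I: "countable I" and lr: "\<And>i. i \<in> I \<Longrightarrow> l i < r i"
  shows "\<exists>\<kappa> C. countable C \<and> (\<forall>s i Y w. s \<notin> C \<longrightarrow> i \<in> I \<longrightarrow>
     (\<forall>v\<in>{l i<..<r i}. Y \<bullet> (A i v + s *\<^sub>R gen_b \<kappa> (y i) (u i) v) = w \<bullet> W i v) \<longrightarrow> Y = 0)"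
proof -
  define bad where "bad i = {\<kappa>. \<kappa> \<noteq> 0 \<and> (\<exists>Y w. Y \<noteq> 0 \<and> (\<forall>v\<in>{l i<..<r i}. Y \<bullet> gen_b \<kappa> (y i) (u i) v = w \<bullet> W i v))}" for i
  have fin: "finite (bad i)" if i: "i \<in> I" for i
  proof -
    define Q where "Q \<kappa> Y w \<longleftrightarrow> Y \<noteq> 0 \<and> (\<forall>v\<in>{l i<..<r i}. Y \<bullet> gen_b \<kappa> (y i) (u i) v = w \<bullet> W i v)" for \<kappa> Y w
    define Y where "Y \<kappa> = (SOME Y. \<exists>w. Q \<kappa> Y w)" for \<kappa>
    define w where "w \<kappa> = (SOME w. Q \<kappa> (Y \<kappa>) w)" for \<kappa>
    have QYw: "Q \<kappa> (Y \<kappa>) (w \<kappa>)" if "\<kappa> \<in> bad i" for \<kappa>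
    proof -
      have "\<exists>Y w. Q \<kappa> Y w" using that unfolding Q_def bad_def mem_Collect_eq by (rule conjunct2)
      then have "\<exists>w. Q \<kappa> (Y \<kappa>) w" unfolding Y_def by (rule someI_ex)
      then show ?thesis unfolding w_def by (rule someI_ex)
    qed
    then have Yw: "\<And>\<kappa>. \<kappa> \<in> bad i \<Longrightarrow> Y \<kappa> \<noteq> 0"
      "\<And>\<kappa> v. \<kappa> \<in> bad i \<Longrightarrow> v \<in> {l i<..<r i} \<Longrightarrow> Y \<kappa> \<bullet> gen_b \<kappa> (y i) (u i) v = w \<kappa> \<bullet> W i v"
      unfolding Q_def by blast+
    show ?thesis
    proof (rule finite_if_independent_family[of _ w])
      fix T and c :: "real \<Rightarrow> real"
      assume T: "finite T" "T \<subseteq> bad i" and z: "(\<Sum>\<kappa>\<in>T. c \<kappa> *\<^sub>R w \<kappa>) = 0"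
      have "\<forall>\<kappa>\<in>T. c \<kappa> *\<^sub>R Y \<kappa> = 0"
      proof (rule gen_b_independent[OF lr[OF i] T(1)])
        show "0 \<notin> T" using T(2) by (auto simp: bad_def)
        fix v assume v: "v \<in> {l i<..<r i}"
        have "(\<Sum>\<kappa>\<in>T. (c \<kappa> *\<^sub>R Y \<kappa>) \<bullet> gen_b \<kappa> (y i) (u i) v) = (\<Sum>\<kappa>\<in>T. (c \<kappa> *\<^sub>R w \<kappa>) \<bullet> W i v)"
          by (rule sum.cong[OF refl]) (use Yw(2)[OF subsetD[OF T(2)] v] in simp)
        also have "\<dots> = 0" using z by (simp only: inner_sum_left[symmetric] inner_zero_left)
        finally show "(\<Sum>\<kappa>\<in>T. (c \<kappa> *\<^sub>R Y \<kappa>) \<bullet> gen_b \<kappa> (y i) (u i) v) = 0" .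
      qed
      then show "\<forall>\<kappa>\<in>T. c \<kappa> = 0" using Yw(1) T(2) by auto
    qed
  qed
  have "countable (insert 0 (\<Union>i\<in>I. bad i))" by (rule countable_insert, rule countable_UN[OF I]) (rule countable_finite[OF fin])
  then have "insert 0 (\<Union>i\<in>I. bad i) \<noteq> UNIV" using uncountable_UNIV_real by metis
  then obtain \<kappa> where "\<kappa> \<notin> insert 0 (\<Union>i\<in>I. bad i)" by blast
  then have \<kappa>: "\<kappa> \<noteq> 0" "\<And>i. i \<in> I \<Longrightarrow> \<kappa> \<notin> bad i" by auto
  define C where "C = (\<Union>i\<in>I. {s. \<exists>Y w. Y \<noteq> 0 \<and> (\<forall>v\<in>{l i<..<r i}. Y \<bullet> (A i v + s *\<^sub>R gen_b \<kappa> (y i) (u i) v) = w \<bullet> W i v)})"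
  have fC: "finite {s. \<exists>Y w. Y \<noteq> 0 \<and> (\<forall>v\<in>{l i<..<r i}. Y \<bullet> (A i v + s *\<^sub>R gen_b \<kappa> (y i) (u i) v) = w \<bullet> W i v)}"
    if i: "i \<in> I" for i
  proof (rule pencil_exceptional_finite[where A = "A i" and B = "gen_b \<kappa> (y i) (u i)" and W = "W i"])
    fix Y w assume Yw: "\<And>v. v \<in> {l i<..<r i} \<Longrightarrow> Y \<bullet> gen_b \<kappa> (y i) (u i) v = w \<bullet> W i v"
    show "Y = 0"
    proof (rule ccontr)
      assume Y: "Y \<noteq> 0"
      have "\<kappa> \<in> bad i" unfolding bad_def mem_Collect_eq
        by (rule conjI[OF \<kappa>(1)], rule exI[of _ Y], rule exI[of _ w], rule conjI[OF Y], rule ballI, rule Yw)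
      then show False using \<kappa>(2)[OF i] by contradiction
    qed
  qed
  have cC: "countable C" unfolding C_def
    by (rule countable_UN[OF I]) (rule countable_finite[OF fC])
  have CI: "s \<in> C" if "i \<in> I" "Y \<noteq> 0" "\<forall>v\<in>{l i<..<r i}. Y \<bullet> (A i v + s *\<^sub>R gen_b \<kappa> (y i) (u i) v) = w \<bullet> W i v" for s i Y w
    unfolding C_def by (rule UN_I[OF that(1)], rule CollectI, rule exI[of _ Y], rule exI[of _ w], rule conjI[OF that(2,3)])
  show ?thesis
  proof (rule exI[of _ \<kappa>], rule exI[of _ C], rule conjI[OF cC], intro allI impI)
    fix s i Y w
    assume s: "s \<notin> C" and h: "i \<in> I" "\<forall>v\<in>{l i<..<r i}. Y \<bullet> (A i v + s *\<^sub>R gen_b \<kappa> (y i) (u i) v) = w \<bullet> W i v"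
    show "Y = 0"
    proof (rule ccontr)
      assume "Y \<noteq> 0"
      from CI[OF h(1) this h(2)] show False using s by contradiction
    qed
  qed
qed

section \<open>Determining equations\<close>

context jets begin

lemma Dx_base:
  assumes "smooth_on f D" "J \<in> \<Omega>"
  shows "Dx (\<lambda>J. f (point_of_jet J)) J = pderiv_x f (point_of_jet J) + jc J 0 1 * pderiv_u f (point_of_jet J)"
  unfolding Dx_jd jd_base_split[OF assms] by (simp add: pderiv_x_def pderiv_u_def)

lemma Dt_base:
  assumes "smooth_on f D" "J \<in> \<Omega>"
  shows "Dt (\<lambda>J. f (point_of_jet J)) J = frechet_derivative f (at (point_of_jet J)) (1, 0, 0) + jc J 1 0 * pderiv_u f (point_of_jet J)"
  unfolding Dt_jd jd_base_split[OF assms] by (simp add: pderiv_u_def Xt_def)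

lemma Dx_base_zero:
  assumes f: "smooth_on f D" and z: "\<And>p. p \<in> D \<Longrightarrow> pderiv_x f p = 0" "\<And>p. p \<in> D \<Longrightarrow> pderiv_u f p = 0"
    and J: "J \<in> \<Omega>"
  defines "P \<equiv> \<lambda>J. f (point_of_jet J)"
  shows "Dx P J = 0" "Dx (Dx P) J = 0" "Dx (Dx (Dx P)) J = 0" "Dx (Dx (Dx (Dx P))) J = 0"
proof -
  have k: "dfun \<Omega> D UNIV (\<lambda>J. 0)" by (rule dfun_const)
  have Dx0: "Dx (\<lambda>J. 0::real) J = 0" for J by (simp add: Dx_jd jd_const)
  have 1: "Dx P J = 0" if "J \<in> \<Omega>" for J unfolding P_def Dx_base[OF f that] using z pt[OF that] by simp
  have c: "Dx Q J = 0" if "\<And>J. J \<in> \<Omega> \<Longrightarrow> Q J = 0" "J \<in> \<Omega>" for Q J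
    using Dx_cong[OF k that(2), of Q] that(1) Dx0 by simp
  show "Dx P J = 0" "Dx (Dx P) J = 0" "Dx (Dx (Dx P)) J = 0" "Dx (Dx (Dx (Dx P))) J = 0"
    by (rule 1[OF J]) (rule c[OF 1 J] c[OF c[OF 1] J] c[OF c[OF c[OF 1]] J]; assumption)+
qed

lemma Dx_along_unit3:
  assumes f: "smooth_on f D" and L: "\<And>s. jmove J0 (unit 3) s \<in> \<Omega>"
    and J: "J \<in> \<Omega>" "fst J = fst J0" "fst (snd J) = fst (snd J0)" "\<And>j. jc J 0 j = jc J0 0 j + (if j = 3 then s else 0)"
  defines "P \<equiv> \<lambda>J. f (point_of_jet J)" and "Q \<equiv> \<lambda>J. pderiv_u f (point_of_jet J)"
  shows "Dx P J = Dx P J0" and "Dx (Dx P) J = Dx (Dx P) J0"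
    and "Dx (Dx (Dx P)) J = Dx (Dx (Dx P)) J0 + s * pderiv_u f (point_of_jet J0)"
    and "Dx (Dx (Dx (Dx P))) J = Dx (Dx (Dx (Dx P))) J0 + s * (4 * Dx Q J0)"
proof -
  have P0: "dfun \<Omega> D (low 0) P" unfolding P_def by (rule dfun.base[OF f])
  have low: "dfun \<Omega> D (low 1) (Dx P)" "dfun \<Omega> D (low 2) (Dx (Dx P))" "dfun \<Omega> D (low 3) (Dx (Dx (Dx P)))"
    "dfun \<Omega> D (low 4) (Dx (Dx (Dx (Dx P))))"
    using dfun_Dx_low[OF P0] dfun_Dx_low[OF dfun_Dx_low[OF P0]] dfun_Dx_low[OF dfun_Dx_low[OF dfun_Dx_low[OF P0]]]
      dfun_Dx_low[OF dfun_Dx_low[OF dfun_Dx_low[OF dfun_Dx_low[OF P0]]]]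
    by (simp_all add: eval_nat_numeral)
  have smQ: "smooth_on (pderiv_u f) D" using smooth_on_frechet[OF f] by (simp add: pderiv_u_def[abs_def])
  have lowQ: "dfun \<Omega> D (low 1) (Dx Q)"
    using dfun_Dx_low[OF dfun.base[OF smQ, of \<Omega> "low 0"]] unfolding Q_def by simp
  have J0: "J0 \<in> \<Omega>" using L[of 0] by simp
  let ?K = "jmove J0 (unit 3)"
  have pK: "point_of_jet (?K h) = point_of_jet J0" "point_of_jet J = point_of_jet J0" for h
    using J(2,3,4) by (simp_all add: point_of_jet_eq jmove_def)
  have eq: "R J = R (?K s)" if "dfun \<Omega> D (low k) R" for R k
    by (rule dfun_local[OF that J(1) L]) (use pK J(4) in \<open>auto simp: low_def jmove_def\<close>)
  show "Dx P J = Dx P J0"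
    by (rule dfun_local[OF low(1) J(1) J0 pK(2)]) (auto simp: low_def J(4))
  show "Dx (Dx P) J = Dx (Dx P) J0"
    by (rule dfun_local[OF low(2) J(1) J0 pK(2)]) (auto simp: low_def J(4))
  have "jd (Dx (Dx (Dx P))) (?K h) (unit 3) = pderiv_u f (point_of_jet J0)" for h
    using Dx_pow_unit3(1)[OF f L] pK(1) unfolding P_def by simp
  from affine_along[OF low(3) L this] show "Dx (Dx (Dx P)) J = Dx (Dx (Dx P)) J0 + s * pderiv_u f (point_of_jet J0)"
    unfolding eq[OF low(3)] .
  have "jd (Dx (Dx (Dx (Dx P)))) (?K h) (unit 3) = 4 * Dx Q J0" for h
  proof -
    have "Dx Q (?K h) = Dx Q J0"
      by (rule dfun_local[OF lowQ L J0 pK(1)]) (auto simp: low_def jmove_def)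
    then show ?thesis using Dx_pow_unit3(2)[OF f L] unfolding P_def Q_def by simp
  qed
  from affine_along[OF low(4) L this] show "Dx (Dx (Dx (Dx P))) J = Dx (Dx (Dx (Dx P))) J0 + s * (4 * Dx Q J0)"
    unfolding eq[OF low(4)] .
qed

end

text \<open>Lie's criterion at jets with u_xxxx = 0 and u_t = G. By \<open>admits_tau\<close> no
  mixed derivatives of u remain, so the prolongation coefficients of u_x and u_xx are constant in v
  and those of u_xxx and u_xxxx are affine. The existential numbers are chosen before v.\<close>

lemma determining_equation:
  assumes E: "evolution_equation E" and adm: "admits E V" and p: "(t, x, u) \<in> base E"
  defines "p \<equiv> (t, x, u)"
  shows "\<exists>\<psi>0 \<psi>1 b1 b2 e3. \<forall>v. (t, x, u, u1, u2, v) \<in> edom E \<longrightarrow>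
    (frechet_derivative (veta V) (at p) (1, 0, 0) - frechet_derivative (vxi V) (at p) (1, 0, 0) * u1)
    + (pderiv_u (veta V) p - frechet_derivative (vtau V) (at p) (1, 0, 0) - pderiv_u (vxi V) p * u1) * eG E (t, x, u, u1, u2, v)
    - eF E (t, x, u, u1, u2, v) * (\<psi>0 + v * \<psi>1)
    - frechet_derivative (eG E) (at (t, x, u, u1, u2, v)) (vtau V p, vxi V p, veta V p, b1, b2,
        e3 + v * (pderiv_u (veta V) p - 4 * pderiv_u (vxi V) p * u1 - 3 * pderiv_x (vxi V) p)) = 0"
proof -
  let ?N = "point_of_jet3 -` base E"
  have N: "open ?N" "open (base E)"
    using open_vimage[OF base_open[OF smooth_eqD(1)[OF E]] linear_continuous_on[OF bounded_linear_point3, of UNIV, THEN continuous_on_subset]]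
      base_open[OF smooth_eqD(1)[OF E]] linear_continuous_on[OF bounded_linear_point3]
    by (auto simp: base_def intro!: open_vimage)
  have smV: "smooth_on V (base E)" using adm by (simp add: admits_def)
  interpret jets "jets_over ?N" "base E" by (rule jets_over[OF N]) auto
  interpret jets_vf "jets_over ?N" "base E" V by unfold_locales (rule smV)
  define J0 where "J0 = emb (t, x, u, u1, u2, 0)"
  define J where "J v = (t, x, \<lambda>i j. if i = 1 \<and> j = 0 then eG E (t, x, u, u1, u2, v) else jc J0 i j + (if i = 0 \<and> j = 3 then v else 0))" for v
  have c0: "jc J0 0 0 = u" "jc J0 0 (Suc 0) = u1" "jc J0 0 2 = u2" "jc J0 0 3 = 0" "jc J0 0 4 = 0" "fst J0 = t" "fst (snd J0) = x"
    by (simp_all add: J0_def emb_def)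
  have j3: "jet3_of_jet (J v) = (t, x, u, u1, u2, v)" for v using c0 by (simp add: J_def jet3_of_jet_eq)
  have pJ: "point_of_jet (J v) = p" "point_of_jet J0 = p" for v using c0 by (simp_all add: J_def point_of_jet_eq p_def)
  have L: "jmove J0 (unit 3) s \<in> jets_over ?N" for s
    using p c0 by (simp add: jets_over_def point_of_jet3_jet3 point_of_jet_eq jmove_def)
  have J: "J v \<in> jets_over ?N" for v using p pJ by (simp add: jets_over_def point_of_jet3_jet3 p_def)
  have J0: "J0 \<in> jets_over ?N" using L[of 0] by simp
  have cJ: "fst (J v) = fst J0" "fst (snd (J v)) = fst (snd J0)" "\<And>j. jc (J v) 0 j = jc J0 0 j + (if j = 3 then v else 0)" for v
    using c0 by (simp_all add: J_def)
  note ax = Dx_along_unit3[OF smooth_components(2) L J cJ]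
  note ae = Dx_along_unit3[OF smooth_components(3) L J cJ]
  have t0: "Dx tauJ (J v) = 0" "Dx (Dx tauJ) (J v) = 0" "Dx (Dx (Dx tauJ)) (J v) = 0" "Dx (Dx (Dx (Dx tauJ))) (J v) = 0" for v
    by (rule Dx_base_zero[OF smooth_components(1) admits_tau[OF E adm] J]; assumption)+
  have xi1: "Dx xiJ J0 = pderiv_x (vxi V) p + u1 * pderiv_u (vxi V) p"
    using Dx_base[OF smooth_components(2) J0] pJ c0 by simp
  have c: "jc (J v) 0 (Suc 0) = u1" "jc (J v) 0 2 = u2" "jc (J v) 0 3 = v" "jc (J v) 0 4 = 0" "jc (J v) 1 0 = eG E (t, x, u, u1, u2, v)" for v
    using c0 cJ(3)[of v] by (simp_all add: J_def)
  have tu: "pderiv_u (vtau V) p = 0" using admits_tau(2)[OF E adm] p by (simp add: p_def)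
  define b1 where "b1 = Dx etaJ J0 - Dx xiJ J0 * u1"
  define b2 where "b2 = Dx (Dx etaJ) J0 - (Dx (Dx xiJ) J0 * u1 + 2 * Dx xiJ J0 * u2)"
  define e3 where "e3 = Dx (Dx (Dx etaJ)) J0 - (Dx (Dx (Dx xiJ)) J0 * u1 + 3 * Dx (Dx xiJ) J0 * u2)"
  define \<psi>0 where "\<psi>0 = Dx (Dx (Dx (Dx etaJ))) J0 - (Dx (Dx (Dx (Dx xiJ))) J0 * u1 + 4 * Dx (Dx (Dx xiJ)) J0 * u2)"
  define \<psi>1 where "\<psi>1 = 4 * Dx (\<lambda>J. pderiv_u (veta V) (point_of_jet J)) J0
    - (4 * Dx (\<lambda>J. pderiv_u (vxi V) (point_of_jet J)) J0 * u1 + 4 * pderiv_u (vxi V) p * u2 + 6 * Dx (Dx xiJ) J0)"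
  have P1: "prol_coeff V 0 1 (J v) = b1" for v
    unfolding prol_explicit(1)[OF J] t0 ax(1) ae(1) b1_def using c[of v] by simp
  have P2: "prol_coeff V 0 2 (J v) = b2" for v
    unfolding prol_explicit(2)[OF J] t0 ax(1,2) ae(2) b2_def using c[of v] by simp
  have P3: "prol_coeff V 0 3 (J v) = e3 + v * (pderiv_u (veta V) p - 4 * pderiv_u (vxi V) p * u1 - 3 * pderiv_x (vxi V) p)" for v
    unfolding prol_explicit(3)[OF J] t0 ax(1,2,3) ae(3) e3_def pJ using c[of v] xi1 by (simp add: algebra_simps)
  have P4: "prol_coeff V 0 4 (J v) = \<psi>0 + v * \<psi>1" for v
    unfolding prol_explicit(4)[OF J] t0 ax ae(4) \<psi>0_def \<psi>1_def pJ using c[of v] by (simp add: algebra_simps)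
  have P10: "prol_coeff V 1 0 (J v) = (frechet_derivative (veta V) (at p) (1, 0, 0) - frechet_derivative (vxi V) (at p) (1, 0, 0) * u1)
    + (pderiv_u (veta V) p - frechet_derivative (vtau V) (at p) (1, 0, 0) - pderiv_u (vxi V) p * u1) * eG E (t, x, u, u1, u2, v)" for v
    unfolding prol_explicit(5)[OF J] Dt_base[OF smooth_components(1) J] Dt_base[OF smooth_components(2) J] Dt_base[OF smooth_components(3) J] pJ
    using c[of v] tu by (simp add: algebra_simps)
  have t3: "tangent3 (pv V (J v)) = (vtau V p, vxi V p, veta V p, b1, b2,
        e3 + v * (pderiv_u (veta V) p - 4 * pderiv_u (vxi V) p * u1 - 3 * pderiv_x (vxi V) p))" for v
    unfolding tangent3_def pv_simps P1 P2 P3 prol_00 pJ ..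
  have "prolong V (eq_fun E) (J v) = 0" if "(t, x, u, u1, u2, v) \<in> edom E" for v
  proof -
    have "eq_fun E (J v) = 0" unfolding eq_fun_eq j3 c(4,5) by simp
    then show ?thesis using adm that j3 unfolding admits_def by metis
  qed
  then have *: "(frechet_derivative (veta V) (at p) (1, 0, 0) - frechet_derivative (vxi V) (at p) (1, 0, 0) * u1)
    + (pderiv_u (veta V) p - frechet_derivative (vtau V) (at p) (1, 0, 0) - pderiv_u (vxi V) p * u1) * eG E (t, x, u, u1, u2, v)
    - eF E (t, x, u, u1, u2, v) * (\<psi>0 + v * \<psi>1)
    - frechet_derivative (eG E) (at (t, x, u, u1, u2, v)) (vtau V p, vxi V p, veta V p, b1, b2,
        e3 + v * (pderiv_u (veta V) p - 4 * pderiv_u (vxi V) p * u1 - 3 * pderiv_x (vxi V) p)) = 0"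
    if "(t, x, u, u1, u2, v) \<in> edom E" for v
    using prolong_eq_fun[OF E, of "J v" V] that unfolding j3 t3 P4 P10 c(4) by (simp add: algebra_simps)
  show ?thesis
    by (rule exI[of _ \<psi>0], rule exI[of _ \<psi>1], rule exI[of _ b1], rule exI[of _ b2], rule exI[of _ e3], intro allI impI) (rule *)
qed

text \<open>In the pencil the term \<xi>_t u_x belongs to the unrestricted vector w, so a time
  dependent translation in x survives there. Once \<tau> = \<eta> = 0 and \<xi> depends on t alone,
  the prolongation coefficients of the x-derivatives vanish and that of u_t is -\<xi>_t u_x.\<close>

lemma time_dependent_translation:
  assumes E: "evolution_equation E" and adm: "admits E V" and z: "(t, x, u, u1, u2, u3) \<in> edom E"
    and V0: "\<And>p. p \<in> base E \<Longrightarrow> vtau V p = 0" "\<And>p. p \<in> base E \<Longrightarrow> veta V p = 0"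
      "\<And>p. p \<in> base E \<Longrightarrow> pderiv_x (vxi V) p = 0" "\<And>p. p \<in> base E \<Longrightarrow> pderiv_u (vxi V) p = 0"
    and dir: "\<And>z. z \<in> edom E \<Longrightarrow> frechet_derivative (eG E) (at z) (0, 1, 0, 0, 0, 0) = 0"
  shows "frechet_derivative (vxi V) (at (t, x, u)) (1, 0, 0) * u1 = 0"
proof -
  let ?N = "edom E" and ?z = "(t, x, u, u1, u2, u3)"
  have N: "open ?N" "open (base E)" using smooth_eqD(1)[OF E] base_open by (auto simp: base_def)
  have smV: "smooth_on V (base E)" using adm by (simp add: admits_def)
  interpret jets "jets_over ?N" "base E" by (rule jets_over[OF N]) (simp add: base_def)
  interpret jets_vf "jets_over ?N" "base E" V by unfold_locales (rule smV)
  have p: "(t, x, u) \<in> base E" using z by (force simp: base_def)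
  have der0: "frechet_derivative f (at q) w = 0" if "smooth_on f (base E)" "\<And>p. p \<in> base E \<Longrightarrow> f p = 0" "q \<in> base E" for f :: "point \<Rightarrow> real" and q w
    by (rule derivative_zero_direction[OF N(2) that(3,1)]) (simp add: that)
  define J where "J = (t, x, \<lambda>i j. if i = 1 \<and> j = 0 then eG E ?z else jc (emb ?z) i j)"
  have j3: "jet3_of_jet J = ?z" by (simp add: J_def jet3_of_jet_eq emb_def)
  have J: "J \<in> jets_over ?N" using z j3 by (simp add: jets_over_def)
  have pJ: "point_of_jet J = (t, x, u)" by (simp add: J_def point_of_jet_eq emb_def)
  have c: "jc J 0 4 = 0" "jc J 1 0 = eG E ?z" "jc J 0 (Suc 0) = u1" by (simp_all add: J_def emb_def)
  have sol: "eq_fun E J = 0" unfolding eq_fun_eq j3 c by simp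
  then have pr: "prolong V (eq_fun E) J = 0" using adm z j3 unfolding admits_def by metis
  have d0: "pderiv_x f q = 0" "pderiv_u f q = 0" if "smooth_on f (base E)" "\<And>p. p \<in> base E \<Longrightarrow> f p = 0" "q \<in> base E" for f q
    unfolding pderiv_x_def pderiv_u_def using der0[OF that] by simp_all
  note t0 = Dx_base_zero[OF smooth_components(1) d0[OF smooth_components(1) V0(1)] J]
  note e0 = Dx_base_zero[OF smooth_components(3) d0[OF smooth_components(3) V0(2)] J]
  note x0 = Dx_base_zero[OF smooth_components(2) V0(3,4) J]
  have P: "prol_coeff V 0 1 J = 0" "prol_coeff V 0 2 J = 0" "prol_coeff V 0 3 J = 0" "prol_coeff V 0 4 J = 0"
    unfolding prol_explicit[OF J] by (simp_all add: t0 e0 x0)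
  have P10: "prol_coeff V 1 0 J = - frechet_derivative (vxi V) (at (t, x, u)) (1, 0, 0) * u1"
    unfolding prol_explicit(5)[OF J] Dt_base[OF smooth_components(1) J] Dt_base[OF smooth_components(2) J] Dt_base[OF smooth_components(3) J] pJ
    using c der0[OF smooth_components(1) V0(1) p] der0[OF smooth_components(3) V0(2) p] V0(4)[OF p]
    by (simp add: pderiv_u_def)
  have "tangent3 (pv V J) = vxi V (t, x, u) *\<^sub>R (0, 1, 0, 0, 0, 0)"
    unfolding tangent3_def pv_simps P prol_00 pJ using V0(1,2)[OF p] by simp
  then have "frechet_derivative (eG E) (at ?z) (tangent3 (pv V J)) = 0"
    using dir[OF z] linear_cmul[OF has_derivative_linear[OF smooth_on_has_derivative[OF smooth_eqD(3)[OF E] z]]]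
    by (simp only: mult_zero_right real_scaleR_def)
  then show ?thesis using prolong_eq_fun[OF E, of J V] pr z unfolding j3 P P10 c by simp
qed

section \<open>Generic members of the families\<close>

text \<open>The choice \<open>(a, b) = (1, 0)\<close> serves the family of \<open>\<partial>\<^sub>t\<close> and \<open>(0, 1)\<close> that of \<open>\<partial>\<^sub>x\<close>.\<close>

definition gen_g :: "real \<Rightarrow> real \<Rightarrow> real \<Rightarrow> jet3 \<Rightarrow> real" where
  "gen_g a b \<kappa> = (\<lambda>(t, x, u, u1, u2, u3). gen_h \<kappa> (a * x + b * t) u u3)"

lemma smooth_gen_g: "open S \<Longrightarrow> smooth_on (gen_g a b \<kappa>) S"
proof -
  assume S: "open S"
  have e: "gen_g a b \<kappa> = (\<lambda>z. exp (\<kappa> * snd (snd (snd (snd (snd z))))) *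
     (snd (snd (snd (snd (snd z)))) * (snd (snd (snd (snd (snd z)))) * (snd (snd (snd (snd (snd z)))) * snd (snd (snd (snd (snd z))))))
       + (a * fst (snd z) + b * fst z) + fst (snd (snd z)) * snd (snd (snd (snd (snd z))))))"
    by (auto simp: gen_g_def gen_h_def power4_eq_xxxx fun_eq_iff algebra_simps)
  have v: "smooth_on (\<lambda>z::jet3. snd (snd (snd (snd (snd z))))) S" and u: "smooth_on (\<lambda>z::jet3. fst (snd (snd z))) S"
    and x: "smooth_on (\<lambda>z::jet3. fst (snd z)) S" and t: "smooth_on (\<lambda>z::jet3. fst z) S"
    by (intro smooth_on_bounded_linear S bounded_linear_fst bounded_linear_fst_comp bounded_linear_snd_comp bounded_linear_snd)+
  have m: "smooth_on (\<lambda>z. c * f z) S" if "smooth_on f S" for c and f :: "jet3 \<Rightarrow> real"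
    by (rule smooth_on_mult[OF S smooth_on_const that])
  have "smooth_on (exp :: real \<Rightarrow> real) UNIV" using Ck_on_exp by (simp add: smooth_on_def)
  from smooth_on_compose[OF S open_UNIV _ m[OF v] this]
  have ex: "smooth_on (\<lambda>z::jet3. exp (\<kappa> * snd (snd (snd (snd (snd z)))))) S" by simp
  show ?thesis unfolding e
    by (rule smooth_on_mult[OF S ex smooth_on_add[OF S smooth_on_add[OF S smooth_on_mult[OF S v smooth_on_mult[OF S v smooth_on_mult[OF S v v]]]
      smooth_on_add[OF S m[OF x] m[OF t]]] smooth_on_mult[OF S u v]]])
qed

lemma frechet_gen_g:
  "frechet_derivative (gen_g a b \<kappa>) (at (t, x, u, u1, u2, v)) (dt, dx, du, d1, d2, d3) =
     exp (\<kappa> * v) * (a * dx + b * dt) + v * exp (\<kappa> * v) * du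
     + exp (\<kappa> * v) * (\<kappa> * (v ^ 4 + (a * x + b * t) + u * v) + 4 * v ^ 3 + u) * d3"
proof -
  let ?z = "(t, x, u, u1, u2, v)" and ?w = "(dt, dx, du, d1, d2, d3)"
  have "((\<lambda>s. gen_g a b \<kappa> (?z + s *\<^sub>R ?w)) has_real_derivative frechet_derivative (gen_g a b \<kappa>) (at ?z) ?w) (at 0)"
    unfolding has_real_derivative_iff_has_vector_derivative
    by (rule frechet_directional[OF smooth_on_has_derivative[OF smooth_gen_g[OF open_UNIV] UNIV_I]])
  moreover have "((\<lambda>s. gen_g a b \<kappa> (?z + s *\<^sub>R ?w)) has_real_derivative
     exp (\<kappa> * v) * (a * dx + b * dt) + v * exp (\<kappa> * v) * du
     + exp (\<kappa> * v) * (\<kappa> * (v ^ 4 + (a * x + b * t) + u * v) + 4 * v ^ 3 + u) * d3) (at 0)"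
    unfolding gen_g_def gen_h_def
    by (auto intro!: derivative_eq_intros simp: algebra_simps)
  ultimately show ?thesis by (rule DERIV_unique)
qed

lemma zero_if_zero_on_dense:
  fixes f :: "'a::topological_space \<Rightarrow> 'b::t1_space"
  assumes Q: "\<And>X. open X \<Longrightarrow> X \<noteq> {} \<Longrightarrow> \<exists>d\<in>Q. d \<in> X" and N: "open N" and f: "continuous_on N f"
    and z: "\<And>z. z \<in> Q \<Longrightarrow> z \<in> N \<Longrightarrow> f z = c" and zN: "z \<in> N"
  shows "f z = c"
proof (rule ccontr)
  assume "f z \<noteq> c"
  have "open (N \<inter> f -` (- {c}))" using continuous_open_preimage[OF f N, of "- {c}"] by auto
  moreover have "z \<in> N \<inter> f -` (- {c})" using zN \<open>f z \<noteq> c\<close> by simp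
  ultimately obtain d where "d \<in> Q" "d \<in> N" "f d \<noteq> c" using Q[of "N \<inter> f -` (- {c})"] by blast
  then show False using z by blast
qed

text \<open>On the left stand the unknowns multiplied by terms that s g changes, on the right those
  multiplied by functions that s g leaves alone.\<close>

lemma pencil_form:
  fixes k :: real
  assumes "k + e1 * (G + s * h) - F * (\<psi>0 + v * \<psi>1) - ((\<sigma> * Gy + \<eta> * Gu + b1 * G1 + b2 * G2 + (e3 + v * e2) * G3)
     + s * (x * \<sigma> + v * x * \<eta> + d * (e3 + v * e2))) = 0"
  shows "(e1, - \<sigma>, - \<eta>, - e3, - e2) \<bullet> ((G, Gy, Gu, G3, v * G3) + s *\<^sub>R (h, x, v * x, d, v * d)) = (- k, \<psi>0, \<psi>1, b1, b2) \<bullet> (1, F, v * F, G1, G2)"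
proof -
  have "e1 * (G + s * h) + (- \<sigma> * (Gy + s * x) + (- \<eta> * (Gu + s * (v * x)) + (- e3 * (G3 + s * d) + - e2 * (v * G3 + s * (v * d)))))
     = - k * 1 + (\<psi>0 * F + (\<psi>1 * (v * F) + (b1 * G1 + b2 * G2)))"
    using assms by (simp add: algebra_simps)
  then show ?thesis by (simp only: inner_Pair inner_real_def add_Pair scaleR_Pair real_scaleR_def)
qed

text \<open>One exceptional set has to serve every open N and every V on it. Jets from a countable
  dense set, each with intervals in u_xxx shrinking to zero, test every N, and continuity extends
  the vanishing from the dense set to all of N.\<close>

lemma generic_symmetries:
  assumes E: "evolution_equation E" and ab: "(a, b) = (1, 0) \<or> (a, b) = (0, 1)"
    and dir: "\<And>z. z \<in> edom E \<Longrightarrow> frechet_derivative (eG E) (at z) (a, b, 0, 0, 0, 0) = 0"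
  shows "\<exists>\<kappa> C. countable C \<and> (\<forall>s N V t x u u1 u2 u3. s \<notin> C \<longrightarrow> open N \<longrightarrow> N \<subseteq> edom E \<longrightarrow>
     admits (E\<lparr>eG := \<lambda>z. eG E z + s * gen_g a b \<kappa> z, edom := N\<rparr>) V \<longrightarrow> (t, x, u, u1, u2, u3) \<in> N \<longrightarrow>
     a * vxi V (t, x, u) + b * vtau V (t, x, u) = 0 \<and> veta V (t, x, u) = 0 \<and>
     pderiv_u (veta V) (t, x, u) - frechet_derivative (vtau V) (at (t, x, u)) (1, 0, 0) - pderiv_u (vxi V) (t, x, u) * u1 = 0 \<and>
     pderiv_u (veta V) (t, x, u) - 4 * pderiv_u (vxi V) (t, x, u) * u1 - 3 * pderiv_x (vxi V) (t, x, u) = 0)"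
proof -
  obtain Q :: "jet3 set" where Q: "countable Q" "\<And>X. open X \<Longrightarrow> X \<noteq> {} \<Longrightarrow> \<exists>d\<in>Q. d \<in> X" by (rule countable_dense_setE) blast
  define I where "I = Q \<times> (UNIV :: nat set)"
  have cI: "countable I" unfolding I_def using Q(1) by simp
  define u3 where "u3 i = snd (snd (snd (snd (snd (fst i)))))" for i :: "jet3 \<times> nat"
  define z where "z i v = (case fst i of (t, x, u, u1, u2, u3) \<Rightarrow> (t, x, u, u1, u2, v))" for i :: "jet3 \<times> nat" and v :: real
  define \<epsilon> where "\<epsilon> i = 1 / real (Suc (snd i))" for i :: "jet3 \<times> nat"
  let ?G = "\<lambda>i v w. frechet_derivative (eG E) (at (z i v)) w"
  \<comment> \<open>(b, a) is the direction of the variable, x or t, on which the family may still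
    depend; \<sigma> is the matching component of V.\<close>
  define A :: "jet3 \<times> nat \<Rightarrow> real \<Rightarrow> real5" where
    "A i v = (eG E (z i v), ?G i v (b, a, 0, 0, 0, 0), ?G i v (0, 0, 1, 0, 0, 0), ?G i v (0, 0, 0, 0, 0, 1), v * ?G i v (0, 0, 0, 0, 0, 1))" for i v
  define W :: "jet3 \<times> nat \<Rightarrow> real \<Rightarrow> real5" where
    "W i v = (1, eF E (z i v), v * eF E (z i v), ?G i v (0, 0, 0, 1, 0, 0), ?G i v (0, 0, 0, 0, 1, 0))" for i v
  define y where "y i = a * fst (snd (fst i)) + b * fst (fst i)" for i :: "jet3 \<times> nat"
  define uu where "uu i = fst (snd (snd (fst i)))" for i :: "jet3 \<times> nat"
  have "\<exists>\<kappa> C. countable C \<and> (\<forall>s i Y w. s \<notin> C \<longrightarrow> i \<in> I \<longrightarrow>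
     (\<forall>v\<in>{u3 i - \<epsilon> i<..<u3 i + \<epsilon> i}. Y \<bullet> (A i v + s *\<^sub>R gen_b \<kappa> (y i) (uu i) v) = w \<bullet> W i v) \<longrightarrow> Y = 0)"
    by (rule generic_parameters[OF cI]) (simp add: \<epsilon>_def)
  then obtain \<kappa> C where \<kappa>C: "countable C \<and> (\<forall>s i Y w. s \<notin> C \<longrightarrow> i \<in> I \<longrightarrow>
     (\<forall>v\<in>{u3 i - \<epsilon> i<..<u3 i + \<epsilon> i}. Y \<bullet> (A i v + s *\<^sub>R gen_b \<kappa> (y i) (uu i) v) = w \<bullet> W i v) \<longrightarrow> Y = 0)"
    by (elim exE) (rule that)
  note C = conjunct1[OF \<kappa>C] and key = conjunct2[OF \<kappa>C, rule_format]
  define \<sigma> where "\<sigma> V p = a * vxi V p + b * vtau V p" for V and p :: point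
  define e1 where "e1 V p k = pderiv_u (veta V) p - frechet_derivative (vtau V) (at p) (1, 0, 0) - pderiv_u (vxi V) p * k" for V p and k :: real
  define e2 where "e2 V p k = pderiv_u (veta V) p - 4 * pderiv_u (vxi V) p * k - 3 * pderiv_x (vxi V) p" for V p and k :: real
  have main: "\<sigma> V (t, x, u) = 0 \<and> veta V (t, x, u) = 0 \<and> e1 V (t, x, u) u1 = 0 \<and> e2 V (t, x, u) u1 = 0"
    if s: "s \<notin> C" and N: "open N" "N \<subseteq> edom E" and adm: "admits (E\<lparr>eG := \<lambda>z. eG E z + s * gen_g a b \<kappa> z, edom := N\<rparr>) V"
      and zN: "(t, x, u, u1, u2, v3) \<in> N" for s N V t x u u1 u2 v3
  proof -
    define E' where "E' = E\<lparr>eG := \<lambda>z. eG E z + s * gen_g a b \<kappa> z, edom := N\<rparr>"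
    have E's: "edom E' = N" "eF E' = eF E" "eG E' = (\<lambda>z. eG E z + s * gen_g a b \<kappa> z)" by (simp_all add: E'_def)
    have smG: "smooth_on (eG E) N" "smooth_on (gen_g a b \<kappa>) N" using smooth_on_subset[OF smooth_eqD(3)[OF E] N(2)] smooth_gen_g[OF N(1)] by blast+
    have EE: "evolution_equation E'"
      unfolding evolution_equation_def E's using N zN smooth_on_subset[OF smooth_eqD(2)[OF E] N(2)] smooth_eqD(4)[OF E]
        smooth_on_add[OF N(1) smG(1) smooth_on_mult[OF N(1) smooth_on_const smG(2)]] by auto
    have adm: "admits E' V" using adm unfolding E'_def .
    have oB: "open (base E')" using base_open[OF N(1)] by (simp add: base_def E's)
    have smV: "smooth_on V (base E')" using adm by (simp add: admits_def)
    have sm: "smooth_on (vtau V) (base E')" "smooth_on (vxi V) (base E')" "smooth_on (veta V) (base E')"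
      using smooth_on_compose_linear[OF oB bounded_linear_fst smV]
        smooth_on_compose_linear[OF oB bounded_linear_compose[OF bounded_linear_fst bounded_linear_snd] smV]
        smooth_on_compose_linear[OF oB bounded_linear_compose[OF bounded_linear_snd bounded_linear_snd] smV] by auto
    have fr: "frechet_derivative (eG E') (at q) w = frechet_derivative (eG E) (at q) w + s * frechet_derivative (gen_g a b \<kappa>) (at q) w" if q: "q \<in> N" for q w
    proof -
      have "(eG E' has_derivative (\<lambda>w. frechet_derivative (eG E) (at q) w + s * frechet_derivative (gen_g a b \<kappa>) (at q) w)) (at q)"
        unfolding E's by (intro has_derivative_add has_derivative_mult_right smooth_on_has_derivative[OF smG(1) q] smooth_on_has_derivative[OF smG(2) q])
      from fun_cong[OF frechet_derivative_at[OF this]] show ?thesis by simp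
    qed
    define c :: "jet3 \<Rightarrow> real \<times> real \<times> real \<times> real" where
      "c q = (\<sigma> V (point_of_jet3 q), veta V (point_of_jet3 q), e1 V (point_of_jet3 q) (fst (snd (snd (snd q)))), e2 V (point_of_jet3 q) (fst (snd (snd (snd q)))))" for q
    have "c (t, x, u, u1, u2, v3) = 0"
    proof (rule zero_if_zero_on_dense[OF Q(2) N(1) _ _ zN])
      have sub: "point_of_jet3 ` N \<subseteq> base E'" by (simp add: base_def E's)
      have pc: "continuous_on N (\<lambda>q. f (point_of_jet3 q))" if "smooth_on f (base E')" for f :: "point \<Rightarrow> real"
        by (rule continuous_on_compose2[OF smooth_on_continuous_on[OF that] linear_continuous_on[OF bounded_linear_point3] sub])
      have pd: "smooth_on (pderiv_u f) (base E')" "smooth_on (pderiv_x f) (base E')" "smooth_on (\<lambda>p. frechet_derivative f (at p) (1, 0, 0)) (base E')"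
        if "smooth_on f (base E')" for f :: "point \<Rightarrow> real"
        using smooth_on_frechet[OF that] by (simp_all add: pderiv_u_def[abs_def] pderiv_x_def[abs_def])
      show "continuous_on N c"
        unfolding c_def \<sigma>_def e1_def e2_def
        by (intro continuous_intros pc[OF sm(1)] pc[OF sm(2)] pc[OF sm(3)] pc[OF pd(1)[OF sm(3)]] pc[OF pd(3)[OF sm(1)]] pc[OF pd(1)[OF sm(2)]] pc[OF pd(2)[OF sm(2)]])
    next
      fix q assume q: "q \<in> Q" "q \<in> N"
      obtain t x u u1 u2 v3 where qq: "q = (t, x, u, u1, u2, v3)" by (metis surj_pair)
      let ?p = "(t, x, u)"
      have p: "?p \<in> base E'" using q(2) qq by (force simp: base_def E's)
      obtain r where r: "r > 0" "ball q r \<subseteq> N" using N(1) q(2) open_contains_ball by blast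
      obtain n where n: "1 / real (Suc n) < r" using nat_approx_posE[OF r(1)] by blast
      define i where "i = (q, n)"
      have i: "i \<in> I" using q by (simp add: i_def I_def)
      have zi: "z i v = (t, x, u, u1, u2, v)" "u3 i = v3" "y i = a * x + b * t" "uu i = u" "\<epsilon> i = 1 / real (Suc n)" for v
        by (simp_all add: z_def i_def qq u3_def y_def uu_def \<epsilon>_def)
      have inN: "(t, x, u, u1, u2, v) \<in> N" if "v \<in> {u3 i - \<epsilon> i<..<u3 i + \<epsilon> i}" for v
      proof -
        have "dist q (t, x, u, u1, u2, v) = \<bar>v3 - v\<bar>" by (simp add: qq dist_prod_def dist_real_def)
        then have "(t, x, u, u1, u2, v) \<in> ball q r" using that n zi(2,5) unfolding mem_ball by (simp add: abs_less_iff)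
        then show ?thesis using r(2) by blast
      qed
      obtain \<psi>0 \<psi>1 b1 b2 e3 where det: "\<And>v. (t, x, u, u1, u2, v) \<in> edom E' \<Longrightarrow>
          (frechet_derivative (veta V) (at ?p) (1, 0, 0) - frechet_derivative (vxi V) (at ?p) (1, 0, 0) * u1)
          + e1 V ?p u1 * eG E' (t, x, u, u1, u2, v)
          - eF E' (t, x, u, u1, u2, v) * (\<psi>0 + v * \<psi>1)
          - frechet_derivative (eG E') (at (t, x, u, u1, u2, v)) (vtau V ?p, vxi V ?p, veta V ?p, b1, b2, e3 + v * e2 V ?p u1) = 0"
        using determining_equation[OF EE adm p, of u1 u2] unfolding e1_def e2_def by (elim exE) blast
      define k0 where "k0 = frechet_derivative (veta V) (at ?p) (1, 0, 0) - frechet_derivative (vxi V) (at ?p) (1, 0, 0) * u1"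
      define Y :: real5 where "Y = (e1 V ?p u1, - \<sigma> V ?p, - veta V ?p, - e3, - e2 V ?p u1)"
      define w :: real5 where "w = (- k0, \<psi>0, \<psi>1, b1, b2)"
      have "Y = 0"
      proof (rule key[OF s i])
        fix v assume v: "v \<in> {u3 i - \<epsilon> i<..<u3 i + \<epsilon> i}"
        let ?z = "(t, x, u, u1, u2, v)"
        have zN: "?z \<in> N" by (rule inN[OF v])
        define H where "H = frechet_derivative (eG E) (at ?z)"
        have lin: "linear H" unfolding H_def by (rule has_derivative_linear[OF smooth_on_has_derivative[OF smG(1) zN]])
        have H0: "H (a, b, 0, 0, 0, 0) = 0" unfolding H_def using dir N(2) zN by blast
        have d: "H (dt, dx, du, d1, d2, d3) = (a * dx + b * dt) * H (b, a, 0, 0, 0, 0) + du * H (0, 0, 1, 0, 0, 0)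
           + d1 * H (0, 0, 0, 1, 0, 0) + d2 * H (0, 0, 0, 0, 1, 0) + d3 * H (0, 0, 0, 0, 0, 1)" for dt dx du d1 d2 d3
        proof -
          have "(dt, dx, du, d1, d2, d3) = (a * dt + b * dx) *\<^sub>R (a, b, 0, 0, 0, 0) + ((a * dx + b * dt) *\<^sub>R (b, a, 0, 0, 0, 0)
            + (du *\<^sub>R (0, 0, 1, 0, 0, 0) + (d1 *\<^sub>R (0, 0, 0, 1, 0, 0) + (d2 *\<^sub>R (0, 0, 0, 0, 1, 0) + d3 *\<^sub>R (0, 0, 0, 0, 0, 1)))))"
            using ab by auto
          then show ?thesis by (simp only: linear_add[OF lin] linear_cmul[OF lin] H0 real_scaleR_def)
        qed
        have g: "gen_g a b \<kappa> ?z = gen_h \<kappa> (a * x + b * t) u v" by (simp add: gen_g_def)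
        have "k0 + e1 V ?p u1 * (eG E ?z + s * gen_h \<kappa> (a * x + b * t) u v) - eF E ?z * (\<psi>0 + v * \<psi>1)
          - (H (vtau V ?p, vxi V ?p, veta V ?p, b1, b2, e3 + v * e2 V ?p u1)
            + s * (exp (\<kappa> * v) * \<sigma> V ?p + v * exp (\<kappa> * v) * veta V ?p
              + exp (\<kappa> * v) * (\<kappa> * (v ^ 4 + (a * x + b * t) + u * v) + 4 * v ^ 3 + u) * (e3 + v * e2 V ?p u1))) = 0"
          using det[of v, unfolded E's, OF zN] unfolding E's fr[OF zN, unfolded E's] frechet_gen_g g H_def \<sigma>_def k0_def .
        from this[unfolded d[of "vtau V ?p" "vxi V ?p" "veta V ?p" b1 b2 "e3 + v * e2 V ?p u1", folded \<sigma>_def]] show "Y \<bullet> (A i v + s *\<^sub>R gen_b \<kappa> (y i) (uu i) v) = w \<bullet> W i v"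
          unfolding Y_def w_def A_def W_def gen_b_def zi H_def[symmetric] by (rule pencil_form)
      qed
      then show "c q = 0" by (simp add: Y_def c_def qq zero_prod_def)
    qed
    then show ?thesis by (simp add: c_def zero_prod_def)
  qed
  show ?thesis
    by (rule exI[of _ \<kappa>], rule exI[of _ C], rule conjI[OF C], intro allI impI) (rule main[unfolded \<sigma>_def e1_def e2_def])
qed

section \<open>Maximality of the two algebras\<close>

lemma smooth_on_vcomponents:
  assumes "open B" "smooth_on V B"
  shows "smooth_on (vtau V) B" "smooth_on (vxi V) B" "smooth_on (veta V) B"
  using smooth_on_compose_linear[OF assms(1) bounded_linear_fst assms(2)]
    smooth_on_compose_linear[OF assms(1) bounded_linear_compose[OF bounded_linear_fst bounded_linear_snd] assms(2)]
    smooth_on_compose_linear[OF assms(1) bounded_linear_compose[OF bounded_linear_snd bounded_linear_snd] assms(2)] by auto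

lemma constant_if_partials_zero:
  fixes f :: "point \<Rightarrow> real"
  assumes B: "open B" "connected B" and f: "smooth_on f B"
    and z: "\<And>p. p \<in> B \<Longrightarrow> frechet_derivative f (at p) (1, 0, 0) = 0" "\<And>p. p \<in> B \<Longrightarrow> pderiv_x f p = 0" "\<And>p. p \<in> B \<Longrightarrow> pderiv_u f p = 0"
  shows "\<exists>c. \<forall>p\<in>B. f p = c"
proof -
  have "(f has_derivative (\<lambda>h. 0)) (at p)" if p: "p \<in> B" for p
  proof -
    have "frechet_derivative f (at p) h = 0" for h
      using frechet_split[OF f p, of "fst h" "fst (snd h)" "snd (snd h)"] z[OF p] by (simp add: pderiv_x_def pderiv_u_def)
    then have "frechet_derivative f (at p) = (\<lambda>h. 0)" by (rule ext)
    then show ?thesis using smooth_on_has_derivative[OF f p] by simp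
  qed
  then have "f constant_on B"
    by (intro has_derivative_zero_connected_constant_on[OF B(2,1), of "{}"]) (auto intro: smooth_on_continuous_on[OF f] has_derivative_at_withinI)
  then show ?thesis by (simp add: constant_on_def)
qed

lemma family_add:
  shows "family_t E \<Longrightarrow> family_t (E\<lparr>eG := \<lambda>z. eG E z + s * gen_g 1 0 \<kappa> z\<rparr>)"
    and "family_x E \<Longrightarrow> family_x (E\<lparr>eG := \<lambda>z. eG E z + s * gen_g 0 1 \<kappa> z\<rparr>)"
proof -
  have ev: "evolution_equation (E\<lparr>eG := \<lambda>z. eG E z + s * gen_g a b \<kappa> z\<rparr>)" if "evolution_equation E" for a b
    using that smooth_on_add[OF smooth_eqD(1)[OF that] smooth_eqD(3)[OF that] smooth_on_mult[OF smooth_eqD(1)[OF that] smooth_on_const smooth_gen_g[OF smooth_eqD(1)[OF that]]]]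
    by (simp add: evolution_equation_def)
  show "family_t (E\<lparr>eG := \<lambda>z. eG E z + s * gen_g 1 0 \<kappa> z\<rparr>)" if E: "family_t E"
  proof -
    obtain F G where FG: "\<forall>(t, x, u, u1, u2, u3) \<in> edom E. eF E (t, x, u, u1, u2, u3) = F (x, u, u1, u2, u3) \<and>
        eG E (t, x, u, u1, u2, u3) = G (x, u, u1, u2, u3)" using E unfolding family_t_def by (elim conjE exE) (rule that)
    show ?thesis unfolding family_t_def
      by (rule conjI, rule ev, use E in \<open>simp add: family_t_def\<close>, rule exI[of _ F],
          rule exI[of _ "\<lambda>(x, u, u1, u2, u3). G (x, u, u1, u2, u3) + s * gen_h \<kappa> x u u3"])
        (use FG in \<open>auto simp: gen_g_def\<close>)
  qed
  show "family_x (E\<lparr>eG := \<lambda>z. eG E z + s * gen_g 0 1 \<kappa> z\<rparr>)" if E: "family_x E"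
  proof -
    obtain F G where FG: "\<forall>(t, x, u, u1, u2, u3) \<in> edom E. eF E (t, x, u, u1, u2, u3) = F (t, u, u1, u2, u3) \<and>
        eG E (t, x, u, u1, u2, u3) = G (t, u, u1, u2, u3)" using E unfolding family_x_def by (elim conjE exE) (rule that)
    show ?thesis unfolding family_x_def
      by (rule conjI, rule ev, use E in \<open>simp add: family_x_def\<close>, rule exI[of _ F],
          rule exI[of _ "\<lambda>(t, u, u1, u2, u3). G (t, u, u1, u2, u3) + s * gen_h \<kappa> t u u3"])
        (use FG in \<open>auto simp: gen_g_def\<close>)
  qed
qed

lemma evolution_equation_restrict:
  "evolution_equation E \<Longrightarrow> open N \<Longrightarrow> N \<noteq> {} \<Longrightarrow> N \<subseteq> edom E \<Longrightarrow> evolution_equation (E\<lparr>edom := N\<rparr>)"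
  by (auto simp: evolution_equation_def intro: smooth_on_subset)

lemma frechet_zero_on:
  fixes f :: "'a::real_normed_vector \<Rightarrow> real"
  assumes "open B" "smooth_on f B" "\<And>p. p \<in> B \<Longrightarrow> f p = 0" "p \<in> B"
  shows "frechet_derivative f (at p) v = 0"
  by (rule derivative_zero_direction[OF assms(1,4,2)]) (simp add: assms(3,4))

lemma generically_admits_only_t: "generically_admits_only family_t vf_t"
  unfolding generically_admits_only_def
proof (intro allI impI)
  fix E assume E: "family_t E"
  have ev: "evolution_equation E" using E by (simp add: family_t_def)
  obtain \<kappa> C where *: "countable C \<and> (\<forall>s N V t x u u1 u2 u3. s \<notin> C \<longrightarrow> open N \<longrightarrow> N \<subseteq> edom E \<longrightarrow>
     admits (E\<lparr>eG := \<lambda>z. eG E z + s * gen_g 1 0 \<kappa> z, edom := N\<rparr>) V \<longrightarrow> (t, x, u, u1, u2, u3) \<in> N \<longrightarrow>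
     1 * vxi V (t, x, u) + 0 * vtau V (t, x, u) = 0 \<and> veta V (t, x, u) = 0 \<and>
     pderiv_u (veta V) (t, x, u) - frechet_derivative (vtau V) (at (t, x, u)) (1, 0, 0) - pderiv_u (vxi V) (t, x, u) * u1 = 0 \<and>
     pderiv_u (veta V) (t, x, u) - 4 * pderiv_u (vxi V) (t, x, u) * u1 - 3 * pderiv_x (vxi V) (t, x, u) = 0)"
    by (rule exE[OF generic_symmetries[OF ev disjI1[OF refl] family_t_direction(2)[OF E]]], assumption, elim exE) (rule that)
  note key = conjunct2[OF *, rule_format]
  let ?E = "\<lambda>s. E\<lparr>eG := \<lambda>z. eG E z + s * gen_g 1 0 \<kappa> z\<rparr>"
  have "admits_only (?E s) vf_t" if s: "s \<notin> C" for s
    unfolding admits_only_def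
  proof (intro allI impI, elim conjE)
    fix N V assume N: "open N" "connected N" "N \<subseteq> edom (?E s)" and adm: "admits ((?E s)\<lparr>edom := N\<rparr>) V"
    show "\<exists>c. \<forall>p\<in>point_of_jet3 ` N. V p = c *\<^sub>R vf_t p"
    proof (cases "N = {}")
      case False
      have N': "N \<subseteq> edom E" using N(3) by simp
      have ev': "evolution_equation ((?E s)\<lparr>edom := N\<rparr>)"
        by (rule evolution_equation_restrict[OF _ N(1) False N(3)]) (use family_add(1)[OF E] in \<open>simp add: family_t_def\<close>)
      let ?B = "point_of_jet3 ` N"
      have b: "base ((?E s)\<lparr>edom := N\<rparr>) = ?B" by (simp add: base_def)
      have B: "open ?B" "connected ?B"
        using base_open[OF N(1)] connected_continuous_image[OF linear_continuous_on[OF bounded_linear_point3] N(2)] by auto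
      have smV: "smooth_on V ?B" using adm unfolding admits_def b by blast
      note sm = smooth_on_vcomponents[OF B(1) smV]
      have k: "vxi V p = 0" "veta V p = 0" "\<exists>k. pderiv_u (veta V) p - frechet_derivative (vtau V) (at p) (1, 0, 0) - pderiv_u (vxi V) p * k = 0" if p: "p \<in> ?B" for p
      proof -
        obtain t x u u1 u2 u3 where z: "(t, x, u, u1, u2, u3) \<in> N" "p = (t, x, u)" using p by force
        from key[OF s N(1) N' adm z(1)] z(2)
        show "vxi V p = 0" "veta V p = 0" "\<exists>k. pderiv_u (veta V) p - frechet_derivative (vtau V) (at p) (1, 0, 0) - pderiv_u (vxi V) p * k = 0" by auto
      qed
      \<comment> \<open>With \<xi> and \<eta> identically zero the third relation reduces to
        \<tau>_t = 0.\<close>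
      have tt: "frechet_derivative (vtau V) (at p) (1, 0, 0) = 0" if p: "p \<in> ?B" for p
        using k(3)[OF p] frechet_zero_on[OF B(1) sm(2) k(1) p] frechet_zero_on[OF B(1) sm(3) k(2) p] by (auto simp: pderiv_u_def)
      have tx: "pderiv_x (vtau V) p = 0" "pderiv_u (vtau V) p = 0" if "p \<in> ?B" for p
        using admits_tau[OF ev' adm] that unfolding b by blast+
      obtain c where c: "\<And>p. p \<in> ?B \<Longrightarrow> vtau V p = c" using constant_if_partials_zero[OF B sm(1) tt tx] by blast
      have "V p = c *\<^sub>R vf_t p" if "p \<in> ?B" for p using k(1,2)[OF that] c[OF that] by (simp add: vf_t_def prod_eq_iff)
      then show ?thesis by blast
    qed simp
  qed
  then show "\<exists>g C. countable C \<and> (\<forall>s. family_t (E\<lparr>eG := \<lambda>z. eG E z + s * g z\<rparr>)) \<and>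
     (\<forall>s. s \<notin> C \<longrightarrow> admits_only (E\<lparr>eG := \<lambda>z. eG E z + s * g z\<rparr>) vf_t)"
    by (intro exI[of _ "gen_g 1 0 \<kappa>"] exI[of _ C] conjI conjunct1[OF *] allI impI family_add(1)[OF E])
qed

text \<open>The relations see \<xi>_u only in the product \<xi>_u u_x, and likewise \<xi>_t, so a
  jet with non-zero u_x over the same point is required.\<close>

lemma nonzero_ux:
  fixes N :: "jet3 set"
  assumes "open N" "(t, x, u, u1, u2, u3) \<in> N"
  obtains v where "v \<noteq> 0" "(t, x, u, v, u2, u3) \<in> N"
proof (cases "u1 = 0")
  case True
  let ?z = "(t, x, u, u1, u2, u3)"
  obtain r where r: "r > 0" "ball ?z r \<subseteq> N" using assms open_contains_ball by blast
  have "(t, x, u, r / 2, u2, u3) \<in> ball ?z r" using r(1) True by (simp add: dist_prod_def dist_real_def)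
  then show ?thesis using that[of "r / 2"] r by auto
qed (use that assms in blast)

lemma generically_admits_only_x: "generically_admits_only family_x vf_x"
  unfolding generically_admits_only_def
proof (intro allI impI)
  fix E assume E: "family_x E"
  have ev: "evolution_equation E" using E by (simp add: family_x_def)
  obtain \<kappa> C where *: "countable C \<and> (\<forall>s N V t x u u1 u2 u3. s \<notin> C \<longrightarrow> open N \<longrightarrow> N \<subseteq> edom E \<longrightarrow>
     admits (E\<lparr>eG := \<lambda>z. eG E z + s * gen_g 0 1 \<kappa> z, edom := N\<rparr>) V \<longrightarrow> (t, x, u, u1, u2, u3) \<in> N \<longrightarrow>
     0 * vxi V (t, x, u) + 1 * vtau V (t, x, u) = 0 \<and> veta V (t, x, u) = 0 \<and>
     pderiv_u (veta V) (t, x, u) - frechet_derivative (vtau V) (at (t, x, u)) (1, 0, 0) - pderiv_u (vxi V) (t, x, u) * u1 = 0 \<and>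
     pderiv_u (veta V) (t, x, u) - 4 * pderiv_u (vxi V) (t, x, u) * u1 - 3 * pderiv_x (vxi V) (t, x, u) = 0)"
    by (rule exE[OF generic_symmetries[OF ev disjI2[OF refl] family_x_direction(2)[OF E]]], assumption, elim exE) (rule that)
  note key = conjunct2[OF *, rule_format]
  let ?E = "\<lambda>s. E\<lparr>eG := \<lambda>z. eG E z + s * gen_g 0 1 \<kappa> z\<rparr>"
  have "admits_only (?E s) vf_x" if s: "s \<notin> C" for s
    unfolding admits_only_def
  proof (intro allI impI, elim conjE)
    fix N V assume N: "open N" "connected N" "N \<subseteq> edom (?E s)" and adm: "admits ((?E s)\<lparr>edom := N\<rparr>) V"
    show "\<exists>c. \<forall>p\<in>point_of_jet3 ` N. V p = c *\<^sub>R vf_x p"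
    proof (cases "N = {}")
      case False
      have N': "N \<subseteq> edom E" using N(3) by simp
      have fam: "family_x (?E s)" by (rule family_add(2)[OF E])
      have ev': "evolution_equation ((?E s)\<lparr>edom := N\<rparr>)"
        by (rule evolution_equation_restrict[OF _ N(1) False N(3)]) (use fam in \<open>simp add: family_x_def\<close>)
      have dir: "frechet_derivative (eG ((?E s)\<lparr>edom := N\<rparr>)) (at z) (0, 1, 0, 0, 0, 0) = 0" if "z \<in> edom ((?E s)\<lparr>edom := N\<rparr>)" for z
        using family_x_direction(2)[OF fam, of z] N(3) that by auto
      let ?B = "point_of_jet3 ` N"
      have b: "base ((?E s)\<lparr>edom := N\<rparr>) = ?B" by (simp add: base_def)
      have B: "open ?B" "connected ?B"
        using base_open[OF N(1)] connected_continuous_image[OF linear_continuous_on[OF bounded_linear_point3] N(2)] by auto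
      have smV: "smooth_on V ?B" using adm unfolding admits_def b by blast
      note sm = smooth_on_vcomponents[OF B(1) smV]
      have jet: "\<exists>t x u u1 u2 u3. u1 \<noteq> 0 \<and> (t, x, u, u1, u2, u3) \<in> N \<and> p = (t, x, u)" if p: "p \<in> ?B" for p
      proof -
        obtain t x u u1 u2 u3 where z: "(t, x, u, u1, u2, u3) \<in> N" "p = (t, x, u)" using p by force
        from nonzero_ux[OF N(1) z(1)] show ?thesis using z(2) by metis
      qed
      have k: "vtau V p = 0" "veta V p = 0" if p: "p \<in> ?B" for p
        using jet[OF p] key[OF s N(1) N' adm] by force+
      have d0: "frechet_derivative (vtau V) (at p) v = 0" "frechet_derivative (veta V) (at p) v = 0" if "p \<in> ?B" for p v
        using frechet_zero_on[OF B(1) sm(1) k(1) that] frechet_zero_on[OF B(1) sm(3) k(2) that] by blast+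
      have xi: "pderiv_u (vxi V) p = 0" "pderiv_x (vxi V) p = 0" if p: "p \<in> ?B" for p
      proof -
        obtain t x u u1 u2 u3 where z: "u1 \<noteq> 0" "(t, x, u, u1, u2, u3) \<in> N" "p = (t, x, u)" using jet[OF p] by blast
        have e: "pderiv_u (vxi V) p * u1 = 0" "4 * pderiv_u (vxi V) p * u1 + 3 * pderiv_x (vxi V) p = 0"
          using key[OF s N(1) N' adm z(2)] d0[OF p] unfolding z(3) pderiv_u_def by simp_all
        then show "pderiv_u (vxi V) p = 0" using z(1) by simp
        then show "pderiv_x (vxi V) p = 0" using e(2) by simp
      qed
      \<comment> \<open>The relations in \<open>key\<close> do not restrict \<xi>_t; Lie's criterion
        for the perturbed equation is used once more.\<close>
      have xt: "frechet_derivative (vxi V) (at p) (1, 0, 0) = 0" if p: "p \<in> ?B" for p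
      proof -
        obtain t x u u1 u2 u3 where z: "u1 \<noteq> 0" "(t, x, u, u1, u2, u3) \<in> N" "p = (t, x, u)" using jet[OF p] by blast
        have "(t, x, u, u1, u2, u3) \<in> edom ((?E s)\<lparr>edom := N\<rparr>)" using z(2) by simp
        from time_dependent_translation[OF ev' adm this, unfolded b, OF k(1) k(2) xi(2) xi(1) dir]
        have "frechet_derivative (vxi V) (at (t, x, u)) (1, 0, 0) * u1 = 0" by simp
        then show ?thesis using z(1,3) by simp
      qed
      obtain c where c: "\<And>p. p \<in> ?B \<Longrightarrow> vxi V p = c" using constant_if_partials_zero[OF B sm(2) xt xi(2,1)] by blast
      have "V p = c *\<^sub>R vf_x p" if "p \<in> ?B" for p using k[OF that] c[OF that] by (simp add: vf_x_def prod_eq_iff)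
      then show ?thesis by blast
    qed simp
  qed
  then show "\<exists>g C. countable C \<and> (\<forall>s. family_x (E\<lparr>eG := \<lambda>z. eG E z + s * g z\<rparr>)) \<and>
     (\<forall>s. s \<notin> C \<longrightarrow> admits_only (E\<lparr>eG := \<lambda>z. eG E z + s * g z\<rparr>) vf_x)"
    by (intro exI[of _ "gen_g 0 1 \<kappa>"] exI[of _ C] conjI conjunct1[OF *] allI impI family_add(2)[OF E])
qed

section \<open>Inequivalence of the two families\<close>

lemma pullback_field:
  assumes \<Phi>: "point_transformation \<Phi> D"
  obtains V where "smooth_on V D" "pushes_forward \<Phi> D V (\<lambda>p. (cT, cX, 0))"
proof -
  have D: "open D" and sm: "smooth_on (pX \<Phi>) D" "smooth_on (pU \<Phi>) D" "smooth_on (pT \<Phi>) (fst ` D)"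
    and nz: "\<And>p. p \<in> D \<Longrightarrow> deriv (pT \<Phi>) (fst p) \<noteq> 0"
    using \<Phi> by (auto simp: point_transformation_def)
  obtain p0 where "p0 \<in> D" using \<Phi> by (auto simp: point_transformation_def)
  note smdt = point_transformation_T(2)[OF \<Phi> this]
  define Xt Ut where "Xt p = frechet_derivative (pX \<Phi>) (at p) (1, 0, 0)" and "Ut p = frechet_derivative (pU \<Phi>) (at p) (1, 0, 0)" for p
  let ?a = "pderiv_x (pX \<Phi>)" and ?b = "pderiv_u (pX \<Phi>)" and ?c = "pderiv_x (pU \<Phi>)" and ?d = "pderiv_u (pU \<Phi>)"
  have smp: "smooth_on ?a D" "smooth_on ?b D" "smooth_on ?c D" "smooth_on ?d D" "smooth_on Xt D" "smooth_on Ut D"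
    using smooth_on_frechet[OF sm(1)] smooth_on_frechet[OF sm(2)] by (simp_all add: pderiv_x_def[abs_def] pderiv_u_def[abs_def] Xt_def[abs_def] Ut_def[abs_def])
  define \<Delta> where "\<Delta> p = ?a p * ?d p - ?b p * ?c p" for p
  have \<Delta>: "\<Delta> p \<noteq> 0" if "p \<in> D" for p using \<Phi> that by (simp add: point_transformation_def \<Delta>_def)
  have sm\<Delta>: "smooth_on \<Delta> D" unfolding \<Delta>_def[abs_def] by (intro smooth_on_diff smooth_on_mult D smp)
  define \<tau> where "\<tau> p = cT * inverse (deriv (pT \<Phi>) (fst p))" for p :: point
  \<comment> \<open>\<tau> is forced by the equation for T; the other two components come from
    Cramer's rule for the equations for X and U.\<close>
  define V where "V p = (\<tau> p, ((cX - \<tau> p * Xt p) * ?d p - ?b p * (0 - \<tau> p * Ut p)) * inverse (\<Delta> p),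
     (?a p * (0 - \<tau> p * Ut p) - ?c p * (cX - \<tau> p * Xt p)) * inverse (\<Delta> p))" for p
  have sm\<tau>: "smooth_on \<tau> D" unfolding \<tau>_def[abs_def]
    by (intro smooth_on_mult smooth_on_const D smooth_on_inverse smdt nz)
  have "smooth_on V D" unfolding V_def[abs_def]
    by (intro smooth_on_Pair smooth_on_mult smooth_on_diff smooth_on_const D sm\<tau> smp smooth_on_inverse sm\<Delta> \<Delta>)
  moreover have "pushes_forward \<Phi> D V (\<lambda>p. (cT, cX, 0))"
    unfolding pushes_forward_def
  proof
    fix p assume p: "p \<in> D"
    have X: "frechet_derivative (pX \<Phi>) (at p) (V p) = fst (V p) * Xt p + fst (snd (V p)) * ?a p + snd (snd (V p)) * ?b p"
      using frechet_split[OF sm(1) p, of "fst (V p)" "fst (snd (V p))" "snd (snd (V p))"] by (simp add: Xt_def pderiv_x_def pderiv_u_def)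
    have U: "frechet_derivative (pU \<Phi>) (at p) (V p) = fst (V p) * Ut p + fst (snd (V p)) * ?c p + snd (snd (V p)) * ?d p"
      using frechet_split[OF sm(2) p, of "fst (V p)" "fst (snd (V p))" "snd (snd (V p))"] by (simp add: Ut_def pderiv_x_def pderiv_u_def)
    have cram: "(e * d - b * f) * inverse r * a + (a * f - c * e) * inverse r * b = e \<and>
       (e * d - b * f) * inverse r * c + (a * f - c * e) * inverse r * d = f" if r: "r = a * d - b * c" "r \<noteq> 0" for a b c d e f r :: real
    proof -
      have "(e * d - b * f) * inverse r * a + (a * f - c * e) * inverse r * b = e * (r * inverse r)"
        "(e * d - b * f) * inverse r * c + (a * f - c * e) * inverse r * d = f * (r * inverse r)"
        unfolding r(1) by (simp_all add: algebra_simps)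
      then show ?thesis using r(2) by simp
    qed
    note cr = cram[OF \<Delta>_def \<Delta>[OF p], of "cX - \<tau> p * Xt p" "0 - \<tau> p * Ut p"]
    have "fst (V p) * Xt p + (fst (snd (V p)) * ?a p + snd (snd (V p)) * ?b p) = cX"
      "fst (V p) * Ut p + (fst (snd (V p)) * ?c p + snd (snd (V p)) * ?d p) = 0"
      unfolding V_def fst_conv snd_conv conjunct1[OF cr] conjunct2[OF cr] by simp_all
    moreover have "deriv (pT \<Phi>) (fst p) * fst (V p) = cT" using nz[OF p] by (simp add: V_def \<tau>_def)
    ultimately show "frechet_derivative (pmap \<Phi>) (at p) (V p) = (cT, cX, 0)"
      unfolding pmap_frechet[OF \<Phi> p] X U by simp
  qed
  ultimately show ?thesis by (rule that)
qed

text \<open>The translation that E' admits pulls back to a symmetry of E near z, hence to a constant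
  multiple of W. Its image at one point is enough for both contradictions that follow.\<close>

lemma symmetry_from_equivalent:
  assumes E: "evolution_equation E" and E': "evolution_equation E'" and eq: "equivalent_near E z E'"
    and dir: "\<And>z. z \<in> edom E' \<Longrightarrow> frechet_derivative (eF E') (at z) (cT, cX, 0, 0, 0, 0) = 0"
      "\<And>z. z \<in> edom E' \<Longrightarrow> frechet_derivative (eG E') (at z) (cT, cX, 0, 0, 0, 0) = 0"
    and only: "admits_only E W"
  obtains \<Phi> D p c where "point_transformation \<Phi> D" "p \<in> D" "frechet_derivative (pmap \<Phi>) (at p) (c *\<^sub>R W p) = (cT, cX, 0)"
proof -
  obtain \<Phi> D where \<Phi>: "point_transformation \<Phi> D" and tn: "transforms_near \<Phi> D E z E'"
    using eq unfolding equivalent_near_def by blast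
  obtain N0 where N: "open N0 \<and> z \<in> N0 \<and> N0 \<subseteq> edom E \<and> point_of_jet3 ` N0 \<subseteq> D \<and>
      (\<forall>J. jet3_of_jet J \<in> N0 \<longrightarrow> Dx (pX \<Phi> \<circ> point_of_jet) J \<noteq> 0 \<and>
           jet3_of_jet (prolong_trans \<Phi> J) \<in> edom E' \<and> (eq_fun E J = 0 \<longleftrightarrow> eq_fun E' (prolong_trans \<Phi> J) = 0))"
    using tn unfolding transforms_near_def by (elim exE) (rule that)
  note N0 = conjunct1[OF N] conjunct2[OF N, THEN conjunct1] conjunct2[OF N, THEN conjunct2, THEN conjunct1]
    conjunct2[OF N, THEN conjunct2, THEN conjunct2, THEN conjunct1]
  note tr = conjunct2[OF N, THEN conjunct2, THEN conjunct2, THEN conjunct2, rule_format]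
  obtain r where r: "r > 0" "ball z r \<subseteq> N0" using N0(1,2) open_contains_ball by blast
  have zr: "z \<in> ball z r" using r(1) by simp
  obtain V where V: "smooth_on V D" "pushes_forward \<Phi> D V (\<lambda>p. (cT, cX, 0))" by (rule pullback_field[OF \<Phi>])
  have sub: "ball z r \<subseteq> edom E" "point_of_jet3 ` ball z r \<subseteq> D" using r(2) N0(3,4) by auto
  have ne: "ball z r \<noteq> {}" using zr by blast
  have tr': "Dx (pX \<Phi> \<circ> point_of_jet) J \<noteq> 0 \<and>
           jet3_of_jet (prolong_trans \<Phi> J) \<in> edom E' \<and> (eq_fun E J = 0 \<longleftrightarrow> eq_fun E' (prolong_trans \<Phi> J) = 0)"
    if "jet3_of_jet J \<in> ball z r" for J using tr[OF subsetD[OF r(2) that]] .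
  have "admits (E\<lparr>edom := ball z r\<rparr>) V"
    by (rule pullback_symmetry[OF \<Phi> open_ball ne sub E E' tr' dir V])
  then obtain c where c: "\<forall>p\<in>point_of_jet3 ` ball z r. V p = c *\<^sub>R W p"
    using only open_ball connected_ball sub(1) unfolding admits_only_def by blast
  have p: "point_of_jet3 z \<in> D" using sub(2) zr by blast
  have Vc: "V (point_of_jet3 z) = c *\<^sub>R W (point_of_jet3 z)" using c zr by blast
  have "frechet_derivative (pmap \<Phi>) (at (point_of_jet3 z)) (V (point_of_jet3 z)) = (cT, cX, 0)"
    using V(2) p unfolding pushes_forward_def by (rule bspec)
  then show ?thesis unfolding Vc by (rule that[OF \<Phi> p])
qed

lemma generic_member:
  assumes "generically_admits_only \<F> W" "\<F> E"
  obtains E' where "\<F> E'" "admits_only E' W"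
proof -
  obtain g C where *: "countable C" "\<forall>s. \<F> (E\<lparr>eG := \<lambda>z. eG E z + s * g z\<rparr>)"
     "\<forall>s. s \<notin> C \<longrightarrow> admits_only (E\<lparr>eG := \<lambda>z. eG E z + s * g z\<rparr>) W"
    using assms unfolding generically_admits_only_def by blast
  obtain s :: real where "s \<notin> C" using *(1) uncountable_UNIV_real by (metis UNIV_eq_I)
  then show ?thesis using that * by blast
qed

text \<open>Starting points for \<open>generic_member\<close>, which perturbs a given
  member.\<close>

lemma family_examples: "family_t \<lparr>edom = UNIV, eF = \<lambda>_. 1, eG = \<lambda>_. 0\<rparr>" "family_x \<lparr>edom = UNIV, eF = \<lambda>_. 1, eG = \<lambda>_. 0\<rparr>"
  by (auto simp: family_t_def family_x_def evolution_equation_def)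

text \<open>If c d/dt is mapped to d/dx, the t-component T' c = 0 forces c = 0, while the zero
  vector is not mapped to d/dx.\<close>

lemma inequivalent_t: "\<exists>E. family_t E \<and> (\<forall>E'. family_x E' \<longrightarrow> (\<forall>z\<in>edom E. \<not> equivalent_near E z E'))"
proof -
  obtain E where E: "family_t E" "admits_only E vf_t" by (rule generic_member[OF generically_admits_only_t family_examples(1)])
  have "\<not> equivalent_near E z E'" if E': "family_x E'" for E' z
  proof
    assume eq: "equivalent_near E z E'"
    have ev: "evolution_equation E" "evolution_equation E'" using E(1) E' by (simp_all add: family_t_def family_x_def)
    obtain \<Phi> D p c where *: "point_transformation \<Phi> D" "p \<in> D" "frechet_derivative (pmap \<Phi>) (at p) (c *\<^sub>R vf_t p) = (0, 1, 0)"
      by (rule symmetry_from_equivalent[OF ev eq family_x_direction[OF E'] E(2)]; assumption)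
    have "deriv (pT \<Phi>) (fst p) * c = 0" "frechet_derivative (pX \<Phi>) (at p) (c *\<^sub>R vf_t p) = 1"
      using *(3) unfolding pmap_frechet[OF *(1,2)] by (simp_all add: vf_t_def)
    moreover have "deriv (pT \<Phi>) (fst p) \<noteq> 0" "smooth_on (pX \<Phi>) D" using *(1,2) by (simp_all add: point_transformation_def)
    ultimately show False
      using linear_0[OF has_derivative_linear[OF smooth_on_has_derivative[OF _ *(2)]], of "pX \<Phi>"] by simp
  qed
  then show ?thesis using E(1) by blast
qed

text \<open>Multiples of d/dx have images without t-component, so none is mapped to d/dt.\<close>

lemma inequivalent_x: "\<exists>E. family_x E \<and> (\<forall>E'. family_t E' \<longrightarrow> (\<forall>z\<in>edom E. \<not> equivalent_near E z E'))"
proof -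
  obtain E where E: "family_x E" "admits_only E vf_x" by (rule generic_member[OF generically_admits_only_x family_examples(2)])
  have "\<not> equivalent_near E z E'" if E': "family_t E'" for E' z
  proof
    assume eq: "equivalent_near E z E'"
    have ev: "evolution_equation E" "evolution_equation E'" using E(1) E' by (simp_all add: family_t_def family_x_def)
    obtain \<Phi> D p c where *: "point_transformation \<Phi> D" "p \<in> D" "frechet_derivative (pmap \<Phi>) (at p) (c *\<^sub>R vf_x p) = (1, 0, 0)"
      by (rule symmetry_from_equivalent[OF ev eq family_t_direction[OF E'] E(2)]; assumption)
    show False using *(3) unfolding pmap_frechet[OF *(1,2)] by (simp add: vf_x_def)
  qed
  then show ?thesis using E(1) by blast
qed

theorem theorem1:
  "(\<forall>E. family_t E \<longrightarrow> admits E vf_t) \<and>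
   (\<forall>E. family_x E \<longrightarrow> admits E vf_x) \<and>
   (\<forall>E V. evolution_equation E \<and> admits E V \<and> (\<exists>p\<in>base E. V p \<noteq> 0) \<and> generic_on V (base E) \<longrightarrow>
      (\<forall>z\<in>edom E. \<exists>\<Phi> D E'. point_transformation \<Phi> D \<and> transforms_near \<Phi> D E z E' \<and>
         (family_t E' \<and> pushes_forward \<Phi> (D \<inter> base E) V vf_t \<or>
          family_x E' \<and> pushes_forward \<Phi> (D \<inter> base E) V vf_x))) \<and>
   \<not> equivalent_algebras vf_t vf_x \<and> \<not> equivalent_algebras vf_x vf_t \<and>
   (\<exists>E. family_t E \<and> (\<forall>E'. family_x E' \<longrightarrow> (\<forall>z\<in>edom E. \<not> equivalent_near E z E'))) \<and>
   (\<exists>E. family_x E \<and> (\<forall>E'. family_t E' \<longrightarrow> (\<forall>z\<in>edom E. \<not> equivalent_near E z E'))) \<and>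
   generically_admits_only family_t vf_t \<and>
   generically_admits_only family_x vf_x"
proof (intro conjI not_equivalent_translations inequivalent_t inequivalent_x generically_admits_only_t generically_admits_only_x allI impI ballI)
  show "\<exists>\<Phi> D E'. point_transformation \<Phi> D \<and> transforms_near \<Phi> D E z E' \<and>
         (family_t E' \<and> pushes_forward \<Phi> (D \<inter> base E) V vf_t \<or>
          family_x E' \<and> pushes_forward \<Phi> (D \<inter> base E) V vf_x)"
    if h: "evolution_equation E \<and> admits E V \<and> (\<exists>p\<in>base E. V p \<noteq> 0) \<and> generic_on V (base E)" and z: "z \<in> edom E" for E V z
    by (rule one_parameter_symmetry[OF conjunct1[OF h] conjunct1[OF conjunct2[OF h]] conjunct1[OF conjunct2[OF conjunct2[OF h]]]
      conjunct2[OF conjunct2[OF conjunct2[OF h]]] z])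
qed (rule family_t_admits family_x_admits; assumption)+

end
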